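(* Let $k$ and $m$ be positive integers. The following operator systems are unitally completely order isomorphic: (1) the operator system quotient $\mathbb{C}^{k+m}/\mathrm{span}\{(\underbrace{1,\dots,1}_{k},\underbrace{-1,\dots,-1}_{m})\}$; (2) the coproduct $\mathbb{C}^k\oplus_1\mathbb{C}^m$; (3) $\{x+y: x\in\mathbb{C}^k,\ y\in\mathbb{C}^m\}\subset\mathbb{C}^k*_1\mathbb{C}^m$, where $*_1$ is the unital C*-algebra free product; (4) $\mathcal{S}=\mathrm{span}\{e,a,a^2,\dots,a^{k-1},b,b^2,\dots,b^{m-1}\}\subset C^*(\mathbb{Z}_k*\mathbb{Z}_m)$, where $\mathbb{Z}_k*\mathbb{Z}_m=\langle a,b: a^k=b^m=e\rangle$ is identified with its canonical image in its full group C*-algebra $C^*(\mathbb{Z}_k*\mathbb{Z}_m)$. Moreover, each of these operator systems (under these identifications) contains enough unitaries in $C^*(\mathbb{Z}_k*\mathbb{Z}_m)$.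
   Context: An operator system is a unital $*$-closed subspace of some $B(H)$ with the induced matrix order (equivalently, in the abstract sense of Choi–Effros); ucp means unital completely positive. Quotients: a kernel in an operator system $\mathcal{S}$ (unit $e$) is the kernel $J$ of a ucp map on $\mathcal{S}$. The operator system quotient $\mathcal{S}/J$ is the algebraic quotient with unit $\dot e=e+J$, where $(\dot s_{ij})\in M_n(\mathcal{S}/J)$ is positive iff for every $\epsilon>0$ the element $(\dot s_{ij})+\epsilon\,\mathrm{diag}(\dot e,\dots,\dot e)$ has a positive representative in $M_n(\mathcal{S})$. The span of a self-adjoint element that is neither positive nor negative is a kernel. Coproduct: $\mathcal{S}\oplus_1\mathcal{T}$ is the operator system (unique up to unital complete order isomorphism) with unital complete order embeddings $i:\mathcal{S}\to\mathcal{S}\oplus_1\mathcal{T}$, $j:\mathcal{T}\to\mathcal{S}\oplus_1\mathcal{T}$ such that for all ucp maps $\phi:\mathcal{S}\to\mathcal{R}$, $\psi:\mathcal{T}\to\mathcal{R}$ into any operator system $\mathcal{R}$ there is a unique ucp map $\varphi:\mathcal{S}\oplus_1\mathcal{T}\to\mathcal{R}$ with $\varphi\circ i=\phi$ and $\varphi\circ j=\psi$. An operator subsystem $\mathcal{S}$ of a unital C*-algebra $\mathcal{A}$ contains enough unitaries in $\mathcal{A}$ if there is a collection of unitaries of $\mathcal{A}$ lying in $\mathcal{S}$ that generates $\mathcal{A}$ as a C*-algebra. *)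

theory Defs
  imports Jordan_Normal_Form.VS_Connect
    "HOL-Algebra.QuotRing"
begin

section \<open>Complex *-vector spaces and matrices over them\<close>

text \<open>
  Complex vector spaces are modules over \<^term>\<open>class_ring :: complex ring\<close>.  For operator systems
  the field \<^const>\<open>one\<close> holds the unit e and the field \<^const>\<open>mult\<close> is ignored (it is part of the
  module record of the library); for C*-algebras both have their usual meaning.
\<close>

record 'a star_module = "(complex, 'a) module" +
  star :: "'a \<Rightarrow> 'a"

locale star_vector_space =
  fixes V :: "('a, 'm) star_module_scheme" (structure)
  assumes vector_space: "module class_ring V"
    and one_in: "\<one> \<in> carrier V"
    and star_closed: "x \<in> carrier V \<Longrightarrow> star V x \<in> carrier V"
    and star_star: "x \<in> carrier V \<Longrightarrow> star V (star V x) = x"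
    and star_add: "\<lbrakk>x \<in> carrier V; y \<in> carrier V\<rbrakk> \<Longrightarrow> star V (x \<oplus> y) = star V x \<oplus> star V y"
    and star_smult: "x \<in> carrier V \<Longrightarrow> star V (c \<odot> x) = cnj c \<odot> star V x"
    and star_one: "star V \<one> = \<one>"

definition mats :: "('a, 'm) partial_object_scheme \<Rightarrow> nat \<Rightarrow> nat \<Rightarrow> 'a mat set" where
  "mats V p n = {X \<in> carrier_mat p n. \<forall>i<p. \<forall>j<n. X $$ (i, j) \<in> carrier V}"

definition madd :: "('a, 'm) ring_scheme \<Rightarrow> 'a mat \<Rightarrow> 'a mat \<Rightarrow> 'a mat" where
  "madd V X Y = mat (dim_row X) (dim_col X) (\<lambda>ij. X $$ ij \<oplus>\<^bsub>V\<^esub> Y $$ ij)"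

definition madjoint :: "('a, 'm) star_module_scheme \<Rightarrow> 'a mat \<Rightarrow> 'a mat" where
  "madjoint V X = mat (dim_col X) (dim_row X) (\<lambda>(i, j). star V (X $$ (j, i)))"

definition mdiag :: "(complex, 'a, 'm) module_scheme \<Rightarrow> nat \<Rightarrow> complex \<Rightarrow> 'a mat" where
  "mdiag V n c = mat n n (\<lambda>(i, j). if i = j then c \<odot>\<^bsub>V\<^esub> \<one>\<^bsub>V\<^esub> else \<zero>\<^bsub>V\<^esub>)"

text \<open>The matrix A* X A for a scalar matrix A.\<close>

definition mcompress :: "(complex, 'a, 'm) module_scheme \<Rightarrow> complex mat \<Rightarrow> 'a mat \<Rightarrow> 'a mat" where
  "mcompress V A X = mat (dim_col A) (dim_col A) (\<lambda>(i, j).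
     \<Oplus>\<^bsub>V\<^esub>p\<in>{..<dim_row A}. \<Oplus>\<^bsub>V\<^esub>q\<in>{..<dim_row A}. (cnj (A $$ (p, i)) * A $$ (q, j)) \<odot>\<^bsub>V\<^esub> X $$ (p, q))"


section \<open>Operator systems in the sense of Choi and Effros\<close>

record 'a opsys = "'a star_module" +
  mpos :: "nat \<Rightarrow> 'a mat set"

locale operator_system = star_vector_space S
  for S :: "('a, 'm) opsys_scheme" (structure) +
  assumes mpos_mats: "mpos S n \<subseteq> mats S n n"
    and mpos_hermitian: "X \<in> mpos S n \<Longrightarrow> madjoint S X = X"
    and mpos_add: "\<lbrakk>X \<in> mpos S n; Y \<in> mpos S n\<rbrakk> \<Longrightarrow> madd S X Y \<in> mpos S n"
    and mpos_compress: "\<lbrakk>X \<in> mpos S n; A \<in> carrier_mat n p\<rbrakk> \<Longrightarrow> mcompress S A X \<in> mpos S p"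
    and mpos_proper:
      "\<lbrakk>X \<in> mpos S n; map_mat (\<lambda>x. \<ominus> x) X \<in> mpos S n\<rbrakk> \<Longrightarrow> X = mdiag S n 0"
    and matrix_order_unit:
      "\<lbrakk>X \<in> mats S n n; madjoint S X = X\<rbrakk> \<Longrightarrow> \<exists>r>0. madd S X (mdiag S n (complex_of_real r)) \<in> mpos S n"
    and archimedean:
      "\<lbrakk>X \<in> mats S n n; \<And>\<epsilon>. \<epsilon> > 0 \<Longrightarrow> madd S X (mdiag S n (complex_of_real \<epsilon>)) \<in> mpos S n\<rbrakk>
       \<Longrightarrow> X \<in> mpos S n"

text \<open>Maps between structures are relevant on the carrier only.\<close>

definition unital_linear ::
  "('a, 'm) star_module_scheme \<Rightarrow> ('b, 'n) star_module_scheme \<Rightarrow> ('a \<Rightarrow> 'b) \<Rightarrow> bool" where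
  "unital_linear V W f \<longleftrightarrow>
     f ` carrier V \<subseteq> carrier W \<and>
     (\<forall>x\<in>carrier V. \<forall>y\<in>carrier V. f (x \<oplus>\<^bsub>V\<^esub> y) = f x \<oplus>\<^bsub>W\<^esub> f y) \<and>
     (\<forall>c. \<forall>x\<in>carrier V. f (c \<odot>\<^bsub>V\<^esub> x) = c \<odot>\<^bsub>W\<^esub> f x) \<and>
     f \<one>\<^bsub>V\<^esub> = \<one>\<^bsub>W\<^esub>"

definition ucp :: "('a, 'm) opsys_scheme \<Rightarrow> ('b, 'n) opsys_scheme \<Rightarrow> ('a \<Rightarrow> 'b) \<Rightarrow> bool" where
  "ucp S T f \<longleftrightarrow> unital_linear S T f \<and> (\<forall>n. \<forall>X\<in>mpos S n. map_mat f X \<in> mpos T n)"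

definition uco_embedding ::
  "('a, 'm) opsys_scheme \<Rightarrow> ('b, 'n) opsys_scheme \<Rightarrow> ('a \<Rightarrow> 'b) \<Rightarrow> bool" where
  "uco_embedding S T f \<longleftrightarrow>
     unital_linear S T f \<and> inj_on f (carrier S) \<and>
     (\<forall>n. \<forall>X\<in>mats S n n. X \<in> mpos S n \<longleftrightarrow> map_mat f X \<in> mpos T n)"

definition uco_isomorphism ::
  "('a, 'm) opsys_scheme \<Rightarrow> ('b, 'n) opsys_scheme \<Rightarrow> ('a \<Rightarrow> 'b) \<Rightarrow> bool" where
  "uco_isomorphism S T f \<longleftrightarrow> uco_embedding S T f \<and> f ` carrier S = carrier T"


section \<open>Quotients and coproducts of operator systems\<close>

text \<open>
  Since one cannot quantify over types, notions that refer to all operator systems (or all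
  C*-algebras) carry a type argument: the test objects have their carriers in that type.
\<close>

definition is_kernel :: "'r itself \<Rightarrow> ('a, 'm) opsys_scheme \<Rightarrow> 'a set \<Rightarrow> bool" where
  "is_kernel (TYPE('r)) S J \<longleftrightarrow>
     (\<exists>(R :: 'r opsys) f. operator_system R \<and> ucp S R f \<and> J = {x \<in> carrier S. f x = \<zero>\<^bsub>R\<^esub>})"

text \<open>The order is the one of the quotient by a kernel J; the elements are the cosets of J.\<close>

definition quotient_opsys :: "('a, 'm) opsys_scheme \<Rightarrow> 'a set \<Rightarrow> 'a set opsys" where
  "quotient_opsys S J =
     \<lparr>carrier = a_rcosets\<^bsub>S\<^esub> J, mult = rcoset_mult S J, one = J +>\<^bsub>S\<^esub> \<one>\<^bsub>S\<^esub>, zero = J,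
      add = set_add S, smult = (\<lambda>c Y. \<Union>y\<in>Y. J +>\<^bsub>S\<^esub> (c \<odot>\<^bsub>S\<^esub> y)), star = (\<lambda>Y. star S ` Y),
      mpos = (\<lambda>n. {X \<in> carrier_mat n n. (\<forall>i<n. \<forall>j<n. X $$ (i, j) \<in> a_rcosets\<^bsub>S\<^esub> J) \<and>
        (\<forall>\<epsilon>>0. \<exists>P\<in>mpos S n. map_mat (\<lambda>s. J +>\<^bsub>S\<^esub> s) P =
           mat n n (\<lambda>(i, j). X $$ (i, j) <+>\<^bsub>S\<^esub>
             (if i = j then J +>\<^bsub>S\<^esub> (complex_of_real \<epsilon> \<odot>\<^bsub>S\<^esub> \<one>\<^bsub>S\<^esub>) else J)))})\<rparr>"

definition is_coproduct ::
  "'r itself \<Rightarrow> 'a opsys \<Rightarrow> 'b opsys \<Rightarrow> 'c opsys \<Rightarrow> ('a \<Rightarrow> 'c) \<Rightarrow> ('b \<Rightarrow> 'c) \<Rightarrow> bool" where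
  "is_coproduct (TYPE('r)) S T C i j \<longleftrightarrow>
     operator_system C \<and> uco_embedding S C i \<and> uco_embedding T C j \<and>
     (\<forall>(R :: 'r opsys) \<phi> \<psi>. operator_system R \<longrightarrow> ucp S R \<phi> \<longrightarrow> ucp T R \<psi> \<longrightarrow>
        (\<exists>h. (ucp C R h \<and> (\<forall>x\<in>carrier S. h (i x) = \<phi> x) \<and> (\<forall>y\<in>carrier T. h (j y) = \<psi> y)) \<and>
           (\<forall>h'. ucp C R h' \<and> (\<forall>x\<in>carrier S. h' (i x) = \<phi> x) \<and> (\<forall>y\<in>carrier T. h' (j y) = \<psi> y)
              \<longrightarrow> (\<forall>z\<in>carrier C. h' z = h z))))"


section \<open>Unital C*-algebras\<close>

record 'a cstar = "'a star_module" +
  cnorm :: "'a \<Rightarrow> real"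

locale cstar_algebra = star_vector_space A + ring A
  for A :: "('a, 'm) cstar_scheme" (structure) +
  assumes smult_mult_left:
      "\<lbrakk>x \<in> carrier A; y \<in> carrier A\<rbrakk> \<Longrightarrow> (c \<odot> x) \<otimes> y = c \<odot> (x \<otimes> y)"
    and smult_mult_right:
      "\<lbrakk>x \<in> carrier A; y \<in> carrier A\<rbrakk> \<Longrightarrow> x \<otimes> (c \<odot> y) = c \<odot> (x \<otimes> y)"
    and star_mult:
      "\<lbrakk>x \<in> carrier A; y \<in> carrier A\<rbrakk> \<Longrightarrow> star A (x \<otimes> y) = star A y \<otimes> star A x"
    and norm_nonneg: "x \<in> carrier A \<Longrightarrow> 0 \<le> cnorm A x"
    and norm_zero_iff: "x \<in> carrier A \<Longrightarrow> cnorm A x = 0 \<longleftrightarrow> x = \<zero>"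
    and norm_triangle:
      "\<lbrakk>x \<in> carrier A; y \<in> carrier A\<rbrakk> \<Longrightarrow> cnorm A (x \<oplus> y) \<le> cnorm A x + cnorm A y"
    and norm_smult: "x \<in> carrier A \<Longrightarrow> cnorm A (c \<odot> x) = cmod c * cnorm A x"
    and norm_mult:
      "\<lbrakk>x \<in> carrier A; y \<in> carrier A\<rbrakk> \<Longrightarrow> cnorm A (x \<otimes> y) \<le> cnorm A x * cnorm A y"
    and cstar_identity: "x \<in> carrier A \<Longrightarrow> cnorm A (star A x \<otimes> x) = (cnorm A x)\<^sup>2"
    and complete:
      "\<lbrakk>\<And>n. (s :: nat \<Rightarrow> 'a) n \<in> carrier A;
        \<And>\<epsilon>. \<epsilon> > 0 \<Longrightarrow> \<exists>N. \<forall>p\<ge>N. \<forall>q\<ge>N. cnorm A (s p \<ominus> s q) < \<epsilon>\<rbrakk>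
       \<Longrightarrow> \<exists>l\<in>carrier A. (\<lambda>n. cnorm A (s n \<ominus> l)) \<longlonglongrightarrow> 0"

definition cstar_hom :: "('a, 'm) cstar_scheme \<Rightarrow> ('b, 'n) cstar_scheme \<Rightarrow> ('a \<Rightarrow> 'b) \<Rightarrow> bool" where
  "cstar_hom A B f \<longleftrightarrow>
     f \<in> Ring.ring_hom A B \<and>
     (\<forall>c. \<forall>x\<in>carrier A. f (c \<odot>\<^bsub>A\<^esub> x) = c \<odot>\<^bsub>B\<^esub> f x) \<and>
     (\<forall>x\<in>carrier A. f (star A x) = star B (f x))"

text \<open>
  The positive cone of the n by n matrices over a C*-algebra consists of the matrices Y* Y.  Here Y
  may be rectangular, so that Y* Y is a sum of squares Z* Z of n by n matrices Z; over a C*-algebra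
  every such sum is again a single square.
\<close>

definition cstar_mpos :: "('a, 'm) cstar_scheme \<Rightarrow> nat \<Rightarrow> 'a mat set" where
  "cstar_mpos A n = {X. \<exists>p. \<exists>Y\<in>mats A p n.
     X = mat n n (\<lambda>(i, j). \<Oplus>\<^bsub>A\<^esub>l\<in>{..<p}. star A (Y $$ (l, i)) \<otimes>\<^bsub>A\<^esub> Y $$ (l, j))}"

definition operator_subspace :: "('a, 'm) cstar_scheme \<Rightarrow> 'a set \<Rightarrow> bool" where
  "operator_subspace A V \<longleftrightarrow>
     LinearCombinations.submodule class_ring V A \<and> \<one>\<^bsub>A\<^esub> \<in> V \<and> (\<forall>x\<in>V. star A x \<in> V)"

definition opsub :: "('a, 'm) cstar_scheme \<Rightarrow> 'a set \<Rightarrow> 'a opsys" where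
  "opsub A V =
     \<lparr>carrier = V, mult = mult A, one = one A, zero = zero A, add = add A, smult = smult A,
      star = star A, mpos = (\<lambda>n. {X \<in> cstar_mpos A n. \<forall>i<n. \<forall>j<n. X $$ (i, j) \<in> V})\<rparr>"

definition unitaries :: "('a, 'm) cstar_scheme \<Rightarrow> 'a set" where
  "unitaries A =
     {x \<in> carrier A. star A x \<otimes>\<^bsub>A\<^esub> x = \<one>\<^bsub>A\<^esub> \<and> x \<otimes>\<^bsub>A\<^esub> star A x = \<one>\<^bsub>A\<^esub>}"

definition cstar_subalgebra :: "('a, 'm) cstar_scheme \<Rightarrow> 'a set \<Rightarrow> bool" where
  "cstar_subalgebra A B \<longleftrightarrow>
     LinearCombinations.submodule class_ring B A \<and>
     (\<forall>x\<in>B. \<forall>y\<in>B. x \<otimes>\<^bsub>A\<^esub> y \<in> B) \<and> (\<forall>x\<in>B. star A x \<in> B) \<and>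
     (\<forall>s l. (\<forall>n :: nat. s n \<in> B) \<and> l \<in> carrier A \<and> (\<lambda>n. cnorm A (s n \<ominus>\<^bsub>A\<^esub> l)) \<longlonglongrightarrow> 0 \<longrightarrow> l \<in> B)"

definition cstar_generated :: "('a, 'm) cstar_scheme \<Rightarrow> 'a set \<Rightarrow> 'a set" where
  "cstar_generated A U = \<Inter>{B. cstar_subalgebra A B \<and> U \<subseteq> B}"

definition contains_enough_unitaries :: "('a, 'm) cstar_scheme \<Rightarrow> 'a set \<Rightarrow> bool" where
  "contains_enough_unitaries A V \<longleftrightarrow>
     operator_subspace A V \<and>
     (\<exists>U \<subseteq> unitaries A \<inter> V. cstar_generated A U = carrier A)"

definition is_cstar_free_product ::
  "'r itself \<Rightarrow> 'a cstar \<Rightarrow> 'b cstar \<Rightarrow> 'c cstar \<Rightarrow> ('a \<Rightarrow> 'c) \<Rightarrow> ('b \<Rightarrow> 'c) \<Rightarrow> bool" where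
  "is_cstar_free_product (TYPE('r)) A B C i j \<longleftrightarrow>
     cstar_algebra C \<and> cstar_hom A C i \<and> cstar_hom B C j \<and>
     (\<forall>(R :: 'r cstar) f g. cstar_algebra R \<longrightarrow> cstar_hom A R f \<longrightarrow> cstar_hom B R g \<longrightarrow>
        (\<exists>h. (cstar_hom C R h \<and> (\<forall>x\<in>carrier A. h (i x) = f x) \<and> (\<forall>y\<in>carrier B. h (j y) = g y)) \<and>
           (\<forall>h'. cstar_hom C R h' \<and> (\<forall>x\<in>carrier A. h' (i x) = f x) \<and> (\<forall>y\<in>carrier B. h' (j y) = g y)
              \<longrightarrow> (\<forall>z\<in>carrier C. h' z = h z))))"

text \<open>
  The full group C*-algebra, given by its universal property: unitary representations u of the
  discrete group G in a C*-algebra extend uniquely to the C*-algebra.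
\<close>

definition unitary_hom :: "('g, 'k) monoid_scheme \<Rightarrow> ('a, 'm) cstar_scheme \<Rightarrow> ('g \<Rightarrow> 'a) \<Rightarrow> bool" where
  "unitary_hom G A u \<longleftrightarrow> u \<in> hom G A \<and> u ` carrier G \<subseteq> unitaries A"

definition is_full_group_cstar ::
  "'r itself \<Rightarrow> 'g monoid \<Rightarrow> 'c cstar \<Rightarrow> ('g \<Rightarrow> 'c) \<Rightarrow> bool" where
  "is_full_group_cstar (TYPE('r)) G C u \<longleftrightarrow>
     cstar_algebra C \<and> unitary_hom G C u \<and>
     (\<forall>(R :: 'r cstar) v. cstar_algebra R \<longrightarrow> unitary_hom G R v \<longrightarrow>
        (\<exists>h. (cstar_hom C R h \<and> (\<forall>g\<in>carrier G. h (u g) = v g)) \<and>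
           (\<forall>h'. cstar_hom C R h' \<and> (\<forall>g\<in>carrier G. h' (u g) = v g)
              \<longrightarrow> (\<forall>z\<in>carrier C. h' z = h z))))"


section \<open>Groups given by generators and relators\<close>

text \<open>In a word, (x, True) stands for the generator x and (x, False) for its inverse.\<close>

inductive word_eq :: "('x \<times> bool) list set \<Rightarrow> ('x \<times> bool) list \<Rightarrow> ('x \<times> bool) list \<Rightarrow> bool"
  for R where
  refl: "word_eq R w w"
| sym: "word_eq R v w \<Longrightarrow> word_eq R w v"
| trans: "\<lbrakk>word_eq R u v; word_eq R v w\<rbrakk> \<Longrightarrow> word_eq R u w"
| append: "\<lbrakk>word_eq R v w; word_eq R v' w'\<rbrakk> \<Longrightarrow> word_eq R (v @ v') (w @ w')"
| cancel: "word_eq R [(x, s), (x, \<not> s)] []"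
| relator: "r \<in> R \<Longrightarrow> word_eq R r []"

definition word_class :: "('x \<times> bool) list set \<Rightarrow> ('x \<times> bool) list \<Rightarrow> ('x \<times> bool) list set" where
  "word_class R w = {v. word_eq R w v}"

definition presented_group :: "('x \<times> bool) list set \<Rightarrow> ('x \<times> bool) list set monoid" where
  "presented_group R =
     \<lparr>carrier = range (word_class R),
      mult = (\<lambda>X Y. \<Union>x\<in>X. \<Union>y\<in>Y. word_class R (x @ y)),
      one = word_class R []\<rparr>"


section \<open>The objects of the theorem\<close>

definition Cpow :: "nat \<Rightarrow> complex vec cstar" where
  "Cpow k =
     \<lparr>carrier = carrier_vec k, mult = (\<lambda>v w. vec k (\<lambda>i. v $ i * w $ i)), one = vec k (\<lambda>_. 1),
      zero = 0\<^sub>v k, add = (+), smult = (\<cdot>\<^sub>v), star = map_vec cnj,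
      cnorm = (\<lambda>v. Max ((\<lambda>i. cmod (v $ i)) ` {..<k}))\<rparr>"

definition Cpow_opsys :: "nat \<Rightarrow> complex vec opsys" where
  "Cpow_opsys k = opsub (Cpow k) (carrier (Cpow k))"

definition null_space :: "nat \<Rightarrow> nat \<Rightarrow> complex vec set" where
  "null_space k m =
     LinearCombinations.module.span class_ring (Cpow_opsys (k + m))
       {vec (k + m) (\<lambda>i. if i < k then 1 else - 1)}"

definition quotient_system :: "nat \<Rightarrow> nat \<Rightarrow> complex vec set opsys" where
  "quotient_system k m = quotient_opsys (Cpow_opsys (k + m)) (null_space k m)"

definition sum_system ::
  "nat \<Rightarrow> nat \<Rightarrow> 'a cstar \<Rightarrow> (complex vec \<Rightarrow> 'a) \<Rightarrow> (complex vec \<Rightarrow> 'a) \<Rightarrow> 'a opsys" where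
  "sum_system k m A i j =
     opsub A {i x \<oplus>\<^bsub>A\<^esub> j y | x y. x \<in> carrier (Cpow k) \<and> y \<in> carrier (Cpow m)}"

datatype gen = gen_a | gen_b

definition cyclic_relators :: "nat \<Rightarrow> nat \<Rightarrow> (gen \<times> bool) list set" where
  "cyclic_relators k m = {replicate k (gen_a, True), replicate m (gen_b, True)}"

definition free_prod_cyclic :: "nat \<Rightarrow> nat \<Rightarrow> (gen \<times> bool) list set monoid" where
  "free_prod_cyclic k m = presented_group (cyclic_relators k m)"

definition power_system ::
  "nat \<Rightarrow> nat \<Rightarrow> 'a cstar \<Rightarrow> ((gen \<times> bool) list set \<Rightarrow> 'a) \<Rightarrow> 'a opsys" where
  "power_system k m C u =
     (let a = u (word_class (cyclic_relators k m) [(gen_a, True)]);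
          b = u (word_class (cyclic_relators k m) [(gen_b, True)])
      in opsub C (LinearCombinations.module.span class_ring C
           ({\<one>\<^bsub>C\<^esub>} \<union> {a [^]\<^bsub>C\<^esub> i | i :: nat. 1 \<le> i \<and> i < k}
             \<union> {b [^]\<^bsub>C\<^esub> i | i :: nat. 1 \<le> i \<and> i < m})))"

end

theory Submission
  imports Defs "HOL-Library.Countable" "HOL-Analysis.L2_Norm"
begin

text \<open>
  The cyclic unitaries a and b have spectral projections, so that \<open>C*(Z_k)\<close> is \<open>C^k\<close> and the full group
  algebra C is the free product of \<open>C^k\<close> and \<open>C^m\<close>; its subspace of sums is the span of the powers of a
  and b.  The map \<open>(x, y) \<mapsto> (\<alpha> x + \<beta> y) / 2\<close> is unital completely positive with kernel the span of the
  sign vector, and the point is that the induced map on the quotient is a complete order embedding.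
  If a hermitian matrix over \<open>C^(k+m)\<close> has no positive representative even after adding a positive multiple of
  the unit, Hahn-Banach separates it from the cone: this gives positive semidefinite matrices \<open>E s\<close>
  whose sum over s < k equals the sum over \<open>s \<ge> k\<close>.  Two Gram decompositions of this common sum
  are intertwined by a self-adjoint unitary, which produces a finite-dimensional
  representation of the free product and a vector at which the image in C fails to be positive.
  The quotient is the coproduct because the average of two ucp maps on \<open>C^k\<close> and \<open>C^m\<close> kills the sign vector.
\<close>

section \<open>Complex *-algebras\<close>

text \<open>The C*-axioms are abstract, and the order on matrices over A is given by the Gram
  matrices Y* Y alone; nothing passes through the spectrum or a Hilbert space representation of a
  general A. That these cones are proper and Archimedean is proved inside the algebra, from a square
  root iteration that needs only a complete norm and power bounded elements. Matrices over A then
  get by with the sum of the norms of their entries, which is in general not a C*-norm.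

  The order on the quotient already contains an arbitrarily small multiple of the unit. For this
  reason the separation is done with a gauge and a margin \<epsilon>, and the sum of the cone and
  the null space is never shown to be closed.

  Universal properties are tested on algebras whose carrier lies in a given type \<open>'u\<close>.
  The injection \<open>universe\<close> makes room there for the finite matrix algebras in which the
  dilation takes place.

  The factor 1/2 in the map on C^(k+m) makes it unital and reappears as the factor 2 in the
  inclusions of C^k and C^m into the quotient.\<close>

context star_vector_space
begin

interpretation M: Module.module class_ring V
  by (rule vector_space)

lemma zero_in [simp, intro]: "\<zero> \<in> carrier V"
  by simp

lemma smult_in [simp, intro]: "x \<in> carrier V \<Longrightarrow> c \<odot> x \<in> carrier V"
  by (simp add: M.smult_closed)

lemma add_in: "x \<in> carrier V \<Longrightarrow> y \<in> carrier V \<Longrightarrow> x \<oplus> y \<in> carrier V"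
  by simp

lemma smult_add_left: "x \<in> carrier V \<Longrightarrow> (a + b) \<odot> x = a \<odot> x \<oplus> b \<odot> x"
  using M.smult_l_distr by simp

lemma smult_add_right:
  "x \<in> carrier V \<Longrightarrow> y \<in> carrier V \<Longrightarrow> a \<odot> (x \<oplus> y) = a \<odot> x \<oplus> a \<odot> y"
  using M.smult_r_distr by simp

lemma smult_smult [simp]: "x \<in> carrier V \<Longrightarrow> a \<odot> (b \<odot> x) = (a * b) \<odot> x"
  using M.smult_assoc1 by simp

lemma one_smult [simp]: "x \<in> carrier V \<Longrightarrow> 1 \<odot> x = x"
  using M.smult_one by simp

lemma zero_smult [simp]: "x \<in> carrier V \<Longrightarrow> 0 \<odot> x = \<zero>"
  using M.smult_l_null by simp

lemma smult_zero [simp]: "a \<odot> \<zero> = \<zero>"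
  using M.smult_r_null by simp

lemma uminus_smult: "x \<in> carrier V \<Longrightarrow> \<ominus> x = (- 1) \<odot> x"
  using M.smult_l_minus[of 1 x] by (simp add: class_ring_simps)

lemma abelian_group_V: "abelian_group V"
  by (rule M.abelian_group_axioms)

lemma finsum_smult:
  "finite I \<Longrightarrow> f \<in> I \<rightarrow> carrier V \<Longrightarrow> c \<odot> (\<Oplus>i\<in>I. f i) = (\<Oplus>i\<in>I. c \<odot> f i)"
  using M.finsum_smult_ldistr[of I c f] by simp

lemma star_zero [simp]: "star V \<zero> = \<zero>"
  using star_smult[OF one_in, of 0] star_one one_in by simp

lemma star_uminus: "x \<in> carrier V \<Longrightarrow> star V (\<ominus> x) = \<ominus> star V x"
  by (simp add: uminus_smult star_smult star_closed)

lemma star_finsum: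
  "finite I \<Longrightarrow> f \<in> I \<rightarrow> carrier V \<Longrightarrow> star V (\<Oplus>i\<in>I. f i) = (\<Oplus>i\<in>I. star V (f i))"
proof (induction rule: finite_induct)
  case (insert i I)
  moreover have "(\<lambda>i. star V (f i)) \<in> I \<rightarrow> carrier V" "f \<in> I \<rightarrow> carrier V"
    using insert.prems by (auto intro!: star_closed)
  ultimately show ?case
    by (simp add: M.finsum_insert star_closed star_add M.finsum_closed Pi_iff)
qed simp

end

text \<open>The algebraic half of a C*-algebra. It passes from A to the matrices over A
  (\<open>mat_alg_star_alg\<close>), where no C*-norm is constructed.\<close>

locale star_alg = star_vector_space A + ring A
  for A :: "('a, 'm) cstar_scheme" (structure) +
  assumes smult_mult_left:
      "\<lbrakk>x \<in> carrier A; y \<in> carrier A\<rbrakk> \<Longrightarrow> (c \<odot> x) \<otimes> y = c \<odot> (x \<otimes> y)"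
    and smult_mult_right:
      "\<lbrakk>x \<in> carrier A; y \<in> carrier A\<rbrakk> \<Longrightarrow> x \<otimes> (c \<odot> y) = c \<odot> (x \<otimes> y)"
    and star_mult:
      "\<lbrakk>x \<in> carrier A; y \<in> carrier A\<rbrakk> \<Longrightarrow> star A (x \<otimes> y) = star A y \<otimes> star A x"
begin

lemma star_minus:
  "x \<in> carrier A \<Longrightarrow> y \<in> carrier A \<Longrightarrow> star A (x \<ominus> y) = star A x \<ominus> star A y"
  by (simp add: a_minus_def star_add star_uminus)

lemma smult_minus_right:
  "x \<in> carrier A \<Longrightarrow> y \<in> carrier A \<Longrightarrow> a \<odot> (x \<ominus> y) = a \<odot> x \<ominus> a \<odot> y"
  by (simp add: a_minus_def smult_add_right uminus_smult mult.commute)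

lemma star_pow: "x \<in> carrier A \<Longrightarrow> star A (x [^] (n :: nat)) = star A x [^] n"
proof (induction n)
  case (Suc n)
  then show ?case
    using nat_pow_comm[of "star A x" n 1] by (simp add: star_mult star_closed)
qed (simp add: star_one)

lemma double: "x \<in> carrier A \<Longrightarrow> x \<oplus> x = 2 \<odot> x"
  using smult_add_left[of x 1 1] by simp

end

text \<open>An isometric involution replaces the C*-identity, so that M_n(A) with the sum of the
  entry norms is an instance. The norm of the unit is left open; in M_n(A) it is n times the norm of
  the unit of A.\<close>

locale banach_star_alg = star_alg A
  for A :: "('a, 'm) cstar_scheme" (structure) +
  assumes norm_nonneg: "x \<in> carrier A \<Longrightarrow> 0 \<le> cnorm A x"
    and norm_zero_iff: "x \<in> carrier A \<Longrightarrow> cnorm A x = 0 \<longleftrightarrow> x = \<zero>"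
    and norm_triangle:
      "\<lbrakk>x \<in> carrier A; y \<in> carrier A\<rbrakk> \<Longrightarrow> cnorm A (x \<oplus> y) \<le> cnorm A x + cnorm A y"
    and norm_smult: "x \<in> carrier A \<Longrightarrow> cnorm A (c \<odot> x) = cmod c * cnorm A x"
    and norm_mult:
      "\<lbrakk>x \<in> carrier A; y \<in> carrier A\<rbrakk> \<Longrightarrow> cnorm A (x \<otimes> y) \<le> cnorm A x * cnorm A y"
    and norm_star: "x \<in> carrier A \<Longrightarrow> cnorm A (star A x) = cnorm A x"
    and complete:
      "\<lbrakk>\<And>n. (s :: nat \<Rightarrow> 'a) n \<in> carrier A;
        \<And>\<epsilon>. \<epsilon> > 0 \<Longrightarrow> \<exists>N. \<forall>p\<ge>N. \<forall>q\<ge>N. cnorm A (s p \<ominus> s q) < \<epsilon>\<rbrakk>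
       \<Longrightarrow> \<exists>l\<in>carrier A. (\<lambda>n. cnorm A (s n \<ominus> l)) \<longlonglongrightarrow> 0"
begin

lemma norm_zero [simp]: "cnorm A \<zero> = 0"
  using norm_zero_iff by blast

lemma norm_uminus: "x \<in> carrier A \<Longrightarrow> cnorm A (\<ominus> x) = cnorm A x"
  by (simp add: uminus_smult norm_smult)

lemma norm_minus_commute:
  assumes "x \<in> carrier A" "y \<in> carrier A"
  shows "cnorm A (x \<ominus> y) = cnorm A (y \<ominus> x)"
proof -
  have "x \<ominus> y = \<ominus> (y \<ominus> x)"
    using assms by algebra
  then show ?thesis
    using assms by (simp add: norm_uminus)
qed

lemma norm_triangle_minus:
  assumes "x \<in> carrier A" "y \<in> carrier A"
  shows "cnorm A (x \<ominus> y) \<le> cnorm A x + cnorm A y"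
  using norm_triangle[of x "\<ominus> y"] assms by (simp add: a_minus_def norm_uminus)

text \<open>Limits are expressed through \<open>cnorm\<close>, since carriers are sets in a record
  and have no type class topology.\<close>

definition tends :: "(nat \<Rightarrow> 'a) \<Rightarrow> 'a \<Rightarrow> bool" where
  "tends s l \<longleftrightarrow> (\<lambda>n. cnorm A (s n \<ominus> l)) \<longlonglongrightarrow> 0"

lemma tendsI:
  assumes "\<And>n. s n \<in> carrier A" "l \<in> carrier A"
    and "\<And>n. cnorm A (s n \<ominus> l) \<le> b n" "b \<longlonglongrightarrow> 0"
  shows "tends s l"
  unfolding tends_def
  by (rule tendsto_sandwich[of "\<lambda>_. 0" _ _ b]) (use assms in \<open>auto simp: norm_nonneg\<close>)

lemma tends_const: "l \<in> carrier A \<Longrightarrow> tends (\<lambda>_. l) l"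
  by (simp add: tends_def r_neg a_minus_def)

lemma tends_unique:
  assumes "\<And>n. s n \<in> carrier A" "l \<in> carrier A" "l' \<in> carrier A" "tends s l" "tends s l'"
  shows "l = l'"
proof -
  have "cnorm A (l \<ominus> l') \<le> cnorm A (s n \<ominus> l) + cnorm A (s n \<ominus> l')" for n
  proof -
    have "l \<ominus> l' = (l \<ominus> s n) \<oplus> (s n \<ominus> l')"
      using assms(1)[of n] assms(2,3) by algebra
    then show ?thesis
      using norm_triangle[of "l \<ominus> s n" "s n \<ominus> l'"] norm_minus_commute[of l "s n"] assms(1)[of n] assms(2,3)
      by simp
  qed
  moreover have "(\<lambda>n. cnorm A (s n \<ominus> l) + cnorm A (s n \<ominus> l')) \<longlonglongrightarrow> 0"
    using tendsto_add[OF assms(4,5)[unfolded tends_def]] by simp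
  ultimately have "cnorm A (l \<ominus> l') \<le> 0"
    by (intro LIMSEQ_le_const) auto
  then have "l \<ominus> l' = \<zero>"
    using norm_zero_iff norm_nonneg assms(2,3) by (metis antisym minus_closed)
  then show ?thesis
    using assms(2,3) by simp
qed

lemma tends_add:
  assumes "\<And>n. s n \<in> carrier A" "\<And>n. s' n \<in> carrier A" "l \<in> carrier A" "l' \<in> carrier A"
    and "tends s l" "tends s' l'"
  shows "tends (\<lambda>n. s n \<oplus> s' n) (l \<oplus> l')"
proof (rule tendsI[where b = "\<lambda>n. cnorm A (s n \<ominus> l) + cnorm A (s' n \<ominus> l')"])
  fix n
  have "s n \<oplus> s' n \<ominus> (l \<oplus> l') = (s n \<ominus> l) \<oplus> (s' n \<ominus> l')"
    using assms(1)[of n] assms(2)[of n] assms(3,4) by algebra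
  then show "cnorm A (s n \<oplus> s' n \<ominus> (l \<oplus> l')) \<le> cnorm A (s n \<ominus> l) + cnorm A (s' n \<ominus> l')"
    using norm_triangle[of "s n \<ominus> l" "s' n \<ominus> l'"] assms by simp
qed (use assms tendsto_add[OF assms(5,6)[unfolded tends_def]] in auto)

lemma tends_smult:
  assumes "\<And>n. s n \<in> carrier A" "l \<in> carrier A" "tends s l"
  shows "tends (\<lambda>n. c \<odot> s n) (c \<odot> l)"
  using tendsto_mult[OF tendsto_const[of "cmod c"] assms(3)[unfolded tends_def]] assms(1,2)
  by (simp add: tends_def norm_smult flip: smult_minus_right)

lemma tends_star:
  assumes "\<And>n. s n \<in> carrier A" "l \<in> carrier A" "tends s l"
  shows "tends (\<lambda>n. star A (s n)) (star A l)"
  using assms by (simp add: tends_def norm_star flip: star_minus)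

lemma tends_Suc: "tends s l \<Longrightarrow> tends (\<lambda>n. s (Suc n)) l"
  unfolding tends_def by (rule LIMSEQ_Suc)

lemma tends_norm_le:
  assumes "\<And>n. s n \<in> carrier A" "l \<in> carrier A" "tends s l" "\<And>n. cnorm A (s n) \<le> K"
  shows "cnorm A l \<le> K"
proof -
  have "cnorm A l \<le> cnorm A (s n \<ominus> l) + K" for n
  proof -
    have "l = s n \<ominus> (s n \<ominus> l)"
      using assms(1)[of n] assms(2) by algebra
    then show ?thesis
      using norm_triangle_minus[of "s n" "s n \<ominus> l"] assms(1,2) assms(4)[of n] by fastforce
  qed
  moreover have "(\<lambda>n. cnorm A (s n \<ominus> l) + K) \<longlonglongrightarrow> 0 + K"
    using assms(3) unfolding tends_def by (intro tendsto_intros)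
  ultimately have "cnorm A l \<le> 0 + K"
    by (intro LIMSEQ_le_const) auto
  then show ?thesis
    by simp
qed

lemma tends_mult:
  assumes "\<And>n. s n \<in> carrier A" "\<And>n. s' n \<in> carrier A" "l \<in> carrier A" "l' \<in> carrier A"
    and "tends s l" "tends s' l'"
  shows "tends (\<lambda>n. s n \<otimes> s' n) (l \<otimes> l')"
proof (rule tendsI[where b = "\<lambda>n. cnorm A (s n \<ominus> l) * (cnorm A (s' n \<ominus> l') + cnorm A l')
    + cnorm A l * cnorm A (s' n \<ominus> l')"])
  fix n
  let ?x = "s n \<ominus> l" and ?y = "s' n \<ominus> l'"
  have eq: "s n \<otimes> s' n \<ominus> l \<otimes> l' = ?x \<otimes> (?y \<oplus> l') \<oplus> l \<otimes> ?y"
    using assms(1)[of n] assms(2)[of n] assms(3,4) by algebra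
  have "cnorm A (s n \<otimes> s' n \<ominus> l \<otimes> l') \<le> cnorm A (?x \<otimes> (?y \<oplus> l')) + cnorm A (l \<otimes> ?y)"
    unfolding eq by (rule norm_triangle) (use assms in auto)
  also have "\<dots> \<le> cnorm A ?x * cnorm A (?y \<oplus> l') + cnorm A l * cnorm A ?y"
    by (intro add_mono norm_mult) (use assms in auto)
  also have "\<dots> \<le> cnorm A ?x * (cnorm A ?y + cnorm A l') + cnorm A l * cnorm A ?y"
    by (intro add_mono mult_left_mono norm_triangle norm_nonneg order_refl) (use assms in auto)
  finally show "cnorm A (s n \<otimes> s' n \<ominus> l \<otimes> l') \<le> \<dots>" .
next
  have "(\<lambda>n. cnorm A (s n \<ominus> l) * (cnorm A (s' n \<ominus> l') + cnorm A l')
    + cnorm A l * cnorm A (s' n \<ominus> l')) \<longlonglongrightarrow> 0 * (0 + cnorm A l') + cnorm A l * 0"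
    using assms(5,6) unfolding tends_def by (intro tendsto_intros)
  then show "(\<lambda>n. cnorm A (s n \<ominus> l) * (cnorm A (s' n \<ominus> l') + cnorm A l')
    + cnorm A l * cnorm A (s' n \<ominus> l')) \<longlonglongrightarrow> 0"
    by simp
qed (use assms in auto)

subsection \<open>Square roots of power bounded perturbations of the unit\<close>

text \<open>\<open>pow_cone h c x\<close> holds if x = p(h) for a polynomial p with nonnegative
  coefficients and c = p(1). When all powers of h have norm at most K, such an x has norm at most K
  c, so estimates in the algebra reduce to the scalar case h = 1.\<close>

inductive pow_cone :: "'a \<Rightarrow> real \<Rightarrow> 'a \<Rightarrow> bool" for h where
  cone_zero: "pow_cone h 0 \<zero>"
| cone_pow: "pow_cone h 1 (h [^] (l :: nat))"
| cone_add: "pow_cone h c x \<Longrightarrow> pow_cone h d y \<Longrightarrow> pow_cone h (c + d) (x \<oplus> y)"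
| cone_scale: "pow_cone h c x \<Longrightarrow> t \<ge> 0 \<Longrightarrow> pow_cone h (t * c) (complex_of_real t \<odot> x)"

context
  fixes h
  assumes h: "h \<in> carrier A"
begin

lemma pow_cone_in: "pow_cone h c x \<Longrightarrow> x \<in> carrier A"
  by (induction rule: pow_cone.induct) (use h in auto)

lemma pow_cone_nonneg: "pow_cone h c x \<Longrightarrow> c \<ge> 0"
  by (induction rule: pow_cone.induct) auto

lemma pow_cone_commute:
  assumes "y \<in> carrier A" "y \<otimes> h = h \<otimes> y"
  shows "pow_cone h c x \<Longrightarrow> y \<otimes> x = x \<otimes> y"
proof (induction rule: pow_cone.induct)
  case (cone_pow l)
  show ?case
  proof (induction l)
    case (Suc l)
    have "y \<otimes> (h [^] l \<otimes> h) = h [^] l \<otimes> (y \<otimes> h)"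
      using h assms(1) Suc by (metis m_assoc nat_pow_closed)
    then show ?case
      using h assms by (simp add: m_assoc)
  qed (use assms in simp)
qed (use assms(1) pow_cone_in in \<open>auto simp: r_distr l_distr smult_mult_left smult_mult_right\<close>)

lemma pow_cone_commute': "pow_cone h c x \<Longrightarrow> pow_cone h d y \<Longrightarrow> x \<otimes> y = y \<otimes> x"
  using pow_cone_commute[of x d y] pow_cone_commute[of h c x] pow_cone_in h by auto

lemma pow_cone_star: "star A h = h \<Longrightarrow> pow_cone h c x \<Longrightarrow> star A x = x"
  by (rotate_tac, induction rule: pow_cone.induct)
    (use h pow_cone_in in \<open>auto simp: star_add star_smult star_pow\<close>)

lemma pow_cone_mult: "pow_cone h c x \<Longrightarrow> pow_cone h d y \<Longrightarrow> pow_cone h (c * d) (x \<otimes> y)"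
proof (induction rule: pow_cone.induct)
  case cone_zero
  then show ?case
    using pow_cone_in pow_cone.intros(1) by simp
next
  case (cone_pow l)
  then show ?case
  proof (induction rule: pow_cone.induct)
    case (cone_pow l')
    then show ?case
      using h pow_cone.intros(2)[of h "l + l'"] by (simp add: nat_pow_mult)
  qed (use h pow_cone_in pow_cone.intros in \<open>auto simp: r_distr smult_mult_right\<close>)
next
  case (cone_add c x c' x')
  then show ?case
    using pow_cone.intros(3)[of h "c * d" "x \<otimes> y" "c' * d" "x' \<otimes> y"] pow_cone_in
    by (simp add: l_distr distrib_right)
next
  case (cone_scale c x t)
  then show ?case
    using pow_cone.intros(4)[of h "c * d" "x \<otimes> y" t] pow_cone_in
    by (simp add: smult_mult_left mult.assoc)
qed

lemma pow_cone_norm: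
  assumes "\<And>l :: nat. cnorm A (h [^] l) \<le> K"
  shows "pow_cone h c x \<Longrightarrow> cnorm A x \<le> K * c"
proof (induction rule: pow_cone.induct)
  case (cone_add c x d y)
  then show ?case
    using norm_triangle[of x y] pow_cone_in by (fastforce simp: distrib_left)
next
  case (cone_scale c x t)
  then show ?case
    using pow_cone_in mult_left_mono[of "cnorm A x" "K * c" t] by (simp add: norm_smult mult_ac)
qed (use assms in auto)

text \<open>A fixed point R of R = (h + R^2) / 2 satisfies (1 - R)^2 = 1 - h. Every iterate is a
  polynomial in h with nonnegative coefficients; \<open>sqrt_bound\<close> is its value at h = 1, an
  increasing sequence bounded by 1.\<close>

primrec sqrt_seq :: "nat \<Rightarrow> 'a" where
  "sqrt_seq 0 = \<zero>"
| "sqrt_seq (Suc n) = (1 / 2) \<odot> (h \<oplus> sqrt_seq n \<otimes> sqrt_seq n)"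

primrec sqrt_bound :: "nat \<Rightarrow> real" where
  "sqrt_bound 0 = 0"
| "sqrt_bound (Suc n) = (1 / 2) * (1 + sqrt_bound n * sqrt_bound n)"

lemma sqrt_seq_cone: "pow_cone h (sqrt_bound n) (sqrt_seq n)"
proof (induction n)
  case (Suc n)
  have "pow_cone h 1 h"
    using cone_pow[of h 1] h by simp
  from cone_scale[OF cone_add[OF this pow_cone_mult[OF Suc Suc]], of "1 / 2"]
  show ?case
    by simp
qed (simp add: cone_zero)

lemma sqrt_seq_in: "sqrt_seq n \<in> carrier A"
  using sqrt_seq_cone pow_cone_in by blast

text \<open>Since the iterates commute, the increment after consecutive iterates x and y is (y -
  x)(y + x) / 2. So increments inherit nonnegative coefficients, and their coefficient sums are the
  increments of \<open>sqrt_bound\<close>.\<close>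

lemma sqrt_seq_step:
  "pow_cone h (sqrt_bound (Suc n) - sqrt_bound n) (sqrt_seq (Suc n) \<ominus> sqrt_seq n)"
proof (induction n)
  case 0
  have "sqrt_seq (Suc 0) \<ominus> sqrt_seq 0 = (1 / 2) \<odot> h"
    using h by (simp add: a_minus_def)
  then show ?case
    using cone_scale[OF cone_pow[of h 1], of "1 / 2"] h by simp
next
  case (Suc n)
  let ?x = "sqrt_seq n" and ?y = "sqrt_seq (Suc n)"
  let ?a = "sqrt_bound n" and ?b = "sqrt_bound (Suc n)"
  note in_A = sqrt_seq_in[of n] sqrt_seq_in[of "Suc n"]
  have "?x \<otimes> ?y = ?y \<otimes> ?x"
    using sqrt_seq_cone pow_cone_commute' by blast
  then have "(h \<oplus> ?y \<otimes> ?y) \<ominus> (h \<oplus> ?x \<otimes> ?x) = (?y \<ominus> ?x) \<otimes> (?y \<oplus> ?x)"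
    using in_A h by algebra
  then have "sqrt_seq (Suc (Suc n)) \<ominus> ?y = (1 / 2) \<odot> ((?y \<ominus> ?x) \<otimes> (?y \<oplus> ?x))"
    using in_A h smult_minus_right[of "h \<oplus> ?y \<otimes> ?y" "h \<oplus> ?x \<otimes> ?x" "1 / 2"]
    by (metis add_in m_closed sqrt_seq.simps(2))
  moreover have "sqrt_bound (Suc (Suc n)) - ?b = (1 / 2) * ((?b - ?a) * (?b + ?a))"
    by (simp add: algebra_simps)
  moreover have "pow_cone h (1 / 2 * ((?b - ?a) * (?b + ?a))) ((1 / 2) \<odot> ((?y \<ominus> ?x) \<otimes> (?y \<oplus> ?x)))"
    using cone_scale[OF pow_cone_mult[OF Suc cone_add[OF sqrt_seq_cone[of "Suc n"] sqrt_seq_cone[of n]]],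
        of "1 / 2"] by (simp del: sqrt_seq.simps sqrt_bound.simps)
  ultimately show ?case
    by metis
qed

lemma sqrt_seq_diff: "pow_cone h (sqrt_bound (n + d) - sqrt_bound n) (sqrt_seq (n + d) \<ominus> sqrt_seq n)"
proof (induction d)
  case 0
  then show ?case
    using sqrt_seq_in cone_zero by (simp add: a_minus_def r_neg)
next
  case (Suc d)
  have "(sqrt_seq (Suc (n + d)) \<ominus> sqrt_seq (n + d)) \<oplus> (sqrt_seq (n + d) \<ominus> sqrt_seq n) = sqrt_seq (Suc (n + d)) \<ominus> sqrt_seq n"
    using sqrt_seq_in[of "Suc (n + d)"] sqrt_seq_in[of "n + d"] sqrt_seq_in[of n] by algebra
  then show ?case
    using cone_add[OF sqrt_seq_step[of "n + d"] Suc] by simp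
qed

lemma sqrt_bound_le: "0 \<le> sqrt_bound n \<and> sqrt_bound n \<le> 1"
proof (induction n)
  case (Suc n)
  then have "sqrt_bound n * sqrt_bound n \<le> 1 * 1"
    by (intro mult_mono) auto
  then show ?case
    using Suc by simp
qed simp

text \<open>The increments of \<open>sqrt_seq\<close> have norm at most K times those of the
  convergent sequence \<open>sqrt_bound\<close>, so the iteration is Cauchy. Power boundedness of h
  suffices; for matrices over A it will be obtained from the order, although the norm of h may
  exceed 1. Commutation with y holds for every iterate and survives the limit.\<close>

theorem sqrt_exists:
  assumes star: "star A h = h" and K: "\<And>l :: nat. cnorm A (h [^] l) \<le> K"
  obtains R where "R \<in> carrier A" "star A R = R" "(\<one> \<ominus> R) \<otimes> (\<one> \<ominus> R) = \<one> \<ominus> h" "cnorm A R \<le> K"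
    "\<And>y. y \<in> carrier A \<Longrightarrow> y \<otimes> h = h \<otimes> y \<Longrightarrow> y \<otimes> R = R \<otimes> y"
proof -
  note [simp] = sqrt_seq_in
  have K0: "K \<ge> 0"
    using K[of 0] norm_nonneg[of \<one>] one_in by simp
  have mono: "sqrt_bound n \<le> sqrt_bound (n + d)" for n d
    using pow_cone_nonneg[OF sqrt_seq_diff[of n d]] by simp
  then have "incseq sqrt_bound"
    by (auto simp: incseq_def le_iff_add)
  then have "convergent sqrt_bound"
    using sqrt_bound_le by (intro Bseq_mono_convergent BseqI'[of _ 1]) (auto simp: incseq_def)
  then have Cauchy: "Cauchy sqrt_bound"
    by (rule convergent_Cauchy)
  have le: "cnorm A (sqrt_seq p \<ominus> sqrt_seq q) \<le> K * \<bar>sqrt_bound p - sqrt_bound q\<bar>" for p q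
  proof (cases "p \<le> q")
    case True
    then show ?thesis
      using pow_cone_norm[OF K sqrt_seq_diff[of p "q - p"]] mono[of p "q - p"]
        norm_minus_commute[of "sqrt_seq p" "sqrt_seq q"] by simp
  next
    case False
    then show ?thesis
      using pow_cone_norm[OF K sqrt_seq_diff[of q "p - q"]] mono[of q "p - q"] by simp
  qed
  have "\<exists>N. \<forall>p\<ge>N. \<forall>q\<ge>N. cnorm A (sqrt_seq p \<ominus> sqrt_seq q) < \<epsilon>" if "\<epsilon> > 0" for \<epsilon>
  proof -
    \<comment> \<open>K can be 0, in the zero algebra, hence K + 1.\<close>
    have pos: "\<epsilon> / (K + 1) > 0"
      using that K0 by simp
    obtain N where N: "\<forall>p\<ge>N. \<forall>q\<ge>N. \<bar>sqrt_bound p - sqrt_bound q\<bar> < \<epsilon> / (K + 1)"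
      using CauchyD[OF Cauchy pos] by auto
    have "cnorm A (sqrt_seq p \<ominus> sqrt_seq q) < \<epsilon>" if "p \<ge> N" "q \<ge> N" for p q
    proof -
      have "cnorm A (sqrt_seq p \<ominus> sqrt_seq q) \<le> (K + 1) * \<bar>sqrt_bound p - sqrt_bound q\<bar>"
        using le[of p q] by (simp add: distrib_right)
      also have "\<dots> < (K + 1) * (\<epsilon> / (K + 1))"
        using N that K0 by (intro mult_strict_left_mono) auto
      finally show ?thesis
        using K0 by simp
    qed
    then show ?thesis
      by blast
  qed
  with complete[of sqrt_seq] obtain R where R: "R \<in> carrier A" "tends sqrt_seq R"
    by (auto simp: tends_def)
  have "tends (\<lambda>n. sqrt_seq (Suc n)) ((1 / 2) \<odot> (h \<oplus> R \<otimes> R))"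
    unfolding sqrt_seq.simps
    by (intro tends_smult tends_add tends_mult tends_const) (use h R in auto)
  with tends_Suc[OF R(2)] have eq: "R = (1 / 2) \<odot> (h \<oplus> R \<otimes> R)"
    using tends_unique[of "\<lambda>n. sqrt_seq (Suc n)"] R(1) h sqrt_seq_in by (metis (no_types, lifting) add_in m_closed smult_in)
  have "R \<oplus> R = h \<oplus> R \<otimes> R"
    using arg_cong[OF eq, of "\<lambda>x. 2 \<odot> x"] R h by (simp add: double)
  moreover have "(\<one> \<ominus> R) \<otimes> (\<one> \<ominus> R) = \<one> \<ominus> (R \<oplus> R) \<oplus> R \<otimes> R"
    using R(1) by (simp add: a_minus_def l_distr r_distr l_minus r_minus minus_add a_ac)
  moreover have "\<one> \<ominus> (h \<oplus> R \<otimes> R) \<oplus> R \<otimes> R = \<one> \<ominus> h"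
    using R(1) h by algebra
  ultimately have sq: "(\<one> \<ominus> R) \<otimes> (\<one> \<ominus> R) = \<one> \<ominus> h"
    by simp
  have "star A (sqrt_seq n) = sqrt_seq n" for n
    using pow_cone_star[OF star sqrt_seq_cone] .
  then have "star A R = R"
    using tends_star[OF _ R] tends_unique[OF _ _ _ _ R(2)] R(1) star_closed by auto
  moreover have "cnorm A R \<le> K"
  proof (rule tends_norm_le[OF _ R])
    fix n
    show "cnorm A (sqrt_seq n) \<le> K"
      using pow_cone_norm[OF K sqrt_seq_cone[of n]] mult_left_mono[OF conjunct2[OF sqrt_bound_le[of n]] K0] by simp
  qed simp
  moreover have "y \<otimes> R = R \<otimes> y" if "y \<in> carrier A" "y \<otimes> h = h \<otimes> y" for y
  proof (rule tends_unique)
    show "tends (\<lambda>n. y \<otimes> sqrt_seq n) (y \<otimes> R)"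
      by (intro tends_mult tends_const) (use that R in auto)
    have "tends (\<lambda>n. sqrt_seq n \<otimes> y) (R \<otimes> y)"
      by (intro tends_mult tends_const) (use that R in auto)
    then show "tends (\<lambda>n. y \<otimes> sqrt_seq n) (R \<otimes> y)"
      using pow_cone_commute[OF that sqrt_seq_cone] by simp
  qed (use that R in auto)
  ultimately show thesis
    using that sq R(1) by blast
qed

end

end

section \<open>Positive elements of C*-algebras\<close>

context cstar_algebra
begin

lemma norm_le_norm_star:
  assumes "x \<in> carrier A"
  shows "cnorm A x \<le> cnorm A (star A x)"
proof (cases "cnorm A x = 0")
  case False
  have "(cnorm A x)\<^sup>2 \<le> cnorm A (star A x) * cnorm A x"
    using norm_mult[of "star A x" x] assms by (simp add: cstar_identity star_closed)
  then show ?thesis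
    using False norm_nonneg[OF assms] by (simp add: power2_eq_square)
qed (use assms in \<open>simp add: norm_nonneg star_closed\<close>)

lemma norm_star_eq: "x \<in> carrier A \<Longrightarrow> cnorm A (star A x) = cnorm A x"
  using norm_le_norm_star[of x] norm_le_norm_star[of "star A x"] by (simp add: star_closed star_star)

end

sublocale cstar_algebra \<subseteq> banach_star_alg A
  by unfold_locales
    (auto simp: smult_mult_left smult_mult_right star_mult norm_nonneg norm_zero_iff norm_smult norm_star_eq
      intro: norm_triangle norm_mult complete)

context cstar_algebra
begin

text \<open>The zero algebra is allowed, so the norm of the unit is 0 or 1.\<close>

lemma norm_one_le: "cnorm A \<one> \<le> 1"
proof -
  have "(cnorm A \<one>)\<^sup>2 = cnorm A \<one>"
    using cstar_identity[OF one_in] star_one by simp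
  then have "cnorm A \<one> = 0 \<or> cnorm A \<one> = 1"
    by (simp add: power2_eq_square)
  then show ?thesis
    by auto
qed

section \<open>Self-adjoint elements, real scalars and square roots near the unit\<close>

definition sa :: "'a \<Rightarrow> bool" where
  "sa x \<longleftrightarrow> x \<in> carrier A \<and> star A x = x"

definition scalar :: "real \<Rightarrow> 'a" where
  "scalar t = complex_of_real t \<odot> \<one>"

lemma scalar_in [simp]: "scalar t \<in> carrier A"
  by (simp add: scalar_def)

lemma scalar_0 [simp]: "scalar 0 = \<zero>" and scalar_1: "scalar 1 = \<one>"
  by (simp_all add: scalar_def)

lemma scalar_add: "scalar (s + t) = scalar s \<oplus> scalar t"
  by (simp add: scalar_def smult_add_left)

lemma smult_scalar: "complex_of_real s \<odot> scalar t = scalar (s * t)"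
  by (simp add: scalar_def)

lemma sa_in: "sa x \<Longrightarrow> x \<in> carrier A"
  by (simp add: sa_def)

lemma sa_scalar: "sa (scalar t)"
  by (simp add: sa_def scalar_def star_smult star_one)

lemma sa_add: "sa x \<Longrightarrow> sa y \<Longrightarrow> sa (x \<oplus> y)"
  by (simp add: sa_def star_add)

lemma sa_minus: "sa x \<Longrightarrow> sa y \<Longrightarrow> sa (x \<ominus> y)"
  by (simp add: sa_def star_minus)

lemma sa_smult: "sa x \<Longrightarrow> sa (complex_of_real t \<odot> x)"
  by (simp add: sa_def star_smult)

lemma sa_square: "sa x \<Longrightarrow> sa (x \<otimes> x)"
  by (simp add: sa_def star_mult)

lemma sa_star_mult: "x \<in> carrier A \<Longrightarrow> sa (star A x \<otimes> x)"
  by (simp add: sa_def star_mult star_closed star_star)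

lemma sa_norm_square: "sa x \<Longrightarrow> cnorm A (x \<otimes> x) = (cnorm A x)\<^sup>2"
  using cstar_identity[of x] by (simp add: sa_def)

lemma sa_square_zero: "sa x \<Longrightarrow> x \<otimes> x = \<zero> \<Longrightarrow> x = \<zero>"
  using sa_norm_square[of x] norm_zero_iff[of x] by (simp add: sa_def)

lemma norm_pow_le:
  assumes "x \<in> carrier A" "cnorm A x \<le> 1"
  shows "cnorm A (x [^] (l :: nat)) \<le> 1"
proof (induction l)
  case 0
  then show ?case
    using norm_one_le by simp
next
  case (Suc l)
  have "cnorm A (x [^] l \<otimes> x) \<le> 1 * 1"
    by (rule order_trans[OF norm_mult mult_mono]) (use assms Suc in \<open>auto simp: norm_nonneg\<close>)
  then show ?case
    by simp
qed

text \<open>Here r = 1 - R for the limit R of the iteration with K = 1. The bound on 1 - r is kept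
  because it makes r positive in the sense of \<open>pos\<close>, with witness t = 1.\<close>

lemma root_near_one:
  assumes "sa h" "cnorm A h \<le> 1"
  obtains r where "sa r" "r \<otimes> r = \<one> \<ominus> h" "cnorm A (\<one> \<ominus> r) \<le> 1"
    "\<And>y. y \<in> carrier A \<Longrightarrow> y \<otimes> h = h \<otimes> y \<Longrightarrow> y \<otimes> r = r \<otimes> y"
proof -
  have h: "h \<in> carrier A" "star A h = h"
    using assms(1) by (auto simp: sa_def)
  obtain R where R: "R \<in> carrier A" "star A R = R" "(\<one> \<ominus> R) \<otimes> (\<one> \<ominus> R) = \<one> \<ominus> h" "cnorm A R \<le> 1"
    and comm: "\<And>y. y \<in> carrier A \<Longrightarrow> y \<otimes> h = h \<otimes> y \<Longrightarrow> y \<otimes> R = R \<otimes> y"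
    using sqrt_exists[OF h norm_pow_le[OF h(1) assms(2)]] by blast
  show thesis
  proof (rule that)
    show "sa (\<one> \<ominus> R)"
      using R by (simp add: sa_def star_minus star_one)
    have "\<one> \<ominus> (\<one> \<ominus> R) = R"
      using R(1) by algebra
    then show "cnorm A (\<one> \<ominus> (\<one> \<ominus> R)) \<le> 1"
      using R(4) by simp
    show "y \<otimes> (\<one> \<ominus> R) = (\<one> \<ominus> R) \<otimes> y" if "y \<in> carrier A" "y \<otimes> h = h \<otimes> y" for y
      using comm[OF that] that(1) R(1) by (simp add: a_minus_def r_distr l_distr l_minus r_minus)
  qed (use R in auto)
qed

text \<open>Positivity without spectra: for self-adjoint h the inequality says that the spectrum
  lies in [0, 2 t]. Closure under sums and nonnegative multiples is then the triangle
  inequality.\<close>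

definition pos :: "'a \<Rightarrow> bool" where
  "pos h \<longleftrightarrow> sa h \<and> (\<exists>t\<ge>0. cnorm A (scalar t \<ominus> h) \<le> t)"

lemma pos_sa: "pos h \<Longrightarrow> sa h"
  by (simp add: pos_def)

lemma pos_in: "pos h \<Longrightarrow> h \<in> carrier A"
  by (simp add: pos_def sa_def)

lemma pos_zero: "pos \<zero>"
  by (auto simp: pos_def sa_def a_minus_def intro!: exI[of _ 0])

lemma pos_add:
  assumes "pos h" "pos k"
  shows "pos (h \<oplus> k)"
proof -
  obtain t s where ts: "t \<ge> 0" "cnorm A (scalar t \<ominus> h) \<le> t" "s \<ge> 0" "cnorm A (scalar s \<ominus> k) \<le> s"
    using assms by (auto simp: pos_def)
  note hk = assms[THEN pos_in]
  have "scalar (t + s) \<ominus> (h \<oplus> k) = (scalar t \<ominus> h) \<oplus> (scalar s \<ominus> k)"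
    using hk scalar_in[of t] scalar_in[of s] unfolding scalar_add by algebra
  moreover have "cnorm A \<dots> \<le> t + s"
    by (rule order_trans[OF norm_triangle add_mono]) (use hk ts in auto)
  ultimately show ?thesis
    using ts assms by (auto simp: pos_def sa_add intro!: exI[of _ "t + s"])
qed

lemma pos_scale:
  assumes "pos h" "c \<ge> 0"
  shows "pos (complex_of_real c \<odot> h)"
proof -
  obtain t where t: "t \<ge> 0" "cnorm A (scalar t \<ominus> h) \<le> t"
    using assms by (auto simp: pos_def)
  have "scalar (c * t) \<ominus> complex_of_real c \<odot> h = complex_of_real c \<odot> (scalar t \<ominus> h)"
    using pos_in[OF assms(1)] by (simp add: smult_minus_right smult_scalar)
  then have "cnorm A (scalar (c * t) \<ominus> complex_of_real c \<odot> h) \<le> c * t"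
    using t assms pos_in[OF assms(1)] by (simp add: norm_smult mult_left_mono)
  then show ?thesis
    using assms t by (auto simp: pos_def sa_smult intro!: exI[of _ "c * t"])
qed

lemma pos_root:
  assumes "pos h"
  obtains r where "pos r" "r \<otimes> r = h" "\<And>y. y \<in> carrier A \<Longrightarrow> y \<otimes> h = h \<otimes> y \<Longrightarrow> y \<otimes> r = r \<otimes> y"
proof -
  obtain t where t: "t \<ge> 0" "cnorm A (scalar t \<ominus> h) \<le> t"
    using assms by (auto simp: pos_def)
  have h: "sa h" "h \<in> carrier A"
    using assms by (auto simp: pos_def sa_def)
  show thesis
  proof (cases "t = 0")
    case True
    then have "cnorm A (\<ominus> h) \<le> 0"
      using t h by (simp add: a_minus_def)
    then have "h = \<zero>"
      using h norm_nonneg[of h] norm_zero_iff[of h] by (simp add: norm_uminus)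
    then show ?thesis
      using that[of \<zero>] pos_zero by simp
  next
    case False
    \<comment> \<open>Then 1 - g = h / t and g has norm at most 1; the root of h is sqrt t times the
      root of 1 - g.\<close>
    define g where "g = complex_of_real (1 / t) \<odot> (scalar t \<ominus> h)"
    have g: "sa g"
      unfolding g_def by (intro sa_smult sa_minus sa_scalar h)
    have "cnorm A g \<le> 1"
      using t False h by (simp add: g_def norm_smult norm_divide)
    from root_near_one[OF g this] obtain r0 where r0: "sa r0" "r0 \<otimes> r0 = \<one> \<ominus> g" "cnorm A (\<one> \<ominus> r0) \<le> 1"
      and comm: "\<And>y. y \<in> carrier A \<Longrightarrow> y \<otimes> g = g \<otimes> y \<Longrightarrow> y \<otimes> r0 = r0 \<otimes> y"
      by blast
    have r0_in: "r0 \<in> carrier A"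
      using r0 by (simp add: sa_def)
    have g_eq: "g = \<one> \<ominus> complex_of_real (1 / t) \<odot> h"
      using False h by (simp add: g_def scalar_def smult_minus_right)
    have eq: "\<one> \<ominus> g = complex_of_real (1 / t) \<odot> h"
    proof -
      have "complex_of_real (1 / t) \<odot> h \<in> carrier A"
        using h by simp
      then show ?thesis
        unfolding g_eq by algebra
    qed
    define r where "r = complex_of_real (sqrt t) \<odot> r0"
    show ?thesis
    proof (rule that)
      have "scalar (sqrt t) \<ominus> r = complex_of_real (sqrt t) \<odot> (\<one> \<ominus> r0)"
        using r0_in by (simp add: r_def scalar_def smult_minus_right)
      then have "cnorm A (scalar (sqrt t) \<ominus> r) \<le> sqrt t"
        using r0 r0_in t(1) mult_left_mono[OF r0(3), of "sqrt t"] by (simp add: norm_smult)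
      then show "pos r"
        unfolding pos_def using t(1) r0(1) by (auto simp: r_def sa_smult intro!: exI[of _ "sqrt t"])
      have "complex_of_real (sqrt t) * complex_of_real (sqrt t) = complex_of_real t"
        using t(1) by (simp flip: of_real_mult)
      then show "r \<otimes> r = h"
        using r0_in r0(2) eq False h by (simp add: r_def smult_mult_left smult_mult_right)
      show "y \<otimes> r = r \<otimes> y" if y: "y \<in> carrier A" "y \<otimes> h = h \<otimes> y" for y
      proof -
        have "y \<otimes> g = g \<otimes> y"
          using y h unfolding g_eq
          by (simp add: a_minus_def r_distr l_distr l_minus r_minus smult_mult_left smult_mult_right)
        from comm[OF y(1) this] show ?thesis
          using r0_in y by (simp add: r_def smult_mult_left smult_mult_right)
      qed
    qed
  qed
qed

text \<open>The point is that r + i w is a multiple of a unitary.\<close>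

lemma norm_le_of_squares:
  assumes r: "sa r" and w: "sa w" and comm: "r \<otimes> w = w \<otimes> r"
    and sum: "r \<otimes> r \<oplus> w \<otimes> w = scalar \<tau>" and "\<tau> \<ge> 0"
  shows "(cnorm A r)\<^sup>2 \<le> \<tau>"
proof -
  note in_A = sa_in[OF r] sa_in[OF w]
  define v where "v = \<i> \<odot> w"
  have v: "v \<in> carrier A" "star A v = \<ominus> v"
    using w in_A by (auto simp: v_def sa_def star_smult uminus_smult)
  have "v \<otimes> v = \<ominus> (w \<otimes> w)" "r \<otimes> v = v \<otimes> r"
    using in_A comm by (simp_all add: v_def smult_mult_left smult_mult_right uminus_smult)
  moreover define u where "u = r \<oplus> v"
  have u: "u \<in> carrier A" "star A u = r \<ominus> v"
    using in_A v r by (auto simp: u_def star_add sa_def a_minus_def)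
  have "star A u \<otimes> u = r \<otimes> r \<oplus> r \<otimes> v \<ominus> v \<otimes> r \<ominus> v \<otimes> v"
    unfolding u(2) unfolding u_def using in_A v(1) by algebra
  ultimately have "star A u \<otimes> u = r \<otimes> r \<oplus> w \<otimes> w"
    using in_A v(1) by (simp add: a_minus_def a_assoc r_neg r_neg1)
  then have "(cnorm A u)\<^sup>2 = cnorm A (scalar \<tau>)"
    using sum cstar_identity[OF u(1)] by simp
  also have "\<dots> \<le> \<tau>"
    using mult_left_mono[OF norm_one_le \<open>\<tau> \<ge> 0\<close>] \<open>\<tau> \<ge> 0\<close> by (simp add: scalar_def norm_smult)
  finally have le: "(cnorm A u)\<^sup>2 \<le> \<tau>" .
  have "u \<oplus> star A u = r \<oplus> r"
    unfolding u(2) unfolding u_def using in_A v(1) by algebra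
  then have "2 * cnorm A r = cnorm A (u \<oplus> star A u)"
    using in_A by (simp add: double norm_smult)
  also have "\<dots> \<le> 2 * cnorm A u"
    using norm_triangle[of u "star A u"] u(1) by (simp add: star_closed norm_star_eq)
  finally have "cnorm A r \<le> cnorm A u"
    by simp
  then show ?thesis
    using le norm_nonneg[OF in_A(1)] by (meson order_trans power_mono)
qed

text \<open>After scaling, g = r^2 / t has norm at most 1, and 1 - g has a root b commuting with r.
  The squares of b and r / sqrt t add up to 1, so \<open>norm_le_of_squares\<close> bounds b, and
  the norm of 1 - g is the square of the norm of b. This is the inequality that \<open>pos\<close>
  asks for.\<close>

lemma pos_square:
  assumes r: "sa r"
  shows "pos (r \<otimes> r)"
proof -
  \<comment> \<open>The summand 1 only keeps t positive when r = 0.\<close>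
  define t where "t = (cnorm A r)\<^sup>2 + 1"
  have t: "t > 0"
    by (simp add: t_def add_nonneg_pos)
  note r_in = sa_in[OF r]
  define g where "g = complex_of_real (1 / t) \<odot> (r \<otimes> r)"
  have g: "sa g"
    unfolding g_def by (intro sa_smult sa_square r)
  have "cnorm A g = (cnorm A r)\<^sup>2 / t"
    using t r_in sa_norm_square[OF r] by (simp add: g_def norm_smult norm_divide)
  then have "cnorm A g \<le> 1"
    using t by (simp add: t_def)
  from root_near_one[OF g this] obtain b where b: "sa b" "b \<otimes> b = \<one> \<ominus> g"
    and comm: "\<And>y. y \<in> carrier A \<Longrightarrow> y \<otimes> g = g \<otimes> y \<Longrightarrow> y \<otimes> b = b \<otimes> y"
    by blast
  define r' where "r' = complex_of_real (1 / sqrt t) \<odot> r"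
  have "complex_of_real (1 / sqrt t) * complex_of_real (1 / sqrt t) = complex_of_real (1 / t)"
    using t by (simp flip: of_real_mult)
  then have r'r': "r' \<otimes> r' = g"
    using r_in by (simp add: r'_def g_def smult_mult_left smult_mult_right del: of_real_divide)
  have "r \<otimes> g = g \<otimes> r"
    using r_in by (simp add: g_def smult_mult_left smult_mult_right m_assoc)
  from comm[OF r_in this] have "b \<otimes> r' = r' \<otimes> b"
    using r_in sa_in[OF b(1)] by (simp add: r'_def smult_mult_left smult_mult_right)
  moreover have "b \<otimes> b \<oplus> r' \<otimes> r' = scalar 1"
    unfolding b(2) r'r' scalar_1 using sa_in[OF g] by algebra
  moreover have "sa r'"
    unfolding r'_def by (intro sa_smult r)
  ultimately have "(cnorm A b)\<^sup>2 \<le> 1"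
    using norm_le_of_squares[OF b(1)] by simp
  then have "cnorm A (\<one> \<ominus> g) \<le> 1"
    using sa_norm_square[OF b(1)] b(2) by simp
  moreover have "scalar t \<ominus> r \<otimes> r = complex_of_real t \<odot> (\<one> \<ominus> g)"
    using t r_in by (simp add: g_def scalar_def smult_minus_right)
  ultimately have "cnorm A (scalar t \<ominus> r \<otimes> r) \<le> t"
    using t sa_in[OF g] mult_left_mono[of _ 1 t] by (simp add: norm_smult)
  then show ?thesis
    unfolding pos_def using t sa_square[OF r] by (auto intro!: exI[of _ t])
qed

text \<open>Square roots r of h and w of - h commute, and r^2 + w^2 = 0, so
  \<open>norm_le_of_squares\<close> with bound 0 gives r = 0.\<close>

lemma pos_antisym:
  assumes "pos h" "pos (\<ominus> h)"
  shows "h = \<zero>"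
proof -
  obtain r where r: "pos r" "r \<otimes> r = h" "\<And>y. y \<in> carrier A \<Longrightarrow> y \<otimes> h = h \<otimes> y \<Longrightarrow> y \<otimes> r = r \<otimes> y"
    using pos_root[OF assms(1)] by blast
  obtain w where w: "pos w" "w \<otimes> w = \<ominus> h"
    using pos_root[OF assms(2)] by blast
  note in_A = pos_in[OF r(1)] pos_in[OF w(1)] pos_in[OF assms(1)]
  have "h = \<ominus> (w \<otimes> w)"
    using w in_A by simp
  then have "w \<otimes> h = h \<otimes> w"
    using in_A by (simp add: l_minus r_minus m_assoc)
  from r(3)[OF in_A(2) this] have comm: "r \<otimes> w = w \<otimes> r"
    by (rule HOL.sym)
  have "r \<otimes> r \<oplus> w \<otimes> w = scalar 0"
    unfolding r(2) w(2) using in_A by (simp add: r_neg)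
  from norm_le_of_squares[OF pos_sa[OF r(1)] pos_sa[OF w(1)] comm this]
  have "(cnorm A r)\<^sup>2 \<le> 0"
    by simp
  then have "r = \<zero>"
    using norm_zero_iff[OF in_A(1)] by simp
  then show ?thesis
    using r(2) by simp
qed

lemma pos_add_eq_zero:
  assumes "pos h" "pos k" "h \<oplus> k = \<zero>"
  shows "h = \<zero>"
proof -
  have "k \<oplus> h = \<zero>"
    using assms(3) pos_in[OF assms(1)] pos_in[OF assms(2)] by (simp add: a_comm)
  then have "\<ominus> h = k"
    using pos_in[OF assms(1)] pos_in[OF assms(2)] by (intro minus_equality)
  then show ?thesis
    using pos_antisym assms by simp
qed

text \<open>With y = z* the elements a = z + y and b = i (z - y) are self-adjoint, and a^2 + b^2 is
  twice the element in question.\<close>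

lemma pos_star_mult_add:
  assumes z: "z \<in> carrier A"
  shows "pos (star A z \<otimes> z \<oplus> z \<otimes> star A z)"
proof -
  define y where "y = star A z"
  have y: "y \<in> carrier A" "star A y = z" "star A z = y"
    using z by (auto simp: y_def star_closed star_star)
  define a where "a = z \<oplus> y"
  define c where "c = z \<ominus> y"
  define b where "b = \<i> \<odot> c"
  have c: "c \<in> carrier A"
    using z y by (simp add: c_def)
  have "star A c = \<ominus> c"
    unfolding c_def using z y by (simp add: star_minus) algebra
  then have "sa a" "sa b"
    using z y c by (auto simp: sa_def a_def b_def star_add star_smult a_comm uminus_smult)
  then have "pos (a \<otimes> a \<oplus> b \<otimes> b)"
    by (intro pos_add pos_square)
  moreover have "b \<otimes> b = \<ominus> (c \<otimes> c)"
    using c by (simp add: b_def smult_mult_left smult_mult_right uminus_smult)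
  moreover have "a \<otimes> a \<ominus> c \<otimes> c = (y \<otimes> z \<oplus> z \<otimes> y) \<oplus> (y \<otimes> z \<oplus> z \<otimes> y)"
    unfolding a_def c_def using z y(1) by algebra
  ultimately have "pos (2 \<odot> (y \<otimes> z \<oplus> z \<otimes> y))"
    using z y(1) by (simp add: a_minus_def double)
  from pos_scale[OF this, of "1 / 2"] show ?thesis
    using z y by simp
qed

text \<open>The usual proof compares the spectra of y* y and y y*. Here the comparison is replaced
  by \<open>pos_star_mult_add\<close>: if h = x* x had a negative part, an element z would arise for
  which z* z and z z* are both negatives of squares while their sum is positive.\<close>

lemma pos_star_mult:
  assumes x: "x \<in> carrier A"
  shows "pos (star A x \<otimes> x)"
proof -
  define h where "h = star A x \<otimes> x"
  have h: "sa h"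
    using x by (simp add: h_def sa_star_mult)
  note h_in = sa_in[OF h]
  obtain s where s: "pos s" "s \<otimes> s = h \<otimes> h"
    and s_comm: "\<And>y. y \<in> carrier A \<Longrightarrow> y \<otimes> (h \<otimes> h) = (h \<otimes> h) \<otimes> y \<Longrightarrow> y \<otimes> s = s \<otimes> y"
    using pos_root[OF pos_square[OF h]] by blast
  note s_in = pos_in[OF s(1)]
  have hs: "h \<otimes> s = s \<otimes> h"
    using s_comm[OF h_in] h_in by (simp add: m_assoc)
  obtain r where r: "pos r" "r \<otimes> r = s" and r_comm: "\<And>y. y \<in> carrier A \<Longrightarrow> y \<otimes> s = s \<otimes> y \<Longrightarrow> y \<otimes> r = r \<otimes> y"
    using pos_root[OF s(1)] by blast
  note r_in = pos_in[OF r(1)]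
  have hr: "h \<otimes> r = r \<otimes> h"
    by (rule r_comm[OF h_in hs])
  have sr: "s \<otimes> r = r \<otimes> s"
    unfolding r(2)[symmetric] using r_in by (simp add: m_assoc)
  \<comment> \<open>s is the absolute value of h, so q is twice the negative part of h; the goal is
    q = 0.\<close>
  define q where "q = s \<ominus> h"
  have q: "sa q"
    unfolding q_def by (intro sa_minus pos_sa s h)
  note q_in = sa_in[OF q]
  have qr: "q \<otimes> r = r \<otimes> q"
    unfolding q_def using h_in s_in r_in sr hr by (simp add: a_minus_def l_distr r_distr l_minus r_minus)
  have qh: "q \<otimes> h = \<ominus> (s \<otimes> q)"
  proof -
    have "q \<otimes> h = s \<otimes> h \<ominus> h \<otimes> h"
      unfolding q_def using h_in s_in by algebra
    also have "\<dots> = \<ominus> (s \<otimes> s \<ominus> s \<otimes> h)"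
      unfolding s(2)[symmetric] using h_in s_in by algebra
    also have "s \<otimes> s \<ominus> s \<otimes> h = s \<otimes> q"
      unfolding q_def using h_in s_in by algebra
    finally show ?thesis .
  qed
  \<comment> \<open>For y = x q below, y* y = q h q = - s q^2, and w is an explicit square root of s
    q^2.\<close>
  define w where "w = q \<otimes> r"
  have w: "sa w"
    using q pos_sa[OF r(1)] qr by (auto simp: sa_def w_def star_mult)
  note w_in = sa_in[OF w]
  have ww: "w \<otimes> w = s \<otimes> q \<otimes> q"
  proof -
    have "w \<otimes> w = (r \<otimes> q) \<otimes> (r \<otimes> q)"
      by (simp add: w_def qr)
    also have "\<dots> = r \<otimes> (q \<otimes> r) \<otimes> q"
      using r_in q_in by algebra
    also have "\<dots> = r \<otimes> (r \<otimes> q) \<otimes> q"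
      by (simp add: qr)
    also have "\<dots> = (r \<otimes> r) \<otimes> q \<otimes> q"
      using r_in q_in by algebra
    finally show ?thesis
      by (simp add: r(2))
  qed
  define y where "y = x \<otimes> q"
  have y: "y \<in> carrier A" "star A y = q \<otimes> star A x"
    using x q by (auto simp: y_def sa_def star_mult)
  note y'_in = star_closed[OF y(1)] and x'_in = star_closed[OF x]
  have yy: "star A y \<otimes> y = \<ominus> (w \<otimes> w)"
  proof -
    have "star A y \<otimes> y = q \<otimes> h \<otimes> q"
      unfolding y(2) unfolding h_def y_def using x x'_in q_in by algebra
    then show ?thesis
      unfolding qh ww using s_in q_in by (simp add: l_minus)
  qed
  define k where "k = y \<otimes> star A y"
  have k: "sa k"
    using y(1) y'_in by (simp add: k_def sa_def star_mult star_star)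
  \<comment> \<open>Now z* z = - w^4 and z z* = - k^2, which forces w^4 = 0.\<close>
  define z where "z = y \<otimes> w"
  have z: "z \<in> carrier A" "star A z = w \<otimes> star A y"
    using y w by (auto simp: z_def sa_def star_mult)
  have "star A z \<otimes> z = w \<otimes> (star A y \<otimes> y) \<otimes> w"
    unfolding z(2) unfolding z_def using w_in y(1) y'_in by algebra
  then have zz1: "star A z \<otimes> z = \<ominus> ((w \<otimes> w) \<otimes> (w \<otimes> w))"
    unfolding yy using w_in by (simp add: l_minus r_minus m_assoc)
  have "z \<otimes> star A z = y \<otimes> (w \<otimes> w) \<otimes> star A y"
    unfolding z(2) unfolding z_def using w_in y(1) y'_in by algebra
  moreover have "w \<otimes> w = \<ominus> (star A y \<otimes> y)"
    unfolding yy using w_in by simp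
  ultimately have zz2: "z \<otimes> star A z = \<ominus> (k \<otimes> k)"
    using y(1) y'_in by (simp add: k_def l_minus r_minus m_assoc)
  let ?W = "(w \<otimes> w) \<otimes> (w \<otimes> w)" and ?K = "k \<otimes> k"
  have posW: "pos ?W" and posK: "pos ?K"
    by (intro pos_square sa_square w k)+
  have "star A z \<otimes> z \<oplus> z \<otimes> star A z = \<ominus> (?W \<oplus> ?K)"
    unfolding zz1 zz2 using pos_in[OF posW] pos_in[OF posK] by (simp add: minus_add)
  then have "pos (\<ominus> (?W \<oplus> ?K))"
    using pos_star_mult_add[OF z(1)] by simp
  then have "?W \<oplus> ?K = \<zero>"
    by (intro pos_antisym pos_add posW posK)
  then have "?W = \<zero>"
    by (rule pos_add_eq_zero[OF posW posK])
  then have "w \<otimes> w = \<zero>"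
    by (rule sa_square_zero[OF sa_square[OF w]])
  then have "cnorm A y = 0"
    using yy cstar_identity[OF y(1)] by simp
  then have "y = \<zero>"
    using norm_zero_iff y by simp
  then have "h \<otimes> q = \<zero>"
    unfolding h_def using x x'_in q_in by (simp add: m_assoc flip: y_def)
  moreover have "h \<otimes> q = q \<otimes> h"
    unfolding q_def using h_in s_in hs by (simp add: a_minus_def l_distr r_distr l_minus r_minus)
  ultimately have "\<ominus> (s \<otimes> q) = \<zero>" and hq: "h \<otimes> q = \<zero>"
    using qh by simp_all
  then have "s \<otimes> q = \<zero>"
    using minus_minus[of "s \<otimes> q"] s_in q_in by simp
  moreover have "q \<otimes> q = s \<otimes> q \<ominus> h \<otimes> q"
    using s_in h_in q_in by (simp add: q_def a_minus_def l_distr l_minus)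
  ultimately have "q = \<zero>"
    using hq by (intro sa_square_zero[OF q]) (simp add: a_minus_def)
  then have "s = h"
    unfolding q_def using s_in h_in by simp
  then show ?thesis
    using s(1) by (simp add: h_def)
qed

text \<open>Commuting roots of y* y and of t - y* y have squares adding up to t. The lemma turns an
  inequality in the order into one in the norm; it is what bounds the entries of a matrix.\<close>

lemma norm_le_of_pos:
  assumes y: "y \<in> carrier A" and pos: "pos (scalar t \<ominus> star A y \<otimes> y)" and "t \<ge> 0"
  shows "(cnorm A y)\<^sup>2 \<le> t"
proof -
  define h where "h = star A y \<otimes> y"
  have h: "pos h"
    unfolding h_def by (rule pos_star_mult[OF y])
  obtain r where r: "pos r" "r \<otimes> r = h" and comm: "\<And>y. y \<in> carrier A \<Longrightarrow> y \<otimes> h = h \<otimes> y \<Longrightarrow> y \<otimes> r = r \<otimes> y"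
    using pos_root[OF h] by blast
  obtain w where w: "pos w" "w \<otimes> w = scalar t \<ominus> h"
    using pos_root[OF pos] by (auto simp: h_def)
  note in_A = pos_in[OF r(1)] pos_in[OF w(1)] pos_in[OF h]
  have "h = scalar t \<ominus> w \<otimes> w"
    unfolding w(2) using in_A scalar_in[of t] by algebra
  then have "w \<otimes> h = h \<otimes> w"
    using in_A by (simp add: scalar_def a_minus_def l_distr r_distr l_minus r_minus m_assoc
        smult_mult_left smult_mult_right)
  from comm[OF in_A(2) this] have rw: "r \<otimes> w = w \<otimes> r"
    by (rule HOL.sym)
  have "r \<otimes> r \<oplus> w \<otimes> w = scalar t"
    unfolding r(2) w(2) using in_A scalar_in[of t] by algebra
  from norm_le_of_squares[OF pos_sa[OF r(1)] pos_sa[OF w(1)] rw this \<open>t \<ge> 0\<close>]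
  have "(cnorm A r)\<^sup>2 \<le> t" .
  then show ?thesis
    using cstar_identity[OF y] sa_norm_square[OF pos_sa[OF r(1)]] r(2) by (simp add: h_def)
qed

lemma pos_finsum:
  "finite I \<Longrightarrow> (\<And>i. i \<in> I \<Longrightarrow> pos (f i)) \<Longrightarrow> pos (\<Oplus>i\<in>I. f i)"
proof (induction rule: finite_induct)
  case (insert i I)
  then have "f \<in> I \<rightarrow> carrier A" "f i \<in> carrier A"
    by (auto simp: pos_in)
  then show ?case
    using insert by (simp add: finsum_insert pos_add)
qed (simp add: pos_zero)

end

section \<open>Transfer along injective maps\<close>

lemma module_class_ringI:
  assumes zero: "\<zero>\<^bsub>V\<^esub> \<in> carrier V"
    and add: "\<And>x y. x \<in> carrier V \<Longrightarrow> y \<in> carrier V \<Longrightarrow> x \<oplus>\<^bsub>V\<^esub> y \<in> carrier V"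
    and smult: "\<And>c x. x \<in> carrier V \<Longrightarrow> c \<odot>\<^bsub>V\<^esub> x \<in> carrier V"
    and assoc: "\<And>x y z. x \<in> carrier V \<Longrightarrow> y \<in> carrier V \<Longrightarrow> z \<in> carrier V \<Longrightarrow>
      (x \<oplus>\<^bsub>V\<^esub> y) \<oplus>\<^bsub>V\<^esub> z = x \<oplus>\<^bsub>V\<^esub> (y \<oplus>\<^bsub>V\<^esub> z)"
    and comm: "\<And>x y. x \<in> carrier V \<Longrightarrow> y \<in> carrier V \<Longrightarrow> x \<oplus>\<^bsub>V\<^esub> y = y \<oplus>\<^bsub>V\<^esub> x"
    and l_zero: "\<And>x. x \<in> carrier V \<Longrightarrow> \<zero>\<^bsub>V\<^esub> \<oplus>\<^bsub>V\<^esub> x = x"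
    and l_neg: "\<And>x. x \<in> carrier V \<Longrightarrow> (- 1) \<odot>\<^bsub>V\<^esub> x \<oplus>\<^bsub>V\<^esub> x = \<zero>\<^bsub>V\<^esub>"
    and distr1: "\<And>a b x. x \<in> carrier V \<Longrightarrow> (a + b) \<odot>\<^bsub>V\<^esub> x = a \<odot>\<^bsub>V\<^esub> x \<oplus>\<^bsub>V\<^esub> b \<odot>\<^bsub>V\<^esub> x"
    and distr2: "\<And>a x y. x \<in> carrier V \<Longrightarrow> y \<in> carrier V \<Longrightarrow>
      a \<odot>\<^bsub>V\<^esub> (x \<oplus>\<^bsub>V\<^esub> y) = a \<odot>\<^bsub>V\<^esub> x \<oplus>\<^bsub>V\<^esub> a \<odot>\<^bsub>V\<^esub> y"
    and smult_smult: "\<And>a b x. x \<in> carrier V \<Longrightarrow> (a * b) \<odot>\<^bsub>V\<^esub> x = a \<odot>\<^bsub>V\<^esub> (b \<odot>\<^bsub>V\<^esub> x)"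
    and one: "\<And>x. x \<in> carrier V \<Longrightarrow> (1 :: complex) \<odot>\<^bsub>V\<^esub> x = x"
  shows "Module.module class_ring V"
proof (rule moduleI)
  show "cring (class_ring :: complex ring)"
    by (rule class_cring.is_cring)
  show "abelian_group V"
    by (rule abelian_groupI) (use assms in blast)+
qed (use assms in simp_all)

text \<open>A record V whose operations correspond under f to those of W. The vector space axioms of
  V are derived, since every identity may be checked after f. The instances are subspaces of an
  algebra, the copy of an algebra in another type and, most importantly, the quotient system inside
  the group C*-algebra.\<close>

locale linear_injection =
  fixes V :: "('a, 'm) star_module_scheme" and W :: "('b, 'n) star_module_scheme" and f :: "'a \<Rightarrow> 'b"
  assumes W: "star_vector_space W"
    and inj: "inj_on f (carrier V)"
    and f_in: "x \<in> carrier V \<Longrightarrow> f x \<in> carrier W"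
    and zero_in: "\<zero>\<^bsub>V\<^esub> \<in> carrier V" and one_in: "\<one>\<^bsub>V\<^esub> \<in> carrier V"
    and add_in: "x \<in> carrier V \<Longrightarrow> y \<in> carrier V \<Longrightarrow> x \<oplus>\<^bsub>V\<^esub> y \<in> carrier V"
    and smult_in: "x \<in> carrier V \<Longrightarrow> c \<odot>\<^bsub>V\<^esub> x \<in> carrier V"
    and star_in: "x \<in> carrier V \<Longrightarrow> star V x \<in> carrier V"
    and f_zero: "f \<zero>\<^bsub>V\<^esub> = \<zero>\<^bsub>W\<^esub>" and f_one: "f \<one>\<^bsub>V\<^esub> = \<one>\<^bsub>W\<^esub>"
    and f_add: "x \<in> carrier V \<Longrightarrow> y \<in> carrier V \<Longrightarrow> f (x \<oplus>\<^bsub>V\<^esub> y) = f x \<oplus>\<^bsub>W\<^esub> f y"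
    and f_smult: "x \<in> carrier V \<Longrightarrow> f (c \<odot>\<^bsub>V\<^esub> x) = c \<odot>\<^bsub>W\<^esub> f x"
    and f_star: "x \<in> carrier V \<Longrightarrow> f (star V x) = star W (f x)"
begin

lemmas f_simps = f_in zero_in one_in add_in smult_in star_in f_zero f_one f_add f_smult f_star

lemma inj_eqI: "f x = f y \<Longrightarrow> x \<in> carrier V \<Longrightarrow> y \<in> carrier V \<Longrightarrow> x = y"
  using inj by (auto dest: inj_onD)

lemma star_vector_space: "star_vector_space V"
proof -
  interpret W: star_vector_space W
    by (rule W)
  interpret WM: abelian_group W
    by (rule W.abelian_group_V)
  have "Module.module class_ring V"
    by (rule module_class_ringI; (rule inj_eqI)?;
      simp add: f_simps WM.a_assoc W.smult_add_left W.smult_add_right WM.a_ac WM.r_neg WM.l_neg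
        flip: W.uminus_smult)
  then show ?thesis
    by (rule star_vector_space.intro)
      ((rule inj_eqI)?; simp add: f_simps W.star_star W.star_add W.star_smult W.star_one W.star_closed)+
qed

end

lemma finsum_hom:
  assumes "finite I" "Module.module class_ring V" "Module.module class_ring W"
    and "f ` carrier V \<subseteq> carrier W"
    and "f \<zero>\<^bsub>V\<^esub> = \<zero>\<^bsub>W\<^esub>"
    and "\<And>x y. x \<in> carrier V \<Longrightarrow> y \<in> carrier V \<Longrightarrow> f (x \<oplus>\<^bsub>V\<^esub> y) = f x \<oplus>\<^bsub>W\<^esub> f y"
    and "g \<in> I \<rightarrow> carrier V"
  shows "f (finsum V g I) = finsum W (\<lambda>i. f (g i)) I"
proof -
  interpret V: abelian_group V
    using assms(2) by (rule Module.module.axioms)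
  interpret W: abelian_group W
    using assms(3) by (rule Module.module.axioms)
  show ?thesis
    using assms(1,7)
  proof (induction rule: finite_induct)
    case empty
    then show ?case
      using assms(5) by simp
  next
    case (insert i I)
    then have "g \<in> I \<rightarrow> carrier V" "g i \<in> carrier V" "(\<lambda>i. f (g i)) \<in> I \<rightarrow> carrier W" "f (g i) \<in> carrier W"
      using assms(4) by auto
    then show ?case
      using insert assms(6)[of "g i" "finsum V g I"] by simp
  qed
qed

section \<open>Matrices over *-algebras\<close>

lemma (in abelian_monoid) finsum_swap:
  assumes "finite I" "finite J" "\<And>i j. i \<in> I \<Longrightarrow> j \<in> J \<Longrightarrow> f i j \<in> carrier G"
  shows "(\<Oplus>i\<in>I. \<Oplus>j\<in>J. f i j) = (\<Oplus>j\<in>J. \<Oplus>i\<in>I. f i j)"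
  using assms(1,3)
proof (induction rule: finite_induct)
  case empty
  then show ?case
    by (simp add: finsum_zero)
next
  case (insert i I)
  have "(\<Oplus>j\<in>J. \<Oplus>i\<in>insert i I. f i j) = (\<Oplus>j\<in>J. f i j \<oplus> (\<Oplus>i\<in>I. f i j))"
    using insert by (intro finsum_cong') (auto intro!: finsum_insert finsum_closed)
  also have "\<dots> = (\<Oplus>j\<in>J. f i j) \<oplus> (\<Oplus>j\<in>J. \<Oplus>i\<in>I. f i j)"
    using insert by (intro finsum_addf) (auto intro!: finsum_closed)
  also have "\<dots> = (\<Oplus>i\<in>insert i I. \<Oplus>j\<in>J. f i j)"
    using insert by (subst finsum_insert) (auto intro!: finsum_closed)
  finally show ?case
    by (rule HOL.sym)
qed

lemma mat_eqI:
  "(\<And>i j. i < p \<Longrightarrow> j < n \<Longrightarrow> f (i, j) = g (i, j)) \<Longrightarrow> mat p n f = mat p n g"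
  by (rule eq_matI) auto

lemma matsE:
  assumes "X \<in> mats V p n"
  obtains x where "X = mat p n x" "\<And>i j. i < p \<Longrightarrow> j < n \<Longrightarrow> x (i, j) \<in> carrier V"
  using assms by (intro that[of "\<lambda>ij. X $$ ij"]) (auto simp: mats_def)

lemma mat_in_mats [simp]:
  "mat p n f \<in> mats V p n \<longleftrightarrow> (\<forall>i<p. \<forall>j<n. f (i, j) \<in> carrier V)"
  by (auto simp: mats_def)

definition mat_mult :: "('a, 'm) ring_scheme \<Rightarrow> 'a mat \<Rightarrow> 'a mat \<Rightarrow> 'a mat" where
  "mat_mult A X Y = mat (dim_row X) (dim_col Y)
     (\<lambda>(i, j). \<Oplus>\<^bsub>A\<^esub>l\<in>{..<dim_col X}. X $$ (i, l) \<otimes>\<^bsub>A\<^esub> Y $$ (l, j))"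

definition mat_smult :: "(complex, 'a, 'm) module_scheme \<Rightarrow> complex \<Rightarrow> 'a mat \<Rightarrow> 'a mat" where
  "mat_smult A c X = map_mat (\<lambda>x. c \<odot>\<^bsub>A\<^esub> x) X"

text \<open>The norm is complete and submultiplicative and the adjoint is isometric for it, but it
  is in general not a C*-norm. It only serves the square root iteration; the order on matrices does
  not refer to it.\<close>

definition mat_alg :: "('a, 'm) cstar_scheme \<Rightarrow> nat \<Rightarrow> 'a mat cstar" where
  "mat_alg A n =
     \<lparr>carrier = mats A n n, mult = mat_mult A, one = mdiag A n 1, zero = mdiag A n 0,
      add = madd A, smult = mat_smult A, star = madjoint A,
      cnorm = (\<lambda>X. \<Sum>i<n. \<Sum>j<n. cnorm A (X $$ (i, j)))\<rparr>"

lemma madd_mat [simp]: "madd V (mat p n x) (mat p n y) = mat p n (\<lambda>ij. x ij \<oplus>\<^bsub>V\<^esub> y ij)"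
  by (auto simp: madd_def intro!: eq_matI)

lemma mat_smult_mat [simp]: "mat_smult V c (mat p n x) = mat p n (\<lambda>ij. c \<odot>\<^bsub>V\<^esub> x ij)"
  by (auto simp: mat_smult_def intro!: eq_matI)

lemma madjoint_mat [simp]: "madjoint V (mat p n x) = mat n p (\<lambda>(i, j). star V (x (j, i)))"
  by (auto simp: madjoint_def intro!: eq_matI)

context star_alg
begin

lemma mat_mult_mat [simp]:
  assumes "\<And>i l. i < p \<Longrightarrow> l < q \<Longrightarrow> x (i, l) \<in> carrier A" "\<And>l j. l < q \<Longrightarrow> j < n \<Longrightarrow> y (l, j) \<in> carrier A"
  shows "mat_mult A (mat p q x) (mat q n y) = mat p n (\<lambda>(i, j). \<Oplus>l\<in>{..<q}. x (i, l) \<otimes> y (l, j))"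
  using assms by (auto simp: mat_mult_def intro!: eq_matI finsum_cong')

lemma mat_mult_in: "X \<in> mats A p q \<Longrightarrow> Y \<in> mats A q n \<Longrightarrow> mat_mult A X Y \<in> mats A p n"
  by (elim matsE) (auto intro!: finsum_closed)

lemma madd_in: "X \<in> mats A p n \<Longrightarrow> Y \<in> mats A p n \<Longrightarrow> madd A X Y \<in> mats A p n"
  by (elim matsE) simp

lemma mat_smult_in: "X \<in> mats A p n \<Longrightarrow> mat_smult A c X \<in> mats A p n"
  by (elim matsE) simp

lemma madjoint_in: "X \<in> mats A p n \<Longrightarrow> madjoint A X \<in> mats A n p"
  by (elim matsE) (simp add: star_closed)

lemma mdiag_in: "mdiag A n c \<in> mats A n n"
  by (simp add: mdiag_def)

lemmas mats_in = mat_mult_in madd_in mat_smult_in madjoint_in mdiag_in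

lemma mat_mult_assoc:
  assumes "X \<in> mats A p q" "Y \<in> mats A q r" "Z \<in> mats A r s"
  shows "mat_mult A (mat_mult A X Y) Z = mat_mult A X (mat_mult A Y Z)"
proof -
  obtain x where x: "X = mat p q x" "\<And>i j. i < p \<Longrightarrow> j < q \<Longrightarrow> x (i, j) \<in> carrier A"
    using assms(1) by (rule matsE) blast
  obtain y where y: "Y = mat q r y" "\<And>i j. i < q \<Longrightarrow> j < r \<Longrightarrow> y (i, j) \<in> carrier A"
    using assms(2) by (rule matsE) blast
  obtain z where z: "Z = mat r s z" "\<And>i j. i < r \<Longrightarrow> j < s \<Longrightarrow> z (i, j) \<in> carrier A"
    using assms(3) by (rule matsE) blast
  have "(\<Oplus>l\<in>{..<r}. (\<Oplus>k\<in>{..<q}. x (i, k) \<otimes> y (k, l)) \<otimes> z (l, j))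
      = (\<Oplus>k\<in>{..<q}. x (i, k) \<otimes> (\<Oplus>l\<in>{..<r}. y (k, l) \<otimes> z (l, j)))" if ij: "i < p" "j < s" for i j
  proof -
    have "(\<Oplus>l\<in>{..<r}. (\<Oplus>k\<in>{..<q}. x (i, k) \<otimes> y (k, l)) \<otimes> z (l, j))
        = (\<Oplus>l\<in>{..<r}. \<Oplus>k\<in>{..<q}. x (i, k) \<otimes> y (k, l) \<otimes> z (l, j))"
      using x(2) y(2) z(2) ij by (intro finsum_cong' finsum_ldistr HOL.refl) (auto intro!: finsum_closed)
    also have "\<dots> = (\<Oplus>k\<in>{..<q}. \<Oplus>l\<in>{..<r}. x (i, k) \<otimes> y (k, l) \<otimes> z (l, j))"
      using x(2) y(2) z(2) ij by (intro finsum_swap) auto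
    also have "\<dots> = (\<Oplus>k\<in>{..<q}. \<Oplus>l\<in>{..<r}. x (i, k) \<otimes> (y (k, l) \<otimes> z (l, j)))"
      using x(2) y(2) z(2) ij by (intro finsum_cong' HOL.refl) (auto simp: m_assoc intro!: finsum_closed)
    also have "\<dots> = (\<Oplus>k\<in>{..<q}. x (i, k) \<otimes> (\<Oplus>l\<in>{..<r}. y (k, l) \<otimes> z (l, j)))"
      using x(2) y(2) z(2) ij by (intro finsum_cong' finsum_rdistr[symmetric] HOL.refl) (auto intro!: finsum_closed)
    finally show ?thesis .
  qed
  then show ?thesis
    using x(2) y(2) z(2) by (auto simp: x(1) y(1) z(1) finsum_closed Pi_iff intro!: mat_eqI)
qed

lemma finsum_delta:
  assumes "i < n" "x \<in> carrier A"
  shows "(\<Oplus>l\<in>{..<n::nat}. if i = l then x else \<zero>) = x" "(\<Oplus>l\<in>{..<n::nat}. if l = i then x else \<zero>) = x"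
  using finsum_singleton[of i "{..<n}" "\<lambda>_. x"] add.finprod_singleton_swap[of i "{..<n}" "\<lambda>_. x"] assms
  by simp_all

lemma mat_mult_one_left:
  assumes "X \<in> mats A p n"
  shows "mat_mult A (mdiag A p c) X = mat_smult A c X"
proof -
  obtain x where x: "X = mat p n x" "\<And>i j. i < p \<Longrightarrow> j < n \<Longrightarrow> x (i, j) \<in> carrier A"
    using assms by (rule matsE) blast
  have "(\<Oplus>l\<in>{..<p}. (if i = l then c \<odot> \<one> else \<zero>) \<otimes> x (l, j)) = c \<odot> x (i, j)" if "i < p" "j < n" for i j
  proof -
    have "(\<Oplus>l\<in>{..<p}. (if i = l then c \<odot> \<one> else \<zero>) \<otimes> x (l, j)) = (\<Oplus>l\<in>{..<p}. if i = l then c \<odot> x (i, j) else \<zero>)"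
      using x(2) that by (intro finsum_cong' HOL.refl) (auto simp: smult_mult_left)
    then show ?thesis
      using x(2) that by (simp add: finsum_delta)
  qed
  then show ?thesis
    using x(2) by (auto simp: x(1) mdiag_def intro!: mat_eqI)
qed

lemma mat_mult_one_right:
  assumes "X \<in> mats A p n"
  shows "mat_mult A X (mdiag A n c) = mat_smult A c X"
proof -
  obtain x where x: "X = mat p n x" "\<And>i j. i < p \<Longrightarrow> j < n \<Longrightarrow> x (i, j) \<in> carrier A"
    using assms by (rule matsE) blast
  have "(\<Oplus>l\<in>{..<n}. x (i, l) \<otimes> (if l = j then c \<odot> \<one> else \<zero>)) = c \<odot> x (i, j)" if "i < p" "j < n" for i j
  proof -
    have "(\<Oplus>l\<in>{..<n}. x (i, l) \<otimes> (if l = j then c \<odot> \<one> else \<zero>)) = (\<Oplus>l\<in>{..<n}. if l = j then c \<odot> x (i, j) else \<zero>)"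
      using x(2) that by (intro finsum_cong' HOL.refl) (auto simp: smult_mult_right)
    then show ?thesis
      using x(2) that by (simp add: finsum_delta)
  qed
  then show ?thesis
    using x(2) by (auto simp: x(1) mdiag_def intro!: mat_eqI)
qed

lemma mat_smult_one: "X \<in> mats A p n \<Longrightarrow> mat_smult A 1 X = X"
  by (elim matsE) (auto intro!: mat_eqI)

lemma madjoint_mult:
  assumes "X \<in> mats A p q" "Y \<in> mats A q r"
  shows "madjoint A (mat_mult A X Y) = mat_mult A (madjoint A Y) (madjoint A X)"
proof -
  obtain x where x: "X = mat p q x" "\<And>i j. i < p \<Longrightarrow> j < q \<Longrightarrow> x (i, j) \<in> carrier A"
    using assms(1) by (rule matsE) blast
  obtain y where y: "Y = mat q r y" "\<And>i j. i < q \<Longrightarrow> j < r \<Longrightarrow> y (i, j) \<in> carrier A"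
    using assms(2) by (rule matsE) blast
  have "star A (\<Oplus>l\<in>{..<q}. x (i, l) \<otimes> y (l, j)) = (\<Oplus>l\<in>{..<q}. star A (y (l, j)) \<otimes> star A (x (i, l)))"
    if "i < p" "j < r" for i j
    using x(2) y(2) that by (subst star_finsum) (auto simp: star_mult star_closed intro!: finsum_cong')
  then show ?thesis
    using x(2) y(2) by (auto simp: x(1) y(1) star_closed intro!: mat_eqI)
qed

lemma mat_mult_madd:
  assumes "X \<in> mats A p q" "Y \<in> mats A p q" "Z \<in> mats A q r"
  shows "mat_mult A (madd A X Y) Z = madd A (mat_mult A X Z) (mat_mult A Y Z)"
  using assms
  by (elim matsE, auto intro!: mat_eqI, subst finsum_addf[symmetric], auto simp: l_distr simp del: finsum_addf intro!: finsum_cong')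

lemma mat_mult_madd_right:
  assumes "X \<in> mats A q r" "Y \<in> mats A q r" "Z \<in> mats A p q"
  shows "mat_mult A Z (madd A X Y) = madd A (mat_mult A Z X) (mat_mult A Z Y)"
  using assms
  by (elim matsE, auto intro!: mat_eqI, subst finsum_addf[symmetric], auto simp: r_distr simp del: finsum_addf intro!: finsum_cong')

lemma mat_mult_smult:
  assumes "X \<in> mats A p q" "Y \<in> mats A q r"
  shows "mat_mult A (mat_smult A c X) Y = mat_smult A c (mat_mult A X Y)"
    and "mat_mult A X (mat_smult A c Y) = mat_smult A c (mat_mult A X Y)"
  using assms
  by (elim matsE, auto simp: finsum_smult intro!: mat_eqI finsum_cong', auto simp: smult_mult_left smult_mult_right)+

lemma mat_alg_star_alg: "star_alg (mat_alg A n)"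
proof -
  have mod: "Module.module class_ring (mat_alg A n)"
    by (rule module_class_ringI; simp add: mat_alg_def; (elim matsE)?;
        auto simp: mdiag_def a_assoc smult_add_left smult_add_right l_neg
          simp flip: uminus_smult intro!: mat_eqI a_comm)
  have sv: "star_vector_space (mat_alg A n)"
    by (rule star_vector_space.intro[OF mod]; simp add: mat_alg_def; (elim matsE)?;
        auto simp: mdiag_def star_star star_add star_smult star_closed star_one intro!: mat_eqI)
  have ring: "ring (mat_alg A n)"
  proof (rule ringI)
    show "abelian_group (mat_alg A n)"
      using mod by (rule Module.module.axioms)
    show "monoid (mat_alg A n)"
      by (rule monoidI)
        (simp_all add: mat_alg_def mats_in mat_mult_assoc mat_mult_one_left mat_mult_one_right mat_smult_one)
  qed (simp_all add: mat_alg_def mat_mult_madd mat_mult_madd_right)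
  show ?thesis
    by (intro star_alg.intro sv ring star_alg_axioms.intro)
      (simp_all add: mat_alg_def mat_mult_smult madjoint_mult)
qed

end

lemma double_sum_ge:
  fixes f :: "nat \<Rightarrow> nat \<Rightarrow> real"
  assumes "\<And>i j. i < n \<Longrightarrow> j < n \<Longrightarrow> 0 \<le> f i j" "i < n" "j < n"
  shows "f i j \<le> (\<Sum>i<n. \<Sum>j<n. f i j)"
proof -
  have "f i j \<le> (\<Sum>j<n. f i j)"
    using assms by (intro member_le_sum[of j "{..<n}" "f i"]) auto
  also have "\<dots> \<le> (\<Sum>i<n. \<Sum>j<n. f i j)"
    using assms by (intro member_le_sum[of i "{..<n}" "\<lambda>i. \<Sum>j<n. f i j"]) (auto intro!: sum_nonneg)
  finally show ?thesis .
qed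

context banach_star_alg
begin

lemma norm_finsum:
  "finite I \<Longrightarrow> f \<in> I \<rightarrow> carrier A \<Longrightarrow> cnorm A (\<Oplus>i\<in>I. f i) \<le> (\<Sum>i\<in>I. cnorm A (f i))"
proof (induction rule: finite_induct)
  case (insert i I)
  then have "f i \<in> carrier A" "f \<in> I \<rightarrow> carrier A"
    by auto
  then show ?case
    using insert norm_triangle[of "f i" "finsum A f I"] by simp
qed simp

lemma mat_alg_minus_entry:
  assumes "X \<in> mats A n n" "Y \<in> mats A n n" "i < n" "j < n"
  shows "(X \<ominus>\<^bsub>mat_alg A n\<^esub> Y) $$ (i, j) = X $$ (i, j) \<ominus> Y $$ (i, j)"
proof -
  interpret M: star_alg "mat_alg A n"
    by (rule mat_alg_star_alg)
  have "X \<ominus>\<^bsub>mat_alg A n\<^esub> Y = madd A X (mat_smult A (- 1) Y)"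
    using M.uminus_smult[of Y] assms by (simp add: a_minus_def) (simp add: mat_alg_def)
  then show ?thesis
    using assms by (elim matsE) (simp add: a_minus_def uminus_smult)
qed

lemma mat_alg_norm_mult:
  assumes "X \<in> mats A n n" "Y \<in> mats A n n"
  shows "cnorm (mat_alg A n) (mat_mult A X Y) \<le> cnorm (mat_alg A n) X * cnorm (mat_alg A n) Y"
proof -
  obtain x where x: "X = mat n n x" "\<And>i j. i < n \<Longrightarrow> j < n \<Longrightarrow> x (i, j) \<in> carrier A"
    using assms(1) by (rule matsE) blast
  obtain y where y: "Y = mat n n y" "\<And>i j. i < n \<Longrightarrow> j < n \<Longrightarrow> y (i, j) \<in> carrier A"
    using assms(2) by (rule matsE) blast
  let ?x = "\<lambda>i l. cnorm A (x (i, l))" and ?y = "\<lambda>l j. cnorm A (y (l, j))"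
  have "cnorm A (mat_mult A X Y $$ (i, j)) \<le> (\<Sum>l<n. ?x i l * ?y l j)" if "i < n" "j < n" for i j
  proof -
    have "cnorm A (mat_mult A X Y $$ (i, j)) \<le> (\<Sum>l<n. cnorm A (x (i, l) \<otimes> y (l, j)))"
      using that x(2) y(2) by (auto simp: x(1) y(1) intro!: norm_finsum)
    also have "\<dots> \<le> (\<Sum>l<n. ?x i l * ?y l j)"
      using that x(2) y(2) by (intro sum_mono norm_mult) auto
    finally show ?thesis .
  qed
  then have "cnorm (mat_alg A n) (mat_mult A X Y) \<le> (\<Sum>i<n. \<Sum>j<n. \<Sum>l<n. ?x i l * ?y l j)"
    by (auto simp: mat_alg_def intro!: sum_mono)
  also have "\<dots> = (\<Sum>i<n. \<Sum>l<n. ?x i l * (\<Sum>j<n. ?y l j))"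
    by (rule sum.cong[OF HOL.refl]) (simp add: sum_distrib_left, rule sum.swap)
  also have "\<dots> \<le> (\<Sum>i<n. \<Sum>l<n. ?x i l * (\<Sum>l<n. \<Sum>j<n. ?y l j))"
    using x(2) y(2)
    by (intro sum_mono mult_left_mono member_le_sum[of _ _ "\<lambda>l. \<Sum>j<n. ?y l j"]) (auto simp: norm_nonneg intro!: sum_nonneg)
  also have "\<dots> = cnorm (mat_alg A n) X * cnorm (mat_alg A n) Y"
    by (simp add: mat_alg_def sum_distrib_right x(1) y(1))
  finally show ?thesis .
qed

lemma mat_alg_banach: "banach_star_alg (mat_alg A n)"
proof (intro banach_star_alg.intro mat_alg_star_alg banach_star_alg_axioms.intro)
  fix X assume "X \<in> carrier (mat_alg A n)"
  then obtain x where x: "X = mat n n x" "\<And>i j. i < n \<Longrightarrow> j < n \<Longrightarrow> x (i, j) \<in> carrier A"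
    by (auto simp: mat_alg_def elim: matsE)
  show "0 \<le> cnorm (mat_alg A n) X"
    using x(2) by (auto simp: mat_alg_def norm_nonneg x(1) intro!: sum_nonneg)
  show "cnorm (mat_alg A n) X = 0 \<longleftrightarrow> X = \<zero>\<^bsub>mat_alg A n\<^esub>"
  proof
    assume "cnorm (mat_alg A n) X = 0"
    then have "cnorm A (x (i, j)) \<le> 0" if "i < n" "j < n" for i j
      using double_sum_ge[of n "\<lambda>i j. cnorm A (x (i, j))" i j] x(2) that
      by (simp add: mat_alg_def x(1) norm_nonneg)
    then have "x (i, j) = \<zero>" if "i < n" "j < n" for i j
      using x(2) that norm_zero_iff norm_nonneg by (metis antisym)
    then show "X = \<zero>\<^bsub>mat_alg A n\<^esub>"
      by (auto simp: mat_alg_def mdiag_def x(1) intro!: mat_eqI)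
  qed (simp add: mat_alg_def mdiag_def)
  show "cnorm (mat_alg A n) (c \<odot>\<^bsub>mat_alg A n\<^esub> X) = cmod c * cnorm (mat_alg A n) X" for c
    using x(2) by (simp add: mat_alg_def norm_smult sum_distrib_left x(1))
  show "cnorm (mat_alg A n) (star (mat_alg A n) X) = cnorm (mat_alg A n) X"
    using x(2) by (simp add: mat_alg_def norm_star x(1)) (rule sum.swap)
  fix Y assume "Y \<in> carrier (mat_alg A n)"
  then obtain y where y: "Y = mat n n y" "\<And>i j. i < n \<Longrightarrow> j < n \<Longrightarrow> y (i, j) \<in> carrier A"
    by (auto simp: mat_alg_def elim: matsE)
  show "cnorm (mat_alg A n) (X \<oplus>\<^bsub>mat_alg A n\<^esub> Y) \<le> cnorm (mat_alg A n) X + cnorm (mat_alg A n) Y"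
    using x(2) y(2)
    by (simp add: mat_alg_def x(1) y(1), intro order_trans[OF sum_mono[OF sum_mono[OF norm_triangle]]])
      (auto simp: sum.distrib)
  show "cnorm (mat_alg A n) (X \<otimes>\<^bsub>mat_alg A n\<^esub> Y) \<le> cnorm (mat_alg A n) X * cnorm (mat_alg A n) Y"
    using mat_alg_norm_mult[of X n Y] x y by (simp add: mat_alg_def)
next
  fix s :: "nat \<Rightarrow> 'a mat"
  assume "\<And>k. s k \<in> carrier (mat_alg A n)"
    and Cauchy: "\<And>\<epsilon>. \<epsilon> > 0 \<Longrightarrow> \<exists>N. \<forall>p\<ge>N. \<forall>q\<ge>N. cnorm (mat_alg A n) (s p \<ominus>\<^bsub>mat_alg A n\<^esub> s q) < \<epsilon>"
  then have s: "s k \<in> mats A n n" for k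
    by (simp add: mat_alg_def)
  then have s_in: "s k $$ (i, j) \<in> carrier A" if "i < n" "j < n" for k i j
    using that by (simp add: mats_def)
  have norm_diff: "cnorm (mat_alg A n) (X \<ominus>\<^bsub>mat_alg A n\<^esub> Y) = (\<Sum>i<n. \<Sum>j<n. cnorm A (X $$ (i, j) \<ominus> Y $$ (i, j)))"
    if "X \<in> mats A n n" "Y \<in> mats A n n" for X Y
    using mat_alg_minus_entry[OF that] by (simp add: mat_alg_def)
  have entry_le: "cnorm A (s p $$ (i, j) \<ominus> s q $$ (i, j)) \<le> cnorm (mat_alg A n) (s p \<ominus>\<^bsub>mat_alg A n\<^esub> s q)"
    if "i < n" "j < n" for i j p q
    using double_sum_ge[of n "\<lambda>i j. cnorm A (s p $$ (i, j) \<ominus> s q $$ (i, j))" i j] s_in that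
      norm_diff[OF s s, of p q] by (simp add: norm_nonneg)
  have "\<exists>l\<in>carrier A. (\<lambda>k. cnorm A (s k $$ (i, j) \<ominus> l)) \<longlonglongrightarrow> 0" if "i < n" "j < n" for i j
  proof (rule complete)
    fix \<epsilon> :: real
    assume "\<epsilon> > 0"
    then obtain N where "\<forall>p\<ge>N. \<forall>q\<ge>N. cnorm (mat_alg A n) (s p \<ominus>\<^bsub>mat_alg A n\<^esub> s q) < \<epsilon>"
      using Cauchy by blast
    then show "\<exists>N. \<forall>p\<ge>N. \<forall>q\<ge>N. cnorm A (s p $$ (i, j) \<ominus> s q $$ (i, j)) < \<epsilon>"
      using entry_le[OF that] by (intro exI[of _ N]) (blast intro: le_less_trans)
  qed (rule s_in[OF that])
  then have "\<forall>i j. \<exists>l. i < n \<longrightarrow> j < n \<longrightarrow> l \<in> carrier A \<and> (\<lambda>k. cnorm A (s k $$ (i, j) \<ominus> l)) \<longlonglongrightarrow> 0"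
    by blast
  then obtain l where l: "\<And>i j. i < n \<Longrightarrow> j < n \<Longrightarrow> l i j \<in> carrier A \<and> (\<lambda>k. cnorm A (s k $$ (i, j) \<ominus> l i j)) \<longlonglongrightarrow> 0"
    by (atomize_elim, simp only: choice_iff)
  define L where "L = mat n n (\<lambda>(i, j). l i j)"
  have L: "L \<in> mats A n n"
    using l by (simp add: L_def)
  have "(\<lambda>k. \<Sum>i<n. \<Sum>j<n. cnorm A (s k $$ (i, j) \<ominus> L $$ (i, j))) \<longlonglongrightarrow> (\<Sum>i<n. \<Sum>j<n. 0)"
    using l by (intro tendsto_sum) (simp add: L_def)
  then show "\<exists>L\<in>carrier (mat_alg A n). (\<lambda>k. cnorm (mat_alg A n) (s k \<ominus>\<^bsub>mat_alg A n\<^esub> L)) \<longlonglongrightarrow> 0"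
    using L norm_diff[OF s L] by (intro bexI[of _ L]) (simp_all add: mat_alg_def)
qed

end

context banach_star_alg
begin

subsection \<open>Archimedean cones\<close>

text \<open>The hypothesis \<open>bound\<close> makes elements between 0 and 1 power bounded, so that \<open>sqrt_exists\<close>
  applies to them.\<close>

context
  fixes C :: "'a set" and K :: real
  assumes C_sa: "X \<in> C \<Longrightarrow> X \<in> carrier A \<and> star A X = X"
    and C_add: "X \<in> C \<Longrightarrow> Y \<in> C \<Longrightarrow> X \<oplus> Y \<in> C"
    and C_conj: "X \<in> C \<Longrightarrow> B \<in> carrier A \<Longrightarrow> star A B \<otimes> X \<otimes> B \<in> C"
    and C_square: "B \<in> carrier A \<Longrightarrow> star A B \<otimes> B \<in> C"
    and bound: "B \<in> carrier A \<Longrightarrow> t \<ge> 0 \<Longrightarrow> complex_of_real t \<odot> \<one> \<ominus> star A B \<otimes> B \<in> C \<Longrightarrow>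
      cnorm A B \<le> K * sqrt t"
begin

text \<open>Conjugation with sqrt t times the unit.\<close>

lemma cone_scale:
  assumes "X \<in> C" "t \<ge> 0"
  shows "complex_of_real t \<odot> X \<in> C"
proof -
  have "star A (complex_of_real (sqrt t) \<odot> \<one>) \<otimes> X \<otimes> (complex_of_real (sqrt t) \<odot> \<one>) \<in> C"
    using assms by (intro C_conj) auto
  moreover have "complex_of_real (sqrt t) * complex_of_real (sqrt t) = complex_of_real t"
    using assms(2) by (simp flip: of_real_mult)
  ultimately show ?thesis
    using C_sa[OF assms(1)] by (simp add: star_smult star_one smult_mult_left smult_mult_right)
qed

text \<open>1 - h is the square of the self-adjoint element 1 - R.\<close>

lemma cone_order_unit_power_bounded:
  assumes h: "h \<in> carrier A" "star A h = h" and K': "\<And>l :: nat. cnorm A (h [^] l) \<le> K'"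
  shows "\<one> \<ominus> h \<in> C"
proof -
  obtain R where R: "R \<in> carrier A" "star A R = R" "(\<one> \<ominus> R) \<otimes> (\<one> \<ominus> R) = \<one> \<ominus> h"
    using sqrt_exists[OF h K'] by blast
  then show ?thesis
    using C_square[of "\<one> \<ominus> R"] by (simp add: star_minus star_one)
qed

text \<open>Scaled to norm at most 1, X becomes power bounded, so 1 - X / t is a square.\<close>

lemma cone_order_unit:
  assumes X: "X \<in> carrier A" "star A X = X"
  shows "\<exists>t>0. complex_of_real t \<odot> \<one> \<ominus> X \<in> C"
proof -
  define t where "t = cnorm A X + 1"
  have t: "t > 0"
    using norm_nonneg[OF X(1)] by (simp add: t_def)
  define h where "h = complex_of_real (1 / t) \<odot> X"
  have h: "h \<in> carrier A" "star A h = h"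
    using X by (simp_all add: h_def star_smult)
  have "cnorm A h \<le> 1"
    using X t by (simp add: h_def norm_smult norm_divide) (simp add: t_def)
  have "cnorm A (h [^] l) \<le> cnorm A \<one> + 1" for l :: nat
  proof (induction l)
    case (Suc l)
    have "cnorm A (h [^] l \<otimes> h) \<le> (cnorm A \<one> + 1) * 1"
      by (rule order_trans[OF norm_mult mult_mono]) (use h Suc \<open>cnorm A h \<le> 1\<close> in \<open>auto simp: norm_nonneg add_nonneg_nonneg\<close>)
    then show ?case
      by simp
  qed simp
  from cone_order_unit_power_bounded[OF h this] have "complex_of_real t \<odot> (\<one> \<ominus> h) \<in> C"
    using t by (intro cone_scale) auto
  then show ?thesis
    using t X by (intro exI[of _ t]) (simp add: h_def smult_minus_right)
qed

text \<open>h and k = c - h commute, and h k = (h k h + k h k) / c is a multiple of a sum of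
  conjugates of members of C. A power of h in front is then split into h^i on both sides, around k
  for an even exponent and around h k for an odd one.\<close>

lemma cone_power_step:
  assumes h: "h \<in> C" and c: "c > 0" and k: "k = complex_of_real c \<odot> \<one> \<ominus> h" "k \<in> C"
  shows "h [^] (l :: nat) \<otimes> k \<in> C"
proof -
  note hA = C_sa[OF h] and kA = C_sa[OF k(2)]
  have hk: "h \<otimes> k = k \<otimes> h" and sum: "h \<oplus> k = complex_of_real c \<odot> \<one>"
    unfolding k using hA smult_in[OF one_in, of c]
    by (simp_all add: a_minus_def l_distr r_distr l_minus r_minus smult_mult_left smult_mult_right a_ac r_neg r_neg1 r_neg2)
  have "(h \<otimes> k) \<otimes> (h \<oplus> k) = h \<otimes> k \<otimes> h \<oplus> k \<otimes> h \<otimes> k"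
    using hA kA hk by (simp add: r_distr)
  also have "\<dots> \<in> C"
    using C_add[OF C_conj[OF k(2), of h] C_conj[OF h, of k]] hA kA by simp
  finally have "complex_of_real (1 / c) \<odot> ((h \<otimes> k) \<otimes> (h \<oplus> k)) \<in> C"
    using c by (intro cone_scale) auto
  then have hkC: "h \<otimes> k \<in> C"
    using c hA kA unfolding sum by (simp add: smult_mult_right)
  have comm: "h [^] i \<otimes> k = k \<otimes> h [^] i" for i :: nat
  proof (induction i)
    case (Suc i)
    have "h [^] i \<otimes> h \<otimes> k = h [^] i \<otimes> k \<otimes> h"
      using hA kA hk by (simp add: m_assoc)
    then show ?case
      using Suc hA kA by (simp add: m_assoc)
  qed (use kA in simp)
  have conj: "h [^] i \<otimes> X \<otimes> h [^] i \<in> C" if "X \<in> C" for X and i :: nat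
    using C_conj[OF that, of "h [^] i"] hA by (simp add: star_pow)
  obtain i where "l = i + i \<or> l = Suc (i + i)"
    by (metis add_Suc_right mult_2 oddE evenE Suc_eq_plus1)
  then show ?thesis
  proof
    assume l: "l = i + i"
    have "h [^] l \<otimes> k = h [^] i \<otimes> (h [^] i \<otimes> k)"
      unfolding l using hA kA by (simp add: m_assoc flip: nat_pow_mult)
    also have "\<dots> = h [^] i \<otimes> (k \<otimes> h [^] i)"
      by (simp only: comm)
    also have "\<dots> = h [^] i \<otimes> k \<otimes> h [^] i"
      using hA kA by (simp add: m_assoc)
    finally show ?thesis
      using conj[OF k(2), of i] by simp
  next
    assume l: "l = Suc (i + i)"
    have "h [^] l = h [^] i \<otimes> h [^] Suc i"
      unfolding l using hA nat_pow_mult[of h i "Suc i"] by (simp del: nat_pow_Suc)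
    also have "h [^] Suc i = h \<otimes> h [^] i"
      by (rule nat_pow_Suc2) (use hA in simp)
    also have "h [^] i \<otimes> (h \<otimes> h [^] i) = h [^] i \<otimes> h \<otimes> h [^] i"
      using hA by (simp add: m_assoc)
    finally have "h [^] l = h [^] i \<otimes> h \<otimes> h [^] i" .
    then have "h [^] l \<otimes> k = h [^] i \<otimes> h \<otimes> (h [^] i \<otimes> k)"
      using hA kA by (simp add: m_assoc)
    also have "\<dots> = h [^] i \<otimes> h \<otimes> (k \<otimes> h [^] i)"
      by (simp only: comm)
    also have "\<dots> = h [^] i \<otimes> (h \<otimes> k) \<otimes> h [^] i"
      using hA kA by (simp add: m_assoc)
    finally show ?thesis
      using conj[OF hkC, of i] by simp
  qed
qed

text \<open>Write p for a power of h and d for the same power of c: then c d - p h = c (d - p) + p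
  (c - h), and the last product lies in C by \<open>cone_power_step\<close>.\<close>

lemma cone_power_le:
  assumes h: "h \<in> C" and c: "c > 0" and k: "complex_of_real c \<odot> \<one> \<ominus> h \<in> C"
  shows "complex_of_real (c ^ Suc l) \<odot> \<one> \<ominus> h [^] Suc l \<in> C"
proof (induction l)
  case 0
  then show ?case
    using k C_sa[OF h] by simp
next
  case (Suc l)
  define k' where "k' = complex_of_real c \<odot> \<one> \<ominus> h"
  define p where "p = h [^] Suc l"
  define d where "d = complex_of_real (c ^ Suc l)"
  note hA = C_sa[OF h]
  have p: "p \<in> carrier A"
    using hA by (simp add: p_def)
  have "p \<otimes> k' \<in> C"
    unfolding p_def by (rule cone_power_step[OF h c k'_def]) (use k in \<open>simp add: k'_def\<close>)
  then have "complex_of_real c \<odot> (d \<odot> \<one> \<ominus> p) \<oplus> p \<otimes> k' \<in> C"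
    using Suc c unfolding p_def d_def by (intro C_add cone_scale) auto
  moreover have "complex_of_real c \<odot> (d \<odot> \<one> \<ominus> p) = (complex_of_real c * d) \<odot> \<one> \<ominus> complex_of_real c \<odot> p"
    using p by (simp add: smult_minus_right)
  moreover have "p \<otimes> k' = complex_of_real c \<odot> p \<ominus> p \<otimes> h"
    using p hA by (simp add: k'_def a_minus_def r_distr r_minus smult_mult_right)
  moreover have "x \<ominus> y \<oplus> (y \<ominus> z) = x \<ominus> z" if "x \<in> carrier A" "y \<in> carrier A" "z \<in> carrier A" for x y z
    using that by algebra
  ultimately have "(complex_of_real c * d) \<odot> \<one> \<ominus> p \<otimes> h \<in> C"
    using p hA by simp
  then show ?case
    by (simp add: p_def d_def)
qed

text \<open>For h = 1 - X / t with suitable t, 0 \<le> h \<le> 1 + \<epsilon> holds for all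
  \<epsilon> > 0 in the order of C. Then h^(2 l) \<le> (1 + \<epsilon>)^(2 l), and
  \<open>bound\<close> applied to h^l gives a norm of at most K (1 + \<epsilon>)^l, hence of at most
  K in the limit. So h is power bounded and X / t = 1 - h is a square.\<close>

theorem archimedean_cone:
  assumes X: "X \<in> carrier A" and eps: "\<And>\<epsilon>. \<epsilon> > 0 \<Longrightarrow> X \<oplus> complex_of_real \<epsilon> \<odot> \<one> \<in> C"
  shows "X \<in> C"
proof -
  have "star A (X \<oplus> 1 \<odot> \<one>) = X \<oplus> 1 \<odot> \<one>"
    using C_sa[OF eps[of 1]] by simp
  then have X_sa: "star A X = X"
    using X by (simp add: star_add star_one star_closed)
  obtain t where t: "t > 0" "complex_of_real t \<odot> \<one> \<ominus> X \<in> C"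
    using cone_order_unit[OF X X_sa] by blast
  define h where "h = complex_of_real (1 / t) \<odot> (complex_of_real t \<odot> \<one> \<ominus> X)"
  have h: "h \<in> C"
    unfolding h_def using t by (intro cone_scale) auto
  note hA = C_sa[OF h]
  have h_eq: "h = \<one> \<ominus> complex_of_real (1 / t) \<odot> X"
    using t X by (simp add: h_def smult_minus_right)
  have k: "complex_of_real (1 + \<epsilon>) \<odot> \<one> \<ominus> h \<in> C" if "\<epsilon> > 0" for \<epsilon>
  proof -
    have "complex_of_real (1 / t) \<odot> (X \<oplus> complex_of_real (t * \<epsilon>) \<odot> \<one>) \<in> C"
      using t that by (intro cone_scale eps) auto
    moreover have "complex_of_real (1 + \<epsilon>) \<odot> \<one> = \<one> \<oplus> complex_of_real \<epsilon> \<odot> \<one>"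
      by (simp add: smult_add_left)
    moreover have "(\<one> \<oplus> y) \<ominus> (\<one> \<ominus> x) = x \<oplus> y" if "x \<in> carrier A" "y \<in> carrier A" for x y
      using that by algebra
    ultimately show ?thesis
      using t X by (simp add: h_eq smult_add_right)
  qed
  have "cnorm A (h [^] l) \<le> K" if "l > 0" for l :: nat
  proof -
    have "cnorm A (h [^] l) \<le> K * (1 + \<epsilon>) ^ l" if eps': "\<epsilon> > 0" for \<epsilon>
    proof -
      \<comment> \<open>\<open>cone_power_le\<close> speaks of exponents that are
        successors.\<close>
      obtain l' where l': "2 * l = Suc l'"
        using \<open>l > 0\<close> by (metis gr0_implies_Suc nat_0_less_mult_iff zero_less_numeral)
      have "h [^] Suc l' = star A (h [^] l) \<otimes> h [^] l"
        using hA by (simp add: star_pow nat_pow_mult flip: l' mult_2 del: nat_pow_Suc)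
      then have "complex_of_real ((1 + \<epsilon>) ^ (2 * l)) \<odot> \<one> \<ominus> star A (h [^] l) \<otimes> h [^] l \<in> C"
        using cone_power_le[OF h _ k[OF eps'], of l'] eps' by (simp add: l' del: nat_pow_Suc power_Suc)
      then have "cnorm A (h [^] l) \<le> K * sqrt ((1 + \<epsilon>) ^ (2 * l))"
        using hA eps' by (intro bound) auto
      then show ?thesis
        using eps' by (simp add: real_sqrt_power power_mult)
    qed
    moreover have "((\<lambda>\<epsilon>. K * (1 + \<epsilon>) ^ l) \<longlongrightarrow> K * (1 + 0) ^ l) (at_right 0)"
      by (intro tendsto_intros)
    ultimately have "cnorm A (h [^] l) \<le> K * (1 + 0) ^ l"
      by (intro tendsto_lowerbound[of _ _ "at_right 0"]) (auto simp: eventually_at_right_less eventually_at_filter)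
    then show ?thesis
      by simp
  qed
  \<comment> \<open>The exponent 0 was excluded so far; that power is the unit.\<close>
  then have "cnorm A (h [^] l) \<le> max K (cnorm A \<one>)" for l :: nat
    by (cases l) (fastforce simp: le_max_iff_disj)+
  from cone_order_unit_power_bounded[OF _ _ this] have "\<one> \<ominus> h \<in> C"
    using hA by blast
  moreover have "\<one> \<ominus> (\<one> \<ominus> x) = x" if "x \<in> carrier A" for x
    using that by algebra
  ultimately have "complex_of_real (1 / t) \<odot> X \<in> C"
    using X by (simp add: h_eq)
  from cone_scale[OF this, of t] show ?thesis
    using t X by simp
qed

end

end

lemma map_mat_id: "map_mat id X = X"
  by (rule eq_matI) auto

context linear_injection
begin

interpretation V: star_vector_space V
  by (rule star_vector_space)
interpretation VM: abelian_group V
  by (rule V.abelian_group_V)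
interpretation W: star_vector_space W
  by (rule W)
interpretation WM: abelian_group W
  by (rule W.abelian_group_V)

lemma f_uminus: "x \<in> carrier V \<Longrightarrow> f (\<ominus>\<^bsub>V\<^esub> x) = \<ominus>\<^bsub>W\<^esub> f x"
  by (simp add: V.uminus_smult W.uminus_smult f_smult f_in)

lemma f_finsum:
  "finite I \<Longrightarrow> g \<in> I \<rightarrow> carrier V \<Longrightarrow> f (finsum V g I) = finsum W (\<lambda>i. f (g i)) I"
  by (rule finsum_hom[OF _ V.vector_space W.vector_space]) (auto simp: f_simps)

lemma f_mats: "X \<in> mats V p n \<Longrightarrow> map_mat f X \<in> mats W p n"
  by (auto simp: mats_def f_in)

lemma f_mats_inj:
  assumes "X \<in> mats V p n" "Y \<in> mats V p n" "map_mat f X = map_mat f Y"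
  shows "X = Y"
proof -
  have "f (X $$ (i, j)) = f (Y $$ (i, j))" if "i < p" "j < n" for i j
    using arg_cong[OF assms(3), of "\<lambda>M. M $$ (i, j)"] assms(1,2) that by (auto simp: mats_def)
  then show ?thesis
    using assms(1,2) by (intro eq_matI) (auto simp: mats_def intro!: inj_eqI)
qed

lemma f_madd: "X \<in> mats V p n \<Longrightarrow> Y \<in> mats V p n \<Longrightarrow> map_mat f (madd V X Y) = madd W (map_mat f X) (map_mat f Y)"
  by (auto simp: madd_def mats_def f_add intro!: eq_matI)

lemma f_madjoint: "X \<in> mats V p n \<Longrightarrow> map_mat f (madjoint V X) = madjoint W (map_mat f X)"
  by (auto simp: madjoint_def mats_def f_star intro!: eq_matI)

lemma f_mdiag: "map_mat f (mdiag V n c) = mdiag W n c"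
  by (auto simp: mdiag_def f_smult f_one f_zero one_in intro!: eq_matI)

lemma f_map_mat_uminus:
  "X \<in> mats V p n \<Longrightarrow> map_mat f (map_mat (\<lambda>x. \<ominus>\<^bsub>V\<^esub> x) X) = map_mat (\<lambda>x. \<ominus>\<^bsub>W\<^esub> x) (map_mat f X)"
  by (auto simp: mats_def f_uminus intro!: eq_matI)

lemma f_mcompress:
  assumes X: "X \<in> mats V n n" and B: "B \<in> carrier_mat n q"
  shows "map_mat f (mcompress V B X) = mcompress W B (map_mat f X)"
proof -
  have in_V: "X $$ (i, j) \<in> carrier V" if "i < n" "j < n" for i j
    using X that by (simp add: mats_def)
  have in_V': "(\<Oplus>\<^bsub>V\<^esub>r\<in>{..<n}. c r \<odot>\<^bsub>V\<^esub> X $$ (p, r)) \<in> carrier V" if "p < n" for c p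
    using that in_V by (intro VM.finsum_closed) auto
  have inner: "f (\<Oplus>\<^bsub>V\<^esub>r\<in>{..<n}. c r \<odot>\<^bsub>V\<^esub> X $$ (p, r)) = (\<Oplus>\<^bsub>W\<^esub>r\<in>{..<n}. c r \<odot>\<^bsub>W\<^esub> map_mat f X $$ (p, r))"
    if "p < n" for c p
  proof -
    have "f (\<Oplus>\<^bsub>V\<^esub>r\<in>{..<n}. c r \<odot>\<^bsub>V\<^esub> X $$ (p, r)) = (\<Oplus>\<^bsub>W\<^esub>r\<in>{..<n}. f (c r \<odot>\<^bsub>V\<^esub> X $$ (p, r)))"
      using that in_V by (intro f_finsum) auto
    also have "\<dots> = (\<Oplus>\<^bsub>W\<^esub>r\<in>{..<n}. c r \<odot>\<^bsub>W\<^esub> map_mat f X $$ (p, r))"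
      using that in_V X by (intro WM.finsum_cong') (auto simp: f_smult f_in mats_def)
    finally show ?thesis .
  qed
  have "f (\<Oplus>\<^bsub>V\<^esub>p\<in>{..<n}. \<Oplus>\<^bsub>V\<^esub>r\<in>{..<n}. c p r \<odot>\<^bsub>V\<^esub> X $$ (p, r))
      = (\<Oplus>\<^bsub>W\<^esub>p\<in>{..<n}. \<Oplus>\<^bsub>W\<^esub>r\<in>{..<n}. c p r \<odot>\<^bsub>W\<^esub> map_mat f X $$ (p, r))" for c
  proof -
    have "f (\<Oplus>\<^bsub>V\<^esub>p\<in>{..<n}. \<Oplus>\<^bsub>V\<^esub>r\<in>{..<n}. c p r \<odot>\<^bsub>V\<^esub> X $$ (p, r))
       = (\<Oplus>\<^bsub>W\<^esub>p\<in>{..<n}. f (\<Oplus>\<^bsub>V\<^esub>r\<in>{..<n}. c p r \<odot>\<^bsub>V\<^esub> X $$ (p, r)))"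
      using in_V' by (intro f_finsum) auto
    also have "\<dots> = (\<Oplus>\<^bsub>W\<^esub>p\<in>{..<n}. \<Oplus>\<^bsub>W\<^esub>r\<in>{..<n}. c p r \<odot>\<^bsub>W\<^esub> map_mat f X $$ (p, r))"
    proof (rule WM.finsum_cong')
      show "(\<lambda>p. \<Oplus>\<^bsub>W\<^esub>r\<in>{..<n}. c p r \<odot>\<^bsub>W\<^esub> map_mat f X $$ (p, r)) \<in> {..<n} \<rightarrow> carrier W"
        using X by (auto simp: f_in mats_def intro!: WM.finsum_closed)
    qed (use inner in auto)
    finally show ?thesis .
  qed
  then show ?thesis
    using X B by (auto simp: mcompress_def mats_def intro!: eq_matI)
qed

end

text \<open>Positivity in S is by assumption the pullback of positivity in T, so each axiom is
  inherited through f. For the quotient system this replaces a direct proof that its cones are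
  proper and Archimedean.\<close>

lemma operator_system_transfer:
  fixes S :: "('a, 'm) opsys_scheme" and T :: "('b, 'n) opsys_scheme"
  assumes T: "operator_system T" and f: "linear_injection S T f"
    and mpos_mats: "\<And>n. mpos S n \<subseteq> mats S n n"
    and mpos_iff: "\<And>n X. X \<in> mats S n n \<Longrightarrow> X \<in> mpos S n \<longleftrightarrow> map_mat f X \<in> mpos T n"
  shows "operator_system S"
proof -
  interpret T: operator_system T
    by (rule T)
  interpret f: linear_injection S T f
    by (rule f)
  interpret S: star_vector_space S
    by (rule f.star_vector_space)
  interpret SM: abelian_group S
    by (rule S.abelian_group_V)
  have in_S: "madd S X Y \<in> mats S n n" "madjoint S X \<in> mats S n n" "mdiag S n c \<in> mats S n n"
    if "X \<in> mats S n n" "Y \<in> mats S n n" for X Y n c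
    using that by (auto simp: mats_def madd_def madjoint_def mdiag_def f.f_simps)
  have diag_in: "mdiag S n c \<in> mats S n n" for n c
    by (auto simp: mats_def mdiag_def f.f_simps)
  show ?thesis
  proof (rule operator_system.intro[OF S.star_vector_space_axioms operator_system_axioms.intro])
    show "mpos S n \<subseteq> mats S n n" for n
      by (rule mpos_mats)
    fix n X
    assume X: "X \<in> mpos S n"
    then have X': "X \<in> mats S n n" "map_mat f X \<in> mpos T n"
      using mpos_mats mpos_iff by auto
    show "madjoint S X = X"
      using T.mpos_hermitian[OF X'(2)] X' in_S by (intro f.f_mats_inj[of _ n n]) (auto simp: f.f_madjoint)
    show "madd S X Y \<in> mpos S n" if "Y \<in> mpos S n" for Y
      using that X' mpos_mats[of n] mpos_iff[of _ n] in_S T.mpos_add[of "map_mat f X" n "map_mat f Y"]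
      by (auto simp: f.f_madd)
    show "mcompress S B X \<in> mpos S p" if "B \<in> carrier_mat n p" for B p
    proof -
      have "X $$ (i, j) \<in> carrier S" if "i < n" "j < n" for i j
        using X'(1) that by (simp add: mats_def)
      then have "mcompress S B X \<in> mats S p p"
        using that X'(1) by (auto simp: mats_def mcompress_def intro!: SM.finsum_closed)
      then show ?thesis
        using mpos_iff f.f_mcompress[OF X'(1) that] T.mpos_compress[OF X'(2) that] by simp
    qed
    show "X = mdiag S n 0" if "map_mat (\<lambda>x. \<ominus>\<^bsub>S\<^esub> x) X \<in> mpos S n"
    proof (rule f.f_mats_inj[of _ n n])
      have "map_mat (\<lambda>x. \<ominus>\<^bsub>T\<^esub> x) (map_mat f X) \<in> mpos T n"
        using that mpos_mats mpos_iff f.f_map_mat_uminus[OF X'(1)] by fastforce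
      then show "map_mat f X = map_mat f (mdiag S n 0)"
        using T.mpos_proper[OF X'(2)] by (simp add: f.f_mdiag)
    qed (use X' diag_in in auto)
  next
    fix X n
    assume X: "X \<in> mats S n n"
    show "\<exists>r>0. madd S X (mdiag S n (complex_of_real r)) \<in> mpos S n" if "madjoint S X = X"
      using T.matrix_order_unit[OF f.f_mats[OF X]] that f.f_madjoint[OF X] mpos_iff[of _ n] X in_S diag_in
      by (auto simp: f.f_madd f.f_mdiag)
    show "X \<in> mpos S n" if "\<And>\<epsilon>. \<epsilon> > 0 \<Longrightarrow> madd S X (mdiag S n (complex_of_real \<epsilon>)) \<in> mpos S n"
    proof -
      have "madd T (map_mat f X) (mdiag T n (complex_of_real \<epsilon>)) \<in> mpos T n" if "\<epsilon> > 0" for \<epsilon>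
        using \<open>\<And>\<epsilon>. \<epsilon> > 0 \<Longrightarrow> _\<close>[OF that] mpos_iff[of "madd S X (mdiag S n (complex_of_real \<epsilon>))" n] X in_S diag_in
        by (simp add: f.f_madd f.f_mdiag)
      then show ?thesis
        using T.archimedean[OF f.f_mats[OF X]] mpos_iff[OF X] by simp
    qed
  qed
qed

section \<open>Operator subsystems of C*-algebras\<close>

context star_alg
begin

lemma finsum_lessThan_add:
  fixes p q :: nat
  assumes "\<And>l. l < p + q \<Longrightarrow> f l \<in> carrier A"
  shows "(\<Oplus>l\<in>{..<p + q}. f l) = (\<Oplus>l\<in>{..<p}. f l) \<oplus> (\<Oplus>l\<in>{..<q}. f (p + l))"
  using assms
proof (induction q)
  case (Suc q)
  have f: "f \<in> {..<p + q} \<rightarrow> carrier A" "(\<lambda>l. f (p + l)) \<in> {..<q} \<rightarrow> carrier A" "f (p + q) \<in> carrier A"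
      "f \<in> {..<p} \<rightarrow> carrier A"
    using Suc.prems by auto
  then show ?case
    using Suc by (simp add: lessThan_Suc a_lcomm)
qed (auto intro!: finsum_closed)

lemma madjoint_madjoint: "X \<in> mats A p n \<Longrightarrow> madjoint A (madjoint A X) = X"
  by (elim matsE) (auto simp: star_star intro!: mat_eqI)

lemma cstar_mpos_alt: "X \<in> cstar_mpos A n \<longleftrightarrow> (\<exists>p. \<exists>Y\<in>mats A p n. X = mat_mult A (madjoint A Y) Y)"
proof -
  have "mat n n (\<lambda>(i, j). \<Oplus>l\<in>{..<p}. star A (Y $$ (l, i)) \<otimes> Y $$ (l, j)) = mat_mult A (madjoint A Y) Y"
    if "Y \<in> mats A p n" for p Y
    using that by (elim matsE) (auto simp: star_closed intro!: mat_eqI finsum_cong')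
  then show ?thesis
    by (auto simp: cstar_mpos_def)
qed

lemma cstar_mposI: "Y \<in> mats A p n \<Longrightarrow> mat_mult A (madjoint A Y) Y \<in> cstar_mpos A n"
  by (auto simp: cstar_mpos_alt)

lemma cstar_mposE:
  assumes "X \<in> cstar_mpos A n"
  obtains p Y where "Y \<in> mats A p n" "X = mat_mult A (madjoint A Y) Y"
  using assms by (auto simp: cstar_mpos_alt)

lemma cstar_mpos_in: "X \<in> cstar_mpos A n \<Longrightarrow> X \<in> mats A n n"
  by (elim cstar_mposE) (auto intro: mats_in)

lemma cstar_mpos_adjoint: "X \<in> cstar_mpos A n \<Longrightarrow> madjoint A X = X"
  by (elim cstar_mposE) (auto simp: madjoint_mult[OF madjoint_in] madjoint_madjoint)

text \<open>One Gram factor is placed on top of the other; rectangular factors make this possible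
  without square roots.\<close>

lemma cstar_mpos_add:
  assumes "X \<in> cstar_mpos A n" "Y \<in> cstar_mpos A n"
  shows "madd A X Y \<in> cstar_mpos A n"
proof -
  obtain p Z where Z: "Z \<in> mats A p n" "X = mat_mult A (madjoint A Z) Z"
    using assms(1) by (rule cstar_mposE)
  obtain q W where W: "W \<in> mats A q n" "Y = mat_mult A (madjoint A W) W"
    using assms(2) by (rule cstar_mposE)
  obtain z where z: "Z = mat p n z" "\<And>i j. i < p \<Longrightarrow> j < n \<Longrightarrow> z (i, j) \<in> carrier A"
    using Z(1) by (rule matsE) blast
  obtain w where w: "W = mat q n w" "\<And>i j. i < q \<Longrightarrow> j < n \<Longrightarrow> w (i, j) \<in> carrier A"
    using W(1) by (rule matsE) blast
  define V where "V = mat (p + q) n (\<lambda>(l, j). if l < p then z (l, j) else w (l - p, j))"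
  have V: "V \<in> mats A (p + q) n"
    using z(2) w(2) by (auto simp: V_def)
  have "madd A X Y = mat_mult A (madjoint A V) V"
    unfolding Z(2) W(2) z(1) w(1) V_def using z(2) w(2)
    by (subst mat_mult_mat madjoint_mat; auto simp: star_closed madjoint_mat)+
      (auto simp: finsum_lessThan_add star_closed intro!: mat_eqI arg_cong2[of _ _ _ _ "(\<oplus>)"] finsum_cong')
  then show ?thesis
    using cstar_mposI[OF V] by simp
qed

lemma cstar_mpos_conj:
  assumes "X \<in> cstar_mpos A n" and B: "B \<in> mats A n q"
  shows "mat_mult A (madjoint A B) (mat_mult A X B) \<in> cstar_mpos A q"
proof -
  obtain p Y where Y: "Y \<in> mats A p n" "X = mat_mult A (madjoint A Y) Y"
    using assms(1) by (rule cstar_mposE)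
  have "mat_mult A (madjoint A B) (mat_mult A X B) = mat_mult A (madjoint A (mat_mult A Y B)) (mat_mult A Y B)"
    unfolding Y(2) using Y(1) B
    by (simp add: madjoint_mult mat_mult_assoc[of _ n p _ n _ q] mat_mult_assoc[of _ q n _ p _ q] mats_in)
  then show ?thesis
    using cstar_mposI[OF mat_mult_in[OF Y(1) B]] by simp
qed

text \<open>Scalars c become c times the unit, so compression by a scalar matrix is a special case
  of \<open>cstar_mpos_conj\<close>.\<close>

lemma mcompress_alt:
  assumes X: "X \<in> mats A n n" and B: "B \<in> carrier_mat n q"
  shows "mcompress A B X = mat_mult A (madjoint A (map_mat (\<lambda>c. c \<odot> \<one>) B)) (mat_mult A X (map_mat (\<lambda>c. c \<odot> \<one>) B))"
proof -
  obtain x where x: "X = mat n n x" "\<And>i j. i < n \<Longrightarrow> j < n \<Longrightarrow> x (i, j) \<in> carrier A"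
    using X by (rule matsE) blast
  have B': "map_mat (\<lambda>c. c \<odot> \<one>) B = mat n q (\<lambda>ij. B $$ ij \<odot> \<one>)"
    using B by (auto intro!: eq_matI)
  have "(\<Oplus>p\<in>{..<n}. \<Oplus>r\<in>{..<n}. (cnj (B $$ (p, i)) * B $$ (r, j)) \<odot> x (p, r))
     = (\<Oplus>p\<in>{..<n}. star A (B $$ (p, i) \<odot> \<one>) \<otimes> (\<Oplus>r\<in>{..<n}. x (p, r) \<otimes> (B $$ (r, j) \<odot> \<one>)))"
    if ij: "i < q" "j < q" for i j
  proof (rule finsum_cong')
    fix p
    assume p: "p \<in> {..<n}"
    have "star A (B $$ (p, i) \<odot> \<one>) \<otimes> (\<Oplus>r\<in>{..<n}. x (p, r) \<otimes> (B $$ (r, j) \<odot> \<one>))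
        = (\<Oplus>r\<in>{..<n}. star A (B $$ (p, i) \<odot> \<one>) \<otimes> (x (p, r) \<otimes> (B $$ (r, j) \<odot> \<one>)))"
      using p x(2) by (intro finsum_rdistr) (auto simp: star_closed)
    also have "\<dots> = (\<Oplus>r\<in>{..<n}. (cnj (B $$ (p, i)) * B $$ (r, j)) \<odot> x (p, r))"
      using p x(2)
      by (intro finsum_cong') (auto simp: star_smult star_one smult_mult_left smult_mult_right mult.commute)
    finally show "(\<Oplus>r\<in>{..<n}. (cnj (B $$ (p, i)) * B $$ (r, j)) \<odot> x (p, r))
       = star A (B $$ (p, i) \<odot> \<one>) \<otimes> (\<Oplus>r\<in>{..<n}. x (p, r) \<otimes> (B $$ (r, j) \<odot> \<one>))" ..
  qed (use x(2) in \<open>auto intro!: finsum_closed m_closed star_closed\<close>)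
  moreover have "mcompress A B X = mat q q (\<lambda>(i, j). (\<Oplus>p\<in>{..<n}. \<Oplus>r\<in>{..<n}. (cnj (B $$ (p, i)) * B $$ (r, j)) \<odot> x (p, r)))"
    unfolding mcompress_def using B x(2)
    by (auto simp: x(1) intro!: eq_matI finsum_cong' finsum_closed)
  ultimately show ?thesis
    unfolding B' using x(2) by (auto simp: x(1) star_closed finsum_closed intro!: mat_eqI)
qed

lemma map_mat_uminus: "X \<in> mats A p n \<Longrightarrow> map_mat (\<lambda>x. \<ominus> x) X = mat_smult A (- 1) X"
  by (elim matsE) (auto simp: uminus_smult intro!: eq_matI)

lemma mat_smult_entry: "X \<in> mats A p n \<Longrightarrow> i < p \<Longrightarrow> j < n \<Longrightarrow> mat_smult A c X $$ (i, j) = c \<odot> X $$ (i, j)"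
  by (elim matsE) auto

lemma mat_smult_mdiag: "mat_smult A c (mdiag A n d) = mdiag A n (c * d)"
  by (auto simp: mdiag_def intro!: mat_eqI)

end

section \<open>Properness, order unit and Archimedean property of the matrix cones\<close>

context cstar_algebra
begin

lemma pos_finsum_eq_zero:
  "finite I \<Longrightarrow> (\<And>i. i \<in> I \<Longrightarrow> pos (f i)) \<Longrightarrow> (\<Oplus>i\<in>I. f i) = \<zero> \<Longrightarrow> i \<in> I \<Longrightarrow> f i = \<zero>"
proof (induction rule: finite_induct)
  case (insert k I)
  then have "f \<in> I \<rightarrow> carrier A" "f k \<in> carrier A"
    by (auto simp: pos_in)
  then have "f k \<oplus> finsum A f I = \<zero>" "pos (finsum A f I)" "pos (f k)"
    using insert by (auto intro: pos_finsum)
  then have "f k = \<zero>" "finsum A f I = \<zero>"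
    using pos_add_eq_zero pos_in by (metis a_comm)+
  then show ?case
    using insert by auto
qed simp

lemma gram_diag:
  assumes "Y \<in> mats A p n" "j < n"
  shows "mat_mult A (madjoint A Y) Y $$ (j, j) = (\<Oplus>l\<in>{..<p}. star A (Y $$ (l, j)) \<otimes> Y $$ (l, j))"
  using assms by (elim matsE) (auto simp: star_closed intro!: finsum_cong')

lemma gram_diag_pos: "Y \<in> mats A p n \<Longrightarrow> j < n \<Longrightarrow> l < p \<Longrightarrow> pos (star A (Y $$ (l, j)) \<otimes> Y $$ (l, j))"
  by (intro pos_star_mult) (simp add: mats_def)

text \<open>A diagonal entry of X is a sum of elements y* y, and so is its negative; by
  \<open>pos_antisym\<close> it vanishes. Then every summand vanishes and with it every entry of
  Y.\<close>

lemma cstar_mpos_proper: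
  assumes X: "X \<in> cstar_mpos A n" and X': "mat_smult A (- 1) X \<in> cstar_mpos A n"
  shows "X = mdiag A n 0"
proof -
  obtain p Y where Y: "Y \<in> mats A p n" "X = mat_mult A (madjoint A Y) Y"
    using X by (rule cstar_mposE)
  obtain q Z where Z: "Z \<in> mats A q n" "mat_smult A (- 1) X = mat_mult A (madjoint A Z) Z"
    using X' by (rule cstar_mposE)
  have Y0: "Y $$ (l, j) = \<zero>" if "l < p" "j < n" for l j
  proof -
    let ?s = "\<Oplus>l\<in>{..<p}. star A (Y $$ (l, j)) \<otimes> Y $$ (l, j)"
    have s: "pos ?s"
      using gram_diag_pos[OF Y(1) \<open>j < n\<close>] by (intro pos_finsum) auto
    have "pos (\<Oplus>l\<in>{..<q}. star A (Z $$ (l, j)) \<otimes> Z $$ (l, j))"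
      using gram_diag_pos[OF Z(1) \<open>j < n\<close>] by (intro pos_finsum) auto
    moreover have "(\<Oplus>l\<in>{..<q}. star A (Z $$ (l, j)) \<otimes> Z $$ (l, j)) = mat_smult A (- 1) X $$ (j, j)"
      using gram_diag[OF Z(1) \<open>j < n\<close>] Z(2) by simp
    moreover have "\<dots> = \<ominus> ?s"
      using gram_diag[OF Y(1) \<open>j < n\<close>] pos_in[OF s] mat_smult_entry[OF cstar_mpos_in[OF X] \<open>j < n\<close> \<open>j < n\<close>] Y(2)
      by (simp add: uminus_smult)
    ultimately have "?s = \<zero>"
      using s by (intro pos_antisym) auto
    then have "star A (Y $$ (l, j)) \<otimes> Y $$ (l, j) = \<zero>"
      using gram_diag_pos[OF Y(1) \<open>j < n\<close>] \<open>l < p\<close>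
      by (intro pos_finsum_eq_zero[of "{..<p}" "\<lambda>l. star A (Y $$ (l, j)) \<otimes> Y $$ (l, j)"]) auto
    then show ?thesis
      using cstar_identity[of "Y $$ (l, j)"] norm_zero_iff[of "Y $$ (l, j)"] Y(1) that by (simp add: mats_def)
  qed
  obtain y where y: "Y = mat p n y" "\<And>i j. i < p \<Longrightarrow> j < n \<Longrightarrow> y (i, j) \<in> carrier A"
    using Y(1) by (rule matsE) blast
  have "(\<Oplus>l\<in>{..<p}. star A (y (l, i)) \<otimes> y (l, j)) = \<zero>" if "i < n" "j < n" for i j
    using Y0 that y by (intro add.finprod_one_eqI) (auto simp: star_closed)
  then show ?thesis
    unfolding Y(2) using y(2) by (auto simp: y(1) star_closed mdiag_def intro!: mat_eqI)
qed

text \<open>If t - B* B is positive, its diagonal entries show that y* y \<le> t for each entry y of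
  B, so y has norm at most sqrt t. The constant n^2 counts the entries; this supplies the hypothesis
  \<open>bound\<close> for the cone of Gram matrices.\<close>

lemma mat_norm_bound:
  assumes B: "B \<in> mats A n n" and "t \<ge> 0"
    and C: "mdiag A n (complex_of_real t) \<ominus>\<^bsub>mat_alg A n\<^esub> mat_mult A (madjoint A B) B \<in> cstar_mpos A n"
  shows "cnorm (mat_alg A n) B \<le> (real n * real n) * sqrt t"
proof -
  obtain p Y where Y: "Y \<in> mats A p n"
      "mdiag A n (complex_of_real t) \<ominus>\<^bsub>mat_alg A n\<^esub> mat_mult A (madjoint A B) B = mat_mult A (madjoint A Y) Y"
    using C by (rule cstar_mposE)
  have "cnorm A (B $$ (i, j)) \<le> sqrt t" if "i < n" "j < n" for i j
  proof -
    let ?f = "\<lambda>l. star A (B $$ (l, j)) \<otimes> B $$ (l, j)"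
    have in_A: "?f l \<in> carrier A" if "l < n" for l
      using that B \<open>j < n\<close> by (auto simp: mats_def intro!: star_closed)
    have "scalar t \<ominus> (\<Oplus>l\<in>{..<n}. ?f l) = (\<Oplus>l\<in>{..<p}. star A (Y $$ (l, j)) \<otimes> Y $$ (l, j))"
      using arg_cong[OF Y(2), of "\<lambda>M. M $$ (j, j)"] gram_diag[OF Y(1) \<open>j < n\<close>] gram_diag[OF B \<open>j < n\<close>] \<open>j < n\<close>
        mat_alg_minus_entry[OF mdiag_in mat_mult_in[OF madjoint_in[OF B] B], of j j "complex_of_real t"]
      by (simp add: mdiag_def scalar_def)
    then have pos1: "pos (scalar t \<ominus> (\<Oplus>l\<in>{..<n}. ?f l))"
      using gram_diag_pos[OF Y(1) \<open>j < n\<close>] by (auto intro!: pos_finsum)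
    have pos2: "pos (\<Oplus>l\<in>{..<n} - {i}. ?f l)"
      using gram_diag_pos[OF B \<open>j < n\<close>] by (intro pos_finsum) auto
    have "(\<Oplus>l\<in>insert i ({..<n} - {i}). ?f l) = ?f i \<oplus> (\<Oplus>l\<in>{..<n} - {i}. ?f l)"
      using in_A \<open>i < n\<close> by (intro finsum_insert) auto
    moreover have "insert i ({..<n} - {i}) = {..<n}"
      using \<open>i < n\<close> by auto
    ultimately have "(\<Oplus>l\<in>{..<n}. ?f l) = ?f i \<oplus> (\<Oplus>l\<in>{..<n} - {i}. ?f l)"
      by simp
    moreover have "scalar t \<ominus> (x \<oplus> y) \<oplus> y = scalar t \<ominus> x" if "x \<in> carrier A" "y \<in> carrier A" for x y
      using that scalar_in[of t] by algebra
    ultimately have "pos (scalar t \<ominus> ?f i)"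
      using pos_add[OF pos1 pos2] in_A[OF \<open>i < n\<close>] pos_in[OF pos2] by simp
    then have "(cnorm A (B $$ (i, j)))\<^sup>2 \<le> t"
      using B that \<open>t \<ge> 0\<close> by (intro norm_le_of_pos) (auto simp: mats_def)
    then show ?thesis
      by (rule real_le_rsqrt)
  qed
  then have "cnorm (mat_alg A n) B \<le> (\<Sum>i<n. \<Sum>j<n. sqrt t)"
    by (simp add: mat_alg_def del: sum_constant) (intro sum_mono, simp)
  then show ?thesis
    by simp
qed

text \<open>Both are instances of the results on Archimedean cones, applied in
  \<open>mat_alg A n\<close> to the Gram matrices with K = n^2.\<close>

lemma
  shows cstar_mpos_order_unit:
      "\<lbrakk>X \<in> mats A n n; madjoint A X = X\<rbrakk> \<Longrightarrow> \<exists>r>0. madd A X (mdiag A n (complex_of_real r)) \<in> cstar_mpos A n"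
    and cstar_mpos_archimedean:
      "\<lbrakk>X \<in> mats A n n; \<And>\<epsilon>. \<epsilon> > 0 \<Longrightarrow> madd A X (mdiag A n (complex_of_real \<epsilon>)) \<in> cstar_mpos A n\<rbrakk>
       \<Longrightarrow> X \<in> cstar_mpos A n"
proof -
  interpret M: banach_star_alg "mat_alg A n"
    by (rule mat_alg_banach)
  let ?M = "mat_alg A n"
  have [simp]: "carrier ?M = mats A n n" "mult ?M = mat_mult A" "add ?M = madd A" "star ?M = madjoint A"
      "smult ?M = mat_smult A" "one ?M = mdiag A n 1"
    by (simp_all add: mat_alg_def)
  have C1: "X \<in> carrier ?M \<and> star ?M X = X" if "X \<in> cstar_mpos A n" for X
    using that cstar_mpos_in cstar_mpos_adjoint by simp
  have C2: "X \<oplus>\<^bsub>?M\<^esub> Y \<in> cstar_mpos A n" if "X \<in> cstar_mpos A n" "Y \<in> cstar_mpos A n" for X Y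
    using that cstar_mpos_add by simp
  have C3: "star ?M B \<otimes>\<^bsub>?M\<^esub> X \<otimes>\<^bsub>?M\<^esub> B \<in> cstar_mpos A n" if "X \<in> cstar_mpos A n" "B \<in> carrier ?M" for X B
    using that cstar_mpos_conj[of X n B n] cstar_mpos_in[of X n]
    by (simp add: mat_mult_assoc[of _ n n _ n _ n] mats_in)
  have C4: "star ?M B \<otimes>\<^bsub>?M\<^esub> B \<in> cstar_mpos A n" if "B \<in> carrier ?M" for B
    using that cstar_mposI by simp
  have C5: "cnorm ?M B \<le> (real n * real n) * sqrt t"
    if "B \<in> carrier ?M" "t \<ge> 0"
      "complex_of_real t \<odot>\<^bsub>?M\<^esub> \<one>\<^bsub>?M\<^esub> \<ominus>\<^bsub>?M\<^esub> star ?M B \<otimes>\<^bsub>?M\<^esub> B \<in> cstar_mpos A n" for B t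
    using that mat_norm_bound by (simp add: mat_smult_mdiag)
  {
    assume X: "X \<in> mats A n n" "madjoint A X = X"
    \<comment> \<open>\<open>cone_order_unit\<close> bounds an element from above, so it is applied
      to - X.\<close>
    have "star ?M (\<ominus>\<^bsub>?M\<^esub> X) = \<ominus>\<^bsub>?M\<^esub> X"
      using X M.star_uminus[of X] by simp
    then obtain t where "t > 0" "complex_of_real t \<odot>\<^bsub>?M\<^esub> \<one>\<^bsub>?M\<^esub> \<ominus>\<^bsub>?M\<^esub> (\<ominus>\<^bsub>?M\<^esub> X) \<in> cstar_mpos A n"
      using M.cone_order_unit[OF C1 C2 C3 C4 C5, of "\<ominus>\<^bsub>?M\<^esub> X"] M.add.inv_closed[of X] X by auto
    moreover have "complex_of_real t \<odot>\<^bsub>?M\<^esub> \<one>\<^bsub>?M\<^esub> \<ominus>\<^bsub>?M\<^esub> (\<ominus>\<^bsub>?M\<^esub> X) = madd A X (mdiag A n (complex_of_real t))"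
      using X M.a_comm[of X "mdiag A n (complex_of_real t)"] M.minus_minus[of X]
      by (simp add: a_minus_def mat_smult_mdiag mats_in)
    ultimately show "\<exists>r>0. madd A X (mdiag A n (complex_of_real r)) \<in> cstar_mpos A n"
      by auto
  }
  {
    assume X: "X \<in> mats A n n" "\<And>\<epsilon>. \<epsilon> > 0 \<Longrightarrow> madd A X (mdiag A n (complex_of_real \<epsilon>)) \<in> cstar_mpos A n"
    show "X \<in> cstar_mpos A n"
      by (rule M.archimedean_cone[OF C1 C2 C3 C4 C5]) (use X in \<open>auto simp: mat_smult_mdiag\<close>)
  }
qed

lemma full_linear_injection:
  assumes "operator_subspace A V"
  shows "linear_injection (opsub A V) A id"
proof (rule linear_injection.intro)
  interpret V: LinearCombinations.submodule class_ring V A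
    using assms by (simp add: operator_subspace_def)
  show "star_vector_space A" ..
  show "\<zero>\<^bsub>opsub A V\<^esub> \<in> carrier (opsub A V)"
    using V.zero_closed by (simp add: opsub_def)
  show "id x \<in> carrier A" if "x \<in> carrier (opsub A V)" for x
    using that V.subset by (auto simp: opsub_def)
  show "x \<oplus>\<^bsub>opsub A V\<^esub> y \<in> carrier (opsub A V)" if "x \<in> carrier (opsub A V)" "y \<in> carrier (opsub A V)" for x y
    using that V.m_closed by (simp add: opsub_def)
  show "c \<odot>\<^bsub>opsub A V\<^esub> x \<in> carrier (opsub A V)" if "x \<in> carrier (opsub A V)" for x c
    using that V.smult_closed by (simp add: opsub_def)
qed (use assms in \<open>auto simp: opsub_def operator_subspace_def\<close>)

lemma operator_subspace_carrier: "operator_subspace A (carrier A)"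
  using vector_space by (auto simp: operator_subspace_def LinearCombinations.submodule_def star_closed)

lemma opsub_uminus:
  assumes "operator_subspace A V" "x \<in> V"
  shows "\<ominus>\<^bsub>opsub A V\<^esub> x = \<ominus> x"
proof -
  interpret L: linear_injection "opsub A V" A id
    by (rule full_linear_injection[OF assms(1)])
  interpret S: star_vector_space "opsub A V"
    by (rule L.star_vector_space)
  show ?thesis
    using S.uminus_smult[of x] uminus_smult[of x] L.f_in[of x] assms(2) by (simp add: opsub_def)
qed

lemma operator_system_full: "operator_system (opsub A (carrier A))"
proof -
  let ?S = "opsub A (carrier A)"
  interpret L: linear_injection ?S A id
    by (rule full_linear_injection[OF operator_subspace_carrier])
  interpret S: star_vector_space ?S
    by (rule L.star_vector_space)
  have eqs: "mats ?S p n = mats A p n" "madd ?S = madd A" "madjoint ?S = madjoint A" "mdiag ?S = mdiag A"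
    "mpos ?S n = cstar_mpos A n" for p n
    using cstar_mpos_in[of _ n]
    by (fastforce simp: opsub_def mats_def madd_def madjoint_def mdiag_def fun_eq_iff)+
  have mc: "mcompress ?S B X = mcompress A B X" if "X \<in> mats A n n" "B \<in> carrier_mat n q" for B X n q
    using L.f_mcompress[of X n B q] that by (simp add: eqs map_mat_id)
  show ?thesis
  proof (rule operator_system.intro[OF S.star_vector_space_axioms operator_system_axioms.intro]; (unfold eqs)?)
    show "mcompress ?S B X \<in> cstar_mpos A p" if "X \<in> cstar_mpos A n" "B \<in> carrier_mat n p" for X n B p
    proof -
      have "map_mat (\<lambda>c. c \<odot> \<one>) B \<in> mats A n p"
        using that(2) by (auto simp: mats_def)
      then show ?thesis
        using cstar_mpos_conj[OF that(1)] mc[OF cstar_mpos_in[OF that(1)] that(2)]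
          mcompress_alt[OF cstar_mpos_in[OF that(1)] that(2)] by simp
    qed
    show "X = mdiag A n 0" if "X \<in> cstar_mpos A n" "map_mat (\<lambda>x. \<ominus>\<^bsub>?S\<^esub> x) X \<in> cstar_mpos A n" for X n
    proof -
      have "map_mat (\<lambda>x. \<ominus>\<^bsub>?S\<^esub> x) X = map_mat (\<lambda>x. \<ominus> x) X"
        using cstar_mpos_in[OF that(1)] by (intro eq_matI) (auto simp: mats_def opsub_uminus operator_subspace_carrier)
      then show ?thesis
        using that map_mat_uminus[OF cstar_mpos_in[OF that(1)]] cstar_mpos_proper by simp
    qed
  qed (use cstar_mpos_in cstar_mpos_adjoint cstar_mpos_add cstar_mpos_order_unit cstar_mpos_archimedean in blast)+
qed

theorem operator_system_opsub:
  assumes "operator_subspace A V"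
  shows "operator_system (opsub A V)"
proof (rule operator_system_transfer[OF operator_system_full])
  have V: "V \<subseteq> carrier A"
    using assms LinearCombinations.submodule.subset by (auto simp: operator_subspace_def)
  show "linear_injection (opsub A V) (opsub A (carrier A)) id"
  proof -
    interpret L: linear_injection "opsub A V" A id
      by (rule full_linear_injection[OF assms])
    interpret F: operator_system "opsub A (carrier A)"
      by (rule operator_system_full)
    show ?thesis
      using L.f_simps V by (intro linear_injection.intro F.star_vector_space_axioms) (auto simp: opsub_def)
  qed
  show "mpos (opsub A V) n \<subseteq> mats (opsub A V) n n" for n
    using cstar_mpos_in by (fastforce simp: opsub_def mats_def)
  show "X \<in> mpos (opsub A V) n \<longleftrightarrow> map_mat id X \<in> mpos (opsub A (carrier A)) n" if "X \<in> mats (opsub A V) n n" for n X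
    using that V by (auto simp: opsub_def mats_def map_mat_id)
qed

end

text \<open>\<open>closed\<close> says that the image of R is norm closed in A; this yields
  completeness, and everything else is pulled back along f.\<close>

lemma cstar_algebra_transfer:
  fixes R :: "('a, 'm) cstar_scheme" and A :: "('b, 'n) cstar_scheme"
  assumes A: "cstar_algebra A" and f: "linear_injection R A f"
    and closed: "\<And>s l. (\<And>n :: nat. s n \<in> carrier R) \<Longrightarrow> l \<in> carrier A \<Longrightarrow>
      (\<lambda>n. cnorm A (f (s n) \<ominus>\<^bsub>A\<^esub> l)) \<longlonglongrightarrow> 0 \<Longrightarrow> l \<in> f ` carrier R"
    and mult_in: "\<And>x y. x \<in> carrier R \<Longrightarrow> y \<in> carrier R \<Longrightarrow> x \<otimes>\<^bsub>R\<^esub> y \<in> carrier R"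
    and f_mult: "\<And>x y. x \<in> carrier R \<Longrightarrow> y \<in> carrier R \<Longrightarrow> f (x \<otimes>\<^bsub>R\<^esub> y) = f x \<otimes>\<^bsub>A\<^esub> f y"
    and norm: "\<And>x. x \<in> carrier R \<Longrightarrow> cnorm R x = cnorm A (f x)"
  shows "cstar_algebra R"
proof -
  interpret A: cstar_algebra A
    by (rule A)
  interpret f: linear_injection R A f
    by (rule f)
  interpret R: star_vector_space R
    by (rule f.star_vector_space)
  interpret RM: abelian_group R
    by (rule R.abelian_group_V)
  note simps = f.f_simps mult_in f_mult norm
  have ring: "ring R"
  proof (rule ringI)
    show "abelian_group R" ..
    show "monoid R"
      by (rule monoidI; (rule f.inj_eqI)?; simp add: simps A.m_assoc)
  qed ((rule f.inj_eqI; simp add: simps A.l_distr A.r_distr))+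
  have minus: "f (x \<ominus>\<^bsub>R\<^esub> y) = f x \<ominus>\<^bsub>A\<^esub> f y" if "x \<in> carrier R" "y \<in> carrier R" for x y
    using that by (simp add: a_minus_def simps f.f_uminus)
  show ?thesis
  proof (rule cstar_algebra.intro[OF R.star_vector_space_axioms ring cstar_algebra_axioms.intro])
    show "cnorm R x = 0 \<longleftrightarrow> x = \<zero>\<^bsub>R\<^esub>" if "x \<in> carrier R" for x
      using that A.norm_zero_iff[of "f x"] f.inj_eqI[of x "\<zero>\<^bsub>R\<^esub>"] by (auto simp: simps)
    show "\<exists>l\<in>carrier R. (\<lambda>n. cnorm R (s n \<ominus>\<^bsub>R\<^esub> l)) \<longlonglongrightarrow> 0"
      if s: "\<And>n. s n \<in> carrier R"
        and Cauchy: "\<And>\<epsilon>. \<epsilon> > 0 \<Longrightarrow> \<exists>N. \<forall>p\<ge>N. \<forall>q\<ge>N. cnorm R (s p \<ominus>\<^bsub>R\<^esub> s q) < \<epsilon>" for s :: "nat \<Rightarrow> 'a"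
    proof -
      have "\<exists>l\<in>carrier A. (\<lambda>n. cnorm A (f (s n) \<ominus>\<^bsub>A\<^esub> l)) \<longlonglongrightarrow> 0"
        using s Cauchy by (intro A.complete) (simp_all add: simps minus)
      then obtain l where "l \<in> carrier R" "(\<lambda>n. cnorm A (f (s n) \<ominus>\<^bsub>A\<^esub> f l)) \<longlonglongrightarrow> 0"
        using closed[of s] s by blast
      then show ?thesis
        using s by (intro bexI[of _ l]) (simp_all add: simps minus)
    qed
  qed ((rule f.inj_eqI)?; simp add: simps A.smult_mult_left A.smult_mult_right A.star_mult
      A.norm_nonneg A.norm_triangle A.norm_smult A.norm_mult A.cstar_identity)+
qed

section \<open>Homomorphisms of C*-algebras\<close>

locale cstar_morphism = A: cstar_algebra A + B: cstar_algebra B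
  for A :: "('a, 'm) cstar_scheme" and B :: "('b, 'n) cstar_scheme" and f +
  assumes hom: "cstar_hom A B f"
begin

lemma f_in: "x \<in> carrier A \<Longrightarrow> f x \<in> carrier B"
  and f_add: "x \<in> carrier A \<Longrightarrow> y \<in> carrier A \<Longrightarrow> f (x \<oplus>\<^bsub>A\<^esub> y) = f x \<oplus>\<^bsub>B\<^esub> f y"
  and f_mult: "x \<in> carrier A \<Longrightarrow> y \<in> carrier A \<Longrightarrow> f (x \<otimes>\<^bsub>A\<^esub> y) = f x \<otimes>\<^bsub>B\<^esub> f y"
  and f_one: "f \<one>\<^bsub>A\<^esub> = \<one>\<^bsub>B\<^esub>"
  and f_smult: "x \<in> carrier A \<Longrightarrow> f (c \<odot>\<^bsub>A\<^esub> x) = c \<odot>\<^bsub>B\<^esub> f x"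
  and f_star: "x \<in> carrier A \<Longrightarrow> f (star A x) = star B (f x)"
  using hom by (auto simp: cstar_hom_def Ring.ring_hom_def)

lemma f_zero: "f \<zero>\<^bsub>A\<^esub> = \<zero>\<^bsub>B\<^esub>"
  using f_smult[OF A.one_in, of 0] A.one_in by (simp add: f_one)

lemma f_finsum: "finite I \<Longrightarrow> g \<in> I \<rightarrow> carrier A \<Longrightarrow> f (finsum A g I) = finsum B (\<lambda>i. f (g i)) I"
  by (rule finsum_hom[OF _ A.vector_space B.vector_space]) (auto simp: f_in f_zero f_add)

lemma f_pow: "x \<in> carrier A \<Longrightarrow> f (x [^]\<^bsub>A\<^esub> (n :: nat)) = f x [^]\<^bsub>B\<^esub> n"
  by (induction n) (auto simp: f_one f_mult)

lemma f_unitary: "x \<in> unitaries A \<Longrightarrow> f x \<in> unitaries B"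
  using f_mult[of "star A x" x] f_mult[of x "star A x"] by (auto simp: unitaries_def f_in f_star A.star_closed f_one)

lemma f_mpos:
  assumes "X \<in> cstar_mpos A n"
  shows "map_mat f X \<in> cstar_mpos B n"
proof -
  obtain p Y where Y: "Y \<in> mats A p n" "X = mat_mult A (madjoint A Y) Y"
    using assms by (rule A.cstar_mposE)
  obtain y where y: "Y = mat p n y" "\<And>i j. i < p \<Longrightarrow> j < n \<Longrightarrow> y (i, j) \<in> carrier A"
    using Y(1) by (rule matsE) blast
  have f_sum: "f (\<Oplus>\<^bsub>A\<^esub>l\<in>{..<p}. star A (y (l, i)) \<otimes>\<^bsub>A\<^esub> y (l, j))
      = (\<Oplus>\<^bsub>B\<^esub>l\<in>{..<p}. star B (f (y (l, i))) \<otimes>\<^bsub>B\<^esub> f (y (l, j)))" if "i < n" "j < n" for i j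
    using y(2) that
    by (subst f_finsum) (auto simp: f_mult f_star f_in A.star_closed B.star_closed intro!: B.finsum_cong')
  have "map_mat f X = mat n n (\<lambda>(i, j). f (\<Oplus>\<^bsub>A\<^esub>l\<in>{..<p}. star A (y (l, i)) \<otimes>\<^bsub>A\<^esub> y (l, j)))"
    unfolding Y(2) y(1) using y(2) by (auto simp: A.star_closed intro!: eq_matI)
  also have "\<dots> = mat_mult B (madjoint B (mat p n (\<lambda>ij. f (y ij)))) (mat p n (\<lambda>ij. f (y ij)))"
    using y(2) f_sum by (auto simp: f_in B.star_closed intro!: mat_eqI)
  finally show ?thesis
    using B.cstar_mposI[of "mat p n (\<lambda>ij. f (y ij))" p n] y(2) by (simp add: f_in)
qed

end

lemma cstar_hom_comp:
  "cstar_hom A B f \<Longrightarrow> cstar_hom B C g \<Longrightarrow> cstar_hom A C (\<lambda>x. g (f x))"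
  by (auto simp: cstar_hom_def Ring.ring_hom_def Pi_iff)

lemma cstar_hom_id: "cstar_hom A A (\<lambda>x. x)"
  by (auto simp: cstar_hom_def Ring.ring_hom_def)

text \<open>The copy of A in another type. Since g is inverted on the whole type by
  \<open>the_inv\<close>, the lemmas on this copy ask for \<open>inj g\<close> and not just for
  injectivity on the carrier.\<close>

definition image_cstar :: "('a \<Rightarrow> 'u) \<Rightarrow> ('a, 'm) cstar_scheme \<Rightarrow> 'u cstar" where
  "image_cstar g A = (let d = the_inv g in
     \<lparr>carrier = g ` carrier A, mult = (\<lambda>x y. g (d x \<otimes>\<^bsub>A\<^esub> d y)), one = g \<one>\<^bsub>A\<^esub>, zero = g \<zero>\<^bsub>A\<^esub>,
      add = (\<lambda>x y. g (d x \<oplus>\<^bsub>A\<^esub> d y)), smult = (\<lambda>c x. g (c \<odot>\<^bsub>A\<^esub> d x)), star = (\<lambda>x. g (star A (d x))),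
      cnorm = (\<lambda>x. cnorm A (d x))\<rparr>)"

lemma image_cstar:
  assumes A: "cstar_algebra A" and g: "inj g"
  shows "cstar_algebra (image_cstar g A)"
    and "cstar_hom (image_cstar g A) A (the_inv g)"
    and "cstar_hom A (image_cstar g A) g"
proof -
  interpret A: cstar_algebra A
    by (rule A)
  have [simp]: "the_inv g (g x) = x" for x
    using g by (simp add: the_inv_f_f)
  have f: "linear_injection (image_cstar g A) A (the_inv g)"
    by (rule linear_injection.intro[OF A.star_vector_space_axioms])
      (auto simp: image_cstar_def Let_def A.one_in A.star_closed intro!: inj_onI)
  show "cstar_algebra (image_cstar g A)"
    by (rule cstar_algebra_transfer[OF A f])
      (simp_all add: image_cstar_def Let_def image_image, auto)
  show "cstar_hom (image_cstar g A) A (the_inv g)" "cstar_hom A (image_cstar g A) g"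
    by (auto simp: image_cstar_def Let_def cstar_hom_def Ring.ring_hom_def)
qed

section \<open>The C*-algebra of complex matrices over a finite index set\<close>

definition mat_app :: "'i set \<Rightarrow> ('i \<Rightarrow> 'i \<Rightarrow> complex) \<Rightarrow> ('i \<Rightarrow> complex) \<Rightarrow> 'i \<Rightarrow> complex" where
  "mat_app I X v = (\<lambda>a. \<Sum>b\<in>I. X a b * v b)"

definition vnorm :: "'i set \<Rightarrow> ('i \<Rightarrow> complex) \<Rightarrow> real" where
  "vnorm I v = L2_set (\<lambda>a. cmod (v a)) I"

definition ip :: "'i set \<Rightarrow> ('i \<Rightarrow> complex) \<Rightarrow> ('i \<Rightarrow> complex) \<Rightarrow> complex" where
  "ip I v w = (\<Sum>a\<in>I. cnj (w a) * v a)"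

text \<open>An infimum of bounds instead of a supremum over the unit sphere: it also makes sense for
  empty I.\<close>

definition op_norm :: "'i set \<Rightarrow> ('i \<Rightarrow> 'i \<Rightarrow> complex) \<Rightarrow> real" where
  "op_norm I X = Inf {c. 0 \<le> c \<and> (\<forall>v. vnorm I (mat_app I X v) \<le> c * vnorm I v)}"

definition adj :: "('i \<Rightarrow> 'i \<Rightarrow> complex) \<Rightarrow> 'i \<Rightarrow> 'i \<Rightarrow> complex" where
  "adj X = (\<lambda>a b. cnj (X b a))"

definition fmult :: "'i set \<Rightarrow> ('i \<Rightarrow> 'i \<Rightarrow> complex) \<Rightarrow> ('i \<Rightarrow> 'i \<Rightarrow> complex) \<Rightarrow> 'i \<Rightarrow> 'i \<Rightarrow> complex" where
  "fmult I X Y = (\<lambda>a b. \<Sum>c\<in>I. X a c * Y c b)"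

text \<open>The vanishing condition off I x I makes equal matrices equal functions. Over a countable
  index type such functions can be coded as elements of \<open>nat \<Rightarrow> complex\<close>,
  and so in the type of the universal algebra.\<close>

definition fun_mat :: "'i set \<Rightarrow> ('i \<Rightarrow> 'i \<Rightarrow> complex) cstar" where
  "fun_mat I =
     \<lparr>carrier = {X. \<forall>a b. a \<notin> I \<or> b \<notin> I \<longrightarrow> X a b = 0}, mult = fmult I,
      one = (\<lambda>a b. if a = b \<and> a \<in> I then 1 else 0), zero = (\<lambda>a b. 0),
      add = (\<lambda>X Y a b. X a b + Y a b), smult = (\<lambda>c X a b. c * X a b), star = adj,
      cnorm = op_norm I\<rparr>"

context
  fixes I :: "'i set"
  assumes fin: "finite I"
begin

lemma vnorm_nonneg: "0 \<le> vnorm I v"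
  by (simp add: vnorm_def L2_set_nonneg)

lemma vnorm_member: "a \<in> I \<Longrightarrow> cmod (v a) \<le> vnorm I v"
  using fin member_le_L2_set[of I a "\<lambda>a. cmod (v a)"] by (simp add: vnorm_def)

lemma ip_self: "ip I v v = complex_of_real ((vnorm I v)\<^sup>2)"
proof -
  have "cnj (v a) * v a = complex_of_real ((cmod (v a))\<^sup>2)" for a
    using complex_norm_square[of "v a"] by (simp add: mult.commute)
  then show ?thesis
    by (simp add: ip_def vnorm_def L2_set_def sum_nonneg)
qed

lemma ip_le: "cmod (ip I v w) \<le> vnorm I v * vnorm I w"
proof -
  have "cmod (ip I v w) \<le> (\<Sum>a\<in>I. \<bar>cmod (w a)\<bar> * \<bar>cmod (v a)\<bar>)"
    unfolding ip_def by (rule order_trans[OF norm_sum]) (simp add: norm_mult)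
  also have "\<dots> \<le> vnorm I w * vnorm I v"
    unfolding vnorm_def by (rule L2_set_mult_ineq)
  finally show ?thesis
    by (simp add: mult.commute)
qed

lemma mat_app_fmult: "mat_app I (fmult I X Y) v = mat_app I X (mat_app I Y v)"
  unfolding mat_app_def fmult_def
  by (subst sum_distrib_left, subst sum.swap) (simp add: sum_distrib_left sum_distrib_right mult.assoc)

lemma ip_mat_app: "ip I (mat_app I X v) w = ip I v (mat_app I (adj X) w)"
  unfolding ip_def mat_app_def adj_def
  by (simp add: sum_distrib_left sum_distrib_right, subst sum.swap) (simp add: mult_ac)

lemma op_norm_sum_bound: "vnorm I (mat_app I X v) \<le> (\<Sum>a\<in>I. \<Sum>b\<in>I. cmod (X a b)) * vnorm I v"
proof -
  have "vnorm I (mat_app I X v) \<le> (\<Sum>a\<in>I. cmod (mat_app I X v a))"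
    unfolding vnorm_def by (rule L2_set_le_sum) simp
  also have "\<dots> \<le> (\<Sum>a\<in>I. \<Sum>b\<in>I. cmod (X a b) * cmod (v b))"
    unfolding mat_app_def by (intro sum_mono order_trans[OF norm_sum]) (simp add: norm_mult)
  also have "\<dots> \<le> (\<Sum>a\<in>I. \<Sum>b\<in>I. cmod (X a b) * vnorm I v)"
    by (intro sum_mono mult_left_mono vnorm_member) auto
  finally show ?thesis
    by (simp add: sum_distrib_right)
qed

lemma op_norm_le: "0 \<le> c \<Longrightarrow> (\<And>v. vnorm I (mat_app I X v) \<le> c * vnorm I v) \<Longrightarrow> op_norm I X \<le> c"
  unfolding op_norm_def by (intro cInf_lower) (auto intro: bdd_belowI[of _ 0])

lemma op_norm_bounds_ne: "{c. 0 \<le> c \<and> (\<forall>v. vnorm I (mat_app I X v) \<le> c * vnorm I v)} \<noteq> {}"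
  using op_norm_sum_bound[of X] by (auto intro!: exI[of _ "\<Sum>a\<in>I. \<Sum>b\<in>I. cmod (X a b)"] sum_nonneg)

lemma op_norm_nonneg: "0 \<le> op_norm I X"
  unfolding op_norm_def by (rule cInf_greatest[OF op_norm_bounds_ne]) auto

lemma op_norm_bound: "vnorm I (mat_app I X v) \<le> op_norm I X * vnorm I v"
proof (cases "vnorm I v = 0")
  case True
  then show ?thesis
    using op_norm_sum_bound[of X v] by simp
next
  case False
  then have pos: "vnorm I v > 0"
    using vnorm_nonneg[of v] by simp
  have "vnorm I (mat_app I X v) / vnorm I v \<le> op_norm I X"
    unfolding op_norm_def by (rule cInf_greatest[OF op_norm_bounds_ne]) (use pos in \<open>auto simp: divide_le_eq\<close>)
  then show ?thesis
    using pos by (simp add: divide_le_eq)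
qed

lemma op_norm_entry:
  assumes "a \<in> I" "b \<in> I"
  shows "cmod (X a b) \<le> op_norm I X"
proof -
  let ?v = "\<lambda>c. if c = b then 1 else 0"
  have "(\<Sum>a\<in>I. (cmod (?v a))\<^sup>2) = (\<Sum>a\<in>I. if a = b then 1 else 0)"
    by (rule sum.cong) auto
  then have "vnorm I ?v = 1"
    using assms fin by (simp add: vnorm_def L2_set_def)
  moreover have "mat_app I X ?v a = X a b"
    using assms fin by (simp add: mat_app_def if_distrib[of "\<lambda>x. _ * x"] cong: if_cong)
  ultimately show ?thesis
    using vnorm_member[OF assms(1), of "mat_app I X ?v"] op_norm_bound[of X ?v] by simp
qed

lemma op_norm_adj_le: "op_norm I (adj X) \<le> op_norm I X"
proof (rule op_norm_le[OF op_norm_nonneg])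
  fix v
  let ?w = "mat_app I (adj X) v"
  have "(vnorm I ?w)\<^sup>2 = cmod (ip I (mat_app I X ?w) v)"
    unfolding ip_mat_app ip_self by (simp only: norm_of_real abs_of_nonneg zero_le_power2)
  also have "\<dots> \<le> (op_norm I X * vnorm I ?w) * vnorm I v"
    by (rule order_trans[OF ip_le mult_right_mono[OF op_norm_bound vnorm_nonneg]])
  finally show "vnorm I ?w \<le> op_norm I X * vnorm I v"
    using vnorm_nonneg[of ?w] op_norm_nonneg[of X] vnorm_nonneg[of v]
    by (cases "vnorm I ?w = 0") (auto simp: power2_eq_square mult_ac)
qed

lemma adj_adj: "adj (adj X) = X"
  by (simp add: adj_def)

lemma op_norm_fmult: "op_norm I (fmult I X Y) \<le> op_norm I X * op_norm I Y"
proof (rule op_norm_le)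
  fix v
  have "vnorm I (mat_app I X (mat_app I Y v)) \<le> op_norm I X * (op_norm I Y * vnorm I v)"
    by (rule order_trans[OF op_norm_bound mult_left_mono[OF op_norm_bound op_norm_nonneg]])
  then show "vnorm I (mat_app I (fmult I X Y) v) \<le> op_norm I X * op_norm I Y * vnorm I v"
    by (simp add: mat_app_fmult mult.assoc)
qed (simp add: op_norm_nonneg)

lemma op_norm_cstar: "op_norm I (fmult I (adj X) X) = (op_norm I X)\<^sup>2"
proof (rule antisym)
  have "op_norm I (fmult I (adj X) X) \<le> op_norm I (adj X) * op_norm I X"
    by (rule op_norm_fmult)
  also have "\<dots> \<le> (op_norm I X)\<^sup>2"
    unfolding power2_eq_square by (rule mult_right_mono[OF op_norm_adj_le op_norm_nonneg])
  finally show "op_norm I (fmult I (adj X) X) \<le> (op_norm I X)\<^sup>2" .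
  let ?n = "op_norm I (fmult I (adj X) X)"
  have "op_norm I X \<le> sqrt ?n"
  proof (rule op_norm_le)
    fix v
    have "(vnorm I (mat_app I X v))\<^sup>2 = cmod (ip I (mat_app I (fmult I (adj X) X) v) v)"
      unfolding mat_app_fmult ip_mat_app[of "adj X"] adj_adj ip_self
      by (simp only: norm_of_real abs_of_nonneg zero_le_power2)
    also have "\<dots> \<le> (?n * vnorm I v) * vnorm I v"
      by (rule order_trans[OF ip_le mult_right_mono[OF op_norm_bound vnorm_nonneg]])
    also have "\<dots> = (sqrt ?n * vnorm I v)\<^sup>2"
      using op_norm_nonneg[of "fmult I (adj X) X"] by (simp add: power_mult_distrib power2_eq_square)
    finally show "vnorm I (mat_app I X v) \<le> sqrt ?n * vnorm I v"
      using power2_le_imp_le op_norm_nonneg vnorm_nonneg by (metis mult_nonneg_nonneg real_sqrt_ge_zero)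
  qed (simp add: op_norm_nonneg)
  then have "(op_norm I X)\<^sup>2 \<le> (sqrt ?n)\<^sup>2"
    by (rule power_mono[OF _ op_norm_nonneg])
  then show "(op_norm I X)\<^sup>2 \<le> ?n"
    using op_norm_nonneg by simp
qed

lemma op_norm_triangle: "op_norm I (\<lambda>a b. X a b + Y a b) \<le> op_norm I X + op_norm I Y"
proof (rule op_norm_le)
  fix v
  have "vnorm I (mat_app I (\<lambda>a b. X a b + Y a b) v) \<le> L2_set (\<lambda>a. cmod (mat_app I X v a) + cmod (mat_app I Y v a)) I"
    unfolding vnorm_def
    by (intro L2_set_mono) (auto simp: mat_app_def distrib_right sum.distrib norm_triangle_ineq)
  also have "\<dots> \<le> vnorm I (mat_app I X v) + vnorm I (mat_app I Y v)"
    unfolding vnorm_def by (rule L2_set_triangle_ineq)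
  also have "\<dots> \<le> op_norm I X * vnorm I v + op_norm I Y * vnorm I v"
    by (intro add_mono op_norm_bound)
  finally show "vnorm I (mat_app I (\<lambda>a b. X a b + Y a b) v) \<le> (op_norm I X + op_norm I Y) * vnorm I v"
    by (simp add: distrib_right)
qed (simp add: op_norm_nonneg)

lemma op_norm_smult_le: "op_norm I (\<lambda>a b. c * X a b) \<le> cmod c * op_norm I X"
proof (rule op_norm_le)
  fix v
  have "mat_app I (\<lambda>a b. c * X a b) v = (\<lambda>a. c * mat_app I X v a)"
    by (simp add: mat_app_def sum_distrib_left mult.assoc)
  then have "vnorm I (mat_app I (\<lambda>a b. c * X a b) v) = cmod c * vnorm I (mat_app I X v)"
    by (simp add: vnorm_def norm_mult L2_set_right_distrib)
  then show "vnorm I (mat_app I (\<lambda>a b. c * X a b) v) \<le> cmod c * op_norm I X * vnorm I v"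
    using mult_left_mono[OF op_norm_bound, of "cmod c" X v] by (simp add: mult.assoc)
qed (simp add: op_norm_nonneg)

lemma op_norm_smult: "op_norm I (\<lambda>a b. c * X a b) = cmod c * op_norm I X"
proof (cases "c = 0")
  case True
  then show ?thesis
    using op_norm_smult_le[of c X] op_norm_nonneg[of "\<lambda>a b. c * X a b"] by simp
next
  case False
  then have "op_norm I X \<le> op_norm I (\<lambda>a b. c * X a b) / cmod c"
    using op_norm_smult_le[of "inverse c" "\<lambda>a b. c * X a b"]
    by (simp add: mult.assoc[symmetric] norm_inverse divide_inverse mult.commute)
  then show ?thesis
    using False op_norm_smult_le[of c X] by (simp add: pos_le_divide_eq mult.commute)
qed

lemma fmult_assoc: "fmult I (fmult I X Y) Z = fmult I X (fmult I Y Z)"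
  unfolding fmult_def
  by (simp add: sum_distrib_left sum_distrib_right, subst sum.swap) (simp add: mult.assoc)

lemma fun_mat_minus:
  assumes "X \<in> carrier (fun_mat I)" "Y \<in> carrier (fun_mat I)" "star_vector_space (fun_mat I)"
  shows "X \<ominus>\<^bsub>fun_mat I\<^esub> Y = (\<lambda>a b. X a b - Y a b)"
proof -
  interpret M: star_vector_space "fun_mat I"
    by (rule assms(3))
  show ?thesis
    using assms(1) M.uminus_smult[OF assms(2)] by (simp add: a_minus_def) (simp add: fun_mat_def)
qed

theorem fun_mat_cstar_algebra: "cstar_algebra (fun_mat I)"
proof -
  have one_l: "fmult I (\<lambda>a b. if a = b \<and> a \<in> I then 1 else 0) X = X" and one_r: "fmult I X (\<lambda>a b. if a = b \<and> a \<in> I then 1 else 0) = X"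
    if "\<forall>a b. a \<notin> I \<or> b \<notin> I \<longrightarrow> X a b = 0" for X
  proof -
    have "(\<Sum>c\<in>I. (if a = c \<and> a \<in> I then 1 else 0) * X c b) = (\<Sum>c\<in>I. if c = a then X a b else 0)" for a b
      by (rule sum.cong) auto
    then show "fmult I (\<lambda>a b. if a = b \<and> a \<in> I then 1 else 0) X = X"
      using that fin by (auto simp: fmult_def fun_eq_iff)
    have "(\<Sum>c\<in>I. X a c * (if c = b \<and> c \<in> I then 1 else 0)) = (\<Sum>c\<in>I. if c = b then X a b else 0)" for a b
      by (rule sum.cong) auto
    then show "fmult I X (\<lambda>a b. if a = b \<and> a \<in> I then 1 else 0) = X"
      using that fin by (auto simp: fmult_def fun_eq_iff)
  qed
  have mod: "Module.module class_ring (fun_mat I)"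
    by (rule module_class_ringI) (auto simp: fun_mat_def fun_eq_iff algebra_simps)
  have sv: "star_vector_space (fun_mat I)"
    by (rule star_vector_space.intro[OF mod]) (auto simp: fun_mat_def adj_def fun_eq_iff)
  have ring: "ring (fun_mat I)"
  proof (rule ringI)
    show "abelian_group (fun_mat I)"
      using mod by (rule Module.module.axioms)
    show "monoid (fun_mat I)"
    proof (rule monoidI)
      show "x \<otimes>\<^bsub>fun_mat I\<^esub> y \<in> carrier (fun_mat I)" if "x \<in> carrier (fun_mat I)" "y \<in> carrier (fun_mat I)" for x y
        using that by (auto simp: fun_mat_def fmult_def)
    qed (auto simp: fun_mat_def fmult_assoc one_l one_r)
  qed (auto simp: fun_mat_def fmult_def fun_eq_iff distrib_left distrib_right sum.distrib)
  show ?thesis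
  proof (rule cstar_algebra.intro[OF sv ring cstar_algebra_axioms.intro])
    show "cnorm (fun_mat I) X = 0 \<longleftrightarrow> X = \<zero>\<^bsub>fun_mat I\<^esub>" if "X \<in> carrier (fun_mat I)" for X
    proof
      assume "cnorm (fun_mat I) X = 0"
      then have "X a b = 0" if "a \<in> I" "b \<in> I" for a b
        using op_norm_entry[OF that, of X] by (simp add: fun_mat_def)
      then show "X = \<zero>\<^bsub>fun_mat I\<^esub>"
        using that by (auto simp: fun_mat_def fun_eq_iff)
    next
      assume "X = \<zero>\<^bsub>fun_mat I\<^esub>"
      then show "cnorm (fun_mat I) X = 0"
        using op_norm_smult[of 0 X] by (simp add: fun_mat_def)
    qed
    show "\<exists>l\<in>carrier (fun_mat I). (\<lambda>n. cnorm (fun_mat I) (s n \<ominus>\<^bsub>fun_mat I\<^esub> l)) \<longlonglongrightarrow> 0"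
      if s: "\<And>n. s n \<in> carrier (fun_mat I)"
        and Cauchy: "\<And>\<epsilon>. \<epsilon> > 0 \<Longrightarrow> \<exists>N. \<forall>p\<ge>N. \<forall>q\<ge>N. cnorm (fun_mat I) (s p \<ominus>\<^bsub>fun_mat I\<^esub> s q) < \<epsilon>"
      for s :: "nat \<Rightarrow> 'i \<Rightarrow> 'i \<Rightarrow> complex"
    proof -
      have "convergent (\<lambda>n. s n a b)" for a b
      proof (cases "a \<in> I \<and> b \<in> I")
        case True
        have "Cauchy (\<lambda>n. s n a b)"
        proof (rule CauchyI)
          fix \<epsilon> :: real
          assume "\<epsilon> > 0"
          then obtain N where "\<forall>p\<ge>N. \<forall>q\<ge>N. op_norm I (\<lambda>a b. s p a b - s q a b) < \<epsilon>"
            using Cauchy[of \<epsilon>] fun_mat_minus[OF s s sv] by (auto simp: fun_mat_def)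
          then show "\<exists>N. \<forall>m\<ge>N. \<forall>n\<ge>N. norm (s m a b - s n a b) < \<epsilon>"
            using op_norm_entry[of a b "\<lambda>a b. s _ a b - s _ a b"] True by (intro exI[of _ N]) (blast intro: le_less_trans)
        qed
        then show ?thesis
          by (rule Cauchy_convergent)
      next
        case False
        then have "s n a b = 0" for n
          using s[of n] by (auto simp: fun_mat_def)
        then show ?thesis
          by (simp add: convergent_const)
      qed
      then have "\<exists>l. \<forall>a b. (\<lambda>n. s n a b) \<longlonglongrightarrow> l a b"
        unfolding convergent_def by (intro exI[of _ "\<lambda>a b. SOME x. (\<lambda>n. s n a b) \<longlonglongrightarrow> x"]) (auto intro: someI_ex)
      then obtain l where l: "\<And>a b. (\<lambda>n. s n a b) \<longlonglongrightarrow> l a b"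
        by blast
      have "l a b = 0" if "a \<notin> I \<or> b \<notin> I" for a b
        using l[of a b] s that LIMSEQ_unique[OF l[of a b], of 0] by (simp add: fun_mat_def)
      then have l_in: "l \<in> carrier (fun_mat I)"
        by (simp add: fun_mat_def)
      have "(\<lambda>n. op_norm I (\<lambda>a b. s n a b - l a b)) \<longlonglongrightarrow> 0"
      proof (rule tendsto_sandwich[of "\<lambda>_. 0" _ _ "\<lambda>n. \<Sum>a\<in>I. \<Sum>b\<in>I. cmod (s n a b - l a b)"])
        show "\<forall>\<^sub>F n in sequentially. op_norm I (\<lambda>a b. s n a b - l a b) \<le> (\<Sum>a\<in>I. \<Sum>b\<in>I. cmod (s n a b - l a b))"
          by (intro always_eventually allI op_norm_le op_norm_sum_bound sum_nonneg) auto
        have "(\<lambda>n. \<Sum>a\<in>I. \<Sum>b\<in>I. cmod (s n a b - l a b)) \<longlonglongrightarrow> (\<Sum>a\<in>I. \<Sum>b\<in>I. 0)"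
          using l by (intro tendsto_sum tendsto_norm_zero) (simp add: LIM_zero)
        then show "(\<lambda>n. \<Sum>a\<in>I. \<Sum>b\<in>I. cmod (s n a b - l a b)) \<longlonglongrightarrow> 0"
          by simp
      qed (auto simp: op_norm_nonneg)
      then show ?thesis
        using l_in fun_mat_minus[OF s l_in sv] by (intro bexI[of _ l]) (auto simp: fun_mat_def)
    qed
    show "star (fun_mat I) (X \<otimes>\<^bsub>fun_mat I\<^esub> Y) = star (fun_mat I) Y \<otimes>\<^bsub>fun_mat I\<^esub> star (fun_mat I) X" for X Y
      by (auto simp: fun_mat_def adj_def fmult_def fun_eq_iff mult.commute)
    show "cnorm (fun_mat I) (c \<odot>\<^bsub>fun_mat I\<^esub> X) = cmod c * cnorm (fun_mat I) X" for X c
      by (simp add: fun_mat_def op_norm_smult)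
    show "cnorm (fun_mat I) (star (fun_mat I) X \<otimes>\<^bsub>fun_mat I\<^esub> X) = (cnorm (fun_mat I) X)\<^sup>2" for X
      by (simp add: fun_mat_def op_norm_cstar)
    show "cnorm (fun_mat I) (X \<otimes>\<^bsub>fun_mat I\<^esub> Y) \<le> cnorm (fun_mat I) X * cnorm (fun_mat I) Y" for X Y
      by (simp add: fun_mat_def op_norm_fmult)
  qed (auto simp: fun_mat_def fun_eq_iff fmult_def sum_distrib_left mult_ac op_norm_nonneg op_norm_triangle)
qed

end

section \<open>Functional calculus of a unitary of finite order\<close>

lemma Cpow_sel:
  "carrier (Cpow k) = carrier_vec k" "mult (Cpow k) = (\<lambda>v w. vec k (\<lambda>i. v $ i * w $ i))"
  "one (Cpow k) = vec k (\<lambda>_. 1)" "zero (Cpow k) = 0\<^sub>v k" "add (Cpow k) = (+)" "smult (Cpow k) = (\<cdot>\<^sub>v)"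
  "star (Cpow k) = map_vec cnj"
  by (simp_all add: Cpow_def)

lemma Cpow_cstar_algebra:
  assumes "k > 0"
  shows "cstar_algebra (Cpow k)"
proof -
  let ?C = "Cpow k" and ?N = "cnorm (Cpow k)"
  have le_iff: "?N v \<le> c \<longleftrightarrow> (\<forall>i<k. cmod (v $ i) \<le> c)" for v c
    using assms by (subst Cpow_def, simp, subst Max_le_iff) auto
  have member: "i < k \<Longrightarrow> cmod (v $ i) \<le> ?N v" for v i
    using le_iff[of v "?N v"] by simp
  have attained: "\<exists>i<k. ?N v = cmod (v $ i)" for v
  proof -
    have "?N v \<in> (\<lambda>i. cmod (v $ i)) ` {..<k}"
      using assms by (subst Cpow_def, simp, intro Max_in) auto
    then show ?thesis
      by auto
  qed
  have nonneg: "0 \<le> ?N v" for v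
    using attained[of v] by auto
  have mod: "Module.module class_ring ?C"
    by (rule module_class_ringI) (auto simp: Cpow_sel algebra_simps intro!: eq_vecI)
  have sv: "star_vector_space ?C"
    by (rule star_vector_space.intro[OF mod]) (auto simp: Cpow_sel intro!: eq_vecI)
  interpret star_vector_space ?C
    by (rule sv)
  have ring: "ring ?C"
  proof (rule ringI)
    show "abelian_group ?C"
      by (rule abelian_group_V)
    show "monoid ?C"
      by (rule monoidI) (auto simp: Cpow_sel intro!: eq_vecI)
  qed (auto simp: Cpow_sel algebra_simps intro!: eq_vecI)
  have minus: "x \<ominus>\<^bsub>?C\<^esub> y = x - y" if "x \<in> carrier_vec k" "y \<in> carrier_vec k" for x y
  proof -
    have "x \<ominus>\<^bsub>?C\<^esub> y = x + (- 1) \<cdot>\<^sub>v y"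
      using uminus_smult[of y] that by (simp add: a_minus_def) (simp add: Cpow_sel)
    then show ?thesis
      using that by (auto intro!: eq_vecI)
  qed
  show ?thesis
  proof (rule cstar_algebra.intro[OF sv ring cstar_algebra_axioms.intro])
    fix x y c
    assume x: "x \<in> carrier ?C"
    then have x': "x \<in> carrier_vec k"
      by (simp add: Cpow_sel)
    show "?N x = 0 \<longleftrightarrow> x = \<zero>\<^bsub>?C\<^esub>"
    proof
      assume "?N x = 0"
      then show "x = \<zero>\<^bsub>?C\<^esub>"
        using le_iff[of x 0] x' by (auto simp: Cpow_sel intro!: eq_vecI)
    next
      assume "x = \<zero>\<^bsub>?C\<^esub>"
      then have "?N x \<le> 0"
        unfolding le_iff by (simp add: Cpow_sel)
      then show "?N x = 0"
        using nonneg[of x] by simp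
    qed
    show "?N (c \<odot>\<^bsub>?C\<^esub> x) = cmod c * ?N x"
    proof (rule antisym)
      show "?N (c \<odot>\<^bsub>?C\<^esub> x) \<le> cmod c * ?N x"
        unfolding le_iff using member[of _ x] x' by (auto simp: Cpow_sel norm_mult mult_left_mono)
      obtain i where "i < k" "?N x = cmod (x $ i)"
        using attained by blast
      then show "cmod c * ?N x \<le> ?N (c \<odot>\<^bsub>?C\<^esub> x)"
        using member[of i "c \<odot>\<^bsub>?C\<^esub> x"] x' by (simp add: Cpow_sel norm_mult)
    qed
    show "?N (star ?C x \<otimes>\<^bsub>?C\<^esub> x) = (?N x)\<^sup>2"
    proof (rule antisym)
      show "?N (star ?C x \<otimes>\<^bsub>?C\<^esub> x) \<le> (?N x)\<^sup>2"
        unfolding le_iff using x' by (auto simp: Cpow_sel norm_mult power2_eq_square intro!: mult_mono member nonneg)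
      obtain i where "i < k" "?N x = cmod (x $ i)"
        using attained by blast
      then show "(?N x)\<^sup>2 \<le> ?N (star ?C x \<otimes>\<^bsub>?C\<^esub> x)"
        using member[of i "star ?C x \<otimes>\<^bsub>?C\<^esub> x"] x' by (simp add: Cpow_sel norm_mult power2_eq_square)
    qed
    assume y: "y \<in> carrier ?C"
    then have y': "y \<in> carrier_vec k"
      by (simp add: Cpow_sel)
    show "?N (x \<oplus>\<^bsub>?C\<^esub> y) \<le> ?N x + ?N y"
      unfolding le_iff using x' y' by (auto simp: Cpow_sel intro!: order_trans[OF norm_triangle_ineq] add_mono member)
    show "?N (x \<otimes>\<^bsub>?C\<^esub> y) \<le> ?N x * ?N y"
      unfolding le_iff using x' y' by (auto simp: Cpow_sel norm_mult intro!: mult_mono member nonneg)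
  next
    fix s :: "nat \<Rightarrow> complex vec"
    assume "\<And>n. s n \<in> carrier ?C"
      and Cauchy: "\<And>\<epsilon>. \<epsilon> > 0 \<Longrightarrow> \<exists>N. \<forall>p\<ge>N. \<forall>q\<ge>N. ?N (s p \<ominus>\<^bsub>?C\<^esub> s q) < \<epsilon>"
    then have s: "s n \<in> carrier_vec k" for n
      by (simp add: Cpow_sel)
    have "convergent (\<lambda>n. s n $ i)" if i: "i < k" for i
    proof -
      have "Cauchy (\<lambda>n. s n $ i)"
      proof (rule CauchyI)
        fix \<epsilon> :: real
        assume "\<epsilon> > 0"
        then obtain N where N: "\<forall>p\<ge>N. \<forall>q\<ge>N. ?N (s p - s q) < \<epsilon>"
          using Cauchy[of \<epsilon>] minus[OF s s] by auto
        have "norm (s p $ i - s q $ i) \<le> ?N (s p - s q)" for p q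
          using member[OF i, of "s p - s q"] s[of p] s[of q] i by simp
        then show "\<exists>N. \<forall>m\<ge>N. \<forall>n\<ge>N. norm (s m $ i - s n $ i) < \<epsilon>"
          using N by (intro exI[of _ N]) (blast intro: le_less_trans)
      qed
      then show ?thesis
        by (rule Cauchy_convergent)
    qed
    then have lim: "(\<lambda>n. s n $ i) \<longlonglongrightarrow> lim (\<lambda>n. s n $ i)" if "i < k" for i
      using that by (simp add: convergent_LIMSEQ_iff)
    define l where "l = vec k (\<lambda>i. lim (\<lambda>n. s n $ i))"
    have l: "l \<in> carrier_vec k"
      by (simp add: l_def)
    have "(\<lambda>n. ?N (s n - l)) \<longlonglongrightarrow> 0"
    proof (rule tendsto_sandwich[of "\<lambda>_. 0" _ _ "\<lambda>n. \<Sum>i<k. cmod (s n $ i - l $ i)"])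
      show "\<forall>\<^sub>F n in sequentially. ?N (s n - l) \<le> (\<Sum>i<k. cmod (s n $ i - l $ i))"
      proof (intro always_eventually allI)
        fix n
        have "cmod (s n $ i - l $ i) \<le> (\<Sum>i<k. cmod (s n $ i - l $ i))" if "i < k" for i
          using that by (intro member_le_sum[of i "{..<k}" "\<lambda>i. cmod (s n $ i - l $ i)"]) auto
        then show "?N (s n - l) \<le> (\<Sum>i<k. cmod (s n $ i - l $ i))"
          unfolding le_iff using s[of n] l by simp
      qed
      have "(\<lambda>n. \<Sum>i<k. cmod (s n $ i - l $ i)) \<longlonglongrightarrow> (\<Sum>i<k. 0)"
        using lim by (intro tendsto_sum tendsto_norm_zero) (simp add: LIM_zero l_def)
      then show "(\<lambda>n. \<Sum>i<k. cmod (s n $ i - l $ i)) \<longlonglongrightarrow> 0"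
        by simp
    qed (auto simp: nonneg)
    then show "\<exists>l\<in>carrier ?C. (\<lambda>n. ?N (s n \<ominus>\<^bsub>?C\<^esub> l)) \<longlonglongrightarrow> 0"
      using minus[OF s l] l by (intro bexI[of _ l]) (auto simp: Cpow_sel)
  qed (auto simp: Cpow_sel nonneg intro!: eq_vecI)
qed

definition prim_root :: "nat \<Rightarrow> complex" where
  "prim_root k = cis (2 * pi / real k)"

lemma prim_root_pow: "prim_root k ^ p = cis (2 * pi * real p / real k)"
  by (simp add: prim_root_def DeMoivre mult_ac)

lemma cnj_prim_root_pow: "cnj (prim_root k ^ p) * prim_root k ^ p = 1"
  by (simp add: prim_root_pow cis_cnj cis_mult)

lemma prim_root_pow_self: "k > 0 \<Longrightarrow> prim_root k ^ k = 1"
  by (simp add: prim_root_pow)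

lemma prim_root_pow_pow:
  assumes "k > 0"
  shows "(prim_root k ^ p) ^ k = 1"
proof -
  have "(prim_root k ^ p) ^ k = (prim_root k ^ k) ^ p"
    unfolding power_mult[symmetric] by (simp only: mult.commute)
  then show ?thesis
    using prim_root_pow_self[OF assms] by simp
qed

text \<open>Orthogonality of the characters of Z_k: for p \<noteq> q the ratio is a nontrivial k-th
  root of unity and its geometric sum vanishes.\<close>

lemma sum_prim_root:
  assumes "p < k" "q < k"
  shows "(\<Sum>l<k. (cnj (prim_root k ^ q) * prim_root k ^ p) ^ l) = (if p = q then of_nat k else 0)"
proof (cases "p = q")
  case True
  then show ?thesis
    using cnj_prim_root_pow[of k q] by simp
next
  case False
  let ?z = "cnj (prim_root k ^ q) * prim_root k ^ p"
  have "prim_root k ^ p \<noteq> prim_root k ^ q"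
    using bij_betw_roots_unity[of k] assms False by (auto simp: prim_root_pow bij_betw_def inj_on_def)
  moreover have "prim_root k ^ q * ?z = prim_root k ^ p"
    using cnj_prim_root_pow[of k q] by (metis mult.assoc mult.commute mult_1)
  ultimately have "?z \<noteq> 1"
    by (metis mult_1_right)
  moreover have "?z ^ k = 1"
    using prim_root_pow_pow[of k p] prim_root_pow_pow[of k q] assms
    by (simp only: power_mult_distrib flip: complex_cnj_power) simp
  ultimately show ?thesis
    using False geometric_sum[of ?z k] by simp
qed

text \<open>The form in which the simplifier leaves the sum, with the conjugate inside the
  power.\<close>

lemma sum_prim_root':
  "p < k \<Longrightarrow> q < k \<Longrightarrow> (\<Sum>l<k. (cnj (prim_root k) ^ q * prim_root k ^ p) ^ l) = (if p = q then of_nat k else 0)"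
  using sum_prim_root[of p k q] by simp

definition root_vec :: "nat \<Rightarrow> complex vec" where
  "root_vec k = vec k (\<lambda>p. prim_root k ^ p)"

text \<open>For a unitary a with a^k = 1 this is the projection onto the eigenspace for the
  eigenvalue \<open>prim_root k ^ q\<close>, obtained by averaging over the cyclic group: the
  discrete Fourier transform of the powers of a.\<close>

definition spectral_proj :: "('a, 'm) cstar_scheme \<Rightarrow> nat \<Rightarrow> 'a \<Rightarrow> nat \<Rightarrow> 'a" where
  "spectral_proj A k a q = (1 / of_nat k) \<odot>\<^bsub>A\<^esub> (\<Oplus>\<^bsub>A\<^esub>l\<in>{..<k}. (cnj (prim_root k ^ q)) ^ l \<odot>\<^bsub>A\<^esub> a [^]\<^bsub>A\<^esub> l)"

text \<open>x is read as a function on the k-th roots of unity, its q-th coordinate being the value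
  at \<open>prim_root k ^ q\<close>; the result is this function applied to a.\<close>

definition func_calc :: "('a, 'm) cstar_scheme \<Rightarrow> nat \<Rightarrow> 'a \<Rightarrow> complex vec \<Rightarrow> 'a" where
  "func_calc A k a x = (\<Oplus>\<^bsub>A\<^esub>q\<in>{..<k}. x $ q \<odot>\<^bsub>A\<^esub> spectral_proj A k a q)"

lemma (in star_vector_space) smult_sum:
  assumes "finite I" "x \<in> carrier V"
  shows "(\<Sum>i\<in>I. c i) \<odot> x = (\<Oplus>i\<in>I. c i \<odot> x)"
proof -
  interpret abelian_group V
    by (rule abelian_group_V)
  show ?thesis
    using assms(1) by (induction rule: finite_induct) (auto simp: assms(2) smult_add_left)
qed

locale cyclic_unitary = cstar_algebra A for A :: "('a, 'm) cstar_scheme" (structure) +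
  fixes k :: nat and a :: 'a
  assumes k: "k > 0" and a: "a \<in> unitaries A" and pow_k: "a [^] k = \<one>"
begin

abbreviation e :: "nat \<Rightarrow> 'a" where
  "e \<equiv> spectral_proj A k a"

lemma a_in [simp]: "a \<in> carrier A" and star_a_a: "star A a \<otimes> a = \<one>"
  using a by (auto simp: unitaries_def)

lemma star_a_in [simp]: "star A a \<in> carrier A"
  by (simp add: star_closed)

lemma e_in [simp]: "e q \<in> carrier A"
  by (auto simp: spectral_proj_def intro!: finsum_closed)

lemma finsum_shift:
  assumes "\<And>l. l \<le> k \<Longrightarrow> g l \<in> carrier A" "g k = g 0"
  shows "(\<Oplus>l\<in>{..<k}. g (Suc l)) = (\<Oplus>l\<in>{..<k}. g l)"
proof -
  have 1: "(\<Oplus>l\<in>{..<1 + k}. g l) = (\<Oplus>l\<in>{..<1}. g l) \<oplus> (\<Oplus>l\<in>{..<k}. g (1 + l))"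
    using assms(1) by (intro finsum_lessThan_add) auto
  have 2: "(\<Oplus>l\<in>{..<k + 1}. g l) = (\<Oplus>l\<in>{..<k}. g l) \<oplus> (\<Oplus>l\<in>{..<1}. g (k + l))"
    using assms(1) by (intro finsum_lessThan_add) auto
  have single: "(\<Oplus>l\<in>{..<1::nat}. f l) = f 0" if "f 0 \<in> carrier A" for f
    using that by (simp add: lessThan_Suc)
  have in_A: "(\<Oplus>l\<in>{..<k}. g l) \<in> carrier A" "(\<Oplus>l\<in>{..<k}. g (Suc l)) \<in> carrier A" "g 0 \<in> carrier A"
    using assms(1) by (auto intro!: finsum_closed)
  have "g 0 \<oplus> (\<Oplus>l\<in>{..<k}. g (Suc l)) = g 0 \<oplus> (\<Oplus>l\<in>{..<k}. g l)"
    using 1 2 single[of g] single[of "\<lambda>l. g (k + l)"] in_A assms by (simp add: a_comm)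
  then show ?thesis
    using in_A by simp
qed

text \<open>Multiplication by a shifts the averaging sum cyclically, because a^k = 1 and the
  coefficients are k-periodic as well.\<close>

lemma a_mult_e: "a \<otimes> e q = (prim_root k ^ q) \<odot> e q"
proof -
  let ?c = "cnj (prim_root k ^ q)" and ?w = "prim_root k ^ q"
  define g where "g = (\<lambda>l. ?c ^ l \<odot> a [^] l)"
  have g: "g l \<in> carrier A" for l
    by (simp add: g_def)
  have "?c ^ k = 1"
    using prim_root_pow_pow[OF k, of q] by (simp only: flip: complex_cnj_power) simp
  then have gk: "g k = g 0"
    using pow_k by (simp add: g_def)
  have "a \<otimes> g l = ?w \<odot> g (Suc l)" for l
  proof -
    have "a \<otimes> a [^] l = a [^] Suc l"
      by (rule nat_pow_Suc2[symmetric]) simp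
    then have "a \<otimes> g l = ?c ^ l \<odot> a [^] Suc l"
      by (simp add: g_def smult_mult_right del: nat_pow_Suc complex_cnj_power)
    also have "?c ^ l = ?w * ?c ^ Suc l"
    proof -
      have "?w * ?c ^ Suc l = (?c * ?w) * ?c ^ l"
        by (simp only: power_Suc mult_ac)
      then show ?thesis
        by (simp only: cnj_prim_root_pow mult_1)
    qed
    finally show ?thesis
      by (simp add: g_def del: nat_pow_Suc complex_cnj_power)
  qed
  then have "a \<otimes> (\<Oplus>l\<in>{..<k}. g l) = (\<Oplus>l\<in>{..<k}. ?w \<odot> g (Suc l))"
    using g by (subst finsum_rdistr) (auto intro!: finsum_cong')
  also have "\<dots> = ?w \<odot> (\<Oplus>l\<in>{..<k}. g l)"
    using g finsum_shift[of g] gk by (subst finsum_smult[symmetric]) auto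
  finally have "a \<otimes> (\<Oplus>l\<in>{..<k}. g l) = ?w \<odot> (\<Oplus>l\<in>{..<k}. g l)" .
  moreover have "e q = (1 / of_nat k) \<odot> (\<Oplus>l\<in>{..<k}. g l)"
    by (simp add: spectral_proj_def g_def)
  moreover have "(\<Oplus>l\<in>{..<k}. g l) \<in> carrier A"
    using g by (auto intro!: finsum_closed)
  ultimately show ?thesis
    by (simp add: smult_mult_right mult.commute)
qed

lemma star_a_mult_e: "star A a \<otimes> e q = cnj (prim_root k ^ q) \<odot> e q"
proof -
  have "e q = star A a \<otimes> (a \<otimes> e q)"
    using star_a_a by (simp add: m_assoc[symmetric])
  then have "e q = (prim_root k ^ q) \<odot> (star A a \<otimes> e q)"
    by (simp add: a_mult_e smult_mult_right)
  from arg_cong[OF this, of "\<lambda>x. cnj (prim_root k ^ q) \<odot> x"] show ?thesis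
    using cnj_prim_root_pow[of k q] by simp
qed

lemma pow_mult_eigen:
  assumes "x \<in> carrier A" "y \<in> carrier A" "x \<otimes> y = c \<odot> y"
  shows "x [^] (l :: nat) \<otimes> y = c ^ l \<odot> y"
proof (induction l)
  case (Suc l)
  then show ?case
    using assms by (simp add: m_assoc smult_mult_right)
qed (use assms in simp)

lemma sum_e: "(\<Oplus>q\<in>{..<k}. e q) = \<one>"
proof -
  have "(\<Oplus>q\<in>{..<k}. e q) = (\<Oplus>q\<in>{..<k}. \<Oplus>l\<in>{..<k}. (1 / of_nat k * (cnj (prim_root k ^ q)) ^ l) \<odot> a [^] l)"
    unfolding spectral_proj_def
    by (intro finsum_cong') (auto simp: finsum_smult intro!: finsum_cong' finsum_closed)
  also have "\<dots> = (\<Oplus>l\<in>{..<k}. \<Oplus>q\<in>{..<k}. (1 / of_nat k * (cnj (prim_root k ^ q)) ^ l) \<odot> a [^] l)"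
    by (rule finsum_swap) auto
  also have "\<dots> = (\<Oplus>l\<in>{..<k}. if l = 0 then \<one> else \<zero>)"
  proof (rule finsum_cong')
    fix l
    assume l: "l \<in> {..<k}"
    have "(\<Sum>q<k. (cnj (prim_root k ^ q)) ^ l) = (\<Sum>q<k. (cnj (prim_root k ^ l) * prim_root k ^ 0) ^ q)"
      by (simp flip: power_mult add: mult.commute)
    also have "\<dots> = (if l = 0 then of_nat k else 0)"
      using l k by (subst sum_prim_root) auto
    finally have "(\<Sum>q<k. 1 / of_nat k * (cnj (prim_root k ^ q)) ^ l) = (if l = 0 then 1 else 0)"
      using k by (simp flip: sum_divide_distrib)
    then show "(\<Oplus>q\<in>{..<k}. (1 / of_nat k * (cnj (prim_root k ^ q)) ^ l) \<odot> a [^] l) = (if l = 0 then \<one> else \<zero>)"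
      by (subst smult_sum[symmetric]) auto
  qed auto
  also have "\<dots> = \<one>"
    using k by (simp add: finsum_delta)
  finally show ?thesis .
qed

text \<open>Averaging against the character p keeps the eigenvalue \<open>prim_root k ^ p\<close>
  and annihilates the other k-th roots of unity.\<close>

lemma avg_eigen:
  assumes "x \<in> carrier A" "x \<otimes> e q = (prim_root k ^ r) \<odot> e q" "p < k" "q < k" "r < k"
  shows "((1 / of_nat k) \<odot> (\<Oplus>l\<in>{..<k}. (cnj (prim_root k ^ p)) ^ l \<odot> x [^] l)) \<otimes> e q = (if r = p then e q else \<zero>)"
proof -
  have "(\<Oplus>l\<in>{..<k}. (cnj (prim_root k ^ p)) ^ l \<odot> x [^] l) \<otimes> e q
      = (\<Oplus>l\<in>{..<k}. ((cnj (prim_root k ^ p)) * prim_root k ^ r) ^ l \<odot> e q)"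
    using assms(1,2)
    by (subst finsum_ldistr)
      (auto simp: smult_mult_left pow_mult_eigen power_mult_distrib intro!: finsum_cong')
  also have "\<dots> = (if r = p then of_nat k else 0) \<odot> e q"
    using assms by (subst smult_sum[symmetric]) (auto simp: sum_prim_root')
  finally show ?thesis
    using assms(1) k by (subst smult_mult_left) (auto intro!: finsum_closed)
qed

lemma e_mult_e: "p < k \<Longrightarrow> q < k \<Longrightarrow> e p \<otimes> e q = (if p = q then e q else \<zero>)"
  using avg_eigen[of a q q p] a_mult_e by (auto simp: spectral_proj_def)

text \<open>The adjoint of \<open>e p\<close> acts on every \<open>e q\<close> as \<open>e p\<close>
  does, and the \<open>e q\<close> add up to the unit.\<close>

lemma star_e:
  assumes "p < k"
  shows "star A (e p) = e p"
proof -
  have "star A (e p) \<otimes> e q = (if p = q then e q else \<zero>)" if q: "q < k" for q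
  proof -
    have star_e: "star A (e p) = (1 / of_nat k) \<odot> (\<Oplus>l\<in>{..<k}. (prim_root k ^ p) ^ l \<odot> star A a [^] l)"
      unfolding spectral_proj_def
      by (subst star_smult, force intro!: finsum_closed, subst star_finsum)
        (auto simp: star_smult star_pow intro!: arg_cong2[of _ _ _ _ "(\<odot>)"] finsum_cong')
    have "(\<Oplus>l\<in>{..<k}. (prim_root k ^ p) ^ l \<odot> star A a [^] l) \<otimes> e q
        = (\<Oplus>l\<in>{..<k}. (cnj (prim_root k ^ q) * prim_root k ^ p) ^ l \<odot> e q)"
      by (subst finsum_ldistr)
        (auto simp: smult_mult_left pow_mult_eigen[OF _ _ star_a_mult_e] power_mult_distrib mult.commute intro!: finsum_cong')
    also have "\<dots> = (if p = q then of_nat k else 0) \<odot> e q"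
      using assms q by (subst smult_sum[symmetric]) (auto simp: sum_prim_root')
    finally show ?thesis
      unfolding star_e using k by (subst smult_mult_left) (auto intro!: finsum_closed)
  qed
  then have "star A (e p) \<otimes> (\<Oplus>q\<in>{..<k}. e q) = (\<Oplus>q\<in>{..<k}. if p = q then e p else \<zero>)"
    by (subst finsum_rdistr) (auto simp: star_closed intro!: finsum_cong')
  then show ?thesis
    using assms by (simp add: sum_e finsum_delta star_closed)
qed

abbreviation \<alpha> :: "complex vec \<Rightarrow> 'a" where
  "\<alpha> \<equiv> func_calc A k a"

lemma func_calc_in [simp]: "\<alpha> x \<in> carrier A"
  by (auto simp: func_calc_def intro!: finsum_closed)

lemma func_calc_mult_e:
  assumes "q < k"
  shows "\<alpha> x \<otimes> e q = x $ q \<odot> e q"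
proof -
  have "\<alpha> x \<otimes> e q = (\<Oplus>p\<in>{..<k}. if p = q then x $ q \<odot> e q else \<zero>)"
    unfolding func_calc_def using assms
    by (subst finsum_ldistr) (auto simp: smult_mult_left e_mult_e intro!: finsum_cong')
  then show ?thesis
    using assms by (simp add: finsum_delta)
qed

lemma func_calc_hom: "cstar_hom (Cpow k) A \<alpha>"
proof -
  have mult: "\<alpha> (x \<otimes>\<^bsub>Cpow k\<^esub> y) = \<alpha> x \<otimes> \<alpha> y" for x y
  proof -
    have "\<alpha> x \<otimes> \<alpha> y = (\<Oplus>q\<in>{..<k}. \<alpha> x \<otimes> (y $ q \<odot> e q))"
      unfolding func_calc_def[of A k a y] by (subst finsum_rdistr) auto
    also have "\<dots> = \<alpha> (x \<otimes>\<^bsub>Cpow k\<^esub> y)"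
      unfolding func_calc_def[of A k a "x \<otimes>\<^bsub>Cpow k\<^esub> y"]
      by (intro finsum_cong') (auto simp: smult_mult_right func_calc_mult_e Cpow_sel mult.commute)
    finally show ?thesis ..
  qed
  have add: "\<alpha> (x \<oplus>\<^bsub>Cpow k\<^esub> y) = \<alpha> x \<oplus> \<alpha> y" if "x \<in> carrier (Cpow k)" "y \<in> carrier (Cpow k)" for x y
    unfolding func_calc_def using that
    by (subst finsum_addf[symmetric]) (auto simp: Cpow_sel smult_add_left simp del: finsum_addf intro!: finsum_cong')
  have smult: "\<alpha> (c \<odot>\<^bsub>Cpow k\<^esub> x) = c \<odot> \<alpha> x" if "x \<in> carrier (Cpow k)" for c x
    unfolding func_calc_def using that
    by (subst finsum_smult) (auto simp: Cpow_sel intro!: finsum_cong')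
  have star: "\<alpha> (star (Cpow k) x) = star A (\<alpha> x)" if "x \<in> carrier (Cpow k)" for x
    unfolding func_calc_def using that
    by (subst star_finsum) (auto simp: Cpow_sel star_smult star_e intro!: finsum_cong')
  have one: "\<alpha> \<one>\<^bsub>Cpow k\<^esub> = \<one>"
    unfolding func_calc_def sum_e[symmetric] by (intro finsum_cong') (auto simp: Cpow_sel)
  show ?thesis
    using mult add smult star one by (auto simp: cstar_hom_def Ring.ring_hom_def)
qed

lemma func_calc_pow: "\<alpha> (vec k (\<lambda>q. (prim_root k ^ q) ^ i)) = a [^] (i :: nat)"
proof -
  have "\<alpha> (vec k (\<lambda>q. (prim_root k ^ q) ^ i)) = (\<Oplus>q\<in>{..<k}. a [^] i \<otimes> e q)"
    unfolding func_calc_def by (intro finsum_cong') (auto simp: pow_mult_eigen[OF _ _ a_mult_e])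
  also have "\<dots> = a [^] i \<otimes> (\<Oplus>q\<in>{..<k}. e q)"
    by (subst finsum_rdistr) auto
  finally show ?thesis
    by (simp add: sum_e)
qed

lemma func_calc_root: "\<alpha> (root_vec k) = a"
  using func_calc_pow[of 1] by (simp add: root_vec_def)

end

lemma (in cstar_morphism) func_calc_natural:
  assumes "a \<in> carrier A"
  shows "f (func_calc A k a x) = func_calc B k (f a) x"
proof -
  have proj_in: "spectral_proj A k a q \<in> carrier A" for q
    using assms by (auto simp: spectral_proj_def intro!: A.finsum_closed)
  have "f (spectral_proj A k a q) = spectral_proj B k (f a) q" for q
    unfolding spectral_proj_def using assms
    by (subst f_smult, force intro!: A.finsum_closed, subst f_finsum)
      (auto simp: f_smult f_pow f_in intro!: arg_cong2[of _ _ _ _ "(\<odot>\<^bsub>B\<^esub>)"] B.finsum_cong')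
  then show ?thesis
    unfolding func_calc_def using proj_in f_in[OF proj_in]
    by (subst f_finsum) (auto simp: f_smult intro!: B.finsum_cong')
qed

lemma root_vec_cyclic:
  assumes "k > 0"
  shows "cyclic_unitary (Cpow k) k (root_vec k)"
proof -
  interpret cstar_algebra "Cpow k"
    by (rule Cpow_cstar_algebra[OF assms])
  have pow: "root_vec k [^]\<^bsub>Cpow k\<^esub> (n :: nat) = vec k (\<lambda>p. (prim_root k ^ p) ^ n)" for n
  proof (induction n)
    case (Suc n)
    then show ?case
      by (simp) (auto simp: Cpow_sel root_vec_def intro!: eq_vecI)
  qed (simp, simp add: Cpow_sel)
  note prim_root_pow_pow[OF assms]
  then have "root_vec k [^]\<^bsub>Cpow k\<^esub> k = \<one>\<^bsub>Cpow k\<^esub>"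
    by (simp add: pow) (simp add: Cpow_sel)
  moreover have "root_vec k \<in> unitaries (Cpow k)"
    using cnj_prim_root_pow[of k] by (auto simp: unitaries_def Cpow_sel root_vec_def mult.commute intro!: eq_vecI)
  ultimately show ?thesis
    using assms by unfold_locales
qed

lemma Cpow_finsum_index:
  assumes "k > 0" "finite I" "p < k" "\<And>i. i \<in> I \<Longrightarrow> f i \<in> carrier_vec k"
  shows "finsum (Cpow k) f I $ p = (\<Sum>i\<in>I. f i $ p)"
proof -
  interpret cstar_algebra "Cpow k"
    by (rule Cpow_cstar_algebra[OF assms(1)])
  show ?thesis
    using assms(2,4)
  proof (induction rule: finite_induct)
    case empty
    then show ?case
      using assms(3) by simp (simp add: Cpow_sel)
  next
    case (insert i I)
    then have "f \<in> I \<rightarrow> carrier (Cpow k)" "f i \<in> carrier (Cpow k)"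
      by (auto simp: Cpow_sel)
    then have "finsum (Cpow k) f (insert i I) = f i \<oplus>\<^bsub>Cpow k\<^esub> finsum (Cpow k) f I" "finsum (Cpow k) f I \<in> carrier (Cpow k)"
      using insert by simp_all
    then show ?case
      using insert assms(3) by (simp add: Cpow_sel)
  qed
qed

text \<open>In C^k the spectral projections of \<open>root_vec k\<close> are the coordinate
  vectors.\<close>

lemma func_calc_root_vec:
  assumes "k > 0" "x \<in> carrier_vec k"
  shows "func_calc (Cpow k) k (root_vec k) x = x"
proof -
  interpret cyclic_unitary "Cpow k" k "root_vec k"
    by (rule root_vec_cyclic[OF assms(1)])
  have pow: "root_vec k [^]\<^bsub>Cpow k\<^esub> (n :: nat) = vec k (\<lambda>p. (prim_root k ^ p) ^ n)" for n
  proof (induction n)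
    case (Suc n)
    then show ?case
      by (simp) (auto simp: Cpow_sel root_vec_def intro!: eq_vecI)
  qed (simp, simp add: Cpow_sel)
  have e_vec: "spectral_proj (Cpow k) k (root_vec k) q \<in> carrier_vec k" for q
    using e_in[of q] by (simp add: Cpow_sel)
  have e: "spectral_proj (Cpow k) k (root_vec k) q $ p = (if p = q then 1 else 0)" if "p < k" "q < k" for p q
  proof -
    let ?g = "\<lambda>l. (cnj (prim_root k ^ q)) ^ l \<odot>\<^bsub>Cpow k\<^esub> root_vec k [^]\<^bsub>Cpow k\<^esub> l"
    have g: "?g l = vec k (\<lambda>p. (cnj (prim_root k ^ q) * prim_root k ^ p) ^ l)" for l
      unfolding pow by (auto simp: Cpow_sel power_mult_distrib intro!: eq_vecI)
    have sum_in: "finsum (Cpow k) ?g {..<k} \<in> carrier_vec k"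
    proof -
      have "?g \<in> {..<k} \<rightarrow> carrier (Cpow k)"
        by (intro Pi_I smult_in nat_pow_closed a_in)
      from finsum_closed[OF this] show ?thesis
        by (simp only: Cpow_sel(1))
    qed
    have "spectral_proj (Cpow k) k (root_vec k) q $ p = 1 / of_nat k * (finsum (Cpow k) ?g {..<k} $ p)"
      unfolding spectral_proj_def using sum_in that(1) by (simp add: Cpow_sel(6))
    also have "finsum (Cpow k) ?g {..<k} $ p = (\<Sum>l<k. (cnj (prim_root k ^ q) * prim_root k ^ p) ^ l)"
      unfolding g using that by (subst Cpow_finsum_index[OF assms(1)]) auto
    finally show ?thesis
      using that assms(1) by (simp add: sum_prim_root')
  qed
  show ?thesis
  proof (rule eq_vecI)
    fix p
    assume "p < dim_vec x"
    then have p: "p < k"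
      using assms(2) by simp
    have "func_calc (Cpow k) k (root_vec k) x $ p = (\<Sum>q<k. (x $ q \<odot>\<^bsub>Cpow k\<^esub> spectral_proj (Cpow k) k (root_vec k) q) $ p)"
      unfolding func_calc_def using p e_vec by (intro Cpow_finsum_index assms(1)) (auto simp: Cpow_sel)
    also have "\<dots> = (\<Sum>q<k. if q = p then x $ q else 0)"
      using p e_vec e by (intro sum.cong) (auto simp: Cpow_sel carrier_vecD[OF e_vec])
    finally show "func_calc (Cpow k) k (root_vec k) x $ p = x $ p"
      using p by simp
  qed (use func_calc_in[of x] assms(2) in \<open>simp add: Cpow_sel\<close>)
qed

text \<open>By naturality of the functional calculus, a homomorphism from C^k is determined by the
  image of the unitary \<open>root_vec k\<close>. In this way C^k plays the role of the group
  algebra of Z_k.\<close>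

lemma cstar_hom_Cpow_eq:
  assumes "k > 0" "cstar_algebra A" "cstar_hom (Cpow k) A f" "x \<in> carrier_vec k"
  shows "f x = func_calc A k (f (root_vec k)) x"
proof -
  interpret f: cstar_morphism "Cpow k" A f
    by (intro cstar_morphism.intro cstar_morphism_axioms.intro assms Cpow_cstar_algebra)
  have "root_vec k \<in> carrier (Cpow k)"
    by (simp add: root_vec_def Cpow_sel)
  from f.func_calc_natural[OF this, of k x] show ?thesis
    using func_calc_root_vec[OF assms(1,4)] by simp
qed

section \<open>The full group C*-algebra as a free product\<close>

lemma word_class_eq_iff: "word_class R v = word_class R w \<longleftrightarrow> word_eq R v w"
  unfolding word_class_def by (auto intro: word_eq.intros)

lemma presented_group_mult:
  "word_class R v \<otimes>\<^bsub>presented_group R\<^esub> word_class R w = word_class R (v @ w)"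
proof -
  have "word_class R (x @ y) = word_class R (v @ w)" if "x \<in> word_class R v" "y \<in> word_class R w" for x y
    using that unfolding word_class_eq_iff by (auto simp: word_class_def intro: word_eq.intros)
  moreover have "v \<in> word_class R v" "w \<in> word_class R w"
    by (auto simp: word_class_def intro: word_eq.intros)
  ultimately have "(\<Union>x\<in>word_class R v. \<Union>y\<in>word_class R w. word_class R (x @ y)) = word_class R (v @ w)"
    by blast
  then show ?thesis
    by (simp add: presented_group_def)
qed

lemma presented_group_carrier: "carrier (presented_group R) = range (word_class R)"
  by (simp add: presented_group_def)

section \<open>Evaluation of words at two unitaries of finite order\<close>

primrec gen_val :: "'a \<Rightarrow> 'a \<Rightarrow> gen \<Rightarrow> 'a" where
  "gen_val a b gen_a = a"
| "gen_val a b gen_b = b"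

definition letter_val :: "('a, 'm) cstar_scheme \<Rightarrow> 'a \<Rightarrow> 'a \<Rightarrow> gen \<times> bool \<Rightarrow> 'a" where
  "letter_val A a b l = (if snd l then gen_val a b (fst l) else star A (gen_val a b (fst l)))"

primrec word_val :: "('a, 'm) cstar_scheme \<Rightarrow> 'a \<Rightarrow> 'a \<Rightarrow> (gen \<times> bool) list \<Rightarrow> 'a" where
  "word_val A a b [] = \<one>\<^bsub>A\<^esub>"
| "word_val A a b (l # w) = letter_val A a b l \<otimes>\<^bsub>A\<^esub> word_val A a b w"

context cstar_algebra
begin

lemma unitariesD:
  assumes "x \<in> unitaries A"
  shows "x \<in> carrier A" "star A x \<otimes> x = \<one>" "x \<otimes> star A x = \<one>"
  using assms by (auto simp: unitaries_def)

lemma unitary_star: "x \<in> unitaries A \<Longrightarrow> star A x \<in> unitaries A"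
  by (auto simp: unitaries_def star_closed star_star)

lemma unitary_one: "\<one> \<in> unitaries A"
  by (simp add: unitaries_def star_one)

lemma unitary_mult:
  assumes x: "x \<in> unitaries A" and y: "y \<in> unitaries A"
  shows "x \<otimes> y \<in> unitaries A"
proof -
  note xy = unitariesD[OF x] unitariesD[OF y]
  note [simp] = xy(1,4) star_closed
  have "star A y \<otimes> star A x \<otimes> (x \<otimes> y) = star A y \<otimes> ((star A x \<otimes> x) \<otimes> y)"
    by (simp add: m_assoc)
  moreover have "x \<otimes> y \<otimes> (star A y \<otimes> star A x) = x \<otimes> ((y \<otimes> star A y) \<otimes> star A x)"
    by (simp add: m_assoc)
  ultimately show ?thesis
    using xy by (simp add: unitaries_def star_mult)
qed

lemma unitary_mult_eq_one:
  assumes x: "x \<in> unitaries A" and y: "y \<in> carrier A" "y \<otimes> x = \<one>"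
  shows "y = star A x"
proof -
  note x = unitariesD[OF x]
  have "y = y \<otimes> (x \<otimes> star A x)"
    using x y by simp
  also have "\<dots> = (y \<otimes> x) \<otimes> star A x"
    using m_assoc[OF y(1) x(1) star_closed[OF x(1)]] by simp
  finally show ?thesis
    using x y by (simp add: star_closed)
qed

context
  fixes a b k m
  assumes a: "a \<in> unitaries A" "a [^] (k :: nat) = \<one>" and b: "b \<in> unitaries A" "b [^] (m :: nat) = \<one>"
begin

lemma gen_val_unitary: "gen_val a b g \<in> unitaries A"
  using a b by (cases g) auto

lemma letter_val_unitary: "letter_val A a b l \<in> unitaries A"
  using gen_val_unitary unitary_star by (auto simp: letter_val_def)

lemma word_val_unitary: "word_val A a b w \<in> unitaries A"
  by (induction w) (auto simp: unitary_one intro: unitary_mult letter_val_unitary)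

lemma word_val_in: "word_val A a b w \<in> carrier A"
  using unitariesD word_val_unitary by blast

lemma word_val_append: "word_val A a b (v @ w) = word_val A a b v \<otimes> word_val A a b w"
  by (induction v) (auto simp: word_val_in m_assoc unitariesD(1)[OF letter_val_unitary])

lemma word_val_replicate: "word_val A a b (replicate n (g, True)) = gen_val a b g [^] n"
proof (induction n)
  case (Suc n)
  have "gen_val a b g \<in> carrier A"
    using gen_val_unitary unitariesD by blast
  from nat_pow_Suc2[OF this, of n] Suc show ?case
    by (simp add: letter_val_def del: nat_pow_Suc)
qed simp

text \<open>Each rule of \<open>word_eq\<close> is respected by unitaries whose k-th and m-th powers
  are the unit: the theorem of von Dyck for this presentation.\<close>

lemma word_val_eq: "word_eq (cyclic_relators k m) v w \<Longrightarrow> word_val A a b v = word_val A a b w"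
proof (induction rule: word_eq.induct)
  case (append v w v' w')
  then show ?case
    by (simp add: word_val_append)
next
  case (cancel x s)
  show ?case
    using unitariesD[OF gen_val_unitary[of x]] by (auto simp: letter_val_def star_closed)
next
  case (relator r)
  then show ?case
    using a b by (auto simp: cyclic_relators_def word_val_replicate)
qed auto

text \<open>A class is evaluated at an arbitrary representative; \<open>word_val_eq\<close> shows
  that the choice does not matter.\<close>

definition class_val :: "(gen \<times> bool) list set \<Rightarrow> 'a" where
  "class_val X = word_val A a b (SOME w. w \<in> X)"

lemma class_val: "class_val (word_class (cyclic_relators k m) w) = word_val A a b w"
proof -
  have "(SOME v. v \<in> word_class (cyclic_relators k m) w) \<in> word_class (cyclic_relators k m) w"
    by (rule someI[of _ w]) (auto simp: word_class_def intro: word_eq.intros)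
  then show ?thesis
    using word_val_eq by (simp add: class_val_def word_class_def)
qed

lemma class_val_unitary_hom: "unitary_hom (free_prod_cyclic k m) A class_val"
proof -
  have "class_val X \<in> unitaries A" for X
    unfolding class_val_def by (rule word_val_unitary)
  moreover have "class_val (X \<otimes>\<^bsub>free_prod_cyclic k m\<^esub> Y) = class_val X \<otimes> class_val Y"
    if "X \<in> carrier (free_prod_cyclic k m)" "Y \<in> carrier (free_prod_cyclic k m)" for X Y
    using that
    by (auto simp: free_prod_cyclic_def presented_group_carrier presented_group_mult class_val word_val_append)
  ultimately show ?thesis
    using unitariesD(1) by (auto simp: unitary_hom_def hom_def)
qed

end

end

section \<open>The generators of the full group C*-algebra and its universal property\<close>

locale full_cyclic_cstar = cstar_algebra C for C :: "'u cstar" (structure) +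
  fixes k m :: nat and u :: "(gen \<times> bool) list set \<Rightarrow> 'u"
  assumes k: "k > 0" and m: "m > 0"
    and full: "is_full_group_cstar TYPE('u) (free_prod_cyclic k m) C u"
begin

abbreviation wc :: "(gen \<times> bool) list \<Rightarrow> (gen \<times> bool) list set" where
  "wc \<equiv> word_class (cyclic_relators k m)"

definition gen_image :: "gen \<Rightarrow> 'u" where
  "gen_image g = u (wc [(g, True)])"

abbreviation "a \<equiv> gen_image gen_a"
abbreviation "b \<equiv> gen_image gen_b"

lemma u_unitary: "u (wc w) \<in> unitaries C"
  using full by (auto simp: is_full_group_cstar_def unitary_hom_def free_prod_cyclic_def presented_group_carrier)

lemma u_in: "u (wc w) \<in> carrier C"
  using u_unitary unitariesD by blast

lemma u_append: "u (wc (v @ w)) = u (wc v) \<otimes> u (wc w)"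
proof -
  have "u (wc v \<otimes>\<^bsub>free_prod_cyclic k m\<^esub> wc w) = u (wc v) \<otimes> u (wc w)"
    using full by (auto simp: is_full_group_cstar_def unitary_hom_def hom_def free_prod_cyclic_def presented_group_carrier)
  then show ?thesis
    by (simp add: free_prod_cyclic_def presented_group_mult)
qed

lemma u_Nil: "u (wc []) = \<one>"
proof -
  let ?e = "u (wc [])"
  have "?e \<otimes> ?e = ?e"
    using u_append[of "[]" "[]"] by simp
  then have "star C ?e \<otimes> ?e \<otimes> ?e = star C ?e \<otimes> ?e"
    using u_in by (simp add: m_assoc star_closed)
  then show ?thesis
    using unitariesD[OF u_unitary[of "[]"]] by simp
qed

lemma gen_image_unitary: "gen_image g \<in> unitaries C"
  by (simp add: gen_image_def u_unitary)

lemma gen_image_in [simp]: "gen_image g \<in> carrier C"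
  using gen_image_unitary unitariesD by blast

lemma u_inverse: "u (wc [(g, False)]) = star C (gen_image g)"
proof (rule unitary_mult_eq_one[OF gen_image_unitary u_in])
  have "wc [(g, False), (g, True)] = wc []"
    unfolding word_class_eq_iff using word_eq.cancel[of _ g False] by simp
  then show "u (wc [(g, False)]) \<otimes> gen_image g = \<one>"
    using u_append[of "[(g, False)]" "[(g, True)]"] u_Nil by (simp add: gen_image_def)
qed

lemma u_replicate: "u (wc (replicate n (g, True))) = gen_image g [^] n"
proof (induction n)
  case 0
  then show ?case
    by (simp add: u_Nil)
next
  case (Suc n)
  have "u (wc (replicate (Suc n) (g, True))) = gen_image g \<otimes> u (wc (replicate n (g, True)))"
    using u_append[of "[(g, True)]" "replicate n (g, True)"] by (simp add: gen_image_def)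
  then show ?case
    using Suc nat_pow_Suc2[of "gen_image g" n] by (simp del: nat_pow_Suc)
qed

lemma a_pow: "a [^] k = \<one>" and b_pow: "b [^] m = \<one>"
proof -
  have "wc (replicate k (gen_a, True)) = wc []" "wc (replicate m (gen_b, True)) = wc []"
    unfolding word_class_eq_iff by (auto intro: word_eq.relator simp: cyclic_relators_def)
  then show "a [^] k = \<one>" "b [^] m = \<one>"
    by (simp_all add: u_Nil flip: u_replicate)
qed

sublocale a: cyclic_unitary C k a
  by (intro cyclic_unitary.intro cstar_algebra_axioms cyclic_unitary_axioms.intro k a_pow gen_image_unitary)

sublocale b: cyclic_unitary C m b
  by (intro cyclic_unitary.intro cstar_algebra_axioms cyclic_unitary_axioms.intro m b_pow gen_image_unitary)

text \<open>Homomorphisms that agree on a and b agree on all words in them, and the uniqueness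
  clause of the universal property carries this to all of C; density of the span of the words is not
  invoked.\<close>

lemma hom_unique:
  fixes R :: "'u cstar"
  assumes R: "cstar_algebra R" and h1: "cstar_hom C R h1" and h2: "cstar_hom C R h2"
    and eq: "h1 a = h2 a" "h1 b = h2 b" and z: "z \<in> carrier C"
  shows "h1 z = h2 z"
proof -
  interpret h1: cstar_morphism C R h1
    by (intro cstar_morphism.intro cstar_morphism_axioms.intro R h1 cstar_algebra_axioms)
  interpret h2: cstar_morphism C R h2
    by (intro cstar_morphism.intro cstar_morphism_axioms.intro R h2 cstar_algebra_axioms)
  have letter: "h1 (u (wc [l])) = h2 (u (wc [l]))" for l
  proof -
    obtain g s where l: "l = (g, s)"
      by (cases l)
    have "h1 (gen_image g) = h2 (gen_image g)"
      using eq by (cases g) auto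
    moreover have "u (wc [l]) = (if s then gen_image g else star C (gen_image g))"
      using u_inverse[of g] by (simp add: l gen_image_def)
    ultimately show ?thesis
      by (simp add: h1.f_star h2.f_star)
  qed
  have word: "h1 (u (wc w)) = h2 (u (wc w))" for w
  proof (induction w)
    case Nil
    then show ?case
      by (simp add: u_Nil h1.f_one h2.f_one)
  next
    case (Cons l w)
    then show ?case
      using letter[of l] u_append[of "[l]" w] u_in by (simp add: h1.f_mult h2.f_mult)
  qed
  let ?v = "\<lambda>g. h1 (u g)"
  have v: "unitary_hom (free_prod_cyclic k m) R ?v"
    using u_in u_append h1.f_unitary[OF u_unitary] h1.f_in
    by (auto simp: unitary_hom_def hom_def free_prod_cyclic_def presented_group_carrier presented_group_mult h1.f_mult)
  have all: "\<forall>g\<in>carrier (free_prod_cyclic k m). h2 (u g) = ?v g"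
    using word by (auto simp: free_prod_cyclic_def presented_group_carrier)
  obtain h where "\<And>h'. cstar_hom C R h' \<Longrightarrow> \<forall>g\<in>carrier (free_prod_cyclic k m). h' (u g) = ?v g \<Longrightarrow>
      \<forall>z\<in>carrier C. h' z = h z"
    using full R v unfolding is_full_group_cstar_def by blast
  from this[OF h1] this[OF h2 all] z show ?thesis
    by simp
qed

text \<open>Evaluating words at the two unitaries gives a unitary representation of the presented
  group, to which the universal property applies.\<close>

lemma hom_exists:
  fixes R :: "'u cstar"
  assumes R: "cstar_algebra R"
    and a': "a' \<in> unitaries R" "a' [^]\<^bsub>R\<^esub> k = \<one>\<^bsub>R\<^esub>" and b': "b' \<in> unitaries R" "b' [^]\<^bsub>R\<^esub> m = \<one>\<^bsub>R\<^esub>"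
  obtains h where "cstar_hom C R h" "h a = a'" "h b = b'"
proof -
  interpret R: cstar_algebra R
    by (rule R)
  let ?v = "R.class_val a' b'"
  have v: "unitary_hom (free_prod_cyclic k m) R ?v"
    by (rule R.class_val_unitary_hom[OF a' b'])
  then obtain h where h: "cstar_hom C R h" "\<forall>g\<in>carrier (free_prod_cyclic k m). h (u g) = ?v g"
    using full R unfolding is_full_group_cstar_def by blast
  have "h (gen_image g) = gen_val a' b' g" for g
    using h(2) R.class_val[OF a' b'] R.unitariesD(1)[OF R.gen_val_unitary[OF a' b']]
    by (simp add: gen_image_def free_prod_cyclic_def presented_group_carrier letter_val_def)
  then show thesis
    using that[OF h(1)] by simp
qed

text \<open>The universal property of C only concerns algebras with carrier in \<open>'u\<close>; the injection g copies R there.\<close>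

lemma free_product_hom:
  fixes R :: "'r cstar" and g :: "'r \<Rightarrow> 'u"
  assumes R: "cstar_algebra R" and g: "inj g"
    and f1: "cstar_hom (Cpow k) R f1" and f2: "cstar_hom (Cpow m) R f2"
  obtains h where "cstar_hom C R h" "\<And>x. x \<in> carrier_vec k \<Longrightarrow> h (a.\<alpha> x) = f1 x"
    "\<And>y. y \<in> carrier_vec m \<Longrightarrow> h (b.\<alpha> y) = f2 y"
proof -
  let ?I = "image_cstar g R"
  note I = image_cstar[OF R g]
  interpret I: cstar_algebra ?I
    by (rule I(1))
  interpret R: cstar_algebra R
    by (rule R)
  interpret f1: cstar_morphism "Cpow k" ?I "\<lambda>x. g (f1 x)"
    by (intro cstar_morphism.intro cstar_morphism_axioms.intro Cpow_cstar_algebra k I(1) cstar_hom_comp[OF f1 I(3)])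
  interpret f2: cstar_morphism "Cpow m" ?I "\<lambda>x. g (f2 x)"
    by (intro cstar_morphism.intro cstar_morphism_axioms.intro Cpow_cstar_algebra m I(1) cstar_hom_comp[OF f2 I(3)])
  interpret rk: cyclic_unitary "Cpow k" k "root_vec k"
    by (rule root_vec_cyclic[OF k])
  interpret rm: cyclic_unitary "Cpow m" m "root_vec m"
    by (rule root_vec_cyclic[OF m])
  obtain h where h: "cstar_hom C ?I h" "h a = g (f1 (root_vec k))" "h b = g (f2 (root_vec m))"
  proof (rule hom_exists[OF I(1)])
    show "g (f1 (root_vec k)) [^]\<^bsub>?I\<^esub> k = \<one>\<^bsub>?I\<^esub>" "g (f2 (root_vec m)) [^]\<^bsub>?I\<^esub> m = \<one>\<^bsub>?I\<^esub>"
      using f1.f_pow[of "root_vec k" k] f2.f_pow[of "root_vec m" m] rk.pow_k rm.pow_k f1.f_one f2.f_one by simp_all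
  qed (use f1.f_unitary[OF rk.a] f2.f_unitary[OF rm.a] in auto)
  interpret h: cstar_morphism C ?I h
    by (intro cstar_morphism.intro cstar_morphism_axioms.intro cstar_algebra_axioms I(1) h(1))
  have inv: "the_inv g (g x) = x" for x
    using g by (simp add: the_inv_f_f)
  show thesis
  proof (rule that)
    show "cstar_hom C R (\<lambda>x. the_inv g (h x))"
      by (rule cstar_hom_comp[OF h(1) I(2)])
    show "the_inv g (h (a.\<alpha> x)) = f1 x" if "x \<in> carrier_vec k" for x
    proof -
      have "h (a.\<alpha> x) = g (f1 x)"
        using h.func_calc_natural[of a k x] h(2) cstar_hom_Cpow_eq[OF k I(1) f1.hom that] by simp
      then show ?thesis
        by (simp only: inv)
    qed
    show "the_inv g (h (b.\<alpha> y)) = f2 y" if "y \<in> carrier_vec m" for y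
    proof -
      have "h (b.\<alpha> y) = g (f2 y)"
        using h.func_calc_natural[of b m y] h(3) cstar_hom_Cpow_eq[OF m I(1) f2.hom that] by simp
      then show ?thesis
        by (simp only: inv)
    qed
  qed
qed

text \<open>Generation is deduced from the universal property: a C*-subalgebra B containing a and b
  is itself a test algebra, so some homomorphism from C to B fixes both, and followed by the
  inclusion it is the identity by uniqueness.\<close>

lemma enough_unitaries:
  assumes V: "operator_subspace C V" and "a \<in> V" "b \<in> V"
  shows "contains_enough_unitaries C V"
proof -
  have "carrier C \<subseteq> B" if B: "cstar_subalgebra C B" and ab: "a \<in> B" "b \<in> B" for B
  proof -
    interpret B: LinearCombinations.submodule class_ring B C
      using B by (simp add: cstar_subalgebra_def)
    let ?B = "C\<lparr>carrier := B\<rparr>"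
    have B_sub: "x \<in> carrier C" if "x \<in> B" for x
      using that B.subset by blast
    have B_mult: "x \<otimes> y \<in> B" if "x \<in> B" "y \<in> B" for x y
      using that B by (simp add: cstar_subalgebra_def)
    have B_star: "star C x \<in> B" if "x \<in> B" for x
      using that B by (simp add: cstar_subalgebra_def)
    have B_closed: "l \<in> B" if "\<And>n. s n \<in> B" "l \<in> carrier C" "(\<lambda>n. cnorm C (s n \<ominus> l)) \<longlonglongrightarrow> 0" for s and l
      using that B unfolding cstar_subalgebra_def by blast
    \<comment> \<open>\<open>cstar_subalgebra\<close> does not mention the unit; it lies in B as the
      power a^k with k > 0.\<close>
    have "a [^] Suc n \<in> B" for n
      by (induction n) (use ab(1) B_mult in auto)
    then have "a [^] k \<in> B"
      using k by (metis gr0_implies_Suc)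
    then have one: "\<one> \<in> B"
      by (simp add: a_pow)
    have lin: "linear_injection ?B C id"
      by (intro linear_injection.intro star_vector_space_axioms)
        (simp_all add: one B_sub B_star B.m_closed B.smult_closed B.zero_closed)
    have B_cstar: "cstar_algebra ?B"
    proof (rule cstar_algebra_transfer[OF cstar_algebra_axioms lin])
      show "l \<in> id ` carrier ?B"
        if "\<And>n. s n \<in> carrier ?B" "l \<in> carrier C" "(\<lambda>n. cnorm C (id (s n) \<ominus> l)) \<longlonglongrightarrow> 0" for s :: "nat \<Rightarrow> 'u" and l
        using B_closed[of s l] that by simp
    qed (simp_all add: B_mult)
    have pow: "x [^]\<^bsub>?B\<^esub> (n :: nat) = x [^] n" for x n
      by (simp add: nat_pow_def)
    have unit: "x \<in> unitaries ?B" if "x \<in> B" "x \<in> unitaries C" for x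
      using that by (auto simp: unitaries_def)
    obtain h where h: "cstar_hom C ?B h" "h a = a" "h b = b"
      by (rule hom_exists[OF B_cstar, of a b])
        (use ab unit gen_image_unitary in \<open>auto simp: pow a_pow b_pow\<close>)
    have "cstar_hom ?B C (\<lambda>x. x)"
      using B_sub by (auto simp: cstar_hom_def Ring.ring_hom_def)
    from cstar_hom_comp[OF h(1) this] have h': "cstar_hom C C h" .
    show ?thesis
    proof
      fix z
      assume z: "z \<in> carrier C"
      have "h z = z"
        using hom_unique[OF cstar_algebra_axioms h' cstar_hom_id _ _ z] h by simp
      moreover have "h z \<in> B"
        using h(1) z by (auto simp: cstar_hom_def Ring.ring_hom_def)
      ultimately show "z \<in> B"
        by simp
    qed
  qed
  then have "carrier C \<subseteq> cstar_generated C {a, b}"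
    by (auto simp: cstar_generated_def)
  moreover have "cstar_subalgebra C (carrier C)"
    using operator_subspace_carrier star_closed by (auto simp: cstar_subalgebra_def operator_subspace_def)
  then have "cstar_generated C {a, b} \<subseteq> carrier C"
    by (auto simp: cstar_generated_def)
  ultimately have "cstar_generated C {a, b} = carrier C"
    by blast
  then show ?thesis
    using assms gen_image_unitary by (auto simp: contains_enough_unitaries_def intro!: exI[of _ "{a, b}"])
qed

end

section \<open>The operator subspace of sums inside the group C*-algebra\<close>

lemma (in star_vector_space) submodule_finsum:
  assumes V: "LinearCombinations.submodule class_ring W V" and "finite I" "\<And>i. i \<in> I \<Longrightarrow> f i \<in> W"
  shows "finsum V f I \<in> W"
proof -
  interpret abelian_group V
    by (rule abelian_group_V)
  interpret W: LinearCombinations.submodule class_ring W V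
    by (rule V)
  show ?thesis
    using assms(2,3)
  proof (induction rule: finite_induct)
    case (insert i I)
    then have "f \<in> I \<rightarrow> carrier V" "f i \<in> carrier V"
      using W.subset by auto
    then show ?case
      using insert W.m_closed by simp
  qed (use W.zero_closed in simp)
qed

lemma hom_sum_operator_subspace:
  assumes f: "cstar_morphism (Cpow k) A f" and g: "cstar_morphism (Cpow m) A g"
  shows "operator_subspace A {f x \<oplus>\<^bsub>A\<^esub> g y | x y. x \<in> carrier (Cpow k) \<and> y \<in> carrier (Cpow m)}"
    (is "operator_subspace A ?S")
proof -
  interpret f: cstar_morphism "Cpow k" A f by (rule f)
  interpret g: cstar_morphism "Cpow m" A g by (rule g)
  let ?K = "carrier (Cpow k)" and ?M = "carrier (Cpow m)"
  have I: "z \<in> ?S" if "z = f x \<oplus>\<^bsub>A\<^esub> g y" "x \<in> ?K" "y \<in> ?M" for x y z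
    using that by blast
  have "z \<oplus>\<^bsub>A\<^esub> w \<in> ?S" if zw: "z \<in> ?S" "w \<in> ?S" for z w
  proof -
    obtain x y where xy: "z = f x \<oplus>\<^bsub>A\<^esub> g y" "x \<in> ?K" "y \<in> ?M"
      using zw(1) by blast
    obtain x' y' where xy': "w = f x' \<oplus>\<^bsub>A\<^esub> g y'" "x' \<in> ?K" "y' \<in> ?M"
      using zw(2) by blast
    show ?thesis
      by (rule I[of _ "x \<oplus>\<^bsub>Cpow k\<^esub> x'" "y \<oplus>\<^bsub>Cpow m\<^esub> y'"])
        (use xy xy' in \<open>auto simp: f.f_add g.f_add f.f_in g.f_in f.B.a_ac\<close>)
  qed
  moreover have "c \<odot>\<^bsub>A\<^esub> z \<in> ?S" if z: "z \<in> ?S" for c z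
  proof -
    obtain x y where xy: "z = f x \<oplus>\<^bsub>A\<^esub> g y" "x \<in> ?K" "y \<in> ?M"
      using z by blast
    show ?thesis
      by (rule I[of _ "c \<odot>\<^bsub>Cpow k\<^esub> x" "c \<odot>\<^bsub>Cpow m\<^esub> y"])
        (use xy in \<open>auto simp: f.f_smult g.f_smult f.f_in g.f_in f.B.smult_add_right\<close>)
  qed
  moreover have "star A z \<in> ?S" if z: "z \<in> ?S" for z
  proof -
    obtain x y where xy: "z = f x \<oplus>\<^bsub>A\<^esub> g y" "x \<in> ?K" "y \<in> ?M"
      using z by blast
    show ?thesis
      by (rule I[of _ "star (Cpow k) x" "star (Cpow m) y"])
        (use xy in \<open>auto simp: f.f_star g.f_star f.f_in g.f_in f.B.star_add f.A.star_closed g.A.star_closed\<close>)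
  qed
  moreover have "\<zero>\<^bsub>A\<^esub> \<in> ?S"
    by (rule I[of _ "\<zero>\<^bsub>Cpow k\<^esub>" "\<zero>\<^bsub>Cpow m\<^esub>"]) (simp_all add: f.f_zero g.f_zero)
  moreover have "\<one>\<^bsub>A\<^esub> \<in> ?S"
    by (rule I[of _ "\<one>\<^bsub>Cpow k\<^esub>" "\<zero>\<^bsub>Cpow m\<^esub>"]) (simp_all add: f.f_one g.f_zero)
  moreover have "?S \<subseteq> carrier A"
    using f.f_in g.f_in by auto
  ultimately show ?thesis
    using f.B.vector_space unfolding operator_subspace_def LinearCombinations.submodule_def by simp
qed

text \<open>Homomorphisms preserve Gram matrices, so a left inverse homomorphism makes f reflect
  positivity at all matrix levels.\<close>

lemma cstar_iso_uco_isomorphism: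
  assumes f: "cstar_morphism A B f" and g: "cstar_hom B A g"
    and gf: "\<And>x. x \<in> carrier A \<Longrightarrow> g (f x) = x" and V: "operator_subspace A V" and W: "f ` V = W"
  shows "uco_isomorphism (opsub A V) (opsub B W) f"
proof -
  interpret f: cstar_morphism A B f
    by (rule f)
  interpret g: cstar_morphism B A g
    by (intro cstar_morphism.intro cstar_morphism_axioms.intro f.A.cstar_algebra_axioms f.B.cstar_algebra_axioms g)
  have V_sub: "x \<in> carrier A" if "x \<in> V" for x
    using V that LinearCombinations.submodule.subset by (auto simp: operator_subspace_def)
  have "map_mat f X \<in> cstar_mpos B n \<longleftrightarrow> X \<in> cstar_mpos A n" if X: "X \<in> mats A n n" for X n
  proof
    assume "map_mat f X \<in> cstar_mpos B n"
    then have "map_mat g (map_mat f X) \<in> cstar_mpos A n"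
      by (rule g.f_mpos)
    moreover have "map_mat g (map_mat f X) = X"
      using X gf by (auto simp: mats_def intro!: eq_matI)
    ultimately show "X \<in> cstar_mpos A n"
      by simp
  qed (rule f.f_mpos)
  moreover have "X \<in> mats A n n" if "X \<in> mats (opsub A V) n n" for X n
    using that V_sub by (auto simp: mats_def opsub_def)
  moreover have "inj_on f V"
    using gf V_sub by (metis inj_on_inverseI)
  ultimately show ?thesis
    unfolding uco_isomorphism_def uco_embedding_def unital_linear_def
    using W V_sub by (auto simp: opsub_def mats_def f.f_add f.f_smult f.f_one)
qed

context full_cyclic_cstar
begin

text \<open>The common copy in C of all four systems: the span of powers equals it by
  \<open>power_system_eq\<close>, and the others are mapped onto it by isomorphisms.\<close>

definition sum_space :: "'u set" where
  "sum_space = {a.\<alpha> x \<oplus> b.\<alpha> y | x y. x \<in> carrier (Cpow k) \<and> y \<in> carrier (Cpow m)}"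

lemma alpha_morphism: "cstar_morphism (Cpow k) C a.\<alpha>" "cstar_morphism (Cpow m) C b.\<alpha>"
  by (intro cstar_morphism.intro cstar_morphism_axioms.intro Cpow_cstar_algebra k m cstar_algebra_axioms
      a.func_calc_hom b.func_calc_hom)+

lemma sum_space_operator_subspace: "operator_subspace C sum_space"
  unfolding sum_space_def by (rule hom_sum_operator_subspace[OF alpha_morphism])

lemma alpha_in_sum_space: "x \<in> carrier (Cpow k) \<Longrightarrow> a.\<alpha> x \<in> sum_space"
  and beta_in_sum_space: "y \<in> carrier (Cpow m) \<Longrightarrow> b.\<alpha> y \<in> sum_space"
proof -
  interpret \<alpha>: cstar_morphism "Cpow k" C a.\<alpha> by (rule alpha_morphism)
  interpret \<beta>: cstar_morphism "Cpow m" C b.\<alpha> by (rule alpha_morphism)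
  show "a.\<alpha> x \<in> sum_space" if "x \<in> carrier (Cpow k)"
    unfolding sum_space_def using that \<beta>.f_zero
    by (intro CollectI exI[of _ x] exI[of _ "\<zero>\<^bsub>Cpow m\<^esub>"]) simp
  show "b.\<alpha> y \<in> sum_space" if "y \<in> carrier (Cpow m)"
    unfolding sum_space_def using that \<alpha>.f_zero
    by (intro CollectI exI[of _ "\<zero>\<^bsub>Cpow k\<^esub>"] exI[of _ y]) simp
qed

lemma a_pow_in_sum_space: "a [^] (i :: nat) \<in> sum_space" and b_pow_in_sum_space: "b [^] (i :: nat) \<in> sum_space"
  using alpha_in_sum_space[of "vec k (\<lambda>q. (prim_root k ^ q) ^ i)"] a.func_calc_pow[of i]
    beta_in_sum_space[of "vec m (\<lambda>q. (prim_root m ^ q) ^ i)"] b.func_calc_pow[of i]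
  by (simp_all add: Cpow_sel)

text \<open>The discrete Fourier transform in both directions: powers of a are values of the
  functional calculus, and the spectral projections are combinations of the powers with exponent
  below k. Likewise for b and m.\<close>

lemma power_system_eq: "power_system k m C u = opsub C sum_space"
proof -
  define G where "G = {\<one>} \<union> {a [^] i | i :: nat. 1 \<le> i \<and> i < k} \<union> {b [^] i | i :: nat. 1 \<le> i \<and> i < m}"
  interpret M: Module.module class_ring C
    by (rule vector_space)
  have G: "G \<subseteq> carrier C"
    by (auto simp: G_def)
  have S: "LinearCombinations.submodule class_ring sum_space C"
    using sum_space_operator_subspace by (simp add: operator_subspace_def)
  have "M.span G \<subseteq> sum_space"
    using sum_space_operator_subspace a_pow_in_sum_space b_pow_in_sum_space
    by (intro M.span_is_subset S) (auto simp: operator_subspace_def G_def)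
  moreover have "sum_space \<subseteq> M.span G"
  proof -
    interpret W: LinearCombinations.submodule class_ring "M.span G" C
      by (rule M.span_is_submodule[OF G])
    have sub: "LinearCombinations.submodule class_ring (M.span G) C"
      by (rule M.span_is_submodule[OF G])
    have span: "G \<subseteq> M.span G"
      by (rule M.in_own_span[OF G])
    \<comment> \<open>The zeroth power is the unit, which G contains separately.\<close>
    have a_span: "a [^] i \<in> M.span G" if "i < k" for i :: nat
      by (rule subsetD[OF span]) (use that in \<open>cases "i = 0"; auto simp: G_def\<close>)
    have "a.e q \<in> M.span G" for q
      unfolding spectral_proj_def by (intro W.smult_closed submodule_finsum[OF sub]) (simp_all add: a_span)
    then have "a.\<alpha> x \<in> M.span G" for x
      unfolding func_calc_def by (intro submodule_finsum[OF sub] W.smult_closed) simp_all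
    moreover have b_span: "b [^] i \<in> M.span G" if "i < m" for i :: nat
      by (rule subsetD[OF span]) (use that in \<open>cases "i = 0"; auto simp: G_def\<close>)
    have "b.e q \<in> M.span G" for q
      unfolding spectral_proj_def by (intro W.smult_closed submodule_finsum[OF sub]) (simp_all add: b_span)
    then have "b.\<alpha> x \<in> M.span G" for x
      unfolding func_calc_def by (intro submodule_finsum[OF sub] W.smult_closed) simp_all
    ultimately show ?thesis
      by (auto simp: sum_space_def intro!: W.m_closed)
  qed
  ultimately have "M.span G = sum_space"
    by blast
  then show ?thesis
    by (simp add: power_system_def Let_def gen_image_def G_def)
qed

lemma sum_space_enough: "contains_enough_unitaries C sum_space"
  using a_pow_in_sum_space[of 1] b_pow_in_sum_space[of 1]
  by (intro enough_unitaries sum_space_operator_subspace) simp_all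

text \<open>F and C have the same universal property, and homomorphisms from C^k and C^m amount to
  unitaries whose k-th and m-th powers are the unit. F already has its carrier in \<open>'u\<close>,
  so the identity serves as the injection in \<open>free_product_hom\<close>.\<close>

lemma free_product_iso:
  fixes F :: "'u cstar"
  assumes F: "is_cstar_free_product TYPE('u) (Cpow k) (Cpow m) F iF jF"
  obtains \<phi> \<psi> where "cstar_morphism F C \<phi>" "cstar_hom C F \<psi>"
    "\<And>z. z \<in> carrier F \<Longrightarrow> \<psi> (\<phi> z) = z" "\<And>z. z \<in> carrier C \<Longrightarrow> \<phi> (\<psi> z) = z"
    "\<phi> ` {iF x \<oplus>\<^bsub>F\<^esub> jF y | x y. x \<in> carrier (Cpow k) \<and> y \<in> carrier (Cpow m)} = sum_space"
proof -
  have F': "cstar_algebra F" "cstar_hom (Cpow k) F iF" "cstar_hom (Cpow m) F jF"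
    using F by (auto simp: is_cstar_free_product_def)
  have univ: "\<exists>h. (cstar_hom F R h \<and> (\<forall>x\<in>carrier (Cpow k). h (iF x) = f x) \<and> (\<forall>y\<in>carrier (Cpow m). h (jF y) = g y)) \<and>
           (\<forall>h'. cstar_hom F R h' \<and> (\<forall>x\<in>carrier (Cpow k). h' (iF x) = f x) \<and> (\<forall>y\<in>carrier (Cpow m). h' (jF y) = g y)
              \<longrightarrow> (\<forall>z\<in>carrier F. h' z = h z))"
    if "cstar_algebra R" "cstar_hom (Cpow k) R f" "cstar_hom (Cpow m) R g" for R :: "'u cstar" and f g
    using F that unfolding is_cstar_free_product_def by blast
  interpret F: cstar_algebra F by (rule F'(1))
  interpret iF: cstar_morphism "Cpow k" F iF
    by (intro cstar_morphism.intro cstar_morphism_axioms.intro F' Cpow_cstar_algebra k)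
  interpret jF: cstar_morphism "Cpow m" F jF
    by (intro cstar_morphism.intro cstar_morphism_axioms.intro F' Cpow_cstar_algebra m)
  obtain \<phi> where \<phi>: "cstar_hom F C \<phi>" "\<forall>x\<in>carrier (Cpow k). \<phi> (iF x) = a.\<alpha> x" "\<forall>y\<in>carrier (Cpow m). \<phi> (jF y) = b.\<alpha> y"
    using univ[OF cstar_algebra_axioms a.func_calc_hom b.func_calc_hom] by blast
  obtain \<psi> where \<psi>: "cstar_hom C F \<psi>" "\<And>x. x \<in> carrier_vec k \<Longrightarrow> \<psi> (a.\<alpha> x) = iF x"
      "\<And>y. y \<in> carrier_vec m \<Longrightarrow> \<psi> (b.\<alpha> y) = jF y"
    using free_product_hom[OF F'(1) inj_on_id F'(2,3)] by (metis id_apply)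
  interpret \<phi>: cstar_morphism F C \<phi>
    by (intro cstar_morphism.intro cstar_morphism_axioms.intro F' cstar_algebra_axioms \<phi>)
  have roots: "root_vec k \<in> carrier (Cpow k)" "root_vec m \<in> carrier (Cpow m)"
    by (simp_all add: root_vec_def Cpow_sel)
  show thesis
  proof (rule that[OF \<phi>.cstar_morphism_axioms \<psi>(1)])
    show "\<phi> (\<psi> z) = z" if "z \<in> carrier C" for z
    proof (rule hom_unique[OF cstar_algebra_axioms cstar_hom_comp[OF \<psi>(1) \<phi>(1)] cstar_hom_id _ _ that])
      show "\<phi> (\<psi> a) = a"
        using \<psi>(2)[of "root_vec k"] \<phi>(2) roots a.func_calc_root by (simp add: Cpow_sel)
      show "\<phi> (\<psi> b) = b"
        using \<psi>(3)[of "root_vec m"] \<phi>(3) roots b.func_calc_root by (simp add: Cpow_sel)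
    qed
    show "\<psi> (\<phi> z) = z" if z: "z \<in> carrier F" for z
    proof -
      obtain h where "\<And>h'. cstar_hom F F h' \<Longrightarrow> \<forall>x\<in>carrier (Cpow k). h' (iF x) = iF x \<Longrightarrow>
          \<forall>y\<in>carrier (Cpow m). h' (jF y) = jF y \<Longrightarrow> \<forall>z\<in>carrier F. h' z = h z"
        using univ[OF F'] by blast
      from this[OF cstar_hom_comp[OF \<phi>(1) \<psi>(1)]] this[OF cstar_hom_id] show ?thesis
        using \<phi>(2,3) \<psi>(2,3) z by (simp add: Cpow_sel)
    qed
    have "\<phi> (iF x \<oplus>\<^bsub>F\<^esub> jF y) = a.\<alpha> x \<oplus> b.\<alpha> y" if "x \<in> carrier (Cpow k)" "y \<in> carrier (Cpow m)" for x y
      using \<phi>(2,3) that by (simp add: \<phi>.f_add iF.f_in jF.f_in)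
    then have "{\<phi> (iF x \<oplus>\<^bsub>F\<^esub> jF y) | x y. x \<in> carrier (Cpow k) \<and> y \<in> carrier (Cpow m)} = sum_space"
      unfolding sum_space_def by (intro Collect_cong ex_cong1) auto
    then show "\<phi> ` {iF x \<oplus>\<^bsub>F\<^esub> jF y | x y. x \<in> carrier (Cpow k) \<and> y \<in> carrier (Cpow m)} = sum_space"
      by blast
  qed
qed

end

section \<open>Finite-dimensional separation and dilation\<close>

text \<open>The functional is extended by one coordinate at a time, starting from the multiples of
  x0. It is a function of the pair (z, x) rather than of the vector z x0 + x; so x0 may have nonzero
  coordinates in I, and no question of well-definedness arises.\<close>

lemma hahn_banach_coordinates:
  fixes p :: "('i \<Rightarrow> real) \<Rightarrow> real"
  assumes fin: "finite I"
    and sub: "\<And>x y. p (\<lambda>i. x i + y i) \<le> p x + p y"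
    and hom: "\<And>c x. c \<ge> 0 \<Longrightarrow> p (\<lambda>i. c * x i) = c * p x"
  shows "\<exists>w. \<forall>z x. (\<forall>i. i \<notin> I \<longrightarrow> x i = 0) \<longrightarrow> z * p x0 + (\<Sum>i\<in>I. w i * x i) \<le> p (\<lambda>i. z * x0 i + x i)"
  using fin
proof (induction rule: finite_induct)
  case empty
  have p0: "p (\<lambda>i. 0) = 0"
    using hom[of 0 "\<lambda>i. 0"] by simp
  have "z * p x0 \<le> p (\<lambda>i. z * x0 i)" for z
  proof (cases "z \<ge> 0")
    case False
    have "0 \<le> p (\<lambda>i. z * x0 i) + p (\<lambda>i. (- z) * x0 i)"
      using sub[of "\<lambda>i. z * x0 i" "\<lambda>i. (- z) * x0 i"] p0 by simp
    then show ?thesis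
      using hom[of "- z" x0] False by simp
  qed (simp add: hom)
  moreover have "x = (\<lambda>i. 0)" if "\<forall>i. x i = (0::real)" for x :: "'i \<Rightarrow> real"
    using that by auto
  ultimately show ?case
    by auto
next
  case (insert j I)
  then obtain w where w: "\<And>z x. (\<And>i. i \<notin> I \<Longrightarrow> x i = 0) \<Longrightarrow> z * p x0 + (\<Sum>i\<in>I. w i * x i) \<le> p (\<lambda>i. z * x0 i + x i)"
    by blast
  define L where "L z x = z * p x0 + (\<Sum>i\<in>I. w i * x i)" for z x
  define \<delta> where "\<delta> = (\<lambda>i. if i = j then 1 else (0::real))"
  define supp where "supp x \<longleftrightarrow> (\<forall>i. i \<notin> I \<longrightarrow> x i = (0::real))" for x
  define lower where "lower = {L z x - p (\<lambda>i. z * x0 i + x i - \<delta> i) | z x. supp x}"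
  \<comment> \<open>Every lower bound for the value at \<delta> is below every upper bound, so that
    the supremum t of the lower bounds is an admissible value.\<close>
  have cross: "L z x - p (\<lambda>i. z * x0 i + x i - \<delta> i) \<le> p (\<lambda>i. z' * x0 i + x' i + \<delta> i) - L z' x'"
    if "supp x" "supp x'" for z x z' x'
  proof -
    have "L z x + L z' x' = L (z + z') (\<lambda>i. x i + x' i)"
      by (simp add: L_def algebra_simps sum.distrib)
    also have "\<dots> \<le> p (\<lambda>i. (z + z') * x0 i + (x i + x' i))"
      unfolding L_def using that by (intro w) (auto simp: supp_def)
    also have "(\<lambda>i. (z + z') * x0 i + (x i + x' i)) = (\<lambda>i. (z * x0 i + x i - \<delta> i) + (z' * x0 i + x' i + \<delta> i))"
      by (simp add: algebra_simps)
    also have "p \<dots> \<le> p (\<lambda>i. z * x0 i + x i - \<delta> i) + p (\<lambda>i. z' * x0 i + x' i + \<delta> i)"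
      by (rule sub)
    finally show ?thesis
      by simp
  qed
  have supp0: "supp (\<lambda>i. 0)"
    by (simp add: supp_def)
  have ne: "lower \<noteq> {}"
    using supp0 by (auto simp: lower_def)
  have bdd: "bdd_above lower"
    using cross[OF _ supp0, of _ _ 0] by (intro bdd_aboveI) (auto simp: lower_def)
  define t where "t = Sup lower"
  have t_lower: "L z x - t \<le> p (\<lambda>i. z * x0 i + x i - \<delta> i)" if "supp x" for z x
    using cSup_upper[OF _ bdd, of "L z x - p (\<lambda>i. z * x0 i + x i - \<delta> i)"] that unfolding t_def[symmetric]
    by (force simp: lower_def)
  have t_upper: "L z x + t \<le> p (\<lambda>i. z * x0 i + x i + \<delta> i)" if "supp x" for z x
  proof -
    have "t \<le> p (\<lambda>i. z * x0 i + x i + \<delta> i) - L z x"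
      unfolding t_def using cross[OF _ that] by (intro cSup_least ne) (auto simp: lower_def)
    then show ?thesis
      by simp
  qed
  have step: "L z x + s * t \<le> p (\<lambda>i. z * x0 i + x i + s * \<delta> i)" if "supp x" for z x s
  proof -
    have L_scale: "c * L (z / c) (\<lambda>i. x i / c) = L z x" if "c > 0" for c
      using that by (simp add: L_def distrib_left sum_distrib_left)
    have p_scale: "c * p (\<lambda>i. z / c * x0 i + x i / c + d * \<delta> i) = p (\<lambda>i. z * x0 i + x i + c * d * \<delta> i)" if "c > 0" for c d
      using that hom[of c "\<lambda>i. z / c * x0 i + x i / c + d * \<delta> i"] by (simp add: distrib_left mult.assoc)
    have supp_scale: "supp (\<lambda>i. x i / c)" for c
      using that by (simp add: supp_def)
    consider "s = 0" | "s > 0" | "s < 0"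
      by linarith
    then show ?thesis
    proof cases
      case 1
      then show ?thesis
        using w[of x z] that by (simp add: L_def supp_def)
    next
      case 2
      have "s * (L (z / s) (\<lambda>i. x i / s) + t) \<le> s * p (\<lambda>i. z / s * x0 i + x i / s + 1 * \<delta> i)"
        using t_upper[OF supp_scale, of "z / s" s] 2 by (intro mult_left_mono) auto
      then show ?thesis
        unfolding distrib_left L_scale[OF 2] p_scale[OF 2] by simp
    next
      case 3
      then have pos: "- s > 0"
        by simp
      have "(- s) * (L (z / (- s)) (\<lambda>i. x i / (- s)) - t) \<le> (- s) * p (\<lambda>i. z / (- s) * x0 i + x i / (- s) + (- 1) * \<delta> i)"
        using t_lower[OF supp_scale, of "z / (- s)" "- s"] pos by (intro mult_left_mono) auto
      then show ?thesis
        unfolding right_diff_distrib L_scale[OF pos] p_scale[OF pos] by simp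
    qed
  qed
  show ?case
  proof (intro exI[of _ "w(j := t)"] allI impI)
    fix z and x :: "'i \<Rightarrow> real"
    assume x: "\<forall>i. i \<notin> insert j I \<longrightarrow> x i = 0"
    define x' where "x' = x(j := 0)"
    have x': "supp x'"
      using x insert by (auto simp: supp_def x'_def)
    have x_eq: "x = (\<lambda>i. x' i + x j * \<delta> i)"
      by (auto simp: x'_def \<delta>_def)
    have "(\<Sum>i\<in>I. (w(j := t)) i * x i) = (\<Sum>i\<in>I. w i * x' i)"
      using insert by (intro sum.cong) (auto simp: x'_def)
    then have "z * p x0 + (\<Sum>i\<in>insert j I. (w(j := t)) i * x i) = L z x' + x j * t"
      using insert by (simp add: L_def)
    also have "\<dots> \<le> p (\<lambda>i. z * x0 i + x' i + x j * \<delta> i)"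
      by (rule step[OF x'])
    also have "(\<lambda>i. z * x0 i + x' i + x j * \<delta> i) = (\<lambda>i. z * x0 i + x i)"
      by (subst (2) x_eq) (simp add: add.assoc)
    finally show "z * p x0 + (\<Sum>i\<in>insert j I. (w(j := t)) i * x i) \<le> p (\<lambda>i. z * x0 i + x i)" .
  qed
qed

text \<open>The real version is applied with real and imaginary parts as separate coordinates. Since
  q only sees the coordinates in I, by \<open>local\<close>, vectors may be cut off outside
  I.\<close>

lemma hahn_banach_complex_coordinates:
  fixes q :: "('i \<Rightarrow> complex) \<Rightarrow> real"
  assumes fin: "finite I"
    and sub: "\<And>x y. q (\<lambda>i. x i + y i) \<le> q x + q y"
    and hom: "\<And>c x. c \<ge> 0 \<Longrightarrow> q (\<lambda>i. complex_of_real c * x i) = c * q x"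
    and local: "\<And>x y. (\<And>i. i \<in> I \<Longrightarrow> x i = y i) \<Longrightarrow> q x = q y"
  shows "\<exists>w. (\<forall>x. Re (\<Sum>i\<in>I. w i * x i) \<le> q x) \<and> q x0 \<le> Re (\<Sum>i\<in>I. w i * x0 i)"
proof -
  define enc :: "('i \<Rightarrow> complex) \<Rightarrow> 'i \<times> bool \<Rightarrow> real" where
    "enc x = (\<lambda>(i, b). if b then Re (x i) else Im (x i))" for x
  define dec :: "('i \<times> bool \<Rightarrow> real) \<Rightarrow> 'i \<Rightarrow> complex" where
    "dec r = (\<lambda>i. Complex (r (i, True)) (r (i, False)))" for r
  have dec_enc: "dec (enc x) = x" for x
    by (simp add: enc_def dec_def)
  define p where "p r = q (dec r)" for r
  have p_sub: "p (\<lambda>i. x i + y i) \<le> p x + p y" for x y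
    using sub[of "dec x" "dec y"] by (simp add: p_def dec_def plus_complex.code)
  have p_hom: "p (\<lambda>i. c * x i) = c * p x" if "c \<ge> 0" for c x
    using hom[OF that, of "dec x"] by (simp add: p_def dec_def complex_of_real_mult_Complex)
  have "\<exists>v. \<forall>z x. (\<forall>i. i \<notin> I \<times> (UNIV :: bool set) \<longrightarrow> x i = 0) \<longrightarrow>
      z * p (enc x0) + (\<Sum>i\<in>I \<times> UNIV. v i * x i) \<le> p (\<lambda>i. z * enc x0 i + x i)"
    by (rule hahn_banach_coordinates) (use fin p_sub p_hom in auto)
  then obtain v where v: "\<And>z x. (\<And>i. i \<notin> I \<times> UNIV \<Longrightarrow> x i = 0) \<Longrightarrow>
      z * p (enc x0) + (\<Sum>i\<in>I \<times> UNIV. v i * x i) \<le> p (\<lambda>i. z * enc x0 i + x i)"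
    by blast
  \<comment> \<open>The sign makes the real part of w x the real pairing of v with the real and
    imaginary parts of x.\<close>
  define w where "w i = Complex (v (i, True)) (- v (i, False))" for i
  define cut where "cut r = (\<lambda>(i, b). if i \<in> I then r (i, b) else (0::real))" for r :: "'i \<times> bool \<Rightarrow> real"
  have sum_eq: "(\<Sum>i\<in>I \<times> UNIV. v i * cut (enc x) i) = Re (\<Sum>i\<in>I. w i * x i)" for x
  proof -
    have "(\<Sum>i\<in>I \<times> UNIV. v i * cut (enc x) i) = (\<Sum>i\<in>I. \<Sum>b\<in>UNIV. v (i, b) * cut (enc x) (i, b))"
      by (simp add: sum.cartesian_product)
    also have "\<dots> = (\<Sum>i\<in>I. Re (w i * x i))"
      by (rule sum.cong) (auto simp: UNIV_bool cut_def enc_def w_def)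
    finally show ?thesis
      by simp
  qed
  have cut0: "cut r i = 0" if "i \<notin> I \<times> UNIV" for r i
    using that by (cases i) (auto simp: cut_def)
  have "Re (\<Sum>i\<in>I. w i * x i) \<le> q x" for x
  proof -
    have "q (dec (cut (enc x))) = q x"
      by (rule local) (simp add: dec_def cut_def enc_def)
    then show ?thesis
      using v[of "cut (enc x)" 0, OF cut0] sum_eq[of x] by (simp add: p_def)
  qed
  \<comment> \<open>Taking z = 1 and x = - x0 on I leaves a vector that is 0 on I, where q
    vanishes.\<close>
  moreover have "q x0 \<le> Re (\<Sum>i\<in>I. w i * x0 i)"
  proof -
    have q0: "q (\<lambda>i. 0) = 0"
      using hom[of 0 "\<lambda>i. 0"] by simp
    have "q (dec (\<lambda>i. 1 * enc x0 i + cut (enc (\<lambda>i. - x0 i)) i)) = q (\<lambda>i. 0)"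
      by (rule local) (simp add: dec_def cut_def enc_def complex_eq_iff)
    then show ?thesis
      using v[of "cut (enc (\<lambda>i. - x0 i))" 1, OF cut0] sum_eq[of "\<lambda>i. - x0 i"] q0
      by (simp add: p_def dec_enc sum_negf)
  qed
  ultimately show ?thesis
    by blast
qed

definition psd :: "nat \<Rightarrow> (nat \<Rightarrow> nat \<Rightarrow> complex) \<Rightarrow> bool" where
  "psd n E \<longleftrightarrow> (\<forall>i<n. \<forall>j<n. E j i = cnj (E i j)) \<and>
     (\<forall>c. 0 \<le> Re (\<Sum>i<n. \<Sum>j<n. E i j * cnj (c i) * c j))"

text \<open>The inductive step is the Schur complement of the last diagonal entry (Cholesky).\<close>

lemma psd_gram:
  "psd n E \<Longrightarrow> \<exists>v. \<forall>i<n. \<forall>j<n. E i j = (\<Sum>l<n. cnj (v l i) * v l j)"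
proof (induction n arbitrary: E)
  case (Suc n)
  define d where "d = Re (E n n)"
  have herm: "E j i = cnj (E i j)" if "i < Suc n" "j < Suc n" for i j
    using Suc.prems that unfolding psd_def by blast
  have nonneg: "0 \<le> Re (\<Sum>i<Suc n. \<Sum>j<Suc n. E i j * cnj (c i) * c j)" for c
    using Suc.prems unfolding psd_def by blast
  have Enn: "E n n = complex_of_real d"
    using herm[of n n] by (simp add: d_def complex_eq_iff)
  \<comment> \<open>The last coordinate z is split off, which shows the form as a quadratic function
    of z.\<close>
  have form: "0 \<le> Re (\<Sum>i<n. \<Sum>j<n. E i j * cnj (c i) * c j) + 2 * Re (cnj z * (\<Sum>j<n. E n j * c j)) + d * (cmod z)\<^sup>2" for c z
  proof -
    define c' where "c' i = (if i = n then z else c i)" for i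
    have 1: "(\<Sum>i<n. \<Sum>j<n. E i j * cnj (c' i) * c' j) = (\<Sum>i<n. \<Sum>j<n. E i j * cnj (c i) * c j)"
      by (intro sum.cong) (auto simp: c'_def)
    have 2: "(\<Sum>j<n. E n j * cnj z * c' j) = cnj z * (\<Sum>j<n. E n j * c j)"
      by (simp add: sum_distrib_left c'_def mult_ac)
    have 3: "(\<Sum>i<n. E i n * cnj (c' i) * z) = cnj (cnj z * (\<Sum>j<n. E n j * c j))"
    proof -
      have "E i n * cnj (c' i) * z = cnj (cnj z * (E n i * c i))" if "i < n" for i
        using herm[of n i] that by (simp add: c'_def mult_ac)
      then show ?thesis
        unfolding sum_distrib_left cnj_sum by (intro sum.cong) auto
    qed
    have 4: "E n n * cnj z * z = complex_of_real (d * (cmod z)\<^sup>2)"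
      using complex_norm_square[of z] by (simp add: Enn mult_ac)
    have "(\<Sum>i<Suc n. \<Sum>j<Suc n. E i j * cnj (c' i) * c' j)
        = (\<Sum>i<n. \<Sum>j<n. E i j * cnj (c' i) * c' j) + (\<Sum>i<n. E i n * cnj (c' i) * z)
          + ((\<Sum>j<n. E n j * cnj z * c' j) + E n n * cnj z * z)"
      by (simp add: sum.distrib c'_def)
    then have "Re (\<Sum>i<Suc n. \<Sum>j<Suc n. E i j * cnj (c' i) * c' j)
        = Re (\<Sum>i<n. \<Sum>j<n. E i j * cnj (c i) * c j) + 2 * Re (cnj z * (\<Sum>j<n. E n j * c j)) + d * (cmod z)\<^sup>2"
      unfolding 1 2 3 4 by (simp del: complex_cnj_mult)
    then show ?thesis
      using nonneg[of c'] by linarith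
  qed
  have d0: "d \<ge> 0"
    using form[of "\<lambda>_. 0" 1] by simp
  show ?case
  proof (cases "d = 0")
    case True
    have E0: "E n i = 0" if i: "i < n" for i
    proof (rule ccontr)
      assume ne: "E n i \<noteq> 0"
      define r where "r = Re (E i i)"
      have delta: "(\<Sum>b<n. f b * (if b = i then 1 else 0)) = f i" for f :: "nat \<Rightarrow> complex"
      proof -
        have "(\<Sum>b<n. f b * (if b = i then 1 else 0)) = (\<Sum>b<n. if b = i then f b else 0)"
          by (intro sum.cong) auto
        then show ?thesis
          using i by simp
      qed
      have sum1: "(\<Sum>a<n. \<Sum>b<n. E a b * cnj (if a = i then 1 else 0) * (if b = i then 1 else 0)) = E i i"
      proof -
        have "(\<Sum>a<n. \<Sum>b<n. E a b * cnj (if a = i then 1 else 0) * (if b = i then 1 else 0))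
          = (\<Sum>a<n. E a i * (if a = i then 1 else 0))"
          by (intro sum.cong HOL.refl, subst delta) simp
        then show ?thesis
          by (simp only: delta)
      qed
      have sum2: "(\<Sum>b<n. E n b * (if b = i then 1 else 0)) = E n i"
        by (rule delta)
      \<comment> \<open>Chosen so that the form takes the value -1.\<close>
      define t where "t = - (r + 1) / (2 * (cmod (E n i))\<^sup>2)"
      have "0 \<le> r + 2 * Re (cnj (complex_of_real t * E n i) * E n i)"
        using form[of "\<lambda>a. if a = i then 1 else 0" "complex_of_real t * E n i"] True
        unfolding sum1 sum2 by (simp add: r_def)
      also have "cnj (complex_of_real t * E n i) * E n i = complex_of_real (t * (cmod (E n i))\<^sup>2)"
        using complex_norm_square[of "E n i"] by (simp add: mult_ac)
      finally show False
        using ne by (simp add: t_def field_simps)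
    qed
    have "psd n E"
      unfolding psd_def
    proof (intro conjI allI impI)
      show "0 \<le> Re (\<Sum>i<n. \<Sum>j<n. E i j * cnj (c i) * c j)" for c
        using form[of c 0] by simp
      show "E j i = cnj (E i j)" if "i < n" "j < n" for i j
        by (rule herm) (use that in simp_all)
    qed
    from Suc.IH[OF this] obtain v where "\<forall>i<n. \<forall>j<n. E i j = (\<Sum>l<n. cnj (v l i) * v l j)" ..
    note v = this[rule_format]
    define v' where "v' l i = (if l < n \<and> i < n then v l i else 0)" for l i
    have "E i j = (\<Sum>l<Suc n. cnj (v' l i) * v' l j)" if ij: "i < Suc n" "j < Suc n" for i j
    proof (cases "i < n \<and> j < n")
      case True
      then have "(\<Sum>l<n. cnj (v' l i) * v' l j) = (\<Sum>l<n. cnj (v l i) * v l j)"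
        by (intro sum.cong) (auto simp: v'_def)
      then have "(\<Sum>l<Suc n. cnj (v' l i) * v' l j) = (\<Sum>l<n. cnj (v l i) * v l j)"
        by (simp add: v'_def)
      then show ?thesis
        using v[of i j] True by presburger
    next
      case False
      moreover have "E i n = 0" if "i < n" for i
        using herm[of n i] E0[OF that] that by simp
      ultimately have "E i j = 0"
        using ij Enn \<open>d = 0\<close> by (auto simp: less_Suc_eq E0)
      moreover have "(\<Sum>l<Suc n. cnj (v' l i) * v' l j) = 0"
        using False by (intro sum.neutral) (auto simp: v'_def)
      ultimately show ?thesis
        by simp
    qed
    then show ?thesis
      by blast
  next
    case False
    then have dpos: "d > 0"
      using d0 by simp
    \<comment> \<open>The last row of the Gram factor; subtracting its contribution leaves the Schur
      complement E'.\<close>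
    define x where "x i = E n i / complex_of_real (sqrt d)" for i
    have sq: "complex_of_real (sqrt d) * complex_of_real (sqrt d) = complex_of_real d"
      using d0 by (simp flip: of_real_mult)
    have x_mult: "cnj (x i) * x j = cnj (E n i) * E n j / complex_of_real d" for i j
      using sq by (simp add: x_def)
    define E' where "E' i j = E i j - cnj (x i) * x j" for i j
    have "psd n E'"
      unfolding psd_def
    proof (intro conjI allI impI)
      fix i j
      assume "i < n" "j < n"
      then show "E' j i = cnj (E' i j)"
        using herm[of i j] by (simp add: E'_def mult.commute)
    next
      fix c
      define s where "s = (\<Sum>j<n. E n j * c j)"
      have "(\<Sum>i<n. \<Sum>j<n. E' i j * cnj (c i) * c j)
          = (\<Sum>i<n. \<Sum>j<n. E i j * cnj (c i) * c j) - (\<Sum>i<n. \<Sum>j<n. (cnj (E n i * c i)) * (E n j * c j) / complex_of_real d)"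
        unfolding sum_subtractf[symmetric]
        by (intro sum.cong HOL.refl, unfold E'_def x_mult) (simp add: algebra_simps)
      also have "(\<Sum>i<n. \<Sum>j<n. (cnj (E n i * c i)) * (E n j * c j) / complex_of_real d) = cnj s * s / complex_of_real d"
        unfolding s_def cnj_sum sum_product sum_divide_distrib ..
      also have "cnj s * s = complex_of_real ((cmod s)\<^sup>2)"
        using complex_norm_square[of s] by (simp add: mult.commute)
      finally have "Re (\<Sum>i<n. \<Sum>j<n. E' i j * cnj (c i) * c j)
          = Re (\<Sum>i<n. \<Sum>j<n. E i j * cnj (c i) * c j) - (cmod s)\<^sup>2 / d"
        by (simp flip: of_real_divide)
      \<comment> \<open>z = - s / d minimises the form in the last coordinate, and the minimum is
        the form of the Schur complement at c.\<close>
      moreover have "0 \<le> Re (\<Sum>i<n. \<Sum>j<n. E i j * cnj (c i) * c j) + 2 * Re (cnj (- s / complex_of_real d) * s)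
          + d * (cmod (- s / complex_of_real d))\<^sup>2"
        using form[of c "- s / complex_of_real d"] by (simp add: s_def)
      moreover have "cnj (- s / complex_of_real d) * s = complex_of_real (- ((cmod s)\<^sup>2 / d))"
        using complex_norm_square[of s] by (simp add: mult.commute)
      moreover have "d * (cmod (- s / complex_of_real d))\<^sup>2 = (cmod s)\<^sup>2 / d"
        using dpos by (simp add: norm_divide power_divide power2_eq_square)
      ultimately show "0 \<le> Re (\<Sum>i<n. \<Sum>j<n. E' i j * cnj (c i) * c j)"
        by (simp only: Re_complex_of_real)
    qed
    from Suc.IH[OF this] obtain v where "\<forall>i<n. \<forall>j<n. E' i j = (\<Sum>l<n. cnj (v l i) * v l j)" ..
    note v = this[rule_format]
    define v' where "v' l i = (if l < n then (if i < n then v l i else 0) else x i)" for l i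
    have "E i j = (\<Sum>l<Suc n. cnj (v' l i) * v' l j)" if ij: "i < Suc n" "j < Suc n" for i j
    proof (cases "i < n \<and> j < n")
      case True
      then have "(\<Sum>l<n. cnj (v' l i) * v' l j) = (\<Sum>l<n. cnj (v l i) * v l j)"
        by (intro sum.cong) (auto simp: v'_def)
      then have "(\<Sum>l<Suc n. cnj (v' l i) * v' l j) = (\<Sum>l<n. cnj (v l i) * v l j) + cnj (x i) * x j"
        by (simp add: v'_def)
      moreover have "E i j = (\<Sum>l<n. cnj (v l i) * v l j) + cnj (x i) * x j"
        using v[of i j] True by (simp add: E'_def algebra_simps)
      ultimately show ?thesis
        by presburger
    next
      case False
      then have "(\<Sum>l<n. cnj (v' l i) * v' l j) = 0"
        by (intro sum.neutral) (auto simp: v'_def)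
      moreover have "E i n = cnj (E n i)" if "i < n" for i
        using herm[of n i] that by simp
      then have "cnj (E n i) * E n j / complex_of_real d = E i j"
        using False ij dpos by (auto simp: less_Suc_eq Enn)
      ultimately show ?thesis
        using x_mult[of i j] by (simp add: v'_def)
    qed
    then show ?thesis
      by blast
  qed
qed simp

context
  fixes I :: "'i set"
  assumes fin: "finite I"
begin

text \<open>Vectors are functions on the whole index type; those in the space proper vanish off
  I.\<close>

definition vsupp :: "('i \<Rightarrow> complex) \<Rightarrow> bool" where
  "vsupp v \<longleftrightarrow> (\<forall>a. a \<notin> I \<longrightarrow> v a = 0)"

lemma mat_app_diff: "mat_app I X (\<lambda>a. v a - w a) = (\<lambda>a. mat_app I X v a - mat_app I X w a)"
  by (simp add: mat_app_def right_diff_distrib sum_subtractf)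

lemma mat_app_vsupp: "X \<in> carrier (fun_mat I) \<Longrightarrow> vsupp (mat_app I X v)"
  by (auto simp: fun_mat_def vsupp_def mat_app_def)

lemma fun_mat_eqI:
  assumes "X \<in> carrier (fun_mat I)" "Y \<in> carrier (fun_mat I)" "\<And>v. vsupp v \<Longrightarrow> mat_app I X v = mat_app I Y v"
  shows "X = Y"
proof (intro ext)
  fix a b
  show "X a b = Y a b"
  proof (cases "b \<in> I")
    case True
    have delta: "mat_app I Z (\<lambda>c. if c = b then 1 else 0) a = Z a b" for Z
      using True fin by (simp add: mat_app_def if_distrib[of "\<lambda>x. _ * x"] cong: if_cong)
    have "vsupp (\<lambda>c. if c = b then 1 else 0)"
      using True by (auto simp: vsupp_def)
    from assms(3)[OF this] show ?thesis
      using delta by metis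
  qed (use assms in \<open>auto simp: fun_mat_def\<close>)
qed

lemma ip_diff_left: "ip I (\<lambda>a. v a - w a) x = ip I v x - ip I w x"
  by (simp add: ip_def right_diff_distrib sum_subtractf)

lemma ip_diff_right: "ip I x (\<lambda>a. v a - w a) = ip I x v - ip I x w"
  by (simp add: ip_def left_diff_distrib sum_subtractf)

text \<open>Gram-Schmidt: e is the component of the next vector orthogonal to the range of R, and
  unless it is zero, the rank one projection onto e is added to R. The last clause, on vectors
  orthogonal to all the given ones, is what \<open>exchange_reflection\<close> builds on.\<close>

lemma span_projection:
  fixes d :: "nat \<Rightarrow> 'i \<Rightarrow> complex"
  assumes "\<And>i. i < n \<Longrightarrow> vsupp (d i)"
  shows "\<exists>R\<in>carrier (fun_mat I). adj R = R \<and> fmult I R R = R \<and> (\<forall>i<n. mat_app I R (d i) = d i) \<and>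
    (\<forall>v. vsupp v \<longrightarrow> (\<forall>i<n. ip I v (d i) = 0) \<longrightarrow> mat_app I R v = (\<lambda>a. 0))"
  using assms
proof (induction n)
  case 0
  show ?case
    by (intro bexI[of _ "\<lambda>a b. 0"]) (auto simp: fun_mat_def adj_def fmult_def mat_app_def)
next
  case (Suc n)
  obtain R where R: "R \<in> carrier (fun_mat I)" "adj R = R" "fmult I R R = R"
      and Rd: "\<And>i. i < n \<Longrightarrow> mat_app I R (d i) = d i"
      and R0: "\<And>v. vsupp v \<Longrightarrow> (\<And>i. i < n \<Longrightarrow> ip I v (d i) = 0) \<Longrightarrow> mat_app I R v = (\<lambda>a. 0)"
    using Suc.IH Suc.prems by force
  define e where "e = (\<lambda>a. d n a - mat_app I R (d n) a)"
  have e: "vsupp e"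
    using Suc.prems[of n] mat_app_vsupp[OF R(1)] by (auto simp: e_def vsupp_def)
  have Re: "mat_app I R e = (\<lambda>a. 0)"
    unfolding e_def mat_app_diff by (simp flip: mat_app_fmult[OF fin] add: R(3))
  show ?case
  proof (cases "e = (\<lambda>a. 0)")
    case True
    then have "mat_app I R (d n) = d n"
      by (auto simp: e_def fun_eq_iff)
    then show ?thesis
      using R Rd R0 by (intro bexI[of _ R]) (auto simp: less_Suc_eq)
  next
    case False
    define N where "N = ip I e e"
    have "vnorm I e \<noteq> 0"
    proof
      assume "vnorm I e = 0"
      then have "e a = 0" if "a \<in> I" for a
        using vnorm_member[OF fin that, of e] by simp
      then show False
        using False e by (auto simp: vsupp_def)
    qed
    then have N: "N \<noteq> 0" "cnj N = N"
      using ip_self[OF fin, of e] by (simp_all add: N_def)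
    define R' where "R' = (\<lambda>a b. R a b + e a * cnj (e b) / N)"
    have R'_in: "R' \<in> carrier (fun_mat I)"
      using R(1) e by (auto simp: R'_def fun_mat_def vsupp_def)
    have app: "mat_app I R' v = (\<lambda>a. mat_app I R v a + e a * (ip I v e / N))" for v
      by (simp add: mat_app_def R'_def ip_def distrib_left sum.distrib sum_distrib_left sum_divide_distrib mult_ac)
    have ipR: "ip I (mat_app I R v) e = 0" for v
      using ip_mat_app[OF fin, of R v e] R(2) Re by (simp add: ip_def)
    have dn: "ip I (d n) e = N"
    proof -
      have "ip I (d n) e = ip I e e + ip I (mat_app I R (d n)) e"
        by (subst (2) e_def) (simp add: ip_diff_left)
      then show ?thesis
        using ipR by (simp add: N_def)
    qed
    have "fmult I R' R' = R'"
    proof (rule fun_mat_eqI)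
      show "fmult I R' R' \<in> carrier (fun_mat I)"
        using R'_in by (auto simp: fun_mat_def fmult_def)
      fix v
      have "mat_app I R (\<lambda>a. mat_app I R v a + e a * c) = mat_app I R v" for c
      proof -
        have "mat_app I R (\<lambda>a. mat_app I R v a + e a * c) = (\<lambda>a. mat_app I R (mat_app I R v) a + mat_app I R e a * c)"
          by (simp add: mat_app_def distrib_left sum.distrib sum_distrib_right mult.assoc)
        then show ?thesis
          using Re by (simp flip: mat_app_fmult[OF fin] add: R(3))
      qed
      moreover have "ip I (\<lambda>a. mat_app I R v a + e a * c) e = c * N" for c :: complex
      proof -
        have "ip I (\<lambda>a. mat_app I R v a + e a * c) e = ip I (mat_app I R v) e + c * N"
          by (simp add: ip_def N_def distrib_left sum.distrib sum_distrib_left mult_ac)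
        then show ?thesis
          using ipR by simp
      qed
      ultimately show "mat_app I (fmult I R' R') v = mat_app I R' v"
        unfolding mat_app_fmult[OF fin] app using N by (simp only:) simp
    qed (rule R'_in)
    moreover have "adj R' = R'"
      using R(2) N(2) by (auto simp: adj_def R'_def fun_eq_iff mult.commute)
    moreover have "mat_app I R' (d i) = d i" if "i < Suc n" for i
    proof (cases "i = n")
      case True
      then show ?thesis
        using dn N by (simp add: app) (simp add: e_def)
    next
      case False
      then have "i < n"
        using that by simp
      then have "ip I (d i) e = 0"
        using ipR[of "d i"] Rd by simp
      then show ?thesis
        using Rd[OF \<open>i < n\<close>] by (simp add: app)
    qed
    moreover have "mat_app I R' v = (\<lambda>a. 0)" if v: "vsupp v" "\<forall>i<Suc n. ip I v (d i) = 0" for v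
    proof -
      have Rv: "mat_app I R v = (\<lambda>a. 0)"
        using v by (intro R0) auto
      have "ip I v (mat_app I R (d n)) = ip I (mat_app I R v) (d n)"
        using ip_mat_app[OF fin, of R v "d n"] R(2) by simp
      then have "ip I v (mat_app I R (d n)) = 0"
        by (simp add: Rv ip_def)
      then have "ip I v e = 0"
        using v(2) by (simp add: e_def ip_diff_right)
      then show ?thesis
        using Rv by (simp add: app)
    qed
    ultimately show ?thesis
      using R'_in by blast
  qed
qed

end

section \<open>Separation in the quotient\<close>

text \<open>M_n(C^T) is the direct product of T copies of M_n, so positivity is a matter of each
  coordinate s. One length p serves all coordinates.\<close>

lemma Cpow_mpos_iff:
  assumes "T > 0" and M: "M \<in> mats (Cpow T) n n"
  shows "M \<in> cstar_mpos (Cpow T) n \<longleftrightarrow>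
    (\<exists>p Z. \<forall>s<T. \<forall>i<n. \<forall>j<n. M $$ (i, j) $ s = (\<Sum>l<(p::nat). cnj (Z s l i) * Z s l j))"
proof
  assume "M \<in> cstar_mpos (Cpow T) n"
  then obtain p Y where Y: "Y \<in> mats (Cpow T) p n"
    and M_eq: "M = mat n n (\<lambda>(i, j). \<Oplus>\<^bsub>Cpow T\<^esub>l\<in>{..<p}. star (Cpow T) (Y $$ (l, i)) \<otimes>\<^bsub>Cpow T\<^esub> Y $$ (l, j))"
    by (auto simp: cstar_mpos_def)
  have Y_in: "Y $$ (l, i) \<in> carrier_vec T" if "l < p" "i < n" for l i
    using Y that by (simp add: mats_def Cpow_sel)
  have "M $$ (i, j) $ s = (\<Sum>l<p. cnj (Y $$ (l, i) $ s) * Y $$ (l, j) $ s)" if "s < T" "i < n" "j < n" for s i j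
  proof -
    have "M $$ (i, j) $ s = (\<Sum>l<p. (star (Cpow T) (Y $$ (l, i)) \<otimes>\<^bsub>Cpow T\<^esub> Y $$ (l, j)) $ s)"
      unfolding M_eq using that assms(1) by (simp add: Cpow_finsum_index) (subst Cpow_finsum_index, auto simp: Cpow_sel)
    also have "\<dots> = (\<Sum>l<p. cnj (Y $$ (l, i) $ s) * Y $$ (l, j) $ s)"
      using that carrier_vecD[OF Y_in] by (intro sum.cong) (auto simp: Cpow_sel)
    finally show ?thesis .
  qed
  then show "\<exists>p Z. \<forall>s<T. \<forall>i<n. \<forall>j<n. M $$ (i, j) $ s = (\<Sum>l<(p::nat). cnj (Z s l i) * Z s l j)"
    by (intro exI[of _ p] exI[of _ "\<lambda>s l i. Y $$ (l, i) $ s"]) simp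
next
  assume "\<exists>p Z. \<forall>s<T. \<forall>i<n. \<forall>j<n. M $$ (i, j) $ s = (\<Sum>l<(p::nat). cnj (Z s l i) * Z s l j)"
  then obtain p :: nat and Z where "\<forall>s<T. \<forall>i<n. \<forall>j<n. M $$ (i, j) $ s = (\<Sum>l<p. cnj (Z s l i) * Z s l j)"
    by (elim exE)
  note Z = this[rule_format]
  define Y where "Y = mat p n (\<lambda>(l, i). vec T (\<lambda>s. Z s l i))"
  have Y: "Y \<in> mats (Cpow T) p n"
    by (auto simp: Y_def Cpow_sel)
  have M_in: "M $$ (i, j) \<in> carrier_vec T" if "i < n" "j < n" for i j
    using M that by (simp add: mats_def Cpow_sel)
  interpret cstar_algebra "Cpow T"
    by (rule Cpow_cstar_algebra[OF assms(1)])
  have sum_in: "(\<Oplus>\<^bsub>Cpow T\<^esub>l\<in>{..<p}. star (Cpow T) (Y $$ (l, i)) \<otimes>\<^bsub>Cpow T\<^esub> Y $$ (l, j)) \<in> carrier_vec T" for i j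
    using finsum_closed[of "\<lambda>l. star (Cpow T) (Y $$ (l, i)) \<otimes>\<^bsub>Cpow T\<^esub> Y $$ (l, j)" "{..<p}"] by (auto simp: Cpow_sel)
  have "M = mat n n (\<lambda>(i, j). \<Oplus>\<^bsub>Cpow T\<^esub>l\<in>{..<p}. star (Cpow T) (Y $$ (l, i)) \<otimes>\<^bsub>Cpow T\<^esub> Y $$ (l, j))"
  proof (rule eq_matI)
    fix i j
    assume "i < dim_row (mat n n (\<lambda>(i, j). \<Oplus>\<^bsub>Cpow T\<^esub>l\<in>{..<p}. star (Cpow T) (Y $$ (l, i)) \<otimes>\<^bsub>Cpow T\<^esub> Y $$ (l, j)))"
      "j < dim_col (mat n n (\<lambda>(i, j). \<Oplus>\<^bsub>Cpow T\<^esub>l\<in>{..<p}. star (Cpow T) (Y $$ (l, i)) \<otimes>\<^bsub>Cpow T\<^esub> Y $$ (l, j)))"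
    then have ij: "i < n" "j < n"
      by auto
    have "M $$ (i, j) = (\<Oplus>\<^bsub>Cpow T\<^esub>l\<in>{..<p}. star (Cpow T) (Y $$ (l, i)) \<otimes>\<^bsub>Cpow T\<^esub> Y $$ (l, j))"
    proof (rule eq_vecI)
      fix s
      assume "s < dim_vec (\<Oplus>\<^bsub>Cpow T\<^esub>l\<in>{..<p}. star (Cpow T) (Y $$ (l, i)) \<otimes>\<^bsub>Cpow T\<^esub> Y $$ (l, j))"
      then have s: "s < T"
        using carrier_vecD[OF sum_in] by simp
      have "(\<Oplus>\<^bsub>Cpow T\<^esub>l\<in>{..<p}. star (Cpow T) (Y $$ (l, i)) \<otimes>\<^bsub>Cpow T\<^esub> Y $$ (l, j)) $ s
          = (\<Sum>l<p. (star (Cpow T) (Y $$ (l, i)) \<otimes>\<^bsub>Cpow T\<^esub> Y $$ (l, j)) $ s)"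
        using s assms(1) by (intro Cpow_finsum_index) (auto simp: Cpow_sel)
      also have "\<dots> = M $$ (i, j) $ s"
        unfolding Z[OF s ij] using s ij by (intro sum.cong) (auto simp: Cpow_sel Y_def)
      finally show "M $$ (i, j) $ s = (\<Oplus>\<^bsub>Cpow T\<^esub>l\<in>{..<p}. star (Cpow T) (Y $$ (l, i)) \<otimes>\<^bsub>Cpow T\<^esub> Y $$ (l, j)) $ s" ..
    qed (use carrier_vecD[OF sum_in] carrier_vecD[OF M_in] ij in simp)
    then show "M $$ (i, j) = mat n n (\<lambda>(i, j). \<Oplus>\<^bsub>Cpow T\<^esub>l\<in>{..<p}. star (Cpow T) (Y $$ (l, i)) \<otimes>\<^bsub>Cpow T\<^esub> Y $$ (l, j)) $$ (i, j)"
      using ij by simp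
  qed (use M in \<open>auto simp: mats_def\<close>)
  then show "M \<in> cstar_mpos (Cpow T) n"
    using Y unfolding cstar_mpos_def by blast
qed

text \<open>An array \<open>y (s, i, j)\<close> stands for the n by n matrix over \<open>Cpow (k + m)\<close> with these coordinates;
  the matrix \<open>H\<close> is the representative of the zero coset in the quotient by \<open>null_space k m\<close>.\<close>

definition amalg_cone :: "nat \<Rightarrow> nat \<Rightarrow> nat \<Rightarrow> (nat \<times> nat \<times> nat \<Rightarrow> complex) \<Rightarrow> bool" where
  "amalg_cone k m n y \<longleftrightarrow> (\<exists>p Z H. \<forall>s<k + m. \<forall>i<n. \<forall>j<n.
     y (s, i, j) = (\<Sum>l<(p :: nat). cnj (Z s l i) * Z s l j) + (if s < k then H i j else - H i j))"

definition unit_array :: "real \<Rightarrow> nat \<times> nat \<times> nat \<Rightarrow> complex" where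
  "unit_array t = (\<lambda>(s, i, j). if i = j then complex_of_real t else 0)"

text \<open>The Hermitian part of every coordinate matrix. It extends the gauge used in
  \<open>separation\<close> to arbitrary arrays, so that the Hahn-Banach lemma applies without
  restriction to a real subspace.\<close>

definition herm :: "(nat \<times> nat \<times> nat \<Rightarrow> complex) \<Rightarrow> nat \<times> nat \<times> nat \<Rightarrow> complex" where
  "herm x = (\<lambda>(s, i, j). (x (s, i, j) + cnj (x (s, j, i))) / 2)"

lemma amalg_coneI:
  "(\<And>s i j. s < k + m \<Longrightarrow> i < n \<Longrightarrow> j < n \<Longrightarrow>
     y (s, i, j) = (\<Sum>l<(p :: nat). cnj (Z s l i) * Z s l j) + (if s < k then H i j else - H i j)) \<Longrightarrow> amalg_cone k m n y"
  unfolding amalg_cone_def by (intro exI[of _ p] exI[of _ Z] exI[of _ H]) blast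

lemma amalg_coneE:
  assumes "amalg_cone k m n y"
  obtains p :: nat and Z H where "\<And>s i j. s < k + m \<Longrightarrow> i < n \<Longrightarrow> j < n \<Longrightarrow>
     y (s, i, j) = (\<Sum>l<p. cnj (Z s l i) * Z s l j) + (if s < k then H i j else - H i j)"
proof -
  obtain p :: nat and Z H where "\<forall>s<k + m. \<forall>i<n. \<forall>j<n.
     y (s, i, j) = (\<Sum>l<p. cnj (Z s l i) * Z s l j) + (if s < k then H i j else - H i j)"
    using assms unfolding amalg_cone_def by (elim exE)
  then show thesis
    by (intro that[where p = p and Z = Z and H = H]) simp
qed

lemma amalg_cone_cong:
  assumes "amalg_cone k m n x" "\<And>s i j. s < k + m \<Longrightarrow> i < n \<Longrightarrow> j < n \<Longrightarrow> y (s, i, j) = x (s, i, j)"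
  shows "amalg_cone k m n y"
proof -
  obtain p :: nat and Z H where "\<And>s i j. s < k + m \<Longrightarrow> i < n \<Longrightarrow> j < n \<Longrightarrow>
     x (s, i, j) = (\<Sum>l<p. cnj (Z s l i) * Z s l j) + (if s < k then H i j else - H i j)"
    using assms(1) by (rule amalg_coneE) blast
  then show ?thesis
    by (intro amalg_coneI[where p = p and Z = Z and H = H]) (simp add: assms(2))
qed

lemma sum_lessThan_add:
  fixes f :: "nat \<Rightarrow> complex"
  shows "(\<Sum>l<p + q. f l) = (\<Sum>l<p. f l) + (\<Sum>l<q. f (p + l))"
  by (induction q) (auto simp: add.assoc)

lemma amalg_cone_add:
  assumes "amalg_cone k m n x" "amalg_cone k m n y"
  shows "amalg_cone k m n (\<lambda>a. x a + y a)"
proof -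
  obtain p :: nat and Z H where x: "\<And>s i j. s < k + m \<Longrightarrow> i < n \<Longrightarrow> j < n \<Longrightarrow>
     x (s, i, j) = (\<Sum>l<p. cnj (Z s l i) * Z s l j) + (if s < k then H i j else - H i j)"
    using assms(1) by (rule amalg_coneE) blast
  obtain q :: nat and W G where y: "\<And>s i j. s < k + m \<Longrightarrow> i < n \<Longrightarrow> j < n \<Longrightarrow>
     y (s, i, j) = (\<Sum>l<q. cnj (W s l i) * W s l j) + (if s < k then G i j else - G i j)"
    using assms(2) by (rule amalg_coneE) blast
  show ?thesis
  proof (rule amalg_coneI[where p = "p + q" and Z = "\<lambda>s l i. if l < p then Z s l i else W s (l - p) i"
        and H = "\<lambda>i j. H i j + G i j"])
    fix s i j
    assume "s < k + m" "i < n" "j < n"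
    then show "x (s, i, j) + y (s, i, j) = (\<Sum>l<p + q. cnj (if l < p then Z s l i else W s (l - p) i) *
        (if l < p then Z s l j else W s (l - p) j)) + (if s < k then H i j + G i j else - (H i j + G i j))"
      by (simp add: sum_lessThan_add x y)
  qed
qed

lemma amalg_cone_scale:
  assumes "amalg_cone k m n x" "c \<ge> 0"
  shows "amalg_cone k m n (\<lambda>a. complex_of_real c * x a)"
proof -
  obtain p :: nat and Z H where x: "\<And>s i j. s < k + m \<Longrightarrow> i < n \<Longrightarrow> j < n \<Longrightarrow>
     x (s, i, j) = (\<Sum>l<p. cnj (Z s l i) * Z s l j) + (if s < k then H i j else - H i j)"
    using assms(1) by (rule amalg_coneE) blast
  have sq: "complex_of_real (sqrt c) * complex_of_real (sqrt c) = complex_of_real c"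
    using assms(2) by (simp flip: of_real_mult)
  have "complex_of_real c * (\<Sum>l<p. cnj (Z s l i) * Z s l j)
    = (\<Sum>l<p. cnj (complex_of_real (sqrt c) * Z s l i) * (complex_of_real (sqrt c) * Z s l j))" for s i j
    unfolding sq[symmetric] sum_distrib_left by (intro sum.cong) (auto simp: mult_ac)
  then show ?thesis
    by (intro amalg_coneI[where p = p and Z = "\<lambda>s l i. complex_of_real (sqrt c) * Z s l i" and H = "\<lambda>i j. complex_of_real c * H i j"])
      (simp add: x distrib_left del: complex_cnj_mult)
qed

lemma amalg_cone_unit:
  assumes "t \<ge> 0"
  shows "amalg_cone k m n (unit_array t)"
proof (rule amalg_coneI[where p = n and Z = "\<lambda>s l i. if l = i then complex_of_real (sqrt t) else 0" and H = "\<lambda>i j. 0"])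
  fix s i j
  assume ij: "i < n" "j < n"
  have "(\<Sum>l<n. cnj (if l = i then complex_of_real (sqrt t) else 0) * (if l = j then complex_of_real (sqrt t) else 0))
      = (\<Sum>l<n. if l = i then (if i = j then complex_of_real (sqrt t) * complex_of_real (sqrt t) else 0) else 0)"
    by (intro sum.cong) auto
  then show "unit_array t (s, i, j) = (\<Sum>l<n. cnj (if l = i then complex_of_real (sqrt t) else 0) *
      (if l = j then complex_of_real (sqrt t) else 0)) + (if s < k then 0 else - 0)"
    using ij assms by (simp add: unit_array_def flip: of_real_mult)
qed

text \<open>These are the elements on which the separating functional is tested for positive
  semidefiniteness; those of \<open>amalg_cone_null\<close> test the equality of the two
  sums.\<close>

lemma amalg_cone_rank_one:
  "amalg_cone k m n (\<lambda>(s, i, j). if s = s0 then cnj (c i) * c j else 0)"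
  by (rule amalg_coneI[where p = 1 and Z = "\<lambda>s l i. if s = s0 then c i else 0" and H = "\<lambda>i j. 0"]) auto

lemma amalg_cone_null: "amalg_cone k m n (\<lambda>(s, i, j). if s < k then H i j else - H i j)"
  by (rule amalg_coneI[where p = 0 and H = H]) auto

text \<open>The order unit property of the matrix cone of \<open>Cpow (k + m)\<close> already gives
  such a t, with H = 0.\<close>

lemma amalg_cone_order_unit:
  assumes "k > 0" and herm: "\<And>s i j. s < k + m \<Longrightarrow> i < n \<Longrightarrow> j < n \<Longrightarrow> y (s, j, i) = cnj (y (s, i, j))"
  shows "\<exists>t\<ge>0. amalg_cone k m n (\<lambda>a. unit_array t a + y a)"
proof -
  let ?T = "k + m"
  have T: "?T > 0"
    using assms(1) by simp
  interpret cstar_algebra "Cpow ?T"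
    by (rule Cpow_cstar_algebra[OF T])
  define X where "X = mat n n (\<lambda>(i, j). vec ?T (\<lambda>s. y (s, i, j)))"
  have X: "X \<in> mats (Cpow ?T) n n"
    by (auto simp: X_def Cpow_sel)
  have "madjoint (Cpow ?T) X = X"
    unfolding X_def by (auto simp: Cpow_sel intro!: mat_eqI eq_vecI herm[symmetric])
  from cstar_mpos_order_unit[OF X this]
  obtain t where t: "t > 0" "madd (Cpow ?T) X (mdiag (Cpow ?T) n (complex_of_real t)) \<in> cstar_mpos (Cpow ?T) n"
    by blast
  obtain p :: nat and Z where "\<forall>s<?T. \<forall>i<n. \<forall>j<n.
      madd (Cpow ?T) X (mdiag (Cpow ?T) n (complex_of_real t)) $$ (i, j) $ s = (\<Sum>l<p. cnj (Z s l i) * Z s l j)"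
    using iffD1[OF Cpow_mpos_iff[OF T madd_in[OF X mdiag_in]] t(2)] by (elim exE)
  note Z = this[rule_format]
  have "amalg_cone k m n (\<lambda>a. unit_array t a + y a)"
  proof (rule amalg_coneI[where p = p and Z = Z and H = "\<lambda>i j. 0"])
    fix s i j
    assume sij: "s < ?T" "i < n" "j < n"
    then show "unit_array t (s, i, j) + y (s, i, j) = (\<Sum>l<p. cnj (Z s l i) * Z s l j) + (if s < k then 0 else - 0)"
      unfolding Z[OF sij, symmetric] by (simp add: X_def mdiag_def unit_array_def Cpow_sel)
  qed
  then show ?thesis
    using t(1) by (intro exI[of _ t]) simp
qed

lemma herm_hermitian: "herm x (s, j, i) = cnj (herm x (s, i, j))"
  by (simp add: herm_def)

text \<open>The gauge q y is the infimum of the t \<ge> 0 for which t minus the Hermitian part of y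
  lies in the cone. Since x + \<epsilon> is outside the cone, q (- x) \<ge> \<epsilon>, and a
  functional dominated by q that attains q at - x has negative real part at x. On elements with
  Hermitian part in the cone its real part is nonnegative: rank one members give positive
  semidefiniteness, and the null elements, which lie in the cone with both signs, give the equality
  of the two sums.\<close>

lemma separation:
  assumes k: "k > 0" and x: "\<And>s i j. s < k + m \<Longrightarrow> i < n \<Longrightarrow> j < n \<Longrightarrow> x (s, j, i) = cnj (x (s, i, j))"
    and "\<epsilon> > 0" and not: "\<not> amalg_cone k m n (\<lambda>a. x a + unit_array \<epsilon> a)"
  obtains E where "\<And>s. s < k + m \<Longrightarrow> psd n (E s)"
    "\<And>i j. i < n \<Longrightarrow> j < n \<Longrightarrow> (\<Sum>s<k. E s i j) = (\<Sum>s<m. E (k + s) i j)"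
    "Re (\<Sum>s<k + m. \<Sum>i<n. \<Sum>j<n. E s i j * x (s, i, j)) < 0"
proof -
  let ?T = "k + m"
  let ?I = "{..<?T} \<times> {..<n} \<times> {..<n}"
  let ?K = "amalg_cone k m n"
  define S where "S y = {t. t \<ge> 0 \<and> ?K (\<lambda>a. unit_array t a - herm y a)}" for y
  define q where "q y = Inf (S y)" for y
  have S_ne: "S y \<noteq> {}" for y
  proof -
    have "\<exists>t\<ge>0. ?K (\<lambda>a. unit_array t a + (- herm y a))"
      by (rule amalg_cone_order_unit[OF k]) (subst herm_hermitian, simp)
    then show ?thesis
      by (simp add: S_def)
  qed
  have bdd: "bdd_below (S y)" for y
    by (rule bdd_belowI[of _ 0]) (auto simp: S_def)
  have q_le: "q y \<le> t" if "t \<ge> 0" "?K (\<lambda>a. unit_array t a - herm y a)" for y t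
    unfolding q_def using that bdd by (intro cInf_lower) (auto simp: S_def)
  have q_nonneg: "0 \<le> q y" for y
    unfolding q_def using S_ne by (intro cInf_greatest) (auto simp: S_def)
  have q_sub: "q (\<lambda>a. y a + z a) \<le> q y + q z" for y z
  proof -
    have sum: "q (\<lambda>a. y a + z a) \<le> t + t'" if t: "t \<in> S y" and t': "t' \<in> S z" for t t'
    proof (rule q_le)
      have "?K (\<lambda>a. (unit_array t a - herm y a) + (unit_array t' a - herm z a))"
        using t t' by (intro amalg_cone_add) (auto simp: S_def)
      then show "?K (\<lambda>a. unit_array (t + t') a - herm (\<lambda>a. y a + z a) a)"
        by (rule amalg_cone_cong) (auto simp: unit_array_def herm_def field_simps)
    qed (use t t' in \<open>auto simp: S_def\<close>)
    have "q (\<lambda>a. y a + z a) - t \<le> q z" if "t \<in> S y" for t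
      unfolding q_def[of z] using sum[OF that] by (intro cInf_greatest S_ne) (simp add: algebra_simps)
    then have "q (\<lambda>a. y a + z a) - q z \<le> q y"
      unfolding q_def[of y] by (intro cInf_greatest S_ne) (simp add: algebra_simps)
    then show ?thesis
      by simp
  qed
  have q0: "q y = 0" if "?K (\<lambda>a. - herm y a)" for y
  proof -
    have "?K (\<lambda>a. unit_array 0 a - herm y a)"
      using that by (rule amalg_cone_cong) (simp add: unit_array_def)
    then show ?thesis
      using q_le[of 0 y] q_nonneg[of y] by simp
  qed
  have q_scale_le: "q (\<lambda>a. complex_of_real c * y a) \<le> c * q y" if c: "c > 0" for c y
  proof -
    have "q (\<lambda>a. complex_of_real c * y a) / c \<le> t" if t: "t \<in> S y" for t
    proof -
      have "?K (\<lambda>a. complex_of_real c * (unit_array t a - herm y a))"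
        using t c by (intro amalg_cone_scale) (auto simp: S_def)
      then have "?K (\<lambda>a. unit_array (c * t) a - herm (\<lambda>a. complex_of_real c * y a) a)"
        by (rule amalg_cone_cong) (auto simp: unit_array_def herm_def field_simps)
      then have "q (\<lambda>a. complex_of_real c * y a) \<le> c * t"
        using t c by (intro q_le) (auto simp: S_def)
      then show ?thesis
        using c by (simp add: divide_le_eq mult.commute)
    qed
    then have "q (\<lambda>a. complex_of_real c * y a) / c \<le> q y"
      unfolding q_def[of y] by (intro cInf_greatest S_ne)
    then show ?thesis
      using c by (simp add: divide_le_eq mult.commute)
  qed
  have q_hom: "q (\<lambda>a. complex_of_real c * y a) = c * q y" if "c \<ge> 0" for c y
  proof (cases "c = 0")
    case True
    have "?K (\<lambda>a. - herm (\<lambda>a. 0) a)"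
      by (rule amalg_cone_cong[OF amalg_cone_null[of k m n "\<lambda>i j. 0"]]) (simp add: herm_def)
    then show ?thesis
      using q0[of "\<lambda>a. 0"] True by simp
  next
    case False
    then have c: "c > 0"
      using that by simp
    have "q (\<lambda>a. complex_of_real (1 / c) * (complex_of_real c * y a)) \<le> 1 / c * q (\<lambda>a. complex_of_real c * y a)"
      using c by (intro q_scale_le) simp
    then have "c * q y \<le> q (\<lambda>a. complex_of_real c * y a)"
      using c by (simp add: field_simps)
    then show ?thesis
      using q_scale_le[OF c, of y] by simp
  qed
  have q_local: "q y = q z" if eq: "\<And>a. a \<in> ?I \<Longrightarrow> y a = z a" for y z
  proof -
    have "?K (\<lambda>a. unit_array t a - herm y a) \<longleftrightarrow> ?K (\<lambda>a. unit_array t a - herm z a)" for t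
      by (rule iffI; erule amalg_cone_cong) (auto simp: herm_def eq)
    then show ?thesis
      by (simp add: q_def S_def)
  qed
  have herm_x: "herm x (s, i, j) = x (s, i, j)" if "s < ?T" "i < n" "j < n" for s i j
    using x[OF that] by (simp add: herm_def)
  have eps: "\<epsilon> \<le> q (\<lambda>a. - x a)"
    unfolding q_def
  proof (rule cInf_greatest[OF S_ne])
    fix t
    assume "t \<in> S (\<lambda>a. - x a)"
    then have t: "t \<ge> 0" "?K (\<lambda>a. unit_array t a - herm (\<lambda>a. - x a) a)"
      by (auto simp: S_def)
    show "\<epsilon> \<le> t"
    proof (rule ccontr)
      assume "\<not> \<epsilon> \<le> t"
      \<comment> \<open>If t < \<epsilon>, then x + \<epsilon> is a member of the cone plus
        \<epsilon> - t times the unit.\<close>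
      then have "?K (\<lambda>a. (unit_array t a - herm (\<lambda>a. - x a) a) + unit_array (\<epsilon> - t) a)"
        by (intro amalg_cone_add t amalg_cone_unit) simp
      then have "?K (\<lambda>a. x a + unit_array \<epsilon> a)"
        by (rule amalg_cone_cong) (use herm_x in \<open>auto simp: herm_def unit_array_def\<close>)
      then show False
        using not by blast
    qed
  qed
  have "\<exists>w. (\<forall>y. Re (\<Sum>a\<in>?I. w a * y a) \<le> q y) \<and> q (\<lambda>a. - x a) \<le> Re (\<Sum>a\<in>?I. w a * - x a)"
    by (rule hahn_banach_complex_coordinates) (auto intro: q_sub q_hom q_local)
  then obtain w where w: "\<And>y. Re (\<Sum>a\<in>?I. w a * y a) \<le> q y" "q (\<lambda>a. - x a) \<le> Re (\<Sum>a\<in>?I. w a * - x a)"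
    by blast
  have sum_I: "(\<Sum>a\<in>?I. g a) = (\<Sum>s<?T. \<Sum>i<n. \<Sum>j<n. g (s, i, j))" for g :: "nat \<times> nat \<times> nat \<Rightarrow> complex"
    by (simp add: sum.cartesian_product)
  have w_pos: "0 \<le> Re (\<Sum>a\<in>?I. w a * y a)" if "?K (herm y)" for y
  proof -
    have "?K (\<lambda>a. - herm (\<lambda>a. - y a) a)"
      using that by (rule amalg_cone_cong) (simp add: herm_def field_simps)
    then show ?thesis
      using w(1)[of "\<lambda>a. - y a"] q0[of "\<lambda>a. - y a"] by (simp add: sum_negf)
  qed
  \<comment> \<open>The Hermitian part of the functional has the same real part on Hermitian
    arrays.\<close>
  define E where "E s i j = (w (s, i, j) + cnj (w (s, j, i))) / 2" for s i j
  have E_sum: "Re (\<Sum>s<?T. \<Sum>i<n. \<Sum>j<n. E s i j * y (s, i, j)) = Re (\<Sum>a\<in>?I. w a * y a)"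
    if y: "\<And>s i j. s < ?T \<Longrightarrow> i < n \<Longrightarrow> j < n \<Longrightarrow> y (s, j, i) = cnj (y (s, i, j))" for y
  proof -
    have "Re (\<Sum>i<n. \<Sum>j<n. E s i j * y (s, i, j)) = Re (\<Sum>i<n. \<Sum>j<n. w (s, i, j) * y (s, i, j))" if s: "s < ?T" for s
    proof -
      define z where "z = (\<Sum>i<n. \<Sum>j<n. w (s, i, j) * y (s, i, j))"
      have "cnj (w (s, j, i)) * y (s, i, j) = cnj (w (s, j, i) * y (s, j, i))" if "i < n" "j < n" for i j
        using y[OF s that(2,1)] by simp
      then have "(\<Sum>i<n. \<Sum>j<n. cnj (w (s, j, i)) * y (s, i, j)) = (\<Sum>i<n. \<Sum>j<n. cnj (w (s, j, i) * y (s, j, i)))"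
        by (intro sum.cong HOL.refl) auto
      also have "\<dots> = (\<Sum>j<n. \<Sum>i<n. cnj (w (s, j, i) * y (s, j, i)))"
        by (rule sum.swap)
      also have "\<dots> = cnj z"
        by (simp only: z_def cnj_sum)
      finally have cnj_z: "(\<Sum>i<n. \<Sum>j<n. cnj (w (s, j, i)) * y (s, i, j)) = cnj z" .
      have "(\<Sum>i<n. \<Sum>j<n. E s i j * y (s, i, j)) = (\<Sum>i<n. \<Sum>j<n. (w (s, i, j) * y (s, i, j) + cnj (w (s, j, i)) * y (s, i, j)) / 2)"
        by (intro sum.cong HOL.refl) (auto simp: E_def field_simps)
      also have "\<dots> = (z + cnj z) / 2"
        unfolding cnj_z[symmetric] unfolding z_def by (simp add: sum.distrib sum_divide_distrib[symmetric])
      finally show ?thesis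
        unfolding z_def[symmetric] by (simp only:) simp
    qed
    then show ?thesis
      unfolding sum_I Re_sum[of _ "{..<?T}"] by (intro sum.cong HOL.refl) (simp only: lessThan_iff)
  qed
  show thesis
  proof (rule that)
    fix s0
    assume s0: "s0 < ?T"
    show "psd n (E s0)"
      unfolding psd_def
    proof (intro conjI allI impI)
      show "E s0 j i = cnj (E s0 i j)" for i j
        by (simp add: E_def add.commute)
      fix c
      define y :: "nat \<times> nat \<times> nat \<Rightarrow> complex" where "y = (\<lambda>(s, i, j). if s = s0 then cnj (c i) * c j else 0)"
      have "?K (herm y)"
        by (rule amalg_cone_cong[OF amalg_cone_rank_one[of k m n s0 c]]) (auto simp: herm_def y_def mult.commute)
      then have "0 \<le> Re (\<Sum>a\<in>?I. w a * y a)"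
        by (rule w_pos)
      also have "Re (\<Sum>a\<in>?I. w a * y a) = Re (\<Sum>s<?T. \<Sum>i<n. \<Sum>j<n. E s i j * y (s, i, j))"
        by (rule E_sum[symmetric]) (auto simp: y_def mult.commute)
      also have "(\<Sum>s<?T. \<Sum>i<n. \<Sum>j<n. E s i j * y (s, i, j)) = (\<Sum>s<?T. if s = s0 then (\<Sum>i<n. \<Sum>j<n. E s0 i j * cnj (c i) * c j) else 0)"
        by (intro sum.cong HOL.refl) (auto simp: y_def mult.assoc)
      also have "\<dots> = (\<Sum>i<n. \<Sum>j<n. E s0 i j * cnj (c i) * c j)"
        using s0 by simp
      finally show "0 \<le> Re (\<Sum>i<n. \<Sum>j<n. E s0 i j * cnj (c i) * c j)" .
    qed
  next
    fix i0 j0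
    assume ij0: "i0 < n" "j0 < n"
    have w0: "(\<Sum>s<?T. (if s < k then 1 else - 1) * w (s, i, j)) = 0" if ij: "i < n" "j < n" for i j
    proof -
      define W where "W = (\<Sum>s<?T. (if s < k then 1 else - 1) * w (s, i, j))"
      \<comment> \<open>The entry c of the null element at (i, j) may be any complex number, and W =
        0 is the only W for which c W always has nonnegative real part.\<close>
      have nonneg: "0 \<le> Re (c * W)" for c
      proof -
        define H where "H = (\<lambda>a b. if a = i \<and> b = j then c else 0)"
        define y :: "nat \<times> nat \<times> nat \<Rightarrow> complex" where "y = (\<lambda>(s, a, b). if s < k then H a b else - H a b)"
        have "?K (herm y)"
          by (rule amalg_cone_cong[OF amalg_cone_null[of k m n "\<lambda>a b. (H a b + cnj (H b a)) / 2"]])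
            (simp add: herm_def y_def field_simps)
        then have "0 \<le> Re (\<Sum>a\<in>?I. w a * y a)"
          by (rule w_pos)
        also have "(\<Sum>a\<in>?I. w a * y a) = (\<Sum>s<?T. \<Sum>a<n. \<Sum>b<n. if b = j then (if a = i then w (s, i, j) * y (s, i, j) else 0) else 0)"
          unfolding sum_I by (intro sum.cong HOL.refl) (simp add: y_def H_def)
        also have "\<dots> = (\<Sum>s<?T. w (s, i, j) * y (s, i, j))"
          using ij by simp
        also have "\<dots> = c * W"
          unfolding W_def sum_distrib_left by (intro sum.cong HOL.refl) (simp add: y_def H_def mult.commute)
        finally show ?thesis .
      qed
      have "Re W = 0" "Im W = 0"
        using nonneg[of 1] nonneg[of "- 1"] nonneg[of \<i>] nonneg[of "- \<i>"] by auto
      then have "W = 0"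
        by (simp add: complex_eq_iff)
      then show ?thesis
        by (simp only: W_def)
    qed
    have "(\<Sum>s<?T. (if s < k then 1 else - 1) * E s i0 j0)
       = ((\<Sum>s<?T. (if s < k then 1 else - 1) * w (s, i0, j0)) + cnj (\<Sum>s<?T. (if s < k then 1 else - 1) * w (s, j0, i0))) / 2"
      unfolding cnj_sum sum.distrib[symmetric] sum_divide_distrib by (intro sum.cong) (auto simp: E_def field_simps)
    then have "(\<Sum>s<?T. (if s < k then 1 else - 1) * E s i0 j0) = 0"
      using w0 ij0 by simp
    moreover have "(\<Sum>s<?T. (if s < k then 1 else - 1) * E s i0 j0) = (\<Sum>s<k. E s i0 j0) - (\<Sum>s<m. E (k + s) i0 j0)"
      by (simp add: sum_lessThan_add sum_negf)
    ultimately show "(\<Sum>s<k. E s i0 j0) = (\<Sum>s<m. E (k + s) i0 j0)"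
      by simp
  next
    have "0 < Re (\<Sum>a\<in>?I. w a * - x a)"
      using w(2) eps \<open>\<epsilon> > 0\<close> by linarith
    then show "Re (\<Sum>s<?T. \<Sum>i<n. \<Sum>j<n. E s i j * x (s, i, j)) < 0"
      using E_sum[of x, OF x] by (simp add: sum_negf)
  qed
qed

section \<open>Dilation to a representation of the free product\<close>

lemma (in cstar_algebra) conj_hom:
  assumes U: "U \<in> carrier A" "star A U = U" "U \<otimes> U = \<one>"
  shows "cstar_hom A A (\<lambda>x. U \<otimes> x \<otimes> U)"
proof -
  have mult: "U \<otimes> (x \<otimes> y) \<otimes> U = U \<otimes> x \<otimes> U \<otimes> (U \<otimes> y \<otimes> U)" if "x \<in> carrier A" "y \<in> carrier A" for x y
  proof -
    have "U \<otimes> x \<otimes> U \<otimes> (U \<otimes> y \<otimes> U) = U \<otimes> x \<otimes> (U \<otimes> U) \<otimes> y \<otimes> U"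
      using U(1) that by algebra
    then show ?thesis
      using U that by (simp add: m_assoc)
  qed
  have star: "U \<otimes> star A x \<otimes> U = star A (U \<otimes> x \<otimes> U)" if "x \<in> carrier A" for x
    using U(1,2) that by (simp add: star_mult star_closed m_assoc)
  have "U \<otimes> (x \<oplus> y) \<otimes> U = U \<otimes> x \<otimes> U \<oplus> U \<otimes> y \<otimes> U" if "x \<in> carrier A" "y \<in> carrier A" for x y
    using U(1) that by (simp add: l_distr r_distr)
  then show ?thesis
    unfolding cstar_hom_def Ring.ring_hom_def using U
    by (simp add: mult star smult_mult_left smult_mult_right)
qed

definition fun_diag :: "'i set \<Rightarrow> ('i \<Rightarrow> complex) \<Rightarrow> 'i \<Rightarrow> 'i \<Rightarrow> complex" where
  "fun_diag I d = (\<lambda>a b. if a = b \<and> a \<in> I then d a else 0)"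

lemma mat_app_diag:
  assumes "finite I"
  shows "mat_app I (fun_diag I d) v a = (if a \<in> I then d a * v a else 0)"
proof -
  have "mat_app I (fun_diag I d) v a = (\<Sum>b\<in>I. if b = a then d a * v a else 0)"
    unfolding mat_app_def by (intro sum.cong) (auto simp: fun_diag_def)
  then show ?thesis
    using assms by simp
qed

text \<open>C^k acts on the basis vector with index a by its coordinate \<tau> a.\<close>

lemma diag_hom:
  assumes "finite I" and \<tau>: "\<And>a. a \<in> I \<Longrightarrow> \<tau> a < k"
  shows "cstar_hom (Cpow k) (fun_mat I) (\<lambda>x. fun_diag I (\<lambda>a. x $ \<tau> a))"
proof -
  have "fmult I (fun_diag I d) (fun_diag I d') = fun_diag I (\<lambda>a. d a * d' a)" for d d'
  proof (intro ext)
    fix a b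
    have "fmult I (fun_diag I d) (fun_diag I d') a b = (\<Sum>c\<in>I. if c = a then fun_diag I (\<lambda>a. d a * d' a) a b else 0)"
      unfolding fmult_def by (intro sum.cong) (auto simp: fun_diag_def)
    then show "fmult I (fun_diag I d) (fun_diag I d') a b = fun_diag I (\<lambda>a. d a * d' a) a b"
      using assms(1) by (simp add: fun_diag_def)
  qed
  then show ?thesis
    using \<tau> by (auto simp: cstar_hom_def Ring.ring_hom_def fun_mat_def Cpow_sel fun_diag_def adj_def fun_eq_iff)
qed

lemma ip_sum_left: "ip I (\<lambda>a. \<Sum>j\<in>J. v j a) w = (\<Sum>j\<in>J. ip I (v j) w)"
  by (simp add: ip_def sum_distrib_left, rule sum.swap)

lemma ip_sum_right: "ip I v (\<lambda>a. \<Sum>j\<in>J. w j a) = (\<Sum>j\<in>J. ip I v (w j))"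
  by (simp add: ip_def sum_distrib_right, rule sum.swap)

lemma ip_add_left: "ip I (\<lambda>a. v a + w a) x = ip I v x + ip I w x"
  by (simp add: ip_def distrib_left sum.distrib)

lemma fun_mat_finsum:
  assumes "finite I" "finite L" "\<And>l. l \<in> L \<Longrightarrow> F l \<in> carrier (fun_mat I)"
  shows "finsum (fun_mat I) F L a b = (\<Sum>l\<in>L. F l a b)"
proof -
  interpret cstar_algebra "fun_mat I"
    by (rule fun_mat_cstar_algebra[OF assms(1)])
  show ?thesis
    using assms(2,3)
  proof (induction rule: finite_induct)
    case empty
    then show ?case
      by simp (simp add: fun_mat_def)
  next
    case (insert l L)
    then have "F \<in> L \<rightarrow> carrier (fun_mat I)" "F l \<in> carrier (fun_mat I)"
      by auto
    then have "finsum (fun_mat I) F (insert l L) = F l \<oplus>\<^bsub>fun_mat I\<^esub> finsum (fun_mat I) F L"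
      using insert by simp
    then show ?case
      using insert by (simp add: fun_mat_def)
  qed
qed

text \<open>For T = Y* Y the form is the sum over l of the squared norms of the vectors obtained by
  adding up Y (l, j) \<xi> j over j.\<close>

lemma fun_mat_mpos_form:
  assumes I: "finite I" and T: "T \<in> cstar_mpos (fun_mat I) n"
  shows "0 \<le> Re (\<Sum>i<n. \<Sum>j<n. ip I (mat_app I (T $$ (i, j)) (\<xi> j)) (\<xi> i))"
proof -
  interpret cstar_algebra "fun_mat I"
    by (rule fun_mat_cstar_algebra[OF I])
  obtain p Y where Y: "Y \<in> mats (fun_mat I) p n"
    and T_eq: "T = mat n n (\<lambda>(i, j). \<Oplus>\<^bsub>fun_mat I\<^esub>l\<in>{..<p}. star (fun_mat I) (Y $$ (l, i)) \<otimes>\<^bsub>fun_mat I\<^esub> Y $$ (l, j))"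
    using T by (auto simp: cstar_mpos_def)
  define y where "y l j = mat_app I (Y $$ (l, j)) (\<xi> j)" for l j
  have Y_in: "Y $$ (l, j) \<in> carrier (fun_mat I)" if "l < p" "j < n" for l j
    using Y that by (simp add: mats_def)
  have "ip I (mat_app I (T $$ (i, j)) (\<xi> j)) (\<xi> i) = (\<Sum>l<p. ip I (y l j) (y l i))" if ij: "i < n" "j < n" for i j
  proof -
    have "T $$ (i, j) = (\<lambda>a b. \<Sum>l<p. fmult I (adj (Y $$ (l, i))) (Y $$ (l, j)) a b)"
    proof (intro ext)
      fix a b
      have "(T $$ (i, j)) a b = (\<Sum>l<p. (star (fun_mat I) (Y $$ (l, i)) \<otimes>\<^bsub>fun_mat I\<^esub> Y $$ (l, j)) a b)"
        using ij Y_in by (simp add: T_eq) (intro fun_mat_finsum I, auto simp: star_closed)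
      then show "(T $$ (i, j)) a b = (\<Sum>l<p. fmult I (adj (Y $$ (l, i))) (Y $$ (l, j)) a b)"
        by (simp add: fun_mat_def)
    qed
    then have "mat_app I (T $$ (i, j)) (\<xi> j) = (\<lambda>a. \<Sum>l<p. mat_app I (fmult I (adj (Y $$ (l, i))) (Y $$ (l, j))) (\<xi> j) a)"
      by (simp add: mat_app_def sum_distrib_right) (intro ext sum.swap)
    then have "ip I (mat_app I (T $$ (i, j)) (\<xi> j)) (\<xi> i)
        = (\<Sum>l<p. ip I (mat_app I (adj (Y $$ (l, i))) (y l j)) (\<xi> i))"
      by (simp only: ip_sum_left mat_app_fmult[OF I] y_def)
    also have "\<dots> = (\<Sum>l<p. ip I (y l j) (y l i))"
      by (simp only: ip_mat_app[OF I] adj_def complex_cnj_cnj y_def)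
    finally show ?thesis .
  qed
  then have "(\<Sum>i<n. \<Sum>j<n. ip I (mat_app I (T $$ (i, j)) (\<xi> j)) (\<xi> i)) = (\<Sum>i<n. \<Sum>j<n. \<Sum>l<p. ip I (y l j) (y l i))"
    by (intro sum.cong HOL.refl) simp
  also have "\<dots> = (\<Sum>i<n. \<Sum>l<p. \<Sum>j<n. ip I (y l j) (y l i))"
    by (intro sum.cong[OF HOL.refl] sum.swap)
  also have "\<dots> = (\<Sum>l<p. \<Sum>i<n. \<Sum>j<n. ip I (y l j) (y l i))"
    by (rule sum.swap)
  also have "\<dots> = (\<Sum>l<p. ip I (\<lambda>a. \<Sum>j<n. y l j a) (\<lambda>a. \<Sum>j<n. y l j a))"
    by (simp only: ip_sum_left ip_sum_right) (intro sum.cong[OF HOL.refl] sum.swap)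
  also have "\<dots> = complex_of_real (\<Sum>l<p. (vnorm I (\<lambda>a. \<Sum>j<n. y l j a))\<^sup>2)"
    by (simp only: ip_self[OF I] of_real_sum)
  finally show ?thesis
    by (simp only: Re_complex_of_real) (intro sum_nonneg zero_le_power2)
qed

text \<open>U is 1 - 2 R, where R is the projection onto the span of the differences \<open>\<xi> i - \<eta> i\<close>.\<close>

lemma exchange_reflection:
  fixes \<xi> \<eta> :: "nat \<Rightarrow> 'i \<Rightarrow> complex"
  assumes I: "finite I" and supp: "\<And>i. i < n \<Longrightarrow> vsupp I (\<xi> i)" "\<And>i. i < n \<Longrightarrow> vsupp I (\<eta> i)"
    and gram: "\<And>i j. i < n \<Longrightarrow> j < n \<Longrightarrow> ip I (\<xi> j) (\<xi> i) = ip I (\<eta> j) (\<eta> i)"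
    and orth: "\<And>i j. i < n \<Longrightarrow> j < n \<Longrightarrow> ip I (\<xi> j) (\<eta> i) = 0" "\<And>i j. i < n \<Longrightarrow> j < n \<Longrightarrow> ip I (\<eta> j) (\<xi> i) = 0"
  obtains U where "U \<in> carrier (fun_mat I)" "adj U = U" "fmult I U U = (\<lambda>a b. if a = b \<and> a \<in> I then 1 else 0)"
    "\<And>i. i < n \<Longrightarrow> mat_app I U (\<xi> i) = \<eta> i"
proof -
  define d where "d i = (\<lambda>a. \<xi> i a - \<eta> i a)" for i
  have d_supp: "vsupp I (d i)" if "i < n" for i
    using supp[OF that] by (simp add: vsupp_def[OF I] d_def)
  obtain R where R: "R \<in> carrier (fun_mat I)" "adj R = R" "fmult I R R = R"
    and Rd: "\<And>i. i < n \<Longrightarrow> mat_app I R (d i) = d i"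
    and R0: "\<And>v. vsupp I v \<Longrightarrow> (\<And>i. i < n \<Longrightarrow> ip I v (d i) = 0) \<Longrightarrow> mat_app I R v = (\<lambda>a. 0)"
    using span_projection[OF I, of n d] d_supp by force
  define U where "U = (\<lambda>a b. fun_diag I (\<lambda>_. 1) a b - 2 * R a b)"
  have U: "U \<in> carrier (fun_mat I)"
    using R(1) by (auto simp: U_def fun_mat_def fun_diag_def)
  have app: "mat_app I U v = (\<lambda>a. v a - 2 * mat_app I R v a)" if "vsupp I v" for v
  proof -
    have "mat_app I U v a = mat_app I (fun_diag I (\<lambda>_. 1)) v a - 2 * mat_app I R v a" for a
      by (simp add: mat_app_def U_def left_diff_distrib sum_subtractf sum_distrib_left mult.assoc)
    then show ?thesis
      using that by (auto simp: mat_app_diag[OF I] vsupp_def[OF I])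
  qed
  have one: "fun_diag I (\<lambda>_. 1) = \<one>\<^bsub>fun_mat I\<^esub>"
    by (simp add: fun_mat_def fun_diag_def)
  interpret M: cstar_algebra "fun_mat I"
    by (rule fun_mat_cstar_algebra[OF I])
  have "fmult I U U = fun_diag I (\<lambda>_. 1)"
  proof (rule fun_mat_eqI[OF I])
    show "fmult I U U \<in> carrier (fun_mat I)"
      using M.m_closed[OF U U] by (simp add: fun_mat_def)
    show "fun_diag I (\<lambda>_. 1) \<in> carrier (fun_mat I)"
      by (simp add: one)
    fix v
    assume v: "vsupp I v"
    have RR: "mat_app I R (\<lambda>a. v a - 2 * mat_app I R v a) = (\<lambda>a. - mat_app I R v a)"
    proof -
      have "mat_app I R (\<lambda>a. v a - 2 * mat_app I R v a) = (\<lambda>a. mat_app I R v a - 2 * mat_app I R (mat_app I R v) a)"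
        by (simp add: mat_app_def right_diff_distrib sum_subtractf sum_distrib_left mult_ac)
      then show ?thesis
        by (simp flip: mat_app_fmult[OF I] add: R(3))
    qed
    have "vsupp I (mat_app I U v)"
      by (rule mat_app_vsupp[OF I U])
    then have "mat_app I U (mat_app I U v) = v"
      using RR by (simp add: app v)
    then show "mat_app I (fmult I U U) v = mat_app I (fun_diag I (\<lambda>_. 1)) v"
      using v by (auto simp: mat_app_fmult[OF I] mat_app_diag[OF I] vsupp_def[OF I])
  qed
  moreover have "adj U = U"
    using R(2) by (auto simp: U_def adj_def fun_diag_def fun_eq_iff)
  \<comment> \<open>R kills \<xi> j + \<eta> j, which is orthogonal to all differences because the
    Gram matrices agree and the cross terms vanish, and R fixes \<xi> j - \<eta> j. So 2 R \<xi> j =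
    \<xi> j - \<eta> j.\<close>
  moreover have "mat_app I U (\<xi> j) = \<eta> j" if j: "j < n" for j
  proof -
    have "mat_app I R (\<lambda>a. \<xi> j a + \<eta> j a) = (\<lambda>a. 0)"
    proof (rule R0)
      show "ip I (\<lambda>a. \<xi> j a + \<eta> j a) (d i) = 0" if "i < n" for i
        using gram[OF that j] orth(1)[OF that j] orth(2)[OF that j]
        by (simp add: d_def ip_add_left ip_diff_right[OF I])
    qed (use supp[OF j] in \<open>simp add: vsupp_def[OF I]\<close>)
    moreover have "mat_app I R (\<lambda>a. \<xi> j a + \<eta> j a) a + mat_app I R (d j) a = 2 * mat_app I R (\<xi> j) a" for a
      unfolding mat_app_def d_def sum_distrib_left sum.distrib[symmetric]
      by (intro sum.cong) (auto simp: algebra_simps)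
    ultimately have "2 * mat_app I R (\<xi> j) a = d j a" for a
      using Rd[OF j] by (metis add_0)
    then show ?thesis
      using supp[OF j] by (simp add: app d_def)
  qed
  ultimately show thesis
    using that[of U] U by (simp add: fun_diag_def)
qed

text \<open>With the injection, \<open>'u\<close> has at least as many elements as there are complex
  sequences, so that copies of the finite matrix algebras are among the test algebras for C.\<close>

locale universal_cyclic_cstar = full_cyclic_cstar C k m u
  for C :: "'u cstar" (structure) and k m u +
  fixes universe :: "(nat \<Rightarrow> complex) \<Rightarrow> 'u"
  assumes inj_universe: "inj universe"
begin

text \<open>A matrix over a countable index type is listed as a sequence along an enumeration of the
  index pairs and then sent through \<open>universe\<close>.\<close>

lemma matrix_representation:
  fixes I :: "'i::countable set"
  assumes I: "finite I" and f: "cstar_hom (Cpow k) (fun_mat I) f" "cstar_hom (Cpow m) (fun_mat I) g"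
  obtains h where "cstar_hom C (fun_mat I) h" "\<And>x. x \<in> carrier_vec k \<Longrightarrow> h (a.\<alpha> x) = f x"
    "\<And>y. y \<in> carrier_vec m \<Longrightarrow> h (b.\<alpha> y) = g y"
proof -
  define enc :: "('i \<Rightarrow> 'i \<Rightarrow> complex) \<Rightarrow> 'u" where
    "enc X = universe (\<lambda>r. case from_nat r of (p, q) \<Rightarrow> X p q)" for X
  have "inj enc"
  proof (rule injI)
    fix X Y
    assume "enc X = enc Y"
    then have eq: "(\<lambda>r. case from_nat r of (p, q) \<Rightarrow> X p q) = (\<lambda>r. case from_nat r of (p, q) \<Rightarrow> Y p q)"
      using inj_universe by (simp add: enc_def inj_eq)
    show "X = Y"
    proof (intro ext)
      fix p q
      show "X p q = Y p q"
        using fun_cong[OF eq, of "to_nat (p, q)"] by simp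
    qed
  qed
  from free_product_hom[OF fun_mat_cstar_algebra[OF I] this f] show thesis
    using that by blast
qed

text \<open>The space is C^(k + m) \<otimes> C^n. Gram vectors of the E s are stacked into \<xi> i
  for s < k and into \<eta> i for s \<ge> k. The Gram matrices of \<xi> and \<eta> are the two equal
  sums, and their supports are disjoint, which gives the vanishing cross terms needed for the
  exchange reflection U. C^k acts diagonally through the blocks s < k; C^m acts diagonally through
  the blocks s \<ge> k, conjugated by U, which carries \<xi> to \<eta>.\<close>

lemma dilation:
  assumes psd: "\<And>s. s < k + m \<Longrightarrow> psd n (E s)"
    and sums: "\<And>i j. i < n \<Longrightarrow> j < n \<Longrightarrow> (\<Sum>s<k. E s i j) = (\<Sum>s<m. E (k + s) i j)"
  obtains I :: "(nat \<times> nat) set" and h \<xi> where "finite I" "cstar_hom C (fun_mat I) h"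
    "\<And>x y i j. x \<in> carrier_vec k \<Longrightarrow> y \<in> carrier_vec m \<Longrightarrow> i < n \<Longrightarrow> j < n \<Longrightarrow>
       ip I (mat_app I (h (a.\<alpha> x \<oplus> b.\<alpha> y)) (\<xi> j)) (\<xi> i) = (\<Sum>s<k. x $ s * E s i j) + (\<Sum>s<m. y $ s * E (k + s) i j)"
proof -
  have "\<forall>s. \<exists>v. s < k + m \<longrightarrow> (\<forall>i<n. \<forall>j<n. E s i j = (\<Sum>l<n. cnj (v l i) * v l j))"
    using psd_gram[OF psd] by blast
  then obtain v where v: "\<forall>s. s < k + m \<longrightarrow> (\<forall>i<n. \<forall>j<n. E s i j = (\<Sum>l<n. cnj (v s l i) * v s l j))"
    unfolding choice_iff by (elim exE)
  note v = v[rule_format]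
  define I where "I = {..<k + m} \<times> {..<n}"
  have I: "finite I"
    by (simp add: I_def)
  define \<xi> where "\<xi> i = (\<lambda>(s, l). if s < k \<and> l < n then v s l i else 0)" for i
  define \<eta> where "\<eta> i = (\<lambda>(s, l). if k \<le> s \<and> s < k + m \<and> l < n then v s l i else 0)" for i
  have sum_I: "(\<Sum>a\<in>I. g a) = (\<Sum>s<k. \<Sum>l<n. g (s, l)) + (\<Sum>s<m. \<Sum>l<n. g (k + s, l))" for g :: "nat \<times> nat \<Rightarrow> complex"
    by (simp add: I_def sum.cartesian_product' sum_lessThan_add)
  have ip1: "ip I (\<lambda>a. x (fst a) * \<xi> j a) (\<xi> i) = (\<Sum>s<k. x s * E s i j)" if "i < n" "j < n" for x i j
  proof -
    have "(\<Sum>l<n. cnj (v s l i) * (x s * v s l j)) = x s * E s i j" if "s < k" for s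
      using v[of s i j] that \<open>i < n\<close> \<open>j < n\<close> by (simp add: sum_distrib_left mult_ac)
    then show ?thesis
      by (simp add: ip_def sum_I \<xi>_def)
  qed
  have ip2: "ip I (\<lambda>a. x (fst a) * \<eta> j a) (\<eta> i) = (\<Sum>s<m. x (k + s) * E (k + s) i j)" if "i < n" "j < n" for x i j
  proof -
    have "(\<Sum>l<n. cnj (v (k + s) l i) * (x (k + s) * v (k + s) l j)) = x (k + s) * E (k + s) i j" if "s < m" for s
      using v[of "k + s" i j] that \<open>i < n\<close> \<open>j < n\<close> by (simp add: sum_distrib_left mult_ac)
    then show ?thesis
      by (simp add: ip_def sum_I \<eta>_def)
  qed
  have supp: "vsupp I (\<xi> i)" "vsupp I (\<eta> i)" for i
    unfolding vsupp_def[OF I] by (auto simp: \<xi>_def \<eta>_def I_def)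
  have gram: "ip I (\<xi> j) (\<xi> i) = ip I (\<eta> j) (\<eta> i)" if "i < n" "j < n" for i j
    using ip1[OF that, of "\<lambda>_. 1"] ip2[OF that, of "\<lambda>_. 1"] sums[OF that] by simp
  have orth: "ip I (\<xi> j) (\<eta> i) = 0" "ip I (\<eta> j) (\<xi> i) = 0" for i j
    by (auto simp: ip_def \<xi>_def \<eta>_def intro!: sum.neutral)
  obtain U where U: "U \<in> carrier (fun_mat I)" "adj U = U" "fmult I U U = (\<lambda>a b. if a = b \<and> a \<in> I then 1 else 0)"
    and U\<xi>: "\<And>i. i < n \<Longrightarrow> mat_app I U (\<xi> i) = \<eta> i"
    using exchange_reflection[of I n \<xi> \<eta>, OF I supp gram orth] by blast
  interpret M: cstar_algebra "fun_mat I"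
    by (rule fun_mat_cstar_algebra[OF I])
  \<comment> \<open>The remaining blocks are sent to coordinate 0 only to make the two actions
    unital; \<xi> vanishes on those of \<tau>1 and \<eta> on those of \<tau>2.\<close>
  define \<tau>1 :: "nat \<times> nat \<Rightarrow> nat" where "\<tau>1 a = (if fst a < k then fst a else 0)" for a
  define \<tau>2 :: "nat \<times> nat \<Rightarrow> nat" where "\<tau>2 a = (if k \<le> fst a then fst a - k else 0)" for a
  let ?f = "\<lambda>x. fun_diag I (\<lambda>a. x $ \<tau>1 a)"
  let ?d = "\<lambda>y. fun_diag I (\<lambda>a. y $ \<tau>2 a)"
  let ?g = "\<lambda>y. fmult I (fmult I U (?d y)) U"
  have f: "cstar_hom (Cpow k) (fun_mat I) ?f"
    using k by (intro diag_hom[OF I]) (auto simp: \<tau>1_def)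
  have d: "cstar_hom (Cpow m) (fun_mat I) ?d"
    using m by (intro diag_hom[OF I]) (auto simp: \<tau>2_def I_def)
  have "cstar_hom (fun_mat I) (fun_mat I) (\<lambda>X. fmult I (fmult I U X) U)"
    using M.conj_hom[of U] U by (simp add: fun_mat_def)
  from cstar_hom_comp[OF d this] have g: "cstar_hom (Cpow m) (fun_mat I) ?g" .
  obtain h where h: "cstar_hom C (fun_mat I) h" "\<And>x. x \<in> carrier_vec k \<Longrightarrow> h (a.\<alpha> x) = ?f x"
      "\<And>y. y \<in> carrier_vec m \<Longrightarrow> h (b.\<alpha> y) = ?g y"
    using matrix_representation[OF I f g] by blast
  have "ip I (mat_app I (h (a.\<alpha> x \<oplus> b.\<alpha> y)) (\<xi> j)) (\<xi> i) = (\<Sum>s<k. x $ s * E s i j) + (\<Sum>s<m. y $ s * E (k + s) i j)"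
    if x: "x \<in> carrier_vec k" and y: "y \<in> carrier_vec m" and ij: "i < n" "j < n" for x y i j
  proof -
    have h_sum: "h (a.\<alpha> x \<oplus> b.\<alpha> y) = (\<lambda>a b. ?f x a b + ?g y a b)"
    proof -
      have "h (a.\<alpha> x \<oplus> b.\<alpha> y) = h (a.\<alpha> x) \<oplus>\<^bsub>fun_mat I\<^esub> h (b.\<alpha> y)"
        using h(1) by (simp add: cstar_hom_def Ring.ring_hom_def)
      then show ?thesis
        using h(2)[OF x] h(3)[OF y] by (simp add: fun_mat_def)
    qed
    have "mat_app I (h (a.\<alpha> x \<oplus> b.\<alpha> y)) (\<xi> j) = (\<lambda>a. mat_app I (?f x) (\<xi> j) a + mat_app I (?g y) (\<xi> j) a)"
      unfolding h_sum by (simp add: mat_app_def distrib_right sum.distrib)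
    then have "ip I (mat_app I (h (a.\<alpha> x \<oplus> b.\<alpha> y)) (\<xi> j)) (\<xi> i)
        = ip I (mat_app I (?f x) (\<xi> j)) (\<xi> i) + ip I (mat_app I (?g y) (\<xi> j)) (\<xi> i)"
      by (simp only: ip_add_left)
    moreover have "mat_app I (?f x) (\<xi> j) = (\<lambda>a. (if fst a < k then x $ fst a else 0) * \<xi> j a)"
      by (intro ext, unfold mat_app_diag[OF I]) (auto simp: \<xi>_def \<tau>1_def I_def split: if_splits)
    then have "ip I (mat_app I (?f x) (\<xi> j)) (\<xi> i) = (\<Sum>s<k. x $ s * E s i j)"
      using ip1[OF ij, of "\<lambda>s. if s < k then x $ s else 0"] by simp
    moreover have "ip I (mat_app I (?g y) (\<xi> j)) (\<xi> i) = ip I (mat_app I (?d y) (\<eta> j)) (\<eta> i)"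
      using U(2) by (simp add: mat_app_fmult[OF I] U\<xi> ij ip_mat_app[OF I, of U])
    moreover have "mat_app I (?d y) (\<eta> j) = (\<lambda>a. y $ (fst a - k) * \<eta> j a)"
      by (intro ext, unfold mat_app_diag[OF I]) (auto simp: \<eta>_def \<tau>2_def I_def split: if_splits)
    then have "ip I (mat_app I (?d y) (\<eta> j)) (\<eta> i) = (\<Sum>s<m. y $ s * E (k + s) i j)"
      using ip2[OF ij, of "\<lambda>s. y $ (s - k)"] by simp
    ultimately show ?thesis
      by simp
  qed
  with that[OF I h(1)] show thesis
    by blast
qed

text \<open>The negative number produced by \<open>separation\<close> would equal the value of the
  form from \<open>dilation\<close> on the image of a positive matrix, which is nonnegative by
  \<open>fun_mat_mpos_form\<close>.\<close>

theorem amalg_cone_of_positive: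
  assumes x: "\<And>i j. i < n \<Longrightarrow> j < n \<Longrightarrow> x i j \<in> carrier_vec k" and y: "\<And>i j. i < n \<Longrightarrow> j < n \<Longrightarrow> y i j \<in> carrier_vec m"
    and z: "\<And>i j s. i < n \<Longrightarrow> j < n \<Longrightarrow> s < k + m \<Longrightarrow> z (s, i, j) = (if s < k then x i j $ s else y i j $ (s - k))"
    and herm: "\<And>s i j. s < k + m \<Longrightarrow> i < n \<Longrightarrow> j < n \<Longrightarrow> z (s, j, i) = cnj (z (s, i, j))"
    and pos: "mat n n (\<lambda>(i, j). a.\<alpha> (x i j) \<oplus> b.\<alpha> (y i j)) \<in> cstar_mpos C n"
    and "\<epsilon> > 0"
  shows "amalg_cone k m n (\<lambda>a. z a + unit_array \<epsilon> a)"
proof (rule ccontr)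
  assume not: "\<not> ?thesis"
  obtain E where E: "\<And>s. s < k + m \<Longrightarrow> psd n (E s)"
    "\<And>i j. i < n \<Longrightarrow> j < n \<Longrightarrow> (\<Sum>s<k. E s i j) = (\<Sum>s<m. E (k + s) i j)"
    and neg: "Re (\<Sum>s<k + m. \<Sum>i<n. \<Sum>j<n. E s i j * z (s, i, j)) < 0"
    by (rule separation[OF k herm \<open>\<epsilon> > 0\<close> not]) (assumption+, rule that, blast+)
  obtain I :: "(nat \<times> nat) set" and h \<xi> where I: "finite I" and h: "cstar_hom C (fun_mat I) h"
    and form: "\<And>x y i j. x \<in> carrier_vec k \<Longrightarrow> y \<in> carrier_vec m \<Longrightarrow> i < n \<Longrightarrow> j < n \<Longrightarrow>
       ip I (mat_app I (h (a.\<alpha> x \<oplus> b.\<alpha> y)) (\<xi> j)) (\<xi> i) = (\<Sum>s<k. x $ s * E s i j) + (\<Sum>s<m. y $ s * E (k + s) i j)"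
    by (rule dilation[OF E]) (assumption+, rule that, blast+)
  interpret h: cstar_morphism C "fun_mat I" h
    by (intro cstar_morphism.intro cstar_morphism_axioms.intro cstar_algebra_axioms fun_mat_cstar_algebra[OF I] h)
  let ?T = "mat n n (\<lambda>(i, j). a.\<alpha> (x i j) \<oplus> b.\<alpha> (y i j))"
  have "0 \<le> Re (\<Sum>i<n. \<Sum>j<n. ip I (mat_app I (map_mat h ?T $$ (i, j)) (\<xi> j)) (\<xi> i))"
    by (rule fun_mat_mpos_form[OF I h.f_mpos[OF pos]])
  also have "(\<Sum>i<n. \<Sum>j<n. ip I (mat_app I (map_mat h ?T $$ (i, j)) (\<xi> j)) (\<xi> i))
      = (\<Sum>i<n. \<Sum>j<n. \<Sum>s<k + m. E s i j * z (s, i, j))"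
  proof (intro sum.cong HOL.refl)
    fix i j
    assume "i \<in> {..<n}" "j \<in> {..<n}"
    then have ij: "i < n" "j < n"
      by auto
    have "ip I (mat_app I (map_mat h ?T $$ (i, j)) (\<xi> j)) (\<xi> i)
        = (\<Sum>s<k. x i j $ s * E s i j) + (\<Sum>s<m. y i j $ s * E (k + s) i j)"
      using form[OF x[OF ij] y[OF ij] ij] ij by simp
    also have "\<dots> = (\<Sum>s<k + m. E s i j * z (s, i, j))"
      using z[OF ij] by (simp add: sum_lessThan_add mult.commute)
    finally show "ip I (mat_app I (map_mat h ?T $$ (i, j)) (\<xi> j)) (\<xi> i) = (\<Sum>s<k + m. E s i j * z (s, i, j))" .
  qed
  also have "\<dots> = (\<Sum>i<n. \<Sum>s<k + m. \<Sum>j<n. E s i j * z (s, i, j))"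
    by (intro sum.cong[OF HOL.refl] sum.swap)
  also have "\<dots> = (\<Sum>s<k + m. \<Sum>i<n. \<Sum>j<n. E s i j * z (s, i, j))"
    by (rule sum.swap)
  finally show False
    using neg by linarith
qed

end

section \<open>The quotient by the span of the sign vector\<close>

lemma Cpow_opsys_sel:
  "carrier (Cpow_opsys k) = carrier_vec k" "one (Cpow_opsys k) = vec k (\<lambda>_. 1)" "zero (Cpow_opsys k) = 0\<^sub>v k"
  "add (Cpow_opsys k) = (+)" "smult (Cpow_opsys k) = (\<cdot>\<^sub>v)" "star (Cpow_opsys k) = map_vec cnj"
  by (simp_all add: Cpow_opsys_def opsub_def Cpow_sel)

lemma Cpow_operator_system: "k > 0 \<Longrightarrow> operator_system (Cpow_opsys k)"
  unfolding Cpow_opsys_def by (rule cstar_algebra.operator_system_full[OF Cpow_cstar_algebra])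

lemma Cpow_opsys_mpos:
  assumes "k > 0"
  shows "mpos (Cpow_opsys k) n = cstar_mpos (Cpow k) n"
proof -
  interpret cstar_algebra "Cpow k"
    by (rule Cpow_cstar_algebra[OF assms])
  show ?thesis
    using cstar_mpos_in by (auto simp: Cpow_opsys_def opsub_def mats_def)
qed

lemma cstar_morphism_ucp:
  assumes f: "cstar_morphism A B f" and V: "operator_subspace A V" and "f ` V \<subseteq> W"
  shows "ucp (opsub A V) (opsub B W) f"
proof -
  interpret f: cstar_morphism A B f
    by (rule f)
  have V: "x \<in> carrier A" if "x \<in> V" for x
    using V that LinearCombinations.submodule.subset by (auto simp: operator_subspace_def)
  have "map_mat f X \<in> mpos (opsub B W) n" if X: "X \<in> mpos (opsub A V) n" for X n
  proof -
    have "X \<in> cstar_mpos A n" and entries: "\<forall>i<n. \<forall>j<n. X $$ (i, j) \<in> V"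
      using X by (auto simp: opsub_def)
    then have "X \<in> carrier_mat n n" "map_mat f X \<in> cstar_mpos B n"
      using f.f_mpos f.A.cstar_mpos_in by (auto simp: mats_def)
    then show ?thesis
      using entries assms(3) by (auto simp: opsub_def)
  qed
  then show ?thesis
    using V assms(3) by (auto simp: ucp_def unital_linear_def opsub_def f.f_add f.f_smult f.f_one)
qed

text \<open>Compression with sqrt t times the identity matrix.\<close>

lemma (in operator_system) mpos_scale:
  assumes X: "X \<in> mpos S n" and "t \<ge> 0"
  shows "map_mat (\<lambda>x. complex_of_real t \<odot> x) X \<in> mpos S n"
proof -
  interpret abelian_group S
    by (rule abelian_group_V)
  let ?B = "mat n n (\<lambda>(i, j). if i = j then complex_of_real (sqrt t) else 0)"
  have X': "X \<in> carrier_mat n n" "\<And>i j. i < n \<Longrightarrow> j < n \<Longrightarrow> X $$ (i, j) \<in> carrier S"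
    using mpos_mats X by (auto simp: mats_def)
  have sq: "complex_of_real (sqrt t) * complex_of_real (sqrt t) = complex_of_real t"
    using assms(2) by (simp flip: of_real_mult)
  have "(\<Oplus>p\<in>{..<n}. \<Oplus>q\<in>{..<n}. (cnj (?B $$ (p, i)) * ?B $$ (q, j)) \<odot> X $$ (p, q)) = complex_of_real t \<odot> X $$ (i, j)"
    if ij: "i < n" "j < n" for i j
  proof -
    have "(\<Oplus>q\<in>{..<n}. (cnj (?B $$ (p, i)) * ?B $$ (q, j)) \<odot> X $$ (p, q))
        = (if i = p then complex_of_real t \<odot> X $$ (p, j) else \<zero>)" if p: "p < n" for p
    proof -
      have "(\<Oplus>q\<in>{..<n}. (cnj (?B $$ (p, i)) * ?B $$ (q, j)) \<odot> X $$ (p, q))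
          = (\<Oplus>q\<in>{..<n}. if j = q then if i = p then complex_of_real t \<odot> X $$ (p, q) else \<zero> else \<zero>)"
        using ij p X'(2) by (intro finsum_cong') (auto simp: sq)
      also have "\<dots> = (if i = p then complex_of_real t \<odot> X $$ (p, j) else \<zero>)"
        using ij p X'(2) by (subst finsum_singleton[of j "{..<n}"]) auto
      finally show ?thesis .
    qed
    then have "(\<Oplus>p\<in>{..<n}. \<Oplus>q\<in>{..<n}. (cnj (?B $$ (p, i)) * ?B $$ (q, j)) \<odot> X $$ (p, q))
        = (\<Oplus>p\<in>{..<n}. if i = p then complex_of_real t \<odot> X $$ (p, j) else \<zero>)"
      using ij X'(2) by (intro finsum_cong') auto
    also have "\<dots> = complex_of_real t \<odot> X $$ (i, j)"
      using ij X'(2) by (subst finsum_singleton[of i "{..<n}"]) auto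
    finally show ?thesis .
  qed
  then have "mcompress S ?B X = map_mat (\<lambda>x. complex_of_real t \<odot> x) X"
    using X'(1) by (auto simp: mcompress_def intro!: eq_matI)
  then show ?thesis
    using mpos_compress[OF X, of ?B n] by simp
qed

lemma ucp_average:
  assumes S: "operator_system S" and R: "operator_system R" and f: "ucp S R f" and g: "ucp S R g"
  shows "ucp S R (\<lambda>x. (1 / 2) \<odot>\<^bsub>R\<^esub> (f x \<oplus>\<^bsub>R\<^esub> g x))" (is "ucp S R ?h")
proof -
  interpret S: operator_system S by (rule S)
  interpret R: operator_system R by (rule R)
  interpret RG: abelian_group R by (rule R.abelian_group_V)
  have fg: "f x \<in> carrier R" "g x \<in> carrier R" if "x \<in> carrier S" for x
    using f g that by (auto simp: ucp_def unital_linear_def)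
  have "?h \<one>\<^bsub>S\<^esub> = \<one>\<^bsub>R\<^esub>"
    using f g R.smult_add_left[of "\<one>\<^bsub>R\<^esub>" "1 / 2" "1 / 2"] R.one_in
    by (simp add: ucp_def unital_linear_def R.smult_add_right)
  moreover have "map_mat ?h X \<in> mpos R n" if X: "X \<in> mpos S n" for X n
  proof -
    have X': "X \<in> carrier_mat n n"
      using S.mpos_mats X by (auto simp: mats_def)
    have "madd R (map_mat f X) (map_mat g X) \<in> mpos R n"
      using f g X by (intro R.mpos_add) (auto simp: ucp_def)
    then have "map_mat (\<lambda>x. complex_of_real (1 / 2) \<odot>\<^bsub>R\<^esub> x) (madd R (map_mat f X) (map_mat g X)) \<in> mpos R n"
      by (rule R.mpos_scale) simp
    also have "map_mat (\<lambda>x. complex_of_real (1 / 2) \<odot>\<^bsub>R\<^esub> x) (madd R (map_mat f X) (map_mat g X)) = map_mat ?h X"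
      using X' by (auto simp: madd_def intro!: eq_matI)
    finally show ?thesis .
  qed
  ultimately show ?thesis
    using f g fg unfolding ucp_def unital_linear_def
    by (auto simp: R.smult_add_right RG.a_ac mult.commute)
qed

text \<open>The coset of x modulo the sign vector, described by the functionals with value y_p +
  y_(k+q) at y: they vanish on the sign vector, and for positive k and m their common kernel is its
  span (\<open>cls_eq_scaled\<close>).\<close>

definition pair_class :: "nat \<Rightarrow> nat \<Rightarrow> complex vec \<Rightarrow> complex vec set" where
  "pair_class k m x = {y \<in> carrier_vec (k + m). \<forall>p<k. \<forall>q<m. y $ p + y $ (k + q) = x $ p + x $ (k + q)}"

locale sign_quotient =
  fixes k m :: nat
  assumes k_pos: "k > 0" and m_pos: "m > 0"
begin

abbreviation "Q \<equiv> quotient_system k m"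
abbreviation "T \<equiv> Cpow_opsys (k + m)"
abbreviation "cls \<equiv> pair_class k m"

definition sign_vec :: "complex vec" where
  "sign_vec = vec (k + m) (\<lambda>i. if i < k then 1 else - 1)"

lemma sign_vec_in [simp]: "sign_vec \<in> carrier_vec (k + m)"
  by (simp add: sign_vec_def)

lemma zero_smult_sign_vec: "0 \<cdot>\<^sub>v sign_vec = 0\<^sub>v (k + m)"
  by (intro eq_vecI) (auto simp: sign_vec_def)

lemma T_operator_system: "operator_system T"
  using k_pos by (intro Cpow_operator_system) simp

sublocale T: operator_system T
  by (rule T_operator_system)

lemma cls_eqI:
  "(\<And>p q. p < k \<Longrightarrow> q < m \<Longrightarrow> x $ p + x $ (k + q) = y $ p + y $ (k + q)) \<Longrightarrow> cls x = cls y"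
  by (simp add: pair_class_def)

lemma in_cls: "x \<in> carrier_vec (k + m) \<Longrightarrow> x \<in> cls x"
  by (simp add: pair_class_def)

lemma cls_eqD:
  assumes "cls x = cls y" "x \<in> carrier_vec (k + m)" "p < k" "q < m"
  shows "x $ p + x $ (k + q) = y $ p + y $ (k + q)"
  using in_cls[OF assms(2)] assms unfolding assms(1) by (simp add: pair_class_def)

lemma in_clsD: "y \<in> cls x \<Longrightarrow> y \<in> carrier_vec (k + m)" "y \<in> cls x \<Longrightarrow> cls y = cls x"
  by (auto simp: pair_class_def)

text \<open>The scalar is the difference of the coordinates at 0; comparison with a fixed index in
  the other block determines all remaining coordinates.\<close>

lemma cls_eq_scaled:
  assumes x: "x \<in> carrier_vec (k + m)" "y \<in> carrier_vec (k + m)" and eq: "cls x = cls y"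
  obtains c where "x = c \<cdot>\<^sub>v sign_vec + y"
proof (rule that[of "x $ 0 - y $ 0"], rule eq_vecI)
  note D = cls_eqD[OF eq x(1)]
  fix s
  assume "s < dim_vec ((x $ 0 - y $ 0) \<cdot>\<^sub>v sign_vec + y)"
  then have s: "s < k + m"
    using x by (simp add: carrier_vecD)
  show "x $ s = ((x $ 0 - y $ 0) \<cdot>\<^sub>v sign_vec + y) $ s"
  proof (cases "s < k")
    case True
    then have "(x $ s + x $ (k + 0)) - (x $ 0 + x $ (k + 0)) = (y $ s + y $ (k + 0)) - (y $ 0 + y $ (k + 0))"
      using D[OF True m_pos] D[OF k_pos m_pos] by simp
    then show ?thesis
      using x s True by (simp add: sign_vec_def algebra_simps)
  next
    case False
    then have "k + (s - k) = s" "s - k < m"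
      using s by auto
    then show ?thesis
      using D[OF k_pos, of "s - k"] x s False by (simp add: sign_vec_def algebra_simps)
  qed
qed (use x in auto)

lemma null_space_eq: "null_space k m = range (\<lambda>c. c \<cdot>\<^sub>v sign_vec)"
proof -
  interpret M: Module.module class_ring T
    by (rule T.vector_space)
  have T: "sign_vec \<in> carrier T"
    by (simp add: Cpow_opsys_sel)
  have "0\<^sub>v (k + m) \<in> range (\<lambda>c. c \<cdot>\<^sub>v sign_vec)"
    by (rule range_eqI[of _ _ 0]) (simp add: zero_smult_sign_vec)
  moreover have "c \<cdot>\<^sub>v sign_vec + c' \<cdot>\<^sub>v sign_vec \<in> range (\<lambda>c. c \<cdot>\<^sub>v sign_vec)" for c c'
    by (rule range_eqI[of _ _ "c + c'"]) (simp add: add_smult_distrib_vec)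
  moreover have "c \<cdot>\<^sub>v (c' \<cdot>\<^sub>v sign_vec) \<in> range (\<lambda>c. c \<cdot>\<^sub>v sign_vec)" for c c'
    by (rule range_eqI[of _ _ "c * c'"]) (simp add: smult_smult_assoc)
  ultimately have "LinearCombinations.submodule class_ring (range (\<lambda>c. c \<cdot>\<^sub>v sign_vec)) T"
    unfolding LinearCombinations.submodule_def using T.vector_space by (auto simp: Cpow_opsys_sel)
  then have "M.span {sign_vec} \<subseteq> range (\<lambda>c. c \<cdot>\<^sub>v sign_vec)"
    by (intro M.span_is_subset) (auto intro: range_eqI[of _ _ 1])
  moreover have "c \<cdot>\<^sub>v sign_vec \<in> M.span {sign_vec}" for c
  proof -
    have "LinearCombinations.submodule class_ring (M.span {sign_vec}) T" "sign_vec \<in> M.span {sign_vec}"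
      using M.span_is_submodule[of "{sign_vec}"] M.in_own_span[of "{sign_vec}"] T by auto
    then show ?thesis
      using LinearCombinations.submodule.smult_closed[of class_ring "M.span {sign_vec}" T c sign_vec]
      by (simp add: Cpow_opsys_sel)
  qed
  ultimately show ?thesis
    unfolding null_space_def sign_vec_def[symmetric] by blast
qed

lemma coset_eq:
  assumes x: "x \<in> carrier_vec (k + m)"
  shows "null_space k m +>\<^bsub>T\<^esub> x = cls x"
proof -
  have "c \<cdot>\<^sub>v sign_vec + x \<in> cls x" for c
    using x by (auto simp: pair_class_def sign_vec_def)
  moreover have "\<exists>c. y = c \<cdot>\<^sub>v sign_vec + x" if "y \<in> cls x" for y
    using in_clsD[OF that] x by (metis cls_eq_scaled)
  ultimately show ?thesis
    unfolding a_r_coset_def' null_space_eq Cpow_opsys_sel by blast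
qed

lemma null_space_cls: "null_space k m = cls (0\<^sub>v (k + m))"
proof -
  have "null_space k m +>\<^bsub>T\<^esub> 0\<^sub>v (k + m) = null_space k m"
    unfolding a_r_coset_def' null_space_eq by (auto simp: Cpow_opsys_sel)
  then show ?thesis
    by (simp add: coset_eq)
qed

lemma set_add_cls:
  assumes x: "x \<in> carrier_vec (k + m)" and y: "y \<in> carrier_vec (k + m)"
  shows "cls x <+>\<^bsub>T\<^esub> cls y = cls (x + y)"
proof
  show "cls x <+>\<^bsub>T\<^esub> cls y \<subseteq> cls (x + y)"
    using x y by (auto simp: set_add_def' Cpow_opsys_sel pair_class_def algebra_simps)
  show "cls (x + y) \<subseteq> cls x <+>\<^bsub>T\<^esub> cls y"
  proof
    fix z
    assume z: "z \<in> cls (x + y)"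
    then have "z - y \<in> cls x"
      using x y by (auto simp: pair_class_def algebra_simps)
    moreover have "z = (z - y) + y"
      using y in_clsD(1)[OF z] by auto
    ultimately show "z \<in> cls x <+>\<^bsub>T\<^esub> cls y"
      using in_cls[OF y] unfolding set_add_def' Cpow_opsys_sel by blast
  qed
qed

lemma Q_carrier: "carrier Q = cls ` carrier_vec (k + m)"
  by (auto simp: quotient_system_def quotient_opsys_def A_RCOSETS_def' Cpow_opsys_sel coset_eq)

lemma Q_one: "\<one>\<^bsub>Q\<^esub> = cls (vec (k + m) (\<lambda>_. 1))"
  by (simp add: quotient_system_def quotient_opsys_def Cpow_opsys_sel coset_eq)

lemma Q_zero: "\<zero>\<^bsub>Q\<^esub> = cls (0\<^sub>v (k + m))"
  by (simp add: quotient_system_def quotient_opsys_def null_space_cls)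

lemma Q_add: "x \<in> carrier_vec (k + m) \<Longrightarrow> y \<in> carrier_vec (k + m) \<Longrightarrow> cls x \<oplus>\<^bsub>Q\<^esub> cls y = cls (x + y)"
  by (simp add: quotient_system_def quotient_opsys_def set_add_cls)

lemma Q_smult:
  assumes x: "x \<in> carrier_vec (k + m)"
  shows "c \<odot>\<^bsub>Q\<^esub> cls x = cls (c \<cdot>\<^sub>v x)"
proof -
  have "null_space k m +>\<^bsub>T\<^esub> (c \<cdot>\<^sub>v y) = cls (c \<cdot>\<^sub>v x)" if y: "y \<in> cls x" for y
  proof -
    have "cls (c \<cdot>\<^sub>v y) = cls (c \<cdot>\<^sub>v x)"
      using y x by (intro cls_eqI) (auto simp: pair_class_def simp flip: distrib_left)
    then show ?thesis
      using in_clsD(1)[OF y] by (simp add: coset_eq)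
  qed
  then have "(\<Union>y\<in>cls x. null_space k m +>\<^bsub>T\<^esub> (c \<cdot>\<^sub>v y)) = cls (c \<cdot>\<^sub>v x)"
    using in_cls[OF x] by auto
  then show ?thesis
    by (simp add: quotient_system_def quotient_opsys_def Cpow_opsys_sel)
qed

lemma Q_star:
  assumes x: "x \<in> carrier_vec (k + m)"
  shows "star Q (cls x) = cls (map_vec cnj x)"
proof -
  have *: "map_vec cnj z \<in> cls (map_vec cnj y)" if "z \<in> cls y" "y \<in> carrier_vec (k + m)" for y z
    using that by (auto simp: pair_class_def simp flip: complex_cnj_add)
  have "map_vec cnj ` cls x = cls (map_vec cnj x)"
  proof
    show "cls (map_vec cnj x) \<subseteq> map_vec cnj ` cls x"
    proof
      fix z
      assume z: "z \<in> cls (map_vec cnj x)"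
      have "map_vec cnj (map_vec cnj y) = y" for y
        by (auto intro!: eq_vecI)
      then show "z \<in> map_vec cnj ` cls x"
        using *[OF z] x by (metis imageI map_carrier_vec)
    qed
  qed (use * x in auto)
  then show ?thesis
    by (simp add: quotient_system_def quotient_opsys_def Cpow_opsys_sel)
qed

lemmas Q_simps = Q_one Q_zero Q_add Q_smult Q_star

lemma Q_mpos_iff:
  "X \<in> mpos Q n \<longleftrightarrow> X \<in> mats Q n n \<and>
     (\<forall>\<epsilon>>0. \<exists>P\<in>mpos T n. map_mat cls P = madd Q X (mdiag Q n (complex_of_real \<epsilon>)))"
proof -
  let ?J = "null_space k m"
  have 1: "map_mat (\<lambda>s. ?J +>\<^bsub>T\<^esub> s) P = map_mat cls P" if "P \<in> mpos T n" for P
    using T.mpos_mats[of n] that by (auto simp: mats_def Cpow_opsys_sel coset_eq subset_iff intro!: eq_matI)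
  have 2: "mat n n (\<lambda>(i, j). X $$ (i, j) <+>\<^bsub>T\<^esub> (if i = j then ?J +>\<^bsub>T\<^esub> (complex_of_real \<epsilon> \<odot>\<^bsub>T\<^esub> \<one>\<^bsub>T\<^esub>) else ?J))
      = madd Q X (mdiag Q n (complex_of_real \<epsilon>))" if "X \<in> carrier_mat n n" for \<epsilon>
  proof -
    have "complex_of_real \<epsilon> \<odot>\<^bsub>Q\<^esub> \<one>\<^bsub>Q\<^esub> = ?J +>\<^bsub>T\<^esub> (complex_of_real \<epsilon> \<odot>\<^bsub>T\<^esub> \<one>\<^bsub>T\<^esub>)"
      by (simp add: Q_simps Cpow_opsys_sel coset_eq)
    moreover have "x \<oplus>\<^bsub>Q\<^esub> y = x <+>\<^bsub>T\<^esub> y" "\<zero>\<^bsub>Q\<^esub> = ?J" for x y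
      by (simp_all add: quotient_system_def quotient_opsys_def)
    ultimately show ?thesis
      using that by (auto simp: madd_def mdiag_def intro!: eq_matI)
  qed
  have "X \<in> mpos Q n \<longleftrightarrow> X \<in> mats Q n n \<and> (\<forall>\<epsilon>>0. \<exists>P\<in>mpos T n. map_mat (\<lambda>s. ?J +>\<^bsub>T\<^esub> s) P =
      mat n n (\<lambda>(i, j). X $$ (i, j) <+>\<^bsub>T\<^esub> (if i = j then ?J +>\<^bsub>T\<^esub> (complex_of_real \<epsilon> \<odot>\<^bsub>T\<^esub> \<one>\<^bsub>T\<^esub>) else ?J)))"
    by (simp add: quotient_system_def quotient_opsys_def mats_def)
  also have "\<dots> \<longleftrightarrow> X \<in> mats Q n n \<and>
     (\<forall>\<epsilon>>0. \<exists>P\<in>mpos T n. map_mat cls P = madd Q X (mdiag Q n (complex_of_real \<epsilon>)))"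
    using 1 2 by (intro conj_cong HOL.refl all_cong bex_cong) (auto simp: mats_def)
  finally show ?thesis .
qed

lemma Q_in: "\<zero>\<^bsub>Q\<^esub> \<in> carrier Q" "\<one>\<^bsub>Q\<^esub> \<in> carrier Q" "x \<in> carrier Q \<Longrightarrow> y \<in> carrier Q \<Longrightarrow> x \<oplus>\<^bsub>Q\<^esub> y \<in> carrier Q"
  "x \<in> carrier Q \<Longrightarrow> c \<odot>\<^bsub>Q\<^esub> x \<in> carrier Q" "x \<in> carrier Q \<Longrightarrow> star Q x \<in> carrier Q"
  by (auto simp: Q_carrier Q_simps)

text \<open>A positive matrix over Q has positive representatives only after \<epsilon> times the
  unit is added; the Archimedean property of R removes this \<epsilon> after f has been
  applied.\<close>

lemma quotient_lift:
  assumes R: "operator_system R" and f: "ucp T R f" and zero: "f sign_vec = \<zero>\<^bsub>R\<^esub>"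
  obtains h where "ucp Q R h" "\<And>x. x \<in> carrier_vec (k + m) \<Longrightarrow> h (cls x) = f x"
proof -
  interpret R: operator_system R by (rule R)
  interpret RG: abelian_group R by (rule R.abelian_group_V)
  define h where "h Y = f (SOME x. x \<in> Y)" for Y
  have f_in: "f x \<in> carrier R" if "x \<in> carrier_vec (k + m)" for x
    using f that by (auto simp: ucp_def unital_linear_def Cpow_opsys_sel)
  have f_add: "f (x + y) = f x \<oplus>\<^bsub>R\<^esub> f y" if "x \<in> carrier_vec (k + m)" "y \<in> carrier_vec (k + m)" for x y
    using f that by (auto simp: ucp_def unital_linear_def Cpow_opsys_sel)
  have f_smult: "f (c \<cdot>\<^sub>v x) = c \<odot>\<^bsub>R\<^esub> f x" if "x \<in> carrier_vec (k + m)" for c x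
    using f that by (auto simp: ucp_def unital_linear_def Cpow_opsys_sel)
  have h: "h (cls x) = f x" if x: "x \<in> carrier_vec (k + m)" for x
  proof -
    let ?y = "SOME y. y \<in> cls x"
    have "?y \<in> cls x"
      using in_cls[OF x] by (rule someI)
    then have y: "?y \<in> carrier_vec (k + m)" "cls ?y = cls x"
      using in_clsD by auto
    obtain c where "?y = c \<cdot>\<^sub>v sign_vec + x"
      using cls_eq_scaled[OF y(1) x y(2)] .
    then have "f ?y = f x"
      using x f_in[OF x] by (simp only: f_add f_smult sign_vec_in smult_carrier_vec zero) simp
    then show ?thesis
      by (simp add: h_def)
  qed
  have h_in: "h Y \<in> carrier R" if "Y \<in> carrier Q" for Y
    using that by (auto simp: Q_carrier h f_in)
  have lin: "unital_linear Q R h"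
    using f unfolding unital_linear_def Q_carrier
    by (auto simp: Q_simps h f_in f_add f_smult) (simp add: ucp_def unital_linear_def Cpow_opsys_sel)
  have zero: "h \<zero>\<^bsub>Q\<^esub> = \<zero>\<^bsub>R\<^esub>"
    using f_smult[of sign_vec 0] f_in[of sign_vec] zero by (simp add: Q_zero h zero_smult_sign_vec)
  have "map_mat h X \<in> mpos R n" if X: "X \<in> mpos Q n" for X n
  proof (rule R.archimedean)
    have X': "X \<in> mats Q n n"
      using X Q_mpos_iff by blast
    then show "map_mat h X \<in> mats R n n"
      by (auto simp: mats_def h_in)
    fix \<epsilon> :: real
    assume "\<epsilon> > 0"
    then obtain P where P: "P \<in> mpos T n" "map_mat cls P = madd Q X (mdiag Q n (complex_of_real \<epsilon>))"
      using X Q_mpos_iff by blast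
    have "madd R (map_mat h X) (mdiag R n (complex_of_real \<epsilon>)) = map_mat h (map_mat cls P)"
      unfolding P(2) using lin X' zero Q_in
      by (auto simp: madd_def mdiag_def mats_def unital_linear_def intro!: eq_matI)
    also have "\<dots> = map_mat f P"
      using P(1) T.mpos_mats[of n] h by (auto simp: mats_def Cpow_opsys_sel intro!: eq_matI)
    finally show "madd R (map_mat h X) (mdiag R n (complex_of_real \<epsilon>)) \<in> mpos R n"
      using f P(1) by (simp add: ucp_def)
  qed
  with lin have "ucp Q R h"
    by (simp add: ucp_def)
  then show thesis
    using h by (rule that)
qed

end

section \<open>Ucp maps, their inverses and the uniqueness of coproducts\<close>

lemma ucp_comp:
  assumes f: "ucp S T f" and g: "ucp T R g"
  shows "ucp S R (\<lambda>x. g (f x))"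
proof -
  have "map_mat (\<lambda>x. g (f x)) X = map_mat g (map_mat f X)" for X
    by (auto intro!: eq_matI)
  then show ?thesis
    using f g by (auto simp: ucp_def unital_linear_def image_subset_iff)
qed

lemma ucp_id: "ucp S S (\<lambda>x. x)"
  by (simp add: ucp_def unital_linear_def map_mat_id[unfolded id_def])

text \<open>A ucp left inverse makes i injective and lets it reflect positivity.\<close>

lemma uco_embedding_of_retraction:
  assumes i: "ucp S R i" and r: "ucp R S r" and ri: "\<And>x. x \<in> carrier S \<Longrightarrow> r (i x) = x"
  shows "uco_embedding S R i"
proof -
  have "X \<in> mpos S n" if X: "X \<in> mats S n n" "map_mat i X \<in> mpos R n" for X n
  proof -
    have "map_mat r (map_mat i X) \<in> mpos S n"
      using r X(2) by (simp add: ucp_def)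
    moreover have "map_mat r (map_mat i X) = X"
      using X(1) ri by (auto simp: mats_def intro!: eq_matI)
    ultimately show ?thesis
      by simp
  qed
  moreover have "inj_on i (carrier S)"
    using ri by (rule inj_on_inverseI)
  ultimately show ?thesis
    using i by (auto simp: uco_embedding_def ucp_def)
qed

lemma uco_isomorphism_of_inverse:
  assumes f: "ucp S R f" and g: "ucp R S g" and "\<And>x. x \<in> carrier S \<Longrightarrow> g (f x) = x"
    and fg: "\<And>y. y \<in> carrier R \<Longrightarrow> f (g y) = y"
  shows "uco_isomorphism S R f"
proof -
  have "f ` carrier S = carrier R"
  proof
    show "carrier R \<subseteq> f ` carrier S"
    proof
      fix y
      assume y: "y \<in> carrier R"
      then have "g y \<in> carrier S"
        using g by (auto simp: ucp_def unital_linear_def)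
      then show "y \<in> f ` carrier S"
        using fg[OF y] by (metis imageI)
    qed
  qed (use f in \<open>simp add: ucp_def unital_linear_def\<close>)
  then show ?thesis
    using uco_embedding_of_retraction[OF assms(1-3)] by (simp add: uco_isomorphism_def)
qed

lemma uco_embedding_ucp:
  assumes "operator_system S" "uco_embedding S R f"
  shows "ucp S R f"
proof -
  have "map_mat f X \<in> mpos R n" if X: "X \<in> mpos S n" for X n
  proof -
    have "X \<in> mats S n n"
      using operator_system.mpos_mats[OF assms(1)] X by (rule subsetD)
    then show ?thesis
      using assms(2) X unfolding uco_embedding_def by blast
  qed
  then show ?thesis
    using assms(2) by (simp add: uco_embedding_def ucp_def)
qed

lemma uco_isomorphism_inverse:
  assumes S: "operator_system S" and R: "operator_system R" and f: "uco_isomorphism S R f"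
  obtains g where "ucp R S g" "\<And>x. x \<in> carrier S \<Longrightarrow> g (f x) = x" "\<And>y. y \<in> carrier R \<Longrightarrow> f (g y) = y"
proof -
  interpret S: operator_system S by (rule S)
  interpret SG: abelian_group S by (rule S.abelian_group_V)
  let ?g = "the_inv_into (carrier S) f"
  have inj: "inj_on f (carrier S)" and im: "f ` carrier S = carrier R" and lin: "unital_linear S R f"
    using f by (auto simp: uco_isomorphism_def uco_embedding_def)
  have gf: "?g (f x) = x" if "x \<in> carrier S" for x
    using the_inv_into_f_f[OF inj that] .
  have g_in: "?g y \<in> carrier S" and fg: "f (?g y) = y" if "y \<in> carrier R" for y
    using that gf unfolding im[symmetric] by auto
  have one: "?g \<one>\<^bsub>R\<^esub> = \<one>\<^bsub>S\<^esub>"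
    using gf[OF S.one_in] lin by (simp add: unital_linear_def)
  have add: "?g (y \<oplus>\<^bsub>R\<^esub> z) = ?g y \<oplus>\<^bsub>S\<^esub> ?g z" if "y \<in> carrier R" "z \<in> carrier R" for y z
  proof -
    have "f (?g y \<oplus>\<^bsub>S\<^esub> ?g z) = y \<oplus>\<^bsub>R\<^esub> z"
      using lin g_in fg that by (simp add: unital_linear_def)
    then show ?thesis
      using gf[of "?g y \<oplus>\<^bsub>S\<^esub> ?g z"] g_in that by simp
  qed
  have smult: "?g (c \<odot>\<^bsub>R\<^esub> y) = c \<odot>\<^bsub>S\<^esub> ?g y" if "y \<in> carrier R" for c y
  proof -
    have "f (c \<odot>\<^bsub>S\<^esub> ?g y) = c \<odot>\<^bsub>R\<^esub> y"
      using lin g_in fg that by (simp add: unital_linear_def)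
    then show ?thesis
      using gf[of "c \<odot>\<^bsub>S\<^esub> ?g y"] g_in that by simp
  qed
  have pos: "map_mat ?g Y \<in> mpos S n" if Y: "Y \<in> mpos R n" for Y n
  proof -
    have Y': "Y \<in> mats R n n"
      using operator_system.mpos_mats[OF R] Y by blast
    then have "map_mat f (map_mat ?g Y) = Y"
      using fg by (auto simp: mats_def intro!: eq_matI)
    moreover have "map_mat ?g Y \<in> mats S n n"
      using Y' g_in by (auto simp: mats_def)
    ultimately show ?thesis
      using f Y by (auto simp: uco_isomorphism_def uco_embedding_def)
  qed
  have "ucp R S ?g"
    unfolding ucp_def unital_linear_def using g_in one add smult pos by (simp add: image_subset_iff)
  then show thesis
    using gf fg by (rule that)
qed

lemma uco_embedding_comp:
  assumes l: "uco_embedding D P l" and f: "uco_embedding P W f"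
  shows "uco_embedding D W (\<lambda>x. f (l x))"
proof -
  have l': "l x \<in> carrier P" if "x \<in> carrier D" for x
    using l that by (auto simp: uco_embedding_def unital_linear_def)
  have "map_mat (\<lambda>x. f (l x)) X = map_mat f (map_mat l X)" for X
    by (auto intro!: eq_matI)
  moreover have "map_mat l X \<in> mats P n n" if "X \<in> mats D n n" for X n
    using that l' by (auto simp: mats_def)
  moreover have "inj_on (\<lambda>x. f (l x)) (carrier D)"
    using l f l' by (auto simp: uco_embedding_def inj_on_def)
  ultimately show ?thesis
    using l f unfolding uco_embedding_def unital_linear_def by (simp add: image_subset_iff)
qed

lemma coproduct_ucp:
  assumes "is_coproduct TYPE('r) A B P i j" "operator_system A" "operator_system B"
  shows "operator_system P" "ucp A P i" "ucp B P j"
proof -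
  have P: "operator_system P" "uco_embedding A P i" "uco_embedding B P j"
    using assms(1) by (simp_all add: is_coproduct_def)
  then show "operator_system P"
    by simp
  show "ucp A P i" "ucp B P j"
    by (rule uco_embedding_ucp[OF assms(2) P(2)], rule uco_embedding_ucp[OF assms(3) P(3)])
qed

lemma coproduct_hom_exists:
  fixes R :: "'r opsys"
  assumes "is_coproduct TYPE('r) A B P i j" "operator_system R" "ucp A R \<phi>" "ucp B R \<psi>"
  obtains h where "ucp P R h" "\<And>x. x \<in> carrier A \<Longrightarrow> h (i x) = \<phi> x" "\<And>y. y \<in> carrier B \<Longrightarrow> h (j y) = \<psi> y"
proof -
  have "\<exists>h. ucp P R h \<and> (\<forall>x\<in>carrier A. h (i x) = \<phi> x) \<and> (\<forall>y\<in>carrier B. h (j y) = \<psi> y)"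
    by (rule ex_forward[OF assms(1)[unfolded is_coproduct_def, THEN conjunct2, THEN conjunct2, THEN conjunct2,
      THEN spec, THEN spec, THEN spec, THEN mp, THEN mp, THEN mp, OF assms(2-4)]]) (erule conjunct1)
  then show thesis
    by (elim exE conjE) (rule that, assumption, simp, simp)
qed

lemma coproduct_hom_unique:
  fixes R :: "'r opsys"
  assumes P: "is_coproduct TYPE('r) A B P i j" and AB: "operator_system A" "operator_system B" and R: "operator_system R"
    and h: "ucp P R h" "ucp P R h'" and eq: "\<And>x. x \<in> carrier A \<Longrightarrow> h (i x) = h' (i x)"
      "\<And>y. y \<in> carrier B \<Longrightarrow> h (j y) = h' (j y)" and z: "z \<in> carrier P"
  shows "h z = h' z"
proof -
  note P' = coproduct_ucp[OF P AB]
  obtain e where e: "\<forall>h'. ucp P R h' \<and> (\<forall>x\<in>carrier A. h' (i x) = h (i x)) \<and> (\<forall>y\<in>carrier B. h' (j y) = h (j y))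
              \<longrightarrow> (\<forall>z\<in>carrier P. h' z = e z)"
    using P[unfolded is_coproduct_def, THEN conjunct2, THEN conjunct2, THEN conjunct2,
      THEN spec, THEN spec, THEN spec, THEN mp, THEN mp, THEN mp, OF R ucp_comp[OF P'(2) h(1)] ucp_comp[OF P'(3) h(1)]]
    by blast
  have "h z = e z"
    by (rule e[THEN spec, THEN mp, THEN bspec]) (simp_all add: h z)
  moreover have "h' z = e z"
    by (rule e[THEN spec, THEN mp, THEN bspec]) (simp_all add: h eq z)
  ultimately show ?thesis
    by simp
qed

lemma coproduct_transfer:
  fixes P :: "'c opsys" and W :: "'d opsys"
  assumes P: "is_coproduct TYPE('r) A B P i j" and A: "operator_system A" and B: "operator_system B"
    and W: "operator_system W" and f: "uco_isomorphism P W f"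
  shows "is_coproduct TYPE('r) A B W (\<lambda>x. f (i x)) (\<lambda>y. f (j y))"
proof -
  note P' = coproduct_ucp[OF P A B]
  obtain g where g: "ucp W P g" "\<And>x. x \<in> carrier P \<Longrightarrow> g (f x) = x" "\<And>y. y \<in> carrier W \<Longrightarrow> f (g y) = y"
    by (rule uco_isomorphism_inverse[OF P'(1) W f]) blast
  have emb: "uco_embedding A P i" "uco_embedding B P j" "uco_embedding P W f"
    using P f by (auto simp: is_coproduct_def uco_isomorphism_def)
  have f': "ucp P W f"
    by (rule uco_embedding_ucp[OF P'(1) emb(3)])
  have i_in: "i x \<in> carrier P" if "x \<in> carrier A" for x
    using P'(2) that by (auto simp: ucp_def unital_linear_def)
  have j_in: "j y \<in> carrier P" if "y \<in> carrier B" for y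
    using P'(3) that by (auto simp: ucp_def unital_linear_def)
  have g_in: "g y \<in> carrier P" if "y \<in> carrier W" for y
    using g(1) that by (auto simp: ucp_def unital_linear_def)
  have univ: "\<exists>h. (ucp W R h \<and> (\<forall>x\<in>carrier A. h (f (i x)) = \<phi> x) \<and> (\<forall>y\<in>carrier B. h (f (j y)) = \<psi> y)) \<and>
           (\<forall>h'. ucp W R h' \<and> (\<forall>x\<in>carrier A. h' (f (i x)) = \<phi> x) \<and> (\<forall>y\<in>carrier B. h' (f (j y)) = \<psi> y)
              \<longrightarrow> (\<forall>z\<in>carrier W. h' z = h z))"
    if R: "operator_system R" "ucp A R \<phi>" "ucp B R \<psi>" for R :: "'r opsys" and \<phi> \<psi>
  proof -
    obtain h where h: "ucp P R h" "\<And>x. x \<in> carrier A \<Longrightarrow> h (i x) = \<phi> x" "\<And>y. y \<in> carrier B \<Longrightarrow> h (j y) = \<psi> y"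
      by (rule coproduct_hom_exists[OF P R]) (rule that, blast+)
    have uniq: "h' z = h (g z)" if h': "ucp W R h'" "\<forall>x\<in>carrier A. h' (f (i x)) = \<phi> x" "\<forall>y\<in>carrier B. h' (f (j y)) = \<psi> y"
        and z: "z \<in> carrier W" for h' z
    proof -
      have "h' (f (g z)) = h (g z)"
        by (rule coproduct_hom_unique[OF P A B R(1) ucp_comp[OF f' h'(1)] h(1)]) (simp_all add: h' h g_in z)
      then show ?thesis
        using g(3)[OF z] by simp
    qed
    show ?thesis
      by (intro exI[of _ "\<lambda>z. h (g z)"] conjI ballI allI impI ucp_comp[OF g(1) h(1)])
        (simp_all only: h(2,3) g(2) i_in j_in, elim conjE, rule uniq)
  qed
  show ?thesis
    unfolding is_coproduct_def
    by (intro conjI allI impI W uco_embedding_comp[OF emb(1,3)] uco_embedding_comp[OF emb(2,3)]) (rule univ)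
qed

text \<open>P and W serve as test objects for each other, which is why both have their carriers in
  the test type \<open>'r\<close>.\<close>

lemma coproduct_unique:
  fixes P W :: "'r opsys"
  assumes P: "is_coproduct TYPE('r) A B P i j" and W: "is_coproduct TYPE('r) A B W i' j'"
    and A: "operator_system A" and B: "operator_system B"
  obtains f where "uco_isomorphism P W f"
proof -
  note P' = coproduct_ucp[OF P A B] and W' = coproduct_ucp[OF W A B]
  obtain f where f: "ucp P W f" "\<And>x. x \<in> carrier A \<Longrightarrow> f (i x) = i' x" "\<And>y. y \<in> carrier B \<Longrightarrow> f (j y) = j' y"
    by (rule coproduct_hom_exists[OF P W']) (rule that, blast+)
  obtain g where g: "ucp W P g" "\<And>x. x \<in> carrier A \<Longrightarrow> g (i' x) = i x" "\<And>y. y \<in> carrier B \<Longrightarrow> g (j' y) = j y"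
    by (rule coproduct_hom_exists[OF W P']) (rule that, blast+)
  show thesis
  proof (rule that, rule uco_isomorphism_of_inverse[OF f(1) g(1)])
    show "g (f x) = x" if "x \<in> carrier P" for x
      by (rule coproduct_hom_unique[OF P A B P'(1) ucp_comp[OF f(1) g(1)] ucp_id]) (simp_all add: f g that)
    show "f (g y) = y" if "y \<in> carrier W" for y
      by (rule coproduct_hom_unique[OF W A B W'(1) ucp_comp[OF g(1) f(1)] ucp_id]) (simp_all add: f g that)
  qed
qed

section \<open>The two inclusions into the quotient and the map induced by averaging\<close>

context sign_quotient
begin

definition join :: "complex vec \<Rightarrow> complex vec \<Rightarrow> complex vec" where
  "join x y = vec (k + m) (\<lambda>s. if s < k then x $ s else y $ (s - k))"

definition fst_part :: "complex vec \<Rightarrow> complex vec" where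
  "fst_part x = vec k (\<lambda>p. x $ p)"

definition snd_part :: "complex vec \<Rightarrow> complex vec" where
  "snd_part x = vec m (\<lambda>q. x $ (k + q))"

lemma part_in [simp]: "fst_part x \<in> carrier_vec k" "snd_part x \<in> carrier_vec m" "join x y \<in> carrier_vec (k + m)"
  by (simp_all add: fst_part_def snd_part_def join_def)

lemma part_join [simp]:
  "x \<in> carrier_vec k \<Longrightarrow> fst_part (join x y) = x" "y \<in> carrier_vec m \<Longrightarrow> snd_part (join x y) = y"
  by (auto simp: fst_part_def snd_part_def join_def intro!: eq_vecI)

lemma part_smult [simp]:
  assumes "x \<in> carrier_vec (k + m)"
  shows "fst_part (c \<cdot>\<^sub>v x) = c \<cdot>\<^sub>v fst_part x" "snd_part (c \<cdot>\<^sub>v x) = c \<cdot>\<^sub>v snd_part x"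
  using assms by (auto simp: fst_part_def snd_part_def intro!: eq_vecI)

lemma part_ucp: "ucp T (Cpow_opsys k) fst_part" "ucp T (Cpow_opsys m) snd_part"
proof -
  have T: "k + m > 0"
    using k_pos by simp
  have "cstar_hom (Cpow (k + m)) (Cpow k) fst_part" "cstar_hom (Cpow (k + m)) (Cpow m) snd_part"
    by (auto simp: cstar_hom_def Ring.ring_hom_def Cpow_sel fst_part_def snd_part_def intro!: eq_vecI)
  then have "cstar_morphism (Cpow (k + m)) (Cpow k) fst_part" "cstar_morphism (Cpow (k + m)) (Cpow m) snd_part"
    by (auto intro!: cstar_morphism.intro cstar_morphism_axioms.intro Cpow_cstar_algebra T k_pos m_pos)
  then show "ucp T (Cpow_opsys k) fst_part" "ucp T (Cpow_opsys m) snd_part"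
    unfolding Cpow_opsys_def
    by (intro cstar_morphism_ucp cstar_algebra.operator_subspace_carrier Cpow_cstar_algebra T;
      simp add: Cpow_sel fst_part_def snd_part_def image_subset_iff)+
qed

lemma induced_map:
  assumes R: "operator_system R" and \<phi>: "ucp (Cpow_opsys k) R \<phi>" and \<psi>: "ucp (Cpow_opsys m) R \<psi>"
  shows "ucp T R (\<lambda>x. (1 / 2) \<odot>\<^bsub>R\<^esub> (\<phi> (fst_part x) \<oplus>\<^bsub>R\<^esub> \<psi> (snd_part x)))" (is ?ucp)
    and "\<exists>h. ucp Q R h \<and> (\<forall>x\<in>carrier_vec (k + m). h (cls x) = (1 / 2) \<odot>\<^bsub>R\<^esub> (\<phi> (fst_part x) \<oplus>\<^bsub>R\<^esub> \<psi> (snd_part x)))"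
proof -
  interpret R: operator_system R by (rule R)
  show ?ucp
    by (rule ucp_average[OF T_operator_system R ucp_comp[OF part_ucp(1) \<phi>] ucp_comp[OF part_ucp(2) \<psi>]])
  have "fst_part sign_vec = \<one>\<^bsub>Cpow_opsys k\<^esub>" "snd_part sign_vec = (- 1) \<odot>\<^bsub>Cpow_opsys m\<^esub> \<one>\<^bsub>Cpow_opsys m\<^esub>"
    by (auto simp: fst_part_def snd_part_def sign_vec_def Cpow_opsys_sel intro!: eq_vecI)
  then have "\<phi> (fst_part sign_vec) = \<one>\<^bsub>R\<^esub>" "\<psi> (snd_part sign_vec) = (- 1) \<odot>\<^bsub>R\<^esub> \<one>\<^bsub>R\<^esub>"
    using \<phi> \<psi> by (simp_all add: ucp_def unital_linear_def Cpow_opsys_sel)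
  moreover have "\<one>\<^bsub>R\<^esub> \<oplus>\<^bsub>R\<^esub> (- 1) \<odot>\<^bsub>R\<^esub> \<one>\<^bsub>R\<^esub> = \<zero>\<^bsub>R\<^esub>"
    using R.smult_add_left[of "\<one>\<^bsub>R\<^esub>" 1 "- 1"] R.one_in by simp
  ultimately have "(1 / 2) \<odot>\<^bsub>R\<^esub> (\<phi> (fst_part sign_vec) \<oplus>\<^bsub>R\<^esub> \<psi> (snd_part sign_vec)) = \<zero>\<^bsub>R\<^esub>"
    by simp
  from this obtain h where "ucp Q R h"
      "\<And>x. x \<in> carrier_vec (k + m) \<Longrightarrow> h (cls x) = (1 / 2) \<odot>\<^bsub>R\<^esub> (\<phi> (fst_part x) \<oplus>\<^bsub>R\<^esub> \<psi> (snd_part x))"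
    by (rule quotient_lift[OF R \<open>?ucp\<close>]) (rule that, blast+)
  then show "\<exists>h. ucp Q R h \<and> (\<forall>x\<in>carrier_vec (k + m). h (cls x) = (1 / 2) \<odot>\<^bsub>R\<^esub> (\<phi> (fst_part x) \<oplus>\<^bsub>R\<^esub> \<psi> (snd_part x)))"
    by blast
qed

text \<open>The factor 2 undoes the 1/2 of the average. The map is unital because 2 (1, 0) is the
  unit (1, 1) plus the sign vector (1, -1); for \<open>incl2\<close> the sign vector is
  subtracted.\<close>

definition incl1 :: "complex vec \<Rightarrow> complex vec set" where
  "incl1 x = cls (2 \<cdot>\<^sub>v join x (0\<^sub>v m))"

definition incl2 :: "complex vec \<Rightarrow> complex vec set" where
  "incl2 y = cls (2 \<cdot>\<^sub>v join (0\<^sub>v k) y)"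

lemma incl_lin: "unital_linear (Cpow_opsys k) Q incl1" "unital_linear (Cpow_opsys m) Q incl2"
  unfolding unital_linear_def
  by (auto simp: incl1_def incl2_def Cpow_opsys_sel Q_carrier Q_simps intro!: cls_eqI)
    (auto simp: join_def algebra_simps)

text \<open>x is the average of 2 (x', 0) and 2 (0, x'') for its two parts x' and x''; a linear map
  on Q is therefore determined by its composites with the inclusions.\<close>

lemma cls_decomp:
  assumes x: "x \<in> carrier_vec (k + m)"
  shows "cls x = (1 / 2) \<odot>\<^bsub>Q\<^esub> (incl1 (fst_part x) \<oplus>\<^bsub>Q\<^esub> incl2 (snd_part x))"
proof -
  have "(1 / 2) \<cdot>\<^sub>v (2 \<cdot>\<^sub>v join (fst_part x) (0\<^sub>v m) + 2 \<cdot>\<^sub>v join (0\<^sub>v k) (snd_part x)) = x"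
    by (rule eq_vecI) (use x in \<open>auto simp: join_def fst_part_def snd_part_def\<close>)
  then show ?thesis
    by (simp add: incl1_def incl2_def Q_simps)
qed

lemma average_incl:
  assumes R: "operator_system R" and \<phi>: "ucp (Cpow_opsys k) R \<phi>" and \<psi>: "ucp (Cpow_opsys m) R \<psi>"
    and h: "\<And>x. x \<in> carrier_vec (k + m) \<Longrightarrow> h (cls x) = (1 / 2) \<odot>\<^bsub>R\<^esub> (\<phi> (fst_part x) \<oplus>\<^bsub>R\<^esub> \<psi> (snd_part x))"
  shows "x \<in> carrier_vec k \<Longrightarrow> h (incl1 x) = \<phi> x" "y \<in> carrier_vec m \<Longrightarrow> h (incl2 y) = \<psi> y"
proof -
  interpret R: operator_system R by (rule R)
  interpret RG: abelian_group R by (rule R.abelian_group_V)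
  have \<phi>': "\<phi> x \<in> carrier R" "\<phi> (c \<cdot>\<^sub>v x) = c \<odot>\<^bsub>R\<^esub> \<phi> x" if "x \<in> carrier_vec k" for c x
    using \<phi> that by (auto simp: ucp_def unital_linear_def Cpow_opsys_sel)
  have \<psi>': "\<psi> x \<in> carrier R" "\<psi> (c \<cdot>\<^sub>v x) = c \<odot>\<^bsub>R\<^esub> \<psi> x" if "x \<in> carrier_vec m" for c x
    using \<psi> that by (auto simp: ucp_def unital_linear_def Cpow_opsys_sel)
  have "0 \<cdot>\<^sub>v 0\<^sub>v n = (0\<^sub>v n :: complex vec)" for n
    by (auto intro!: eq_vecI)
  then have zero: "\<phi> (0\<^sub>v k) = \<zero>\<^bsub>R\<^esub>" "\<psi> (0\<^sub>v m) = \<zero>\<^bsub>R\<^esub>"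
    using \<phi>'(1)[of "0\<^sub>v k"] \<phi>'(2)[of "0\<^sub>v k" 0] \<psi>'(1)[of "0\<^sub>v m"] \<psi>'(2)[of "0\<^sub>v m" 0] by auto
  show "x \<in> carrier_vec k \<Longrightarrow> h (incl1 x) = \<phi> x" "y \<in> carrier_vec m \<Longrightarrow> h (incl2 y) = \<psi> y"
    by (simp_all add: incl1_def incl2_def h \<phi>' \<psi>' zero)
qed

end

section \<open>Identification of the four operator systems\<close>

lemma (in sign_quotient) induced_hom:
  assumes R: "operator_system R" "ucp (Cpow_opsys k) R f" "ucp (Cpow_opsys m) R g"
  shows "\<exists>h. ucp Q R h \<and> (\<forall>x\<in>carrier (Cpow_opsys k). h (incl1 x) = f x) \<and> (\<forall>y\<in>carrier (Cpow_opsys m). h (incl2 y) = g y)"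
proof -
  obtain h where "ucp Q R h"
      "\<And>x. x \<in> carrier_vec (k + m) \<Longrightarrow> h (cls x) = (1 / 2) \<odot>\<^bsub>R\<^esub> (f (fst_part x) \<oplus>\<^bsub>R\<^esub> g (snd_part x))"
    using induced_map(2)[OF R] by blast
  then show ?thesis
    using average_incl[OF R, of h] by (intro exI[of _ h]) (simp add: Cpow_opsys_sel)
qed

text \<open>Evaluation at coordinate 0 times the unit. Paired with the identity of the other
  summand, it induces the retractions that make the inclusions into the quotient embeddings.\<close>

lemma point_ucp:
  assumes "p > 0" "q > 0"
  shows "ucp (Cpow_opsys p) (Cpow_opsys q) (\<lambda>x. vec q (\<lambda>_. x $ 0))"
proof -
  have "cstar_hom (Cpow p) (Cpow q) (\<lambda>x. vec q (\<lambda>_. x $ 0))"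
    using assms by (auto simp: cstar_hom_def Ring.ring_hom_def Cpow_sel intro!: eq_vecI)
  then have "cstar_morphism (Cpow p) (Cpow q) (\<lambda>x. vec q (\<lambda>_. x $ 0))"
    using assms by (intro cstar_morphism.intro cstar_morphism_axioms.intro Cpow_cstar_algebra)
  then show ?thesis
    unfolding Cpow_opsys_def
    by (rule cstar_morphism_ucp[OF _ cstar_algebra.operator_subspace_carrier[OF Cpow_cstar_algebra[OF assms(1)]]])
      (auto simp: Cpow_sel)
qed

section \<open>The averaging map embeds the quotient into the group C*-algebra\<close>

context universal_cyclic_cstar
begin

sublocale sign_quotient k m
  by unfold_locales (rule k, rule m)

abbreviation "S \<equiv> opsub C sum_space"

interpretation alpha: cstar_morphism "Cpow k" C a.\<alpha>
  by (rule alpha_morphism)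

interpretation beta: cstar_morphism "Cpow m" C b.\<alpha>
  by (rule alpha_morphism)

lemma S_operator_system: "operator_system S"
  by (rule operator_system_opsub[OF sum_space_operator_subspace])

lemma alpha_ucp: "ucp (Cpow_opsys k) S a.\<alpha>" and beta_ucp: "ucp (Cpow_opsys m) S b.\<alpha>"
  unfolding Cpow_opsys_def using alpha_in_sum_space beta_in_sum_space
  by (auto intro!: cstar_morphism_ucp alpha_morphism alpha.A.operator_subspace_carrier beta.A.operator_subspace_carrier)

lemma alpha_in: "x \<in> carrier_vec k \<Longrightarrow> a.\<alpha> x \<in> carrier C" and beta_in: "y \<in> carrier_vec m \<Longrightarrow> b.\<alpha> y \<in> carrier C"
  using alpha.f_in beta.f_in by (simp_all add: Cpow_sel)

lemma alpha_smult: "x \<in> carrier_vec k \<Longrightarrow> a.\<alpha> (c \<cdot>\<^sub>v x) = c \<odot> a.\<alpha> x"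
  and beta_smult: "y \<in> carrier_vec m \<Longrightarrow> b.\<alpha> (c \<cdot>\<^sub>v y) = c \<odot> b.\<alpha> y"
  using alpha.f_smult beta.f_smult by (simp_all add: Cpow_sel)

definition avg :: "complex vec \<Rightarrow> 'u" where
  "avg x = (1 / 2) \<odot> (a.\<alpha> (fst_part x) \<oplus> b.\<alpha> (snd_part x))"

lemma avg_eq: "avg = (\<lambda>x. (1 / 2) \<odot>\<^bsub>S\<^esub> (a.\<alpha> (fst_part x) \<oplus>\<^bsub>S\<^esub> b.\<alpha> (snd_part x)))"
  by (simp add: avg_def opsub_def fun_eq_iff)

lemma avg_ucp: "ucp T S avg"
  unfolding avg_eq by (rule induced_map(1)[OF S_operator_system alpha_ucp beta_ucp])

lemma avg_in: "avg x \<in> carrier C"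
  by (simp add: avg_def alpha_in beta_in)

lemma avg_in_sum_space: "x \<in> carrier_vec (k + m) \<Longrightarrow> avg x \<in> sum_space"
  and avg_add: "x \<in> carrier_vec (k + m) \<Longrightarrow> y \<in> carrier_vec (k + m) \<Longrightarrow> avg (x + y) = avg x \<oplus> avg y"
  and avg_smult: "x \<in> carrier_vec (k + m) \<Longrightarrow> avg (c \<cdot>\<^sub>v x) = c \<odot> avg x"
  using avg_ucp by (auto simp: ucp_def unital_linear_def Cpow_opsys_sel opsub_def)

lemma avg_zero: "avg (0\<^sub>v (k + m)) = \<zero>"
  using avg_smult[of sign_vec 0] by (simp add: zero_smult_sign_vec avg_in)

lemma avg_star:
  assumes x: "x \<in> carrier_vec (k + m)"
  shows "avg (map_vec cnj x) = star C (avg x)"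
proof -
  have "fst_part (map_vec cnj x) = map_vec cnj (fst_part x)" "snd_part (map_vec cnj x) = map_vec cnj (snd_part x)"
    using x by (auto simp: fst_part_def snd_part_def intro!: eq_vecI)
  then show ?thesis
    using alpha.f_star[of "fst_part x"] beta.f_star[of "snd_part x"]
    by (simp add: avg_def Cpow_sel star_smult star_add alpha_in beta_in)
qed

lemma avg_join:
  assumes "x \<in> carrier_vec k" "y \<in> carrier_vec m"
  shows "avg (2 \<cdot>\<^sub>v join x y) = a.\<alpha> x \<oplus> b.\<alpha> y"
  using assms by (simp add: avg_def alpha_smult beta_smult alpha_in beta_in smult_add_right)

text \<open>A pair (p, q) defines a character of C that sends \<alpha> x to x_p and \<beta> y to
  y_q. Twice its value at \<open>avg x\<close> is x_p + x_(k+q), and these numbers determine the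
  coset.\<close>

lemma avg_inj:
  assumes x: "x \<in> carrier_vec (k + m)" and y: "y \<in> carrier_vec (k + m)" and eq: "avg x = avg y"
  shows "cls x = cls y"
proof (rule cls_eqI)
  fix p q
  assume p: "p < k" and q: "q < m"
  let ?I = "{0 :: nat}"
  have I: "finite ?I"
    by simp
  obtain h where h: "cstar_hom C (fun_mat ?I) h" "\<And>x. x \<in> carrier_vec k \<Longrightarrow> h (a.\<alpha> x) = fun_diag ?I (\<lambda>_. x $ p)"
    "\<And>y. y \<in> carrier_vec m \<Longrightarrow> h (b.\<alpha> y) = fun_diag ?I (\<lambda>_. y $ q)"
    by (rule matrix_representation[OF I diag_hom[OF I, of "\<lambda>_. p"] diag_hom[OF I, of "\<lambda>_. q"], OF p q]) blast
  interpret h: cstar_morphism C "fun_mat ?I" h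
    by (intro cstar_morphism.intro cstar_morphism_axioms.intro cstar_algebra_axioms fun_mat_cstar_algebra[OF I] h(1))
  have h_avg: "2 * h (avg z) 0 0 = z $ p + z $ (k + q)" for z
  proof -
    have "h (avg z) = (1 / 2) \<odot>\<^bsub>fun_mat ?I\<^esub> (fun_diag ?I (\<lambda>_. fst_part z $ p) \<oplus>\<^bsub>fun_mat ?I\<^esub> fun_diag ?I (\<lambda>_. snd_part z $ q))"
      by (simp add: avg_def h.f_smult h.f_add alpha_in beta_in h(2,3))
    then show ?thesis
      using p q by (simp add: fun_mat_def fun_diag_def fst_part_def snd_part_def)
  qed
  show "x $ p + x $ (k + q) = y $ p + y $ (k + q)"
    unfolding h_avg[symmetric] eq ..
qed

text \<open>Representatives of the entries are chosen so that they form Hermitian arrays, as the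
  separation argument demands. The membership given by \<open>amalg_cone_of_positive\<close> then
  splits such an array plus a multiple of the unit into a positive matrix and a null
  element.\<close>

lemma lift_positive:
  assumes \<phi>: "\<And>x. x \<in> carrier_vec (k + m) \<Longrightarrow> \<phi> (cls x) = avg x" and X: "X \<in> mats Q n n"
    and pos: "map_mat \<phi> X \<in> cstar_mpos C n"
  shows "X \<in> mpos Q n"
proof -
  have X': "X \<in> carrier_mat n n"
    using X by (simp add: mats_def)
  define x where "x i j = (SOME x. x \<in> carrier_vec (k + m) \<and> X $$ (i, j) = cls x)" for i j
  have x: "x i j \<in> carrier_vec (k + m) \<and> X $$ (i, j) = cls (x i j)" if "i < n" "j < n" for i j
    unfolding x_def
  proof (rule someI_ex)
    have "X $$ (i, j) \<in> carrier Q"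
      using X that by (simp add: mats_def)
    then show "\<exists>x. x \<in> carrier_vec (k + m) \<and> X $$ (i, j) = cls x"
      by (auto simp: Q_carrier)
  qed
  note x_in = x[THEN conjunct1] and X_eq = x[THEN conjunct2]
  have entry: "map_mat \<phi> X $$ (i, j) = avg (x i j)" if "i < n" "j < n" for i j
    using X' that X_eq[OF that] \<phi>[OF x_in[OF that]] by simp
  have adj: "star C (avg (x j i)) = avg (x i j)" if "i < n" "j < n" for i j
    using arg_cong[OF cstar_mpos_adjoint[OF pos], of "\<lambda>M. M $$ (i, j)"] X' that
      entry[OF that] entry[OF that(2,1)] by (simp add: madjoint_def)
  \<comment> \<open>Averaging with the adjoint keeps the image under \<open>avg\<close>, as the
    image of X is self-adjoint, and by \<open>avg_inj\<close> it also keeps the coset.\<close>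
  define w where "w i j = (1 / 2) \<cdot>\<^sub>v (x i j + map_vec cnj (x j i))" for i j
  have w_in: "w i j \<in> carrier_vec (k + m)" if "i < n" "j < n" for i j
    using x_in[OF that] x_in[OF that(2,1)] by (simp add: w_def)
  have w_avg: "avg (w i j) = avg (x i j)" if "i < n" "j < n" for i j
  proof -
    have "avg (w i j) = (1 / 2) \<odot> (avg (x i j) \<oplus> avg (x i j))"
      using x_in[OF that] x_in[OF that(2,1)] adj[OF that] by (simp add: w_def avg_smult avg_add avg_star)
    also have "\<dots> = avg (x i j)"
      using smult_add_left[OF avg_in, of "1 / 2" "1 / 2" "x i j"] by (simp add: smult_add_right avg_in)
    finally show ?thesis .
  qed
  have w_cls: "cls (w i j) = X $$ (i, j)" if "i < n" "j < n" for i j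
    using avg_inj[OF w_in[OF that] x_in[OF that] w_avg[OF that]] X_eq[OF that] by simp
  have w_herm: "w j i $ s = cnj (w i j $ s)" if "s < k + m" "i < n" "j < n" for s i j
    using x_in[OF that(2,3)] x_in[OF that(3,2)] that(1) by (simp add: w_def add.commute)
  \<comment> \<open>The factor 1/2 is that of \<open>avg\<close>; accordingly \<epsilon> is halved
    below and P is doubled.\<close>
  define z where "z = (\<lambda>(s, i, j). w i j $ s / 2)"
  have "\<exists>P\<in>mpos T n. map_mat cls P = madd Q X (mdiag Q n (complex_of_real \<epsilon>))" if "\<epsilon> > 0" for \<epsilon> :: real
  proof -
    have "amalg_cone k m n (\<lambda>a. z a + unit_array (\<epsilon> / 2) a)"
    proof (rule amalg_cone_of_positive[where x = "\<lambda>i j. (1 / 2) \<cdot>\<^sub>v fst_part (w i j)" and y = "\<lambda>i j. (1 / 2) \<cdot>\<^sub>v snd_part (w i j)"])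
      have "mat n n (\<lambda>(i, j). a.\<alpha> ((1 / 2) \<cdot>\<^sub>v fst_part (w i j)) \<oplus> b.\<alpha> ((1 / 2) \<cdot>\<^sub>v snd_part (w i j))) = map_mat \<phi> X"
      proof (rule eq_matI)
        fix i j
        assume "i < dim_row (map_mat \<phi> X)" "j < dim_col (map_mat \<phi> X)"
        then have ij: "i < n" "j < n"
          using X' by auto
        have "a.\<alpha> ((1 / 2) \<cdot>\<^sub>v fst_part (w i j)) \<oplus> b.\<alpha> ((1 / 2) \<cdot>\<^sub>v snd_part (w i j)) = avg (w i j)"
          by (simp add: avg_def alpha_smult beta_smult smult_add_right alpha_in beta_in)
        then show "mat n n (\<lambda>(i, j). a.\<alpha> ((1 / 2) \<cdot>\<^sub>v fst_part (w i j)) \<oplus> b.\<alpha> ((1 / 2) \<cdot>\<^sub>v snd_part (w i j))) $$ (i, j)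
            = map_mat \<phi> X $$ (i, j)"
          using entry[OF ij] w_avg[OF ij] ij by simp
      qed (use X' in auto)
      then show "mat n n (\<lambda>(i, j). a.\<alpha> ((1 / 2) \<cdot>\<^sub>v fst_part (w i j)) \<oplus> b.\<alpha> ((1 / 2) \<cdot>\<^sub>v snd_part (w i j))) \<in> cstar_mpos C n"
        using pos by simp
      show "z (s, j, i) = cnj (z (s, i, j))" if "s < k + m" "i < n" "j < n" for s i j
        using w_herm[OF that] by (simp add: z_def)
      show "z (s, i, j) = (if s < k then ((1 / 2) \<cdot>\<^sub>v fst_part (w i j)) $ s else ((1 / 2) \<cdot>\<^sub>v snd_part (w i j)) $ (s - k))"
        if "s < k + m" for i j s
        using that by (auto simp: z_def fst_part_def snd_part_def)
    qed (use \<open>\<epsilon> > 0\<close> in auto)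
    then obtain p :: nat and Z H where ZH: "\<And>s i j. s < k + m \<Longrightarrow> i < n \<Longrightarrow> j < n \<Longrightarrow>
        z (s, i, j) + unit_array (\<epsilon> / 2) (s, i, j) = (\<Sum>l<p. cnj (Z s l i) * Z s l j) + (if s < k then H i j else - H i j)"
      by (rule amalg_coneE) blast
    \<comment> \<open>H is dropped: it enters with opposite signs in the two blocks and cancels in
      every sum of the coordinates p and k + q.\<close>
    define P where "P = mat n n (\<lambda>(i, j). vec (k + m) (\<lambda>s. 2 * (\<Sum>l<p. cnj (Z s l i) * Z s l j)))"
    have sq: "cnj (complex_of_real (sqrt 2) * c) * (complex_of_real (sqrt 2) * d) = 2 * (cnj c * d)" for c d
    proof -
      have "complex_of_real (sqrt 2) * complex_of_real (sqrt 2) = 2"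
        by (simp flip: of_real_mult)
      then show ?thesis
        by (simp add: mult.left_commute mult.assoc[symmetric])
    qed
    have km: "k + m > 0"
      using k by simp
    have "P \<in> cstar_mpos (Cpow (k + m)) n"
    proof (subst Cpow_mpos_iff[OF km])
      show "\<exists>p Z. \<forall>s<k + m. \<forall>i<n. \<forall>j<n. P $$ (i, j) $ s = (\<Sum>l<(p :: nat). cnj (Z s l i) * Z s l j)"
        by (rule exI[of _ p], rule exI[of _ "\<lambda>s l i. complex_of_real (sqrt 2) * Z s l i"])
          (simp only: sq sum_distrib_left[symmetric], simp add: P_def)
    qed (simp add: P_def Cpow_sel)
    then have "P \<in> mpos T n"
      by (simp add: Cpow_opsys_mpos[OF km])
    moreover have "map_mat cls P = madd Q X (mdiag Q n (complex_of_real \<epsilon>))"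
    proof (rule eq_matI)
      fix i j
      assume "i < dim_row (madd Q X (mdiag Q n (complex_of_real \<epsilon>)))" "j < dim_col (madd Q X (mdiag Q n (complex_of_real \<epsilon>)))"
      then have ij: "i < n" "j < n"
        using X' by (auto simp: madd_def)
      let ?d = "if i = j then complex_of_real \<epsilon> \<cdot>\<^sub>v vec (k + m) (\<lambda>_. 1) else 0\<^sub>v (k + m)"
      have "madd Q X (mdiag Q n (complex_of_real \<epsilon>)) $$ (i, j) = cls (w i j) \<oplus>\<^bsub>Q\<^esub> cls ?d"
        using X' ij by (simp add: madd_def mdiag_def w_cls Q_simps)
      also have "\<dots> = cls (w i j + ?d)"
        by (rule Q_add) (use w_in[OF ij] in auto)
      also have "\<dots> = cls (P $$ (i, j))"
      proof (rule cls_eqI)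
        fix p q
        assume pq: "p < k" "q < m"
        have sums: "w i j $ p / 2 + unit_array (\<epsilon> / 2) (p, i, j) + (w i j $ (k + q) / 2 + unit_array (\<epsilon> / 2) (k + q, i, j))
            = P $$ (i, j) $ p / 2 + P $$ (i, j) $ (k + q) / 2"
          using ZH[of p i j] ZH[of "k + q" i j] pq ij by (simp add: z_def P_def)
        show "(w i j + ?d) $ p + (w i j + ?d) $ (k + q) = P $$ (i, j) $ p + P $$ (i, j) $ (k + q)"
          using arg_cong[OF sums, of "\<lambda>c. 2 * c"] w_in[OF ij] pq
          by (simp add: unit_array_def distrib_left add_ac split: if_splits)
      qed
      finally show "map_mat cls P $$ (i, j) = madd Q X (mdiag Q n (complex_of_real \<epsilon>)) $$ (i, j)"
        using ij by (simp add: P_def)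
    qed (use X' in \<open>simp_all add: P_def madd_def\<close>)
    ultimately show ?thesis
      by blast
  qed
  then show ?thesis
    using X Q_mpos_iff by blast
qed

text \<open>Positivity in Q corresponds to positivity of the image by \<open>lift_positive\<close>,
  and the operator system axioms of Q follow by transfer from \<open>S\<close>. The image is all of
  \<open>S\<close> because the class of 2 (x, y) is sent to \<alpha> x + \<beta> y.\<close>

lemma quotient_embedding:
  obtains \<phi> where "operator_system Q" "uco_isomorphism Q S \<phi>" "\<And>x. x \<in> carrier_vec (k + m) \<Longrightarrow> \<phi> (cls x) = avg x"
proof -
  obtain \<phi> where \<phi>: "ucp Q S \<phi>" "\<And>x. x \<in> carrier_vec (k + m) \<Longrightarrow> \<phi> (cls x) = avg x"
    using induced_map(2)[OF S_operator_system alpha_ucp beta_ucp] unfolding fun_cong[OF avg_eq, symmetric] by blast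
  interpret S: operator_system S
    by (rule S_operator_system)
  have inj: "inj_on \<phi> (carrier Q)"
  proof (rule inj_onI)
    fix Y Z
    assume "Y \<in> carrier Q" "Z \<in> carrier Q" and eq: "\<phi> Y = \<phi> Z"
    then obtain y z where yz: "y \<in> carrier_vec (k + m)" "z \<in> carrier_vec (k + m)" "Y = cls y" "Z = cls z"
      by (auto simp: Q_carrier)
    then show "Y = Z"
      using eq avg_inj[OF yz(1,2)] by (simp add: \<phi>(2))
  qed
  have mpos_iff: "X \<in> mpos Q n \<longleftrightarrow> map_mat \<phi> X \<in> mpos S n" if X: "X \<in> mats Q n n" for X n
  proof
    assume "map_mat \<phi> X \<in> mpos S n"
    then show "X \<in> mpos Q n"
      using lift_positive[OF \<phi>(2) X] by (simp add: opsub_def)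
  qed (use \<phi>(1) in \<open>simp add: ucp_def\<close>)
  have "linear_injection Q S \<phi>"
  proof (rule linear_injection.intro)
    show "\<phi> x \<in> carrier S" if "x \<in> carrier Q" for x
      using that by (auto simp: Q_carrier \<phi>(2) opsub_def avg_in_sum_space)
    show "\<phi> (star Q x) = star S (\<phi> x)" if "x \<in> carrier Q" for x
      using that by (auto simp: Q_carrier Q_simps \<phi>(2) opsub_def avg_star)
    show "\<phi> \<zero>\<^bsub>Q\<^esub> = \<zero>\<^bsub>S\<^esub>"
      by (simp add: Q_simps \<phi>(2) opsub_def avg_zero)
  qed (use \<phi>(1) inj Q_in S.star_vector_space_axioms in \<open>simp_all add: ucp_def unital_linear_def\<close>)
  then have Q: "operator_system Q"
    using Q_mpos_iff by (intro operator_system_transfer[OF S_operator_system _ _ mpos_iff]) auto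
  have "\<phi> ` carrier Q = carrier S"
  proof
    show "carrier S \<subseteq> \<phi> ` carrier Q"
    proof
      fix z
      assume "z \<in> carrier S"
      then obtain x y where "x \<in> carrier_vec k" "y \<in> carrier_vec m" "z = a.\<alpha> x \<oplus> b.\<alpha> y"
        by (auto simp: opsub_def sum_space_def Cpow_sel)
      then have "z = \<phi> (cls (2 \<cdot>\<^sub>v join x y))"
        by (simp add: \<phi>(2) avg_join)
      then show "z \<in> \<phi> ` carrier Q"
        by (simp add: Q_carrier)
    qed
  qed (use \<phi>(1) in \<open>simp add: ucp_def unital_linear_def\<close>)
  then have "uco_isomorphism Q S \<phi>"
    using \<phi>(1) inj mpos_iff by (simp add: uco_isomorphism_def uco_embedding_def ucp_def)
  with Q show thesis
    using \<phi>(2) by (rule that)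
qed

text \<open>The ucp map is \<open>avg\<close>, which distinguishes all cosets by
  \<open>avg_inj\<close>.\<close>

lemma null_space_is_kernel: "is_kernel TYPE('u) T (null_space k m)"
proof -
  obtain \<phi> where \<phi>: "\<And>x. x \<in> carrier_vec (k + m) \<Longrightarrow> \<phi> (cls x) = avg x"
    using quotient_embedding by blast
  have "x \<in> null_space k m \<longleftrightarrow> avg x = \<zero>\<^bsub>S\<^esub>" if x: "x \<in> carrier T" for x
  proof -
    have x: "x \<in> carrier_vec (k + m)"
      using x by (simp add: Cpow_opsys_sel)
    have "x \<in> null_space k m \<longleftrightarrow> cls x = cls (0\<^sub>v (k + m))"
      unfolding null_space_cls using in_cls[OF x] in_clsD(2)[of x "0\<^sub>v (k + m)"] by blast
    also have "\<dots> \<longleftrightarrow> avg x = avg (0\<^sub>v (k + m))"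
      using \<phi>[OF x] \<phi>[of "0\<^sub>v (k + m)"] avg_inj[OF x, of "0\<^sub>v (k + m)"] by auto
    finally show ?thesis
      by (simp add: avg_zero opsub_def)
  qed
  moreover have "null_space k m \<subseteq> carrier T"
    using in_clsD(1) by (auto simp: null_space_cls Cpow_opsys_sel)
  ultimately have "null_space k m = {x \<in> carrier T. avg x = \<zero>\<^bsub>S\<^esub>}"
    by blast
  then show ?thesis
    unfolding is_kernel_def using S_operator_system avg_ucp by blast
qed

text \<open>The inclusions are ucp because their composites with \<phi> are \<alpha> and \<beta>,
  and \<phi> reflects positivity. Induced maps come from \<open>quotient_lift\<close>, which leaves
  the type of the test system open; hence \<open>'r\<close> is arbitrary and unrelated to
  \<open>'u\<close>. Uniqueness holds because the ranges of the inclusions span Q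
  (\<open>cls_decomp\<close>).\<close>

lemma quotient_coproduct: "is_coproduct TYPE('r) (Cpow_opsys k) (Cpow_opsys m) Q incl1 incl2"
proof -
  obtain \<phi> where Q: "operator_system Q" and \<phi>: "uco_isomorphism Q S \<phi>" "\<And>x. x \<in> carrier_vec (k + m) \<Longrightarrow> \<phi> (cls x) = avg x"
    using quotient_embedding by blast
  interpret Q: operator_system Q by (rule Q)
  note ops = Cpow_operator_system[OF k] Cpow_operator_system[OF m]
  have avg: "\<phi> (cls x) = (1 / 2) \<odot>\<^bsub>S\<^esub> (a.\<alpha> (fst_part x) \<oplus>\<^bsub>S\<^esub> b.\<alpha> (snd_part x))" if "x \<in> carrier_vec (k + m)" for x
    using \<phi>(2)[OF that] by (simp add: avg_eq)
  note \<phi>_incl = average_incl[OF S_operator_system alpha_ucp beta_ucp avg]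
  have lift: "ucp A Q i" if A: "operator_system A" and i: "unital_linear A Q i" and g: "ucp A S g"
      and \<phi>i: "\<And>x. x \<in> carrier A \<Longrightarrow> \<phi> (i x) = g x" for A :: "complex vec opsys" and i g
  proof -
    have "map_mat i X \<in> mpos Q n" if X: "X \<in> mpos A n" for X n
    proof -
      have X': "X \<in> mats A n n"
        using operator_system.mpos_mats[OF A] X by blast
      then have "map_mat \<phi> (map_mat i X) = map_mat g X"
        using \<phi>i by (auto simp: mats_def intro!: eq_matI)
      moreover have "map_mat g X \<in> mpos S n"
        using g X by (simp add: ucp_def)
      moreover have "map_mat i X \<in> mats Q n n"
        using X' i by (auto simp: mats_def unital_linear_def)
      ultimately show ?thesis
        using \<phi>(1) unfolding uco_isomorphism_def uco_embedding_def by auto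
    qed
    then show ?thesis
      using i by (simp add: ucp_def)
  qed
  have incl: "ucp (Cpow_opsys k) Q incl1" "ucp (Cpow_opsys m) Q incl2"
    using \<phi>_incl by (auto intro!: lift[OF ops(1) incl_lin(1) alpha_ucp] lift[OF ops(2) incl_lin(2) beta_ucp] simp: Cpow_opsys_sel)
  have emb1: "uco_embedding (Cpow_opsys k) Q incl1"
  proof -
    obtain r where "ucp Q (Cpow_opsys k) r" "\<forall>x\<in>carrier (Cpow_opsys k). r (incl1 x) = x"
      using induced_hom[OF ops(1) ucp_id point_ucp[OF m k]] by blast
    then show ?thesis
      by (intro uco_embedding_of_retraction[OF incl(1)]) auto
  qed
  have emb2: "uco_embedding (Cpow_opsys m) Q incl2"
  proof -
    obtain r where "ucp Q (Cpow_opsys m) r" "\<forall>y\<in>carrier (Cpow_opsys m). r (incl2 y) = y"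
      using induced_hom[OF ops(2) point_ucp[OF k m] ucp_id] by blast
    then show ?thesis
      by (intro uco_embedding_of_retraction[OF incl(2)]) auto
  qed
  show ?thesis
    unfolding is_coproduct_def
  proof (intro conjI allI impI Q emb1 emb2)
    fix R :: "'r opsys" and f g
    assume R: "operator_system R" "ucp (Cpow_opsys k) R f" "ucp (Cpow_opsys m) R g"
    obtain h where h: "ucp Q R h" "\<forall>x\<in>carrier (Cpow_opsys k). h (incl1 x) = f x" "\<forall>y\<in>carrier (Cpow_opsys m). h (incl2 y) = g y"
      using induced_hom[OF R] by blast
    have value_eq: "h' (cls x) = (1 / 2) \<odot>\<^bsub>R\<^esub> (f (fst_part x) \<oplus>\<^bsub>R\<^esub> g (snd_part x))"
      if h': "ucp Q R h'" "\<forall>x\<in>carrier (Cpow_opsys k). h' (incl1 x) = f x" "\<forall>y\<in>carrier (Cpow_opsys m). h' (incl2 y) = g y"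
        and x: "x \<in> carrier_vec (k + m)" for h' x
    proof -
      have "incl1 (fst_part x) \<in> carrier Q" "incl2 (snd_part x) \<in> carrier Q"
        by (simp_all add: incl1_def incl2_def Q_carrier)
      then show ?thesis
        using h' Q_in(3) unfolding cls_decomp[OF x] by (simp add: ucp_def unital_linear_def Cpow_opsys_sel)
    qed
    have uniq: "h' z = h z"
      if h': "ucp Q R h'" "\<forall>x\<in>carrier (Cpow_opsys k). h' (incl1 x) = f x" "\<forall>y\<in>carrier (Cpow_opsys m). h' (incl2 y) = g y"
        and "z \<in> carrier Q" for h' z
      using value_eq[OF h'] value_eq[OF h] \<open>z \<in> carrier Q\<close> by (auto simp: Q_carrier)
    show "\<exists>h. (ucp Q R h \<and> (\<forall>x\<in>carrier (Cpow_opsys k). h (incl1 x) = f x) \<and> (\<forall>y\<in>carrier (Cpow_opsys m). h (incl2 y) = g y)) \<and>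
           (\<forall>h'. ucp Q R h' \<and> (\<forall>x\<in>carrier (Cpow_opsys k). h' (incl1 x) = f x) \<and> (\<forall>y\<in>carrier (Cpow_opsys m). h' (incl2 y) = g y)
              \<longrightarrow> (\<forall>z\<in>carrier Q. h' z = h z))"
      by (intro exI[of _ h] conjI h allI impI ballI) (elim conjE, rule uniq)
  qed
qed

end

theorem theorem4p8:
  fixes k m :: nat
    and universe :: "(nat \<Rightarrow> complex) \<Rightarrow> 'u"
    and X :: "'u opsys" and iX jX :: "complex vec \<Rightarrow> 'u"
    and F :: "'u cstar" and iF jF :: "complex vec \<Rightarrow> 'u"
    and C :: "'u cstar" and u :: "(gen \<times> bool) list set \<Rightarrow> 'u"
  assumes "k > 0" and "m > 0"
    and "inj universe"
    and "is_coproduct TYPE('u) (Cpow_opsys k) (Cpow_opsys m) X iX jX"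
    and "is_cstar_free_product TYPE('u) (Cpow k) (Cpow m) F iF jF"
    and "is_full_group_cstar TYPE('u) (free_prod_cyclic k m) C u"
  shows "is_kernel TYPE('u) (Cpow_opsys (k + m)) (null_space k m) \<and>
    operator_system (quotient_system k m) \<and>
    operator_system (sum_system k m F iF jF) \<and>
    operator_system (power_system k m C u) \<and>
    (\<exists>i j. is_coproduct TYPE('r) (Cpow_opsys k) (Cpow_opsys m) (quotient_system k m) i j) \<and>
    (\<exists>\<phi>\<^sub>1 \<phi>\<^sub>2 \<phi>\<^sub>3.
      uco_isomorphism (quotient_system k m) (power_system k m C u) \<phi>\<^sub>1 \<and>
      uco_isomorphism X (power_system k m C u) \<phi>\<^sub>2 \<and>
      uco_isomorphism (sum_system k m F iF jF) (power_system k m C u) \<phi>\<^sub>3 \<and>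
      cstar_hom F C \<phi>\<^sub>3 \<and> bij_betw \<phi>\<^sub>3 (carrier F) (carrier C) \<and>
      contains_enough_unitaries C (\<phi>\<^sub>1 ` carrier (quotient_system k m)) \<and>
      contains_enough_unitaries C (\<phi>\<^sub>2 ` carrier X) \<and>
      contains_enough_unitaries C (\<phi>\<^sub>3 ` carrier (sum_system k m F iF jF)) \<and>
      contains_enough_unitaries C (carrier (power_system k m C u)))"
proof -
  interpret universal_cyclic_cstar C k m u universe
    using assms by (intro universal_cyclic_cstar.intro universal_cyclic_cstar_axioms.intro full_cyclic_cstar.intro
        full_cyclic_cstar_axioms.intro) (simp_all add: is_full_group_cstar_def)
  obtain \<phi>1 where Q: "operator_system Q" and \<phi>1: "uco_isomorphism Q S \<phi>1"
    by (rule quotient_embedding) blast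
  note ops = Cpow_operator_system[OF assms(1)] Cpow_operator_system[OF assms(2)]
  \<comment> \<open>The quotient lives in a type of cosets. Its coproduct structure is moved to
    \<open>S\<close>, which like X has its carrier in \<open>'u\<close>, so that the two can be
    compared.\<close>
  note S_coproduct = coproduct_transfer[OF quotient_coproduct ops S_operator_system \<phi>1]
  obtain \<phi>2 where \<phi>2: "uco_isomorphism X S \<phi>2"
    by (rule coproduct_unique[OF assms(4) S_coproduct ops])
  obtain \<phi>3 \<psi> where \<phi>3: "cstar_morphism F C \<phi>3" and \<psi>: "cstar_hom C F \<psi>"
    and inv: "\<And>z. z \<in> carrier F \<Longrightarrow> \<psi> (\<phi>3 z) = z" "\<And>z. z \<in> carrier C \<Longrightarrow> \<phi>3 (\<psi> z) = z"
    and im: "\<phi>3 ` {iF x \<oplus>\<^bsub>F\<^esub> jF y | x y. x \<in> carrier (Cpow k) \<and> y \<in> carrier (Cpow m)} = sum_space"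
    by (rule free_product_iso[OF assms(5)]) blast
  interpret \<phi>3: cstar_morphism F C \<phi>3 by (rule \<phi>3)
  interpret \<psi>: cstar_morphism C F \<psi>
    by (intro cstar_morphism.intro cstar_morphism_axioms.intro \<psi> \<phi>3.A.cstar_algebra_axioms cstar_algebra_axioms)
  have F_morphisms: "cstar_morphism (Cpow k) F iF" "cstar_morphism (Cpow m) F jF"
    using assms(5) unfolding is_cstar_free_product_def
    by (auto intro!: cstar_morphism.intro cstar_morphism_axioms.intro Cpow_cstar_algebra assms(1,2))
  note F_sum = hom_sum_operator_subspace[OF F_morphisms]
  have sum: "operator_system (sum_system k m F iF jF)" "uco_isomorphism (sum_system k m F iF jF) S \<phi>3"
    unfolding sum_system_def
    by (rule \<phi>3.A.operator_system_opsub[OF F_sum], rule cstar_iso_uco_isomorphism[OF \<phi>3 \<psi> inv(1) F_sum im])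
  have bij: "bij_betw \<phi>3 (carrier F) (carrier C)"
    by (rule bij_betw_byWitness[of _ \<psi>]) (use inv \<phi>3.f_in \<psi>.f_in in auto)
  have images: "\<phi>1 ` carrier Q = sum_space" "\<phi>2 ` carrier X = sum_space"
      "\<phi>3 ` carrier (sum_system k m F iF jF) = sum_space" "carrier S = sum_space"
    using \<phi>1 \<phi>2 sum(2) by (simp_all add: uco_isomorphism_def opsub_def)
  show ?thesis
    unfolding power_system_eq
    by (intro conjI null_space_is_kernel Q sum S_operator_system exI[of _ \<phi>1] exI[of _ \<phi>2] exI[of _ \<phi>3] \<phi>1 \<phi>2 \<phi>3.hom bij
        exI[of _ incl1] exI[of _ incl2] quotient_coproduct)
      (simp_all only: images sum_space_enough)
qed

end
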